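(* Let $E$ be a reflexive sc-Banach space, i.e. all Banach spaces $E_n$ in the sc-structure of $E$ are reflexive. Let $I\subseteq\mathbb R$ be connected, let $1\le p<\infty$ and let $(\omega_n)_{n\in\mathbb N_0}$ be scaled weights. Denote $\hat E_n:=(E_n,\dots,E_0)$. Then $G:=L^p_{\omega_0}(I,E_0)$ has an sc-structure given by $G_n=W^{n,p}_{\omega_n}(I,\hat E_n)$, $n\in\mathbb N_0$.
   Context: sc-structure: A Banach space $E$ has an sc-structure (is an sc-Banach space) if there is a nested sequence of Banach spaces $E=E_0\supset E_1\supset E_2\supset\cdots$ such that the inclusion $E_n\hookrightarrow E_m$ is compact for all $n>m$ and $E_\infty:=\bigcap_{n}E_n$ is dense in every $E_m$. $I$ carries the Lebesgue measure. $L^p(I,X)$ is the Bochner space of strongly measurable $u:I\to X$ with $\big\|\,\|u(\cdot)\|_X\big\|_{L^p(I,\mathbb R)}<\infty$. For a locally bounded measurable weight $\omega$, $L^p_\omega(I,X)$ is the space of strongly measurable $u$ with $\|u\|^p_{L^p_\omega(I,X)}=\int_I\|u(t)\|_X^p\,\omega(t)^p\,dt<\infty$. $C_c^\infty(I,\mathbb R)$ denotes smooth functions with compact support in the interior of $I$. For Banach spaces $X\hookrightarrow Y$ and locally Bochner integrable $u:I\to X$, $v:I\to Y$, $v$ is a weak $k$-th derivative of $u$, written $v=u^{(k)}$, if $\int_I\varphi^{(k)}(t)u(t)\,dt=(-1)^k\int_I\varphi(t)v(t)\,dt$ for all $\varphi\in C_c^\infty(I,\mathbb R)$; $u^{(0)}=u$.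 $W^{n,p}_{\omega}(I,\hat E_n)$ is the space of all $u\in L^p_\omega(I,E_n)$ such that for $1\le k\le n$ the weak derivative $u^{(k)}$ exists and lies in $L^p_\omega(I,E_{n-k})$, with norm $\sum_{k=0}^n\|u^{(k)}\|_{L^p_\omega(I,E_{n-k})}$. A sequence of continuous functions $\omega_m:\mathbb R\to(0,\infty)$, $m\in\mathbb N_0$, is called scaled weights if for all $m<n$ there exist $T\ge0$ and $D>0$ such that (i) $\lim_{t\to\pm\infty}\frac{\omega_m(t)}{\omega_n(t)}=0$; (ii) for all $t_1>t_2>T$: $\frac{\omega_m(t_1)}{\omega_n(t_1)}<D\,\frac{\omega_m(t_2)}{\omega_n(t_2)}$; (iii) for all $t_1<t_2<-T$: $\frac{\omega_m(t_1)}{\omega_n(t_1)}<D\,\frac{\omega_m(t_2)}{\omega_n(t_2)}$. They are restricted to $I$ when used as weights on $I$. *)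

theory Defs
  imports "HOL-Analysis.Analysis"
begin

section \<open>Normed and Banach spaces as carriers\<close>

text \<open>The levels of an sc-structure form a sequence of Banach spaces, each with its own norm, inside
  one vector space. A space is therefore a linear subspace of an ambient real vector space together
  with a norm; values of the norm outside the carrier are irrelevant.\<close>

record 'v nspace =
  car :: "'v set"
  nrm :: "'v \<Rightarrow> real"

definition normed_space :: "'v::real_vector nspace \<Rightarrow> bool" where
  "normed_space X \<longleftrightarrow> subspace (car X) \<and>
     (\<forall>x\<in>car X. 0 \<le> nrm X x \<and> (nrm X x = 0 \<longleftrightarrow> x = 0)) \<and>
     (\<forall>x\<in>car X. \<forall>c. nrm X (c *\<^sub>R x) = \<bar>c\<bar> * nrm X x) \<and>
     (\<forall>x\<in>car X. \<forall>y\<in>car X. nrm X (x + y) \<le> nrm X x + nrm X y)"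

text \<open>The value outside the carrier only serves the locale \<^locale>\<open>Metric_space\<close>, which asks for
  nonnegativity and symmetry on the whole type.\<close>

definition ndist :: "'v::real_vector nspace \<Rightarrow> 'v \<Rightarrow> 'v \<Rightarrow> real" where
  "ndist X x y = (if x \<in> car X \<and> y \<in> car X then nrm X (x - y) else 0)"

lemma Metric_space_ndist:
  assumes "normed_space X"
  shows "Metric_space (car X) (ndist X)"
proof
  have sub: "subspace (car X)" and
    pos: "\<And>x. x \<in> car X \<Longrightarrow> 0 \<le> nrm X x \<and> (nrm X x = 0 \<longleftrightarrow> x = 0)" and
    sc: "\<And>x c. x \<in> car X \<Longrightarrow> nrm X (c *\<^sub>R x) = \<bar>c\<bar> * nrm X x" and
    tri: "\<And>x y. x \<in> car X \<Longrightarrow> y \<in> car X \<Longrightarrow> nrm X (x + y) \<le> nrm X x + nrm X y"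
    using assms by (auto simp: normed_space_def)
  have diff: "\<And>x y. x \<in> car X \<Longrightarrow> y \<in> car X \<Longrightarrow> x - y \<in> car X"
    using sub by (rule subspace_diff)
  show "0 \<le> ndist X x y" for x y
    using pos diff by (auto simp: ndist_def)
  show "ndist X x y = ndist X y x" for x y
    using sc[of "x - y" "-1"] diff by (auto simp: ndist_def)
  show "ndist X x y = 0 \<longleftrightarrow> x = y" if "x \<in> car X" "y \<in> car X" for x y
    using pos diff that by (auto simp: ndist_def)
  show "ndist X x z \<le> ndist X x y + ndist X y z"
    if "x \<in> car X" "y \<in> car X" "z \<in> car X" for x y z
    using tri[OF diff[of x y] diff[of y z]] that by (auto simp: ndist_def)
qed

definition banach_space :: "'v::real_vector nspace \<Rightarrow> bool" where
  "banach_space X \<longleftrightarrow> normed_space X \<and> Metric_space.mcomplete (car X) (ndist X)"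

definition norm_topology :: "'v::real_vector nspace \<Rightarrow> 'v topology" where
  "norm_topology X = Metric_space.mtopology (car X) (ndist X)"

definition compact_inclusion :: "'v::real_vector nspace \<Rightarrow> 'v nspace \<Rightarrow> bool" where
  "compact_inclusion X Y \<longleftrightarrow> car X \<subseteq> car Y \<and>
     (\<forall>B\<subseteq>car X. (\<exists>C. \<forall>x\<in>B. nrm X x \<le> C) \<longrightarrow>
        compactin (norm_topology Y) (norm_topology Y closure_of B))"

definition sc_structure :: "'v::real_vector nspace \<Rightarrow> (nat \<Rightarrow> 'v nspace) \<Rightarrow> bool" where
  "sc_structure X Xs \<longleftrightarrow>
     banach_space X \<and> (\<forall>n. banach_space (Xs n)) \<and>
     car (Xs 0) = car X \<and> (\<forall>x\<in>car X. nrm (Xs 0) x = nrm X x) \<and>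
     (\<forall>n. car (Xs (Suc n)) \<subseteq> car (Xs n)) \<and>
     (\<forall>m n. m < n \<longrightarrow> compact_inclusion (Xs n) (Xs m)) \<and>
     (\<forall>m. norm_topology (Xs m) closure_of (\<Inter>n. car (Xs n)) = car (Xs m))"

section \<open>Reflexivity\<close>

text \<open>Functionals live on the carrier only; they are made unique as functions on the ambient type by
  the value 0 outside.\<close>

definition dual :: "'v::real_vector nspace \<Rightarrow> ('v \<Rightarrow> real) set" where
  "dual X = {f. (\<forall>x. x \<notin> car X \<longrightarrow> f x = 0) \<and>
     (\<forall>x\<in>car X. \<forall>y\<in>car X. f (x + y) = f x + f y) \<and>
     (\<forall>x\<in>car X. \<forall>c. f (c *\<^sub>R x) = c * f x) \<and>
     (\<exists>C. \<forall>x\<in>car X. \<bar>f x\<bar> \<le> C * nrm X x)}"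

definition dual_norm :: "'v::real_vector nspace \<Rightarrow> ('v \<Rightarrow> real) \<Rightarrow> real" where
  "dual_norm X f = (SUP x\<in>{x\<in>car X. nrm X x \<le> 1}. \<bar>f x\<bar>)"

definition bidual :: "'v::real_vector nspace \<Rightarrow> (('v \<Rightarrow> real) \<Rightarrow> real) set" where
  "bidual X = {\<Phi>. (\<forall>f\<in>dual X. \<forall>g\<in>dual X. \<Phi> (\<lambda>x. f x + g x) = \<Phi> f + \<Phi> g) \<and>
     (\<forall>f\<in>dual X. \<forall>c. \<Phi> (\<lambda>x. c * f x) = c * \<Phi> f) \<and>
     (\<exists>C. \<forall>f\<in>dual X. \<bar>\<Phi> f\<bar> \<le> C * dual_norm X f)}"

definition reflexive_space :: "'v::real_vector nspace \<Rightarrow> bool" where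
  "reflexive_space X \<longleftrightarrow> (\<forall>\<Phi>\<in>bidual X. \<exists>x\<in>car X. \<forall>f\<in>dual X. \<Phi> f = f x)"

section \<open>Strong measurability and the Bochner integral\<close>

definition strongly_measurable :: "real set \<Rightarrow> 'v::real_vector nspace \<Rightarrow> (real \<Rightarrow> 'v) \<Rightarrow> bool" where
  "strongly_measurable I X u \<longleftrightarrow> u \<in> I \<rightarrow> car X \<and>
     (\<exists>s :: nat \<Rightarrow> real \<Rightarrow> 'v.
        (\<forall>i. simple_function (lebesgue_on I) (s i) \<and> s i \<in> I \<rightarrow> car X) \<and>
        (AE t in lebesgue_on I. (\<lambda>i. nrm X (s i t - u t)) \<longlonglongrightarrow> 0))"

text \<open>The analogue of \<^const>\<open>has_bochner_integral\<close> for a carrier space: the library constant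
  uses the norm of a type and requires that type to be separable.\<close>

definition has_bochner_integral_in ::
  "real set \<Rightarrow> 'v::real_vector nspace \<Rightarrow> (real \<Rightarrow> 'v) \<Rightarrow> 'v \<Rightarrow> bool" where
  "has_bochner_integral_in I X f x \<longleftrightarrow> x \<in> car X \<and> strongly_measurable I X f \<and>
     (\<exists>s :: nat \<Rightarrow> real \<Rightarrow> 'v.
        (\<forall>i. Bochner_Integration.simple_bochner_integrable (lebesgue_on I) (s i) \<and> s i \<in> I \<rightarrow> car X) \<and>
        (\<lambda>i. \<integral>\<^sup>+t. ennreal (nrm X (f t - s i t)) \<partial>lebesgue_on I) \<longlonglongrightarrow> 0 \<and>
        (\<lambda>i. nrm X (Bochner_Integration.simple_bochner_integral (lebesgue_on I) (s i) - x)) \<longlonglongrightarrow> 0)"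

definition locally_bochner_integrable ::
  "real set \<Rightarrow> 'v::real_vector nspace \<Rightarrow> (real \<Rightarrow> 'v) \<Rightarrow> bool" where
  "locally_bochner_integrable I X u \<longleftrightarrow> u \<in> I \<rightarrow> car X \<and>
     (\<forall>K. compact K \<and> K \<subseteq> I \<longrightarrow> (\<exists>x. has_bochner_integral_in K X u x))"

section \<open>Weak derivatives\<close>

definition test_functions :: "real set \<Rightarrow> (real \<Rightarrow> real) set" where
  "test_functions I = {\<phi>. (\<forall>k t. (deriv ^^ k) \<phi> field_differentiable (at t)) \<and>
     compact (closure {t. \<phi> t \<noteq> 0}) \<and> closure {t. \<phi> t \<noteq> 0} \<subseteq> interior I}"

text \<open>Both integrals are taken in \<open>Y\<close>; \<open>x\<close> is the value of the left-hand one.\<close>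

definition weak_derivative ::
  "real set \<Rightarrow> nat \<Rightarrow> 'v::real_vector nspace \<Rightarrow> 'v nspace \<Rightarrow> (real \<Rightarrow> 'v) \<Rightarrow> (real \<Rightarrow> 'v) \<Rightarrow> bool" where
  "weak_derivative I k X Y u v \<longleftrightarrow>
     locally_bochner_integrable I X u \<and> locally_bochner_integrable I Y v \<and>
     (\<forall>\<phi>\<in>test_functions I. \<exists>x.
        has_bochner_integral_in I Y (\<lambda>t. (deriv ^^ k) \<phi> t *\<^sub>R u t) x \<and>
        has_bochner_integral_in I Y (\<lambda>t. \<phi> t *\<^sub>R v t) ((-1) ^ k *\<^sub>R x))"

section \<open>Functions modulo equality almost everywhere\<close>

quotient_type 'v aefun = "real \<Rightarrow> 'v" / "\<lambda>f g. AE t in lebesgue. f t = g t"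
proof (rule equivpI)
  show "reflp (\<lambda>f g::real \<Rightarrow> 'v. AE t in lebesgue. f t = g t)"
    by (rule reflpI) simp
  show "symp (\<lambda>f g::real \<Rightarrow> 'v. AE t in lebesgue. f t = g t)"
    by (rule sympI) (auto elim: eventually_mono)
  show "transp (\<lambda>f g::real \<Rightarrow> 'v. AE t in lebesgue. f t = g t)"
  proof (rule transpI)
    fix f g h :: "real \<Rightarrow> 'v"
    assume "AE t in lebesgue. f t = g t" "AE t in lebesgue. g t = h t"
    then show "AE t in lebesgue. f t = h t" by eventually_elim simp
  qed
qed

instantiation aefun :: (real_vector) real_vector
begin

lift_definition zero_aefun :: "'a aefun" is "\<lambda>t. 0" .

lift_definition plus_aefun :: "'a aefun \<Rightarrow> 'a aefun \<Rightarrow> 'a aefun" is "\<lambda>f g t. f t + g t"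
  by (auto elim: eventually_elim2)

lift_definition minus_aefun :: "'a aefun \<Rightarrow> 'a aefun \<Rightarrow> 'a aefun" is "\<lambda>f g t. f t - g t"
  by (auto elim: eventually_elim2)

lift_definition uminus_aefun :: "'a aefun \<Rightarrow> 'a aefun" is "\<lambda>f t. - f t"
  by (auto elim: eventually_mono)

lift_definition scaleR_aefun :: "real \<Rightarrow> 'a aefun \<Rightarrow> 'a aefun" is "\<lambda>c f t. c *\<^sub>R f t"
  by (auto elim: eventually_mono)

instance
  by standard (transfer; simp add: algebra_simps)+

end

text \<open>The class of a function on \<open>I\<close> is that of its extension by 0, so that two functions have the
  same class iff they agree almost everywhere on \<open>I\<close>.\<close>

definition cls :: "real set \<Rightarrow> (real \<Rightarrow> 'v::real_vector) \<Rightarrow> 'v aefun" where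
  "cls I u = abs_aefun (\<lambda>t. if t \<in> I then u t else 0)"

section \<open>Weighted Bochner and Sobolev spaces\<close>

definition Lp_nn_integral ::
  "real \<Rightarrow> real set \<Rightarrow> (real \<Rightarrow> real) \<Rightarrow> 'v::real_vector nspace \<Rightarrow> (real \<Rightarrow> 'v) \<Rightarrow> ennreal" where
  "Lp_nn_integral p I \<omega> X u =
     (\<integral>\<^sup>+t. ennreal (nrm X (u t) powr p * \<omega> t powr p) \<partial>lebesgue_on I)"

text \<open>The norm is evaluated on an arbitrary representative; see \<open>nrm_Lp_space_cls\<close> below.\<close>

definition Lp_space ::
  "real \<Rightarrow> real set \<Rightarrow> (real \<Rightarrow> real) \<Rightarrow> 'v::real_vector nspace \<Rightarrow> 'v aefun nspace" where
  "Lp_space p I \<omega> X =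
     \<lparr>car = {cls I u | u. strongly_measurable I X u \<and> Lp_nn_integral p I \<omega> X u < \<infinity>},
      nrm = (\<lambda>c. enn2real (Lp_nn_integral p I \<omega> X (rep_aefun c)) powr (1 / p))\<rparr>"

lemma nrm_Lp_space_cls:
  assumes I: "I \<in> sets lebesgue"
  shows "nrm (Lp_space p I \<omega> X) (cls I u) = enn2real (Lp_nn_integral p I \<omega> X u) powr (1 / p)"
proof -
  have "AE t in lebesgue. rep_aefun (cls I u) t = (if t \<in> I then u t else 0)"
    unfolding cls_def by (rule rep_abs_rsp_left[OF Quotient3_aefun]) simp
  then have "AE t in lebesgue_on I. rep_aefun (cls I u) t = u t"
    using I by (subst AE_restrict_space_iff) (auto elim: eventually_mono)
  then have "Lp_nn_integral p I \<omega> X (rep_aefun (cls I u)) = Lp_nn_integral p I \<omega> X u"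
    unfolding Lp_nn_integral_def by (intro nn_integral_cong_AE) (auto elim: eventually_mono)
  then show ?thesis by (simp add: Lp_space_def)
qed

definition weak_derivative_cls ::
  "real set \<Rightarrow> nat \<Rightarrow> 'v::real_vector nspace \<Rightarrow> 'v nspace \<Rightarrow> 'v aefun \<Rightarrow> 'v aefun \<Rightarrow> bool" where
  "weak_derivative_cls I k X Y c d \<longleftrightarrow>
     (\<exists>u v. c = cls I u \<and> d = cls I v \<and> weak_derivative I k X Y u v)"

definition wderiv ::
  "real set \<Rightarrow> nat \<Rightarrow> 'v::real_vector nspace \<Rightarrow> 'v nspace \<Rightarrow> 'v aefun \<Rightarrow> 'v aefun" where
  "wderiv I k X Y c = (if k = 0 then c else (THE d. weak_derivative_cls I k X Y c d))"

definition Sobolev_space ::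
  "nat \<Rightarrow> real \<Rightarrow> real set \<Rightarrow> (real \<Rightarrow> real) \<Rightarrow> (nat \<Rightarrow> 'v::real_vector nspace) \<Rightarrow> 'v aefun nspace" where
  "Sobolev_space n p I \<omega> E =
     \<lparr>car = {c \<in> car (Lp_space p I \<omega> (E n)).
        \<forall>k\<in>{1..n}. \<exists>d\<in>car (Lp_space p I \<omega> (E (n - k))). weak_derivative_cls I k (E n) (E (n - k)) c d},
      nrm = (\<lambda>c. \<Sum>k=0..n. nrm (Lp_space p I \<omega> (E (n - k))) (wderiv I k (E n) (E (n - k)) c))\<rparr>"

section \<open>Scaled weights\<close>

definition scaled_weights :: "(nat \<Rightarrow> real \<Rightarrow> real) \<Rightarrow> bool" where
  "scaled_weights \<omega> \<longleftrightarrow>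
     (\<forall>m. continuous_on UNIV (\<omega> m) \<and> (\<forall>t. 0 < \<omega> m t)) \<and>
     (\<forall>m n. m < n \<longrightarrow> (\<exists>T D. 0 \<le> T \<and> 0 < D \<and>
        ((\<lambda>t. \<omega> m t / \<omega> n t) \<longlongrightarrow> 0) at_top \<and> ((\<lambda>t. \<omega> m t / \<omega> n t) \<longlongrightarrow> 0) at_bot \<and>
        (\<forall>t1 t2. t1 > t2 \<and> t2 > T \<longrightarrow> \<omega> m t1 / \<omega> n t1 < D * (\<omega> m t2 / \<omega> n t2)) \<and>
        (\<forall>t1 t2. t1 < t2 \<and> t2 < - T \<longrightarrow> \<omega> m t1 / \<omega> n t1 < D * (\<omega> m t2 / \<omega> n t2))))"

end

theory Submission
  imports Defs
begin

text \<open>An element of the \<open>n\<close>-th weighted Sobolev space is handled through a \<open>jet\<close>: representatives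
  \<open>U 0, ..., U n\<close> of the function and of its weak derivatives, \<open>U k\<close> being \<open>p\<close>-integrable with values
  in \<open>E (n - k)\<close>. The norm is the sum of the norms of the entries, so each of the three properties to
  be shown becomes a statement about one \<open>L\<^sup>p\<close>-space at a time and about the relation between entries.

  Completeness (\<open>banach_S\<close>): \<open>L\<^sup>p\<close>-spaces are complete, and the identity that defines weak derivatives
  passes to limits, since pairing with a test function is continuous on \<open>L\<^sup>p\<close>.

  Compactness (\<open>compact_S\<close>): if \<open>m < n\<close>, an entry \<open>U k\<close> with \<open>k \<le> m\<close> is bounded with values in
  \<open>E (n - k)\<close>, which embeds compactly into \<open>E (m - k)\<close>, and has a weak derivative \<open>U (k + 1)\<close> that is
  bounded with values in \<open>E (m - k)\<close>. This is the situation of the Aubin-Lions theorem, which is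
  proved directly (\<open>Aubin_Lions\<close>). Outside a bounded interval everything is small, because the weight
  of level \<open>m\<close> is small compared with that of level \<open>n\<close>. A bounded interval is cut into short cells; on
  a cell a function differs from its average by at most the integral of the norm of its derivative
  (\<open>Poincare_average\<close>), which after summation over the cells is an error proportional to the mesh. What
  remains are finitely many averages. They are bounded in \<open>E (n - k)\<close>, hence totally bounded in
  \<open>E (m - k)\<close>. Compactness is treated as total boundedness throughout.

  Density (\<open>dense_S\<close>): on a bounded interval, mollifications of the entries of a jet approximate them,
  and they are the derivatives of the mollified function. In that function \<open>U 0\<close> may be replaced by a
  combination of finitely many vectors from the intersection of the scale with continuous
  coefficients (\<open>jet_local_approx\<close>). A cutoff function whose derivatives are \<open>O(1/R)\<close> makes the
  approximant compactly supported (\<open>jet_dense\<close>); the result lies in all levels at once.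

  Behind both compactness and density, and behind the uniqueness of weak derivatives, is one theorem:
  mollified functions converge to the function in \<open>L\<^sup>p\<close>, uniformly for mollifiers of small scale
  (\<open>mollification\<close>). Since the spaces are carriers with norms inside a vector space without topology,
  vector-valued functions enter only through simple functions, through their Bochner integrals, and
  through the scalar function \<open>t \<mapsto> nrm X (u t)\<close>; bounds for the latter are expressed by \<open>Lp_le\<close>.\<close>

section \<open>Normed spaces on carriers\<close>

lemma normed_spaceD:
  assumes "normed_space X"
  shows normed_subspace: "subspace (car X)"
    and nrm_nonneg: "x \<in> car X \<Longrightarrow> 0 \<le> nrm X x"
    and nrm_eq_0: "x \<in> car X \<Longrightarrow> nrm X x = 0 \<longleftrightarrow> x = 0"
    and nrm_scale: "x \<in> car X \<Longrightarrow> nrm X (c *\<^sub>R x) = \<bar>c\<bar> * nrm X x"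
    and nrm_triangle: "x \<in> car X \<Longrightarrow> y \<in> car X \<Longrightarrow> nrm X (x + y) \<le> nrm X x + nrm X y"
  using assms by (auto simp: normed_space_def)

lemma car_closed:
  assumes "normed_space X"
  shows car_zero: "0 \<in> car X"
    and car_add: "x \<in> car X \<Longrightarrow> y \<in> car X \<Longrightarrow> x + y \<in> car X"
    and car_diff: "x \<in> car X \<Longrightarrow> y \<in> car X \<Longrightarrow> x - y \<in> car X"
    and car_scale: "x \<in> car X \<Longrightarrow> c *\<^sub>R x \<in> car X"
    and car_sum: "(\<And>a. a \<in> A \<Longrightarrow> f a \<in> car X) \<Longrightarrow> sum f A \<in> car X"
  using normed_subspace[OF assms]
  by (auto intro: subspace_0 subspace_add subspace_diff subspace_scale subspace_sum)

lemma nrm_zero: "normed_space X \<Longrightarrow> nrm X 0 = 0"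
  using nrm_eq_0 car_zero by blast

lemma nrm_minus_commute:
  assumes "normed_space X" "x \<in> car X" "y \<in> car X"
  shows "nrm X (x - y) = nrm X (y - x)"
  using nrm_scale[OF assms(1) car_diff[OF assms], of "-1"] by simp

lemma nrm_diff_triangle:
  assumes "normed_space X" "x \<in> car X" "y \<in> car X" "z \<in> car X"
  shows "nrm X (x - z) \<le> nrm X (x - y) + nrm X (y - z)"
  using nrm_triangle[OF assms(1) car_diff[OF assms(1,2,3)] car_diff[OF assms(1,3,4)]] by simp

lemma nrm_le_add_diff:
  assumes "normed_space X" "x \<in> car X" "y \<in> car X"
  shows "nrm X x \<le> nrm X y + nrm X (x - y)"
  using nrm_triangle[OF assms(1) assms(3) car_diff[OF assms]] by simp

lemma nrm_abs_diff:
  assumes "normed_space X" "x \<in> car X" "y \<in> car X"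
  shows "\<bar>nrm X x - nrm X y\<bar> \<le> nrm X (x - y)"
  using nrm_le_add_diff[OF assms] nrm_le_add_diff[OF assms(1,3,2)] nrm_minus_commute[OF assms]
  by linarith

lemma nrm_triangle_sub:
  assumes "normed_space X" "x \<in> car X" "y \<in> car X"
  shows "nrm X (x - y) \<le> nrm X x + nrm X y"
  using nrm_triangle[OF assms(1,2) car_scale[OF assms(1,3), of "-1"]]
    nrm_scale[OF assms(1,3), of "-1"] by simp

lemma nrm_sum_le:
  assumes "normed_space X" "\<And>a. a \<in> A \<Longrightarrow> f a \<in> car X"
  shows "nrm X (sum f A) \<le> (\<Sum>a\<in>A. nrm X (f a))"
  using assms(2)
proof (induction A rule: infinite_finite_induct)
  case (insert a A)
  then show ?case
    using nrm_triangle[OF assms(1), of "f a" "sum f A"] car_sum[OF assms(1), of A f] by fastforce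
qed (auto simp: nrm_zero[OF assms(1)])

lemma nrm_limit_unique:
  assumes "normed_space X" "x \<in> car X" "y \<in> car X" "\<And>i. s i \<in> car X"
    "(\<lambda>i. nrm X (s i - x)) \<longlonglongrightarrow> 0" "(\<lambda>i. nrm X (s i - y)) \<longlonglongrightarrow> 0"
  shows "x = y"
proof -
  have "(\<lambda>i. nrm X (s i - x) + nrm X (s i - y)) \<longlonglongrightarrow> 0 + 0"
    using assms by (intro tendsto_add)
  moreover have "nrm X (x - y) \<le> nrm X (s i - x) + nrm X (s i - y)" for i
    using nrm_diff_triangle[OF assms(1,2,4,3), of i] nrm_minus_commute[OF assms(1,2,4), of i]
    by simp
  ultimately have "nrm X (x - y) \<le> 0"
    by (intro LIMSEQ_le_const[where X="\<lambda>i. nrm X (s i - x) + nrm X (s i - y)"]) auto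
  then show ?thesis
    using nrm_nonneg[OF assms(1) car_diff[OF assms(1,2,3)]] nrm_eq_0[OF assms(1) car_diff[OF assms(1,2,3)]]
    by simp
qed

lemma nrm_Cauchy_converges:
  assumes X: "banach_space X" and s: "\<And>i. s i \<in> car X"
    and C: "\<And>e. e > 0 \<Longrightarrow> \<exists>N. \<forall>m\<ge>N. \<forall>n\<ge>N. nrm X (s m - s n) < e"
  obtains x where "x \<in> car X" "(\<lambda>i. nrm X (s i - x)) \<longlonglongrightarrow> 0"
proof -
  have n: "normed_space X" using X by (simp add: banach_space_def)
  interpret Metric_space "car X" "ndist X" by (rule Metric_space_ndist[OF n])
  have "MCauchy s"
    unfolding MCauchy_def using C s by (force simp: ndist_def)
  then obtain x where x: "limitin mtopology s x sequentially"
    using X by (auto simp: banach_space_def mcomplete_def)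
  then have xc: "x \<in> car X" and *: "\<And>e. e > 0 \<Longrightarrow> \<exists>N. \<forall>n\<ge>N. ndist X (s n) x < e"
    by (auto simp: limit_metric_sequentially) metis
  moreover have "(\<lambda>i. nrm X (s i - x)) \<longlonglongrightarrow> 0"
    unfolding LIMSEQ_iff
    using * s xc nrm_nonneg[OF n car_diff[OF n]] by (simp add: ndist_def)
  ultimately show thesis using that by blast
qed

text \<open>A subsequence of a Cauchy sequence can be chosen whose steps are dominated by a given
  geometric sequence, and a Cauchy sequence converges as soon as a subsequence does.\<close>

lemma banach_spaceI:
  assumes n: "normed_space X"
    and C: "\<And>s. (\<And>i. s i \<in> car X) \<Longrightarrow> (\<And>i. nrm X (s (Suc i) - s i) \<le> (1/2)^i) \<Longrightarrow>
      \<exists>x\<in>car X. (\<lambda>i. nrm X (s i - x)) \<longlonglongrightarrow> 0"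
  shows "banach_space X"
proof -
  interpret Metric_space "car X" "ndist X" by (rule Metric_space_ndist[OF n])
  have "\<exists>x. limitin mtopology \<sigma> x sequentially" if \<sigma>: "MCauchy \<sigma>" for \<sigma>
  proof -
    have sc: "\<sigma> i \<in> car X" for i using \<sigma> by (auto simp: MCauchy_def)
    have "\<exists>N. \<forall>m\<ge>N. \<forall>n\<ge>N. nrm X (\<sigma> m - \<sigma> n) < (1/2)^i" for i :: nat
    proof -
      have "(0::real) < (1/2)^i" by simp
      with \<sigma> obtain N where N: "\<forall>n n'. N \<le> n \<longrightarrow> N \<le> n' \<longrightarrow> ndist X (\<sigma> n) (\<sigma> n') < (1/2)^i"
        unfolding MCauchy_def by blast
      then have "\<forall>m\<ge>N. \<forall>n\<ge>N. nrm X (\<sigma> m - \<sigma> n) < (1/2)^i"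
        using sc by (auto simp: ndist_def)
      then show ?thesis ..
    qed
    then obtain N where N: "\<And>i m n. m \<ge> N i \<Longrightarrow> n \<ge> N i \<Longrightarrow> nrm X (\<sigma> m - \<sigma> n) < (1/2)^i"
      by metis
    define r where "r i = (\<Sum>j\<le>i. N j) + i" for i
    have mono: "strict_mono r" by (auto simp: strict_mono_Suc_iff r_def)
    have ge: "r i \<ge> N i" for i
      unfolding r_def by (metis atMost_iff finite_atMost le_add1 le_trans member_le_sum order_refl zero_le)
    have "nrm X (\<sigma> (r (Suc i)) - \<sigma> (r i)) \<le> (1/2)^i" for i
      using N[of i "r (Suc i)" "r i"] ge[of i] strict_monoD[OF mono, of i "Suc i"] by force
    from C[of "\<sigma> \<circ> r"] this sc obtain x where
      x: "x \<in> car X" "(\<lambda>i. nrm X (\<sigma> (r i) - x)) \<longlonglongrightarrow> 0" by auto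
    have "limitin mtopology (\<sigma> \<circ> r) x sequentially"
      unfolding limit_metric_sequentially
    proof (intro conjI allI impI)
      fix e :: real assume "e > 0"
      with x(2) obtain M where "\<And>n. n \<ge> M \<Longrightarrow> \<bar>nrm X (\<sigma> (r n) - x)\<bar> < e"
        unfolding LIMSEQ_iff by auto
      then have "\<And>n. n \<ge> M \<Longrightarrow> nrm X (\<sigma> (r n) - x) < e" by fastforce
      then show "\<exists>N. \<forall>n\<ge>N. (\<sigma> \<circ> r) n \<in> car X \<and> ndist X ((\<sigma> \<circ> r) n) x < e"
        using sc x(1) by (auto simp: ndist_def)
    qed (fact x)
    then show ?thesis using MCauchy_convergent_subsequence[OF \<sigma> mono] by blast
  qed
  then show ?thesis using n by (auto simp: banach_space_def mcomplete_def)
qed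

text \<open>Total boundedness as the existence of finite partitions into pieces of small \<open>d\<close>-diameter. Common
  refinements of partitions show that it is preserved by sums of distances; for this \<open>d\<close> need not be a
  metric.\<close>

definition tot_bounded :: "'a set \<Rightarrow> ('a \<Rightarrow> 'a \<Rightarrow> real) \<Rightarrow> bool" where
  "tot_bounded B d \<longleftrightarrow> (\<forall>e>0. \<exists>q::'a \<Rightarrow> nat. finite (q ` B) \<and>
     (\<forall>x\<in>B. \<forall>y\<in>B. q x = q y \<longrightarrow> d x y < e))"

lemma tot_boundedE:
  assumes "tot_bounded B d" "e > 0"
  obtains q :: "'a \<Rightarrow> nat" where "finite (q ` B)"
    "\<And>x y. x \<in> B \<Longrightarrow> y \<in> B \<Longrightarrow> q x = q y \<Longrightarrow> d x y < e"
  using assms unfolding tot_bounded_def by blast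

lemma tot_bounded_add:
  assumes "tot_bounded B d1" "tot_bounded B d2"
  shows "tot_bounded B (\<lambda>x y. d1 x y + d2 x y)"
  unfolding tot_bounded_def
proof (intro allI impI)
  fix e :: real assume "e > 0"
  then have e2: "e/2 > 0" by simp
  obtain q1 :: "'a \<Rightarrow> nat" where q1: "finite (q1 ` B)"
    "\<And>x y. x \<in> B \<Longrightarrow> y \<in> B \<Longrightarrow> q1 x = q1 y \<Longrightarrow> d1 x y < e/2"
    using tot_boundedE[OF assms(1) e2] by blast
  obtain q2 :: "'a \<Rightarrow> nat" where q2: "finite (q2 ` B)"
    "\<And>x y. x \<in> B \<Longrightarrow> y \<in> B \<Longrightarrow> q2 x = q2 y \<Longrightarrow> d2 x y < e/2"
    using tot_boundedE[OF assms(2) e2] by blast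
  note q = q1(1) q2(1) q1(2) q2(2)
  define q where "q x = prod_encode (q1 x, q2 x)" for x
  have "q ` B \<subseteq> prod_encode ` (q1 ` B \<times> q2 ` B)" by (auto simp: q_def)
  then have "finite (q ` B)" using q by (meson finite_SigmaI finite_imageI finite_subset)
  moreover have "d1 x y + d2 x y < e" if "x \<in> B" "y \<in> B" "q x = q y" for x y
    using q(3)[of x y] q(4)[of x y] that by (auto simp: q_def)
  ultimately show "\<exists>q::'a \<Rightarrow> nat. finite (q ` B) \<and> (\<forall>x\<in>B. \<forall>y\<in>B. q x = q y \<longrightarrow> d1 x y + d2 x y < e)"
    by blast
qed

lemma tot_bounded_zero: "tot_bounded B (\<lambda>x y. 0)"
  unfolding tot_bounded_def
proof (intro allI impI)
  fix e :: real assume "e > 0"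
  then show "\<exists>q::'a \<Rightarrow> nat. finite (q ` B) \<and> (\<forall>x\<in>B. \<forall>y\<in>B. q x = q y \<longrightarrow> 0 < e)"
    by (intro exI[of _ "\<lambda>_. 0"]) (auto simp: image_constant_conv)
qed

lemma tot_bounded_sum:
  assumes "finite S" "\<And>i. i \<in> S \<Longrightarrow> tot_bounded B (d i)"
  shows "tot_bounded B (\<lambda>x y. \<Sum>i\<in>S. d i x y)"
  using assms by (induction S rule: finite_induct) (auto intro: tot_bounded_zero tot_bounded_add)

text \<open>The form in which an approximation argument yields total boundedness: the comparison distance \<open>d'\<close>
  and the factor \<open>c\<close> may depend on the error \<open>e\<close>.\<close>

lemma tot_bounded_approx:
  assumes "\<And>e. e > 0 \<Longrightarrow> \<exists>d'. tot_bounded B d' \<and> (\<exists>c>0. \<forall>x\<in>B. \<forall>y\<in>B. d x y \<le> e + c * d' x y)"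
  shows "tot_bounded B d"
  unfolding tot_bounded_def
proof (intro allI impI)
  fix e :: real assume e: "e > 0"
  then obtain d' c where d': "tot_bounded B d'" and c: "c > 0"
    "\<And>x y. x \<in> B \<Longrightarrow> y \<in> B \<Longrightarrow> d x y \<le> e/2 + c * d' x y"
    using assms[of "e/2"] by auto
  have "e/(2*c) > 0" using e c by simp
  then obtain q :: "'a \<Rightarrow> nat" where q: "finite (q ` B)"
    "\<And>x y. x \<in> B \<Longrightarrow> y \<in> B \<Longrightarrow> q x = q y \<Longrightarrow> d' x y < e/(2*c)"
    using tot_boundedE[OF d'] by blast
  have "d x y < e" if "x \<in> B" "y \<in> B" "q x = q y" for x y
  proof -
    have "c * d' x y < e/2" using q(2)[OF that] c by (simp add: field_simps)
    then show ?thesis using c(2)[OF that(1,2)] by simp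
  qed
  with q(1) show "\<exists>q::'a \<Rightarrow> nat. finite (q ` B) \<and> (\<forall>x\<in>B. \<forall>y\<in>B. q x = q y \<longrightarrow> d x y < e)"
    by blast
qed

lemma tot_bounded_image:
  assumes "tot_bounded (f ` B) d"
  shows "tot_bounded B (\<lambda>x y. d (f x) (f y))"
  unfolding tot_bounded_def
proof (intro allI impI)
  fix e :: real assume e: "e > 0"
  show "\<exists>q::_ \<Rightarrow> nat. finite (q ` B) \<and> (\<forall>x\<in>B. \<forall>y\<in>B. q x = q y \<longrightarrow> d (f x) (f y) < e)"
  proof (rule tot_boundedE[OF assms e])
    fix q :: "_ \<Rightarrow> nat" assume "finite (q ` f ` B)"
      "\<And>x y. x \<in> f ` B \<Longrightarrow> y \<in> f ` B \<Longrightarrow> q x = q y \<Longrightarrow> d x y < e"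
    then show ?thesis by (intro exI[of _ "q \<circ> f"]) (auto simp: image_comp)
  qed
qed

lemma mtotally_bounded_iff_tot_bounded:
  assumes n: "normed_space X" and B: "B \<subseteq> car X"
  shows "Metric_space.mtotally_bounded (car X) (ndist X) B \<longleftrightarrow> tot_bounded B (\<lambda>x y. nrm X (x - y))"
proof
  interpret Metric_space "car X" "ndist X" by (rule Metric_space_ndist[OF n])
  assume L: "mtotally_bounded B"
  show "tot_bounded B (\<lambda>x y. nrm X (x - y))"
    unfolding tot_bounded_def
  proof (intro allI impI)
    fix e :: real assume "e > 0"
    then obtain K where K: "finite K" "K \<subseteq> B" "B \<subseteq> (\<Union>x\<in>K. mball x (e/2))"
      using L unfolding mtotally_bounded_def by (meson half_gt_zero)
    obtain g :: "'a \<Rightarrow> nat" where g: "inj_on g K"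
      using K(1) finite_imp_inj_to_nat_seg by meson
    have "\<forall>x\<in>B. \<exists>y\<in>K. x \<in> mball y (e/2)" using K(3) by blast
    then obtain c where c: "\<And>x. x \<in> B \<Longrightarrow> c x \<in> K" "\<And>x. x \<in> B \<Longrightarrow> x \<in> mball (c x) (e/2)"
      by metis
    \<comment> \<open>The piece of \<open>x\<close> is the number of a centre \<open>c x\<close> at distance less than \<open>e/2\<close>.\<close>
    have "nrm X (x - y) < e" if "x \<in> B" "y \<in> B" "g (c x) = g (c y)" for x y
    proof -
      have eq: "c x = c y" using g that c(1) by (meson inj_onD)
      have "x \<in> car X" "y \<in> car X" "c x \<in> car X" using that B K(2) c(1) by auto
      moreover have "nrm X (c x - x) < e/2" "nrm X (c y - y) < e/2"
        using c(2)[OF that(1)] c(2)[OF that(2)] by (auto simp: in_mball ndist_def)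
      ultimately show ?thesis
        using nrm_diff_triangle[OF n, of x "c x" y] nrm_minus_commute[OF n, of x "c x"] eq by simp
    qed
    moreover have "finite ((g \<circ> c) ` B)"
      by (rule finite_subset[of _ "g ` K"]) (use c(1) K(1) in auto)
    ultimately show "\<exists>q::'a \<Rightarrow> nat. finite (q ` B) \<and> (\<forall>x\<in>B. \<forall>y\<in>B. q x = q y \<longrightarrow> nrm X (x - y) < e)"
      by (intro exI[of _ "g \<circ> c"] conjI ballI impI) simp_all
  qed
next
  interpret Metric_space "car X" "ndist X" by (rule Metric_space_ndist[OF n])
  assume R: "tot_bounded B (\<lambda>x y. nrm X (x - y))"
  show "mtotally_bounded B"
    unfolding mtotally_bounded_def
  proof (intro allI impI)
    fix e :: real assume "e > 0"
    obtain q :: "'a \<Rightarrow> nat" where q: "finite (q ` B)"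
      "\<And>x y. x \<in> B \<Longrightarrow> y \<in> B \<Longrightarrow> q x = q y \<Longrightarrow> nrm X (x - y) < e"
      by (rule tot_boundedE[OF R \<open>e > 0\<close>]) blast
    define r where "r i = (SOME x. x \<in> B \<and> q x = i)" for i
    have r: "r (q x) \<in> B \<and> q (r (q x)) = q x" if "x \<in> B" for x
      unfolding r_def by (rule someI[of _ x]) (use that in auto)
    have "x \<in> mball (r (q x)) e" if "x \<in> B" for x
      using q(2)[of "r (q x)" x] r[OF that] that B by (auto simp: in_mball ndist_def)
    then show "\<exists>K. finite K \<and> K \<subseteq> B \<and> B \<subseteq> (\<Union>x\<in>K. mball x e)"
      using q(1) r by (intro exI[of _ "r ` q ` B"]) auto
  qed
qed

lemma compact_inclusion_tot_bounded:
  assumes Y: "normed_space Y" and c: "compact_inclusion X Y"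
    and B: "B \<subseteq> car X" "\<And>x. x \<in> B \<Longrightarrow> nrm X x \<le> C"
  shows "tot_bounded B (\<lambda>x y. nrm Y (x - y))"
proof -
  interpret Metric_space "car Y" "ndist Y" by (rule Metric_space_ndist[OF Y])
  have BY: "B \<subseteq> car Y" using c B(1) by (auto simp: compact_inclusion_def)
  have "compactin mtopology (mtopology closure_of B)"
    using c B unfolding compact_inclusion_def norm_topology_def by blast
  then show ?thesis
    using compact_closure_of_imp_mtotally_bounded BY mtotally_bounded_iff_tot_bounded[OF Y BY] by blast
qed

text \<open>In a Banach space the closure of a totally bounded set is compact.\<close>

lemma compact_inclusionI:
  assumes Y: "banach_space Y" and sub: "car X \<subseteq> car Y"
    and B: "\<And>B C. B \<subseteq> car X \<Longrightarrow> (\<And>x. x \<in> B \<Longrightarrow> nrm X x \<le> C) \<Longrightarrow> tot_bounded B (\<lambda>x y. nrm Y (x - y))"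
  shows "compact_inclusion X Y"
proof -
  have n: "normed_space Y" using Y by (simp add: banach_space_def)
  interpret Metric_space "car Y" "ndist Y" by (rule Metric_space_ndist[OF n])
  show ?thesis
    unfolding compact_inclusion_def norm_topology_def
  proof (intro conjI sub allI impI)
    fix S assume S: "S \<subseteq> car X" "\<exists>C. \<forall>x\<in>S. nrm X x \<le> C"
    then have "tot_bounded S (\<lambda>x y. nrm Y (x - y))" using B by blast
    moreover have "S \<subseteq> car Y" using S sub by blast
    ultimately have "mtotally_bounded S" using mtotally_bounded_iff_tot_bounded[OF n] by blast
    then show "compactin mtopology (mtopology closure_of S)"
      using mtotally_bounded_eq_compact_closure_of Y by (auto simp: banach_space_def)
  qed
qed

text \<open>Continuity of the inclusion, as a constant: the unit ball of \<open>X\<close> splits into finitely many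
  pieces of diameter below 1 in \<open>Y\<close>, so it is bounded in \<open>Y\<close>.\<close>

lemma compact_inclusion_bounded:
  assumes X: "normed_space X" and Y: "normed_space Y" and c: "compact_inclusion X Y"
  obtains K where "0 < K" "\<And>x. x \<in> car X \<Longrightarrow> nrm Y x \<le> K * nrm X x"
proof -
  have sub: "car X \<subseteq> car Y" using c by (auto simp: compact_inclusion_def)
  define B where "B = {x \<in> car X. nrm X x \<le> 1}"
  have "tot_bounded B (\<lambda>x y. nrm Y (x - y))"
    by (rule compact_inclusion_tot_bounded[OF Y c, of _ 1]) (auto simp: B_def)
  note tb = this
  obtain q :: "'a \<Rightarrow> nat" where q: "finite (q ` B)"
    "\<And>x y. x \<in> B \<Longrightarrow> y \<in> B \<Longrightarrow> q x = q y \<Longrightarrow> nrm Y (x - y) < 1"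
    by (rule tot_boundedE[OF tb zero_less_one]) blast
  define r where "r i = (SOME x. x \<in> B \<and> q x = i)" for i
  have r: "r (q x) \<in> B \<and> q (r (q x)) = q x" if "x \<in> B" for x
    unfolding r_def by (rule someI[of _ x]) (use that in auto)
  define K where "K = 1 + (\<Sum>i\<in>q ` B. nrm Y (r i))"
  have nn: "nrm Y (r i) \<ge> 0" if "i \<in> q ` B" for i
    using that r sub nrm_nonneg[OF Y] by (auto simp: B_def)
  have bd: "nrm Y x \<le> K" if "x \<in> B" for x
  proof -
    have "nrm Y x \<le> nrm Y (r (q x)) + nrm Y (x - r (q x))"
      using nrm_le_add_diff[OF Y, of x "r (q x)"] r[OF that] that sub by (auto simp: B_def)
    moreover have "nrm Y (x - r (q x)) < 1"
      using q(2)[of x "r (q x)"] r[OF that] that by auto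
    moreover have "nrm Y (r (q x)) \<le> (\<Sum>i\<in>q ` B. nrm Y (r i))"
      using nn that by (intro member_le_sum q(1)) auto
    ultimately show ?thesis unfolding K_def by linarith
  qed
  have K: "K > 0" unfolding K_def using sum_nonneg[OF nn] by fastforce
  have "nrm Y x \<le> K * nrm X x" if x: "x \<in> car X" for x
  proof (cases "x = 0")
    case True then show ?thesis using nrm_zero[OF X] nrm_zero[OF Y] by simp
  next
    case False
    define a where "a = nrm X x"
    have a: "a > 0" using False nrm_nonneg[OF X x] nrm_eq_0[OF X x] unfolding a_def by linarith
    have "(1/a) *\<^sub>R x \<in> B"
      unfolding B_def using car_scale[OF X x, of "1/a"] nrm_scale[OF X x, of "1/a"] a
      by (simp add: a_def)
    from bd[OF this] have "(1/a) * nrm Y x \<le> K"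
      using nrm_scale[OF Y, of x "1/a"] x sub a by auto
    then show ?thesis using a by (simp add: field_simps a_def)
  qed
  with K show thesis using that by blast
qed

lemma norm_closure_of:
  assumes "normed_space X" "S \<subseteq> car X"
  shows "norm_topology X closure_of S = {x \<in> car X. \<forall>r>0. \<exists>y\<in>S. nrm X (x - y) < r}"
proof -
  interpret Metric_space "car X" "ndist X" by (rule Metric_space_ndist[OF assms(1)])
  show ?thesis
    unfolding norm_topology_def metric_closure_of using assms(2)
    by (auto simp: in_mball ndist_def) (metis subsetD)+
qed

section \<open>Bounds on p-norms of scalar functions\<close>

text \<open>An upper bound for the \<open>p\<close>-norm, as a predicate that includes measurability and the sign of the bound:
  the closure properties below then compose without side conditions on finiteness.\<close>

definition Lp_le :: "'a measure \<Rightarrow> real \<Rightarrow> ('a \<Rightarrow> real) \<Rightarrow> real \<Rightarrow> bool" where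
  "Lp_le M p g c \<longleftrightarrow> g \<in> borel_measurable M \<and> 0 \<le> c \<and>
     (\<integral>\<^sup>+t. ennreal (\<bar>g t\<bar> powr p) \<partial>M) \<le> ennreal (c powr p)"

lemma Lp_leD:
  assumes "Lp_le M p g c"
  shows "g \<in> borel_measurable M" "0 \<le> c" "(\<integral>\<^sup>+t. ennreal (\<bar>g t\<bar> powr p) \<partial>M) \<le> ennreal (c powr p)"
  using assms by (auto simp: Lp_le_def)

lemma Lp_le_mono:
  assumes h: "Lp_le M p h c" and g: "g \<in> borel_measurable M" and p: "p \<ge> 1" and cd: "c \<le> d"
    and AE: "AE t in M. \<bar>g t\<bar> \<le> \<bar>h t\<bar>"
  shows "Lp_le M p g d"
proof -
  have "(\<integral>\<^sup>+t. ennreal (\<bar>g t\<bar> powr p) \<partial>M) \<le> (\<integral>\<^sup>+t. ennreal (\<bar>h t\<bar> powr p) \<partial>M)"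
    by (intro nn_integral_mono_AE) (use AE p in \<open>auto elim!: eventually_mono intro!: ennreal_leI powr_mono2\<close>)
  also have "\<dots> \<le> ennreal (c powr p)" using h by (simp add: Lp_le_def)
  also have "\<dots> \<le> ennreal (d powr p)"
    using h cd p by (intro ennreal_leI powr_mono2) (auto simp: Lp_le_def)
  finally show ?thesis using g h cd by (simp add: Lp_le_def)
qed

lemma Lp_le_zero: "Lp_le M p (\<lambda>t. 0) 0"
  by (simp add: Lp_le_def)

lemma Lp_le_scale:
  assumes h: "Lp_le M p h c"
  shows "Lp_le M p (\<lambda>t. a * h t) (\<bar>a\<bar> * c)"
proof -
  have [measurable]: "h \<in> borel_measurable M" using h by (simp add: Lp_le_def)
  have "(\<integral>\<^sup>+t. ennreal (\<bar>a * h t\<bar> powr p) \<partial>M) = (\<integral>\<^sup>+t. ennreal (\<bar>a\<bar> powr p) * ennreal (\<bar>h t\<bar> powr p) \<partial>M)"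
    by (simp add: abs_mult powr_mult ennreal_mult)
  also have "\<dots> = ennreal (\<bar>a\<bar> powr p) * (\<integral>\<^sup>+t. ennreal (\<bar>h t\<bar> powr p) \<partial>M)"
    by (intro nn_integral_cmult) simp
  also have "\<dots> \<le> ennreal (\<bar>a\<bar> powr p) * ennreal (c powr p)"
    using h by (intro mult_left_mono) (auto simp: Lp_le_def)
  also have "\<dots> = ennreal ((\<bar>a\<bar> * c) powr p)"
    using h by (simp add: powr_mult ennreal_mult Lp_le_def)
  finally show ?thesis using h by (simp add: Lp_le_def)
qed

lemma Lp_le_0_AE:
  assumes h: "Lp_le M p h 0" and p: "p \<ge> 1"
  shows "AE t in M. h t = 0"
proof -
  have [measurable]: "h \<in> borel_measurable M" using h by (simp add: Lp_le_def)
  have "(\<integral>\<^sup>+t. ennreal (\<bar>h t\<bar> powr p) \<partial>M) = 0" using h p by (simp add: Lp_le_def)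
  then have "AE t in M. ennreal (\<bar>h t\<bar> powr p) = 0"
    by (subst (asm) nn_integral_0_iff_AE) auto
  then show ?thesis by (rule eventually_mono) simp
qed

lemma powr_le_self:
  assumes "0 \<le> (s::real)" "s \<le> 1" "p \<ge> 1"
  shows "s powr p \<le> s"
proof (cases "s = 0")
  case False
  then have "s powr p \<le> s powr 1" using assms by (intro powr_mono') auto
  then show ?thesis using False assms by simp
qed (use assms in simp)

text \<open>Convexity of \<open>x \<mapsto> x powr p\<close> at the point \<open>(a + b)/(c + d)\<close>, which is a convex combination of
  \<open>a/c\<close> and \<open>b/d\<close>. Integrated with \<open>c\<close> and \<open>d\<close> the norms, this is the triangle inequality.\<close>

lemma powr_add_convex:
  fixes a b c d p :: real
  assumes "0 \<le> a" "0 \<le> b" "0 < c" "0 < d" "p \<ge> 1"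
  shows "((a + b) / (c + d)) powr p \<le> c/(c+d) * (a/c) powr p + d/(c+d) * (b/d) powr p"
proof -
  \<comment> \<open>The estimate for a single nonzero summand; convexity of the power function is applied only where both are positive.\<close>
  have edge: "(y / (c+d)) powr p \<le> e/(c+d) * (y/e) powr p" if "0 \<le> y" "0 < e" "e \<le> c + d" for y e
  proof -
    have "(y / (c+d)) powr p = (e/(c+d) * (y/e)) powr p" using that assms by simp
    also have "\<dots> = (e/(c+d)) powr p * (y/e) powr p" by (rule powr_mult)
    also have "\<dots> \<le> e/(c+d) * (y/e) powr p"
      using that assms by (intro mult_right_mono powr_le_self) auto
    finally show ?thesis .
  qed
  consider "a = 0" | "b = 0" | "a > 0" "b > 0" using assms by linarith
  then show ?thesis
  proof cases
    case 1 then show ?thesis using edge[of b d] assms by simp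
  next
    case 2 then show ?thesis using edge[of a c] assms by simp
  next
    case 3
    have "(c/(c+d) * (a/c) + d/(c+d) * (b/d)) powr p
        \<le> c/(c+d) * (a/c) powr p + d/(c+d) * (b/d) powr p"
      using convex_onD[OF powr_convex[OF assms(5)], of "d/(c+d)" "a/c" "b/d"] 3 assms
      by (simp add: field_simps)
    moreover have "c/(c+d) * (a/c) + d/(c+d) * (b/d) = (a + b)/(c+d)"
      using assms by (simp add: add_divide_distrib)
    ultimately show ?thesis by simp
  qed
qed

lemma Lp_le_add:
  assumes g: "Lp_le M p g c" and h: "Lp_le M p h d" and p: "p \<ge> 1"
  shows "Lp_le M p (\<lambda>t. \<bar>g t\<bar> + \<bar>h t\<bar>) (c + d)"
proof -
  have [measurable]: "g \<in> borel_measurable M" "h \<in> borel_measurable M"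
    using g h by (auto simp: Lp_le_def)
  have cd: "c \<ge> 0" "d \<ge> 0" using g h by (auto simp: Lp_le_def)
  consider "c = 0" | "d = 0" | "c > 0" "d > 0" using cd by linarith
  then show ?thesis
  proof cases
    case 1
    then have "AE t in M. g t = 0" using g p Lp_le_0_AE by blast
    then show ?thesis using 1 by (intro Lp_le_mono[OF h _ p]) auto
  next
    case 2
    then have "AE t in M. h t = 0" using h p Lp_le_0_AE by blast
    then show ?thesis using 2 by (intro Lp_le_mono[OF g _ p]) auto
  next
    case 3
    define A where "A = (c+d) powr p * (c/(c+d)) / c powr p"
    define B where "B = (c+d) powr p * (d/(c+d)) / d powr p"
    have AB: "A \<ge> 0" "B \<ge> 0" using 3 by (auto simp: A_def B_def)
    have pt: "(\<bar>g t\<bar> + \<bar>h t\<bar>) powr p \<le> A * \<bar>g t\<bar> powr p + B * \<bar>h t\<bar> powr p" for t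
    proof -
      have "(\<bar>g t\<bar> + \<bar>h t\<bar>) powr p = (c+d) powr p * ((\<bar>g t\<bar> + \<bar>h t\<bar>)/(c+d)) powr p"
        using 3 by (simp add: powr_divide)
      also have "\<dots> \<le> (c+d) powr p * (c/(c+d) * (\<bar>g t\<bar>/c) powr p + d/(c+d) * (\<bar>h t\<bar>/d) powr p)"
        using 3 p by (intro mult_left_mono powr_add_convex) auto
      also have "\<dots> = A * \<bar>g t\<bar> powr p + B * \<bar>h t\<bar> powr p"
        using 3 by (simp add: A_def B_def powr_divide algebra_simps)
      finally show ?thesis .
    qed
    have "(\<integral>\<^sup>+t. ennreal ((\<bar>g t\<bar> + \<bar>h t\<bar>) powr p) \<partial>M)
        \<le> (\<integral>\<^sup>+t. ennreal A * ennreal (\<bar>g t\<bar> powr p) + ennreal B * ennreal (\<bar>h t\<bar> powr p) \<partial>M)"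
      by (intro nn_integral_mono) (use pt AB in \<open>simp flip: ennreal_mult ennreal_plus\<close>)
    also have "\<dots> = ennreal A * (\<integral>\<^sup>+t. ennreal (\<bar>g t\<bar> powr p) \<partial>M) + ennreal B * (\<integral>\<^sup>+t. ennreal (\<bar>h t\<bar> powr p) \<partial>M)"
      by (simp add: nn_integral_add nn_integral_cmult)
    also have "\<dots> \<le> ennreal A * ennreal (c powr p) + ennreal B * ennreal (d powr p)"
      using g h by (intro add_mono mult_left_mono) (auto simp: Lp_le_def)
    also have "\<dots> = ennreal (A * c powr p + B * d powr p)"
      using AB by (simp flip: ennreal_mult ennreal_plus)
    also have "A * c powr p + B * d powr p = (c+d) powr p * (c/(c+d) + d/(c+d))"
      using 3 by (simp add: A_def B_def distrib_left)
    also have "\<dots> = (c+d) powr p" using 3 by (simp flip: add_divide_distrib)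
    finally show ?thesis using cd by (simp add: Lp_le_def)
  qed
qed

lemma Lp_le_sum:
  assumes "finite A" "\<And>i. i \<in> A \<Longrightarrow> Lp_le M p (g i) (c i)" "p \<ge> 1"
  shows "Lp_le M p (\<lambda>t. \<Sum>i\<in>A. \<bar>g i t\<bar>) (\<Sum>i\<in>A. c i)"
  using assms
proof (induction A rule: finite_induct)
  case empty then show ?case by (simp add: Lp_le_zero)
next
  case (insert a A)
  have "Lp_le M p (\<lambda>t. \<bar>g a t\<bar> + \<bar>\<Sum>i\<in>A. \<bar>g i t\<bar>\<bar>) (c a + (\<Sum>i\<in>A. c i))"
    by (intro Lp_le_add insert) (use insert in auto)
  moreover have "\<bar>\<Sum>i\<in>A. \<bar>g i t\<bar>\<bar> = (\<Sum>i\<in>A. \<bar>g i t\<bar>)" for t by (simp add: sum_nonneg)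
  ultimately show ?case using insert by simp
qed

lemma Lp_le_Fatou:
  assumes h: "\<And>i::nat. Lp_le M p (h i) c" and g: "g \<in> borel_measurable M" and p: "p \<ge> 1"
    and lim: "AE t in M. (\<lambda>i. h i t) \<longlonglongrightarrow> g t"
  shows "Lp_le M p g c"
proof -
  have [measurable]: "h i \<in> borel_measurable M" for i using h[of i] by (simp add: Lp_le_def)
  note g [measurable]
  have "(\<integral>\<^sup>+t. ennreal (\<bar>g t\<bar> powr p) \<partial>M) = (\<integral>\<^sup>+t. liminf (\<lambda>i. ennreal (\<bar>h i t\<bar> powr p)) \<partial>M)"
  proof (intro nn_integral_cong_AE, use lim in eventually_elim)
    fix t assume "(\<lambda>i. h i t) \<longlonglongrightarrow> g t"
    then have "(\<lambda>i. \<bar>h i t\<bar> powr p) \<longlonglongrightarrow> \<bar>g t\<bar> powr p"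
      using p by (intro tendsto_powr2 tendsto_intros) auto
    then have "(\<lambda>i. ennreal (\<bar>h i t\<bar> powr p)) \<longlonglongrightarrow> ennreal (\<bar>g t\<bar> powr p)"
      by (rule tendsto_ennrealI)
    then show "ennreal (\<bar>g t\<bar> powr p) = liminf (\<lambda>i. ennreal (\<bar>h i t\<bar> powr p))"
      by (metis lim_imp_Liminf sequentially_bot)
  qed
  also have "\<dots> \<le> liminf (\<lambda>i. \<integral>\<^sup>+t. ennreal (\<bar>h i t\<bar> powr p) \<partial>M)"
    by (intro nn_integral_liminf) simp
  also have "\<dots> \<le> ennreal (c powr p)"
    using h by (intro Liminf_le always_eventually) (auto simp: Lp_le_def)
  finally show ?thesis using g h by (simp add: Lp_le_def)
qed

lemma Lp_le_exists:
  assumes "g \<in> borel_measurable M" "(\<integral>\<^sup>+t. ennreal (\<bar>g t\<bar> powr p) \<partial>M) < \<infinity>" "p \<ge> 1"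
  shows "Lp_le M p g (enn2real (\<integral>\<^sup>+t. ennreal (\<bar>g t\<bar> powr p) \<partial>M) powr (1/p))"
  using assms by (simp add: Lp_le_def powr_powr)

lemma Lp_le_least:
  assumes "Lp_le M p g c" "p \<ge> 1"
  shows "enn2real (\<integral>\<^sup>+t. ennreal (\<bar>g t\<bar> powr p) \<partial>M) powr (1/p) \<le> c"
proof -
  have "enn2real (\<integral>\<^sup>+t. ennreal (\<bar>g t\<bar> powr p) \<partial>M) \<le> c powr p"
    using assms by (intro enn2real_leI) (auto simp: Lp_le_def)
  then have "enn2real (\<integral>\<^sup>+t. ennreal (\<bar>g t\<bar> powr p) \<partial>M) powr (1/p) \<le> (c powr p) powr (1/p)"
    using assms by (intro powr_mono2) auto
  also have "\<dots> = c" using assms by (simp add: powr_powr Lp_le_def)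
  finally show ?thesis .
qed

lemma Lp_le_dominated:
  fixes g :: "nat \<Rightarrow> 'a \<Rightarrow> real"
  assumes g: "\<And>i. g i \<in> borel_measurable M" and h: "Lp_le M p h c" and p: "p \<ge> 1"
    and dom: "\<And>i. AE t in M. \<bar>g i t\<bar> \<le> \<bar>h t\<bar>" and lim: "AE t in M. (\<lambda>i. g i t) \<longlonglongrightarrow> 0" and e: "e > 0"
  shows "\<exists>N. \<forall>i\<ge>N. Lp_le M p (g i) e"
proof -
  note g[measurable]
  have [measurable]: "h \<in> borel_measurable M" using h by (simp add: Lp_le_def)
  have "(\<lambda>i. \<integral>\<^sup>+t. ennreal (\<bar>g i t\<bar> powr p) \<partial>M) \<longlonglongrightarrow> (\<integral>\<^sup>+t. 0 \<partial>M)"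
  proof (rule nn_integral_dominated_convergence[where w="\<lambda>t. ennreal (\<bar>h t\<bar> powr p)"])
    show "AE t in M. ennreal (\<bar>g i t\<bar> powr p) \<le> ennreal (\<bar>h t\<bar> powr p)" for i
      using dom[of i] p by (auto elim!: eventually_mono intro!: ennreal_leI powr_mono2)
    show "(\<integral>\<^sup>+t. ennreal (\<bar>h t\<bar> powr p) \<partial>M) < \<infinity>"
      using h by (auto simp: Lp_le_def intro: le_less_trans)
    show "AE t in M. (\<lambda>i. ennreal (\<bar>g i t\<bar> powr p)) \<longlonglongrightarrow> 0"
      using lim
    proof eventually_elim
      fix t assume "(\<lambda>i. g i t) \<longlonglongrightarrow> 0"
      then have "(\<lambda>i. \<bar>g i t\<bar> powr p) \<longlonglongrightarrow> \<bar>0\<bar> powr p"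
        using p by (intro tendsto_powr2 tendsto_intros) auto
      then show "(\<lambda>i. ennreal (\<bar>g i t\<bar> powr p)) \<longlonglongrightarrow> 0"
        using p tendsto_ennrealI by fastforce
    qed
  qed auto
  then have "(\<lambda>i. \<integral>\<^sup>+t. ennreal (\<bar>g i t\<bar> powr p) \<partial>M) \<longlonglongrightarrow> 0" by simp
  moreover have "(0::ennreal) < ennreal (e powr p)" using e by simp
  ultimately have "\<forall>\<^sub>F i in sequentially. (\<integral>\<^sup>+t. ennreal (\<bar>g i t\<bar> powr p) \<partial>M) < ennreal (e powr p)"
    by (rule order_tendstoD)
  then show ?thesis using e g by (auto simp: Lp_le_def eventually_sequentially intro: less_imp_le)
qed

text \<open>The partial sums are bounded by 2 in norm, so their supremum is finite almost everywhere by monotone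
  convergence.\<close>

lemma Lp_le_geometric_sum:
  fixes h :: "nat \<Rightarrow> 'a \<Rightarrow> real"
  assumes h: "\<And>i. Lp_le M p (h i) ((1/2)^i)" and p: "p \<ge> 1"
  shows "AE t in M. summable (\<lambda>i. \<bar>h i t\<bar>)"
proof -
  have [measurable]: "h i \<in> borel_measurable M" for i using h[of i] by (simp add: Lp_le_def)
  define S where "S n t = (\<Sum>i<n. \<bar>h i t\<bar>)" for n t
  have S: "Lp_le M p (S n) 2" for n
  proof -
    have "Lp_le M p (S n) (\<Sum>i<n. (1/2)^i)"
      unfolding S_def by (intro Lp_le_sum h p) auto
    moreover have "(\<Sum>i<n. (1/2)^i) = 2 - 2 * (1/2::real)^n" by (induction n) auto
    then have "(\<Sum>i<n. (1/2)^i) \<le> (2::real)" by simp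
    ultimately show ?thesis using p by (intro Lp_le_mono[of M p "S n" _ "S n" 2]) (auto simp: Lp_le_def)
  qed
  have S0: "S n t \<ge> 0" for n t by (simp add: S_def sum_nonneg)
  have "(\<integral>\<^sup>+t. (SUP n. ennreal (S n t powr p)) \<partial>M) = (SUP n. \<integral>\<^sup>+t. ennreal (S n t powr p) \<partial>M)"
  proof (rule nn_integral_monotone_convergence_SUP)
    show "incseq (\<lambda>n t. ennreal (S n t powr p))"
      using p by (intro incseq_SucI le_funI ennreal_leI powr_mono2) (auto simp: S0, auto simp: S_def)
    show "(\<lambda>t. ennreal (S n t powr p)) \<in> borel_measurable M" for n
      unfolding S_def by simp
  qed
  also have "\<dots> \<le> ennreal (2 powr p)"
    using S S0 by (intro SUP_least) (auto simp: Lp_le_def)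
  finally have "(\<integral>\<^sup>+t. (SUP n. ennreal (S n t powr p)) \<partial>M) \<noteq> \<infinity>" by (auto simp: top_unique)
  moreover have "(\<lambda>t. SUP n. ennreal (S n t powr p)) \<in> borel_measurable M"
    unfolding S_def by measurable
  ultimately have "AE t in M. (SUP n. ennreal (S n t powr p)) \<noteq> \<infinity>"
    by (intro nn_integral_PInf_AE) auto
  then show ?thesis
  proof eventually_elim
    fix t assume "(SUP n. ennreal (S n t powr p)) \<noteq> \<infinity>"
    then obtain r where r: "(SUP n. ennreal (S n t powr p)) = ennreal r" "r \<ge> 0"
      by (metis ennreal_cases infinity_ennreal_def)
    have "S n t \<le> 1 + r" for n
    proof (cases "S n t \<le> 1")
      case False
      have "ennreal (S n t powr p) \<le> ennreal r" unfolding r(1)[symmetric] by (rule SUP_upper) simp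
      then have "S n t powr p \<le> r" using r by simp
      moreover have "S n t powr 1 \<le> S n t powr p" using False p by (intro powr_mono) auto
      ultimately show ?thesis using False by simp
    qed (use r in simp)
    then show "summable (\<lambda>i. \<bar>h i t\<bar>)"
      by (intro bounded_imp_summable[where B="1+r"])
        (auto simp: S_def intro: order_trans[OF _ \<open>S (Suc _) t \<le> 1 + r\<close>[unfolded S_def lessThan_Suc_atMost]])
  qed
qed

text \<open>Hoelder's inequality against the constant 1, up to the factor 2: integrate
  \<open>x \<le> \<eta> + \<eta> powr (1 - p) * x powr p\<close> and choose \<open>\<eta>\<close> so that both terms agree.\<close>

lemma le_eta_add_powr:
  fixes x p \<eta> :: real
  assumes "0 \<le> x" "0 < \<eta>" "p \<ge> 1"
  shows "x \<le> \<eta> + \<eta> powr (1 - p) * x powr p"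
proof (cases "x \<le> \<eta>")
  case True
  have "0 \<le> \<eta> powr (1 - p) * x powr p" by simp
  then show ?thesis using True by linarith
next
  case False
  have "x = x powr (1 - p) * x powr p" using False assms by (simp flip: powr_add)
  also have "\<dots> \<le> \<eta> powr (1 - p) * x powr p"
    using False assms by (intro mult_right_mono powr_mono2') auto
  finally show ?thesis using assms by linarith
qed

lemma Lp_le_imp_L1:
  assumes g: "Lp_le M p g c" and p: "p \<ge> 1" and L: "emeasure M (space M) \<le> ennreal L" "L > 0"
  shows "(\<integral>\<^sup>+t. ennreal \<bar>g t\<bar> \<partial>M) \<le> ennreal (2 * L powr (1 - 1/p) * c)"
proof (cases "c = 0")
  case True
  then have "AE t in M. g t = 0" using g p Lp_le_0_AE by blast
  then have "(\<integral>\<^sup>+t. ennreal \<bar>g t\<bar> \<partial>M) = (\<integral>\<^sup>+t. 0 \<partial>M)"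
    by (intro nn_integral_cong_AE) auto
  then show ?thesis by simp
next
  case False
  then have c: "c > 0" using g by (simp add: Lp_le_def)
  have [measurable]: "g \<in> borel_measurable M" using g by (simp add: Lp_le_def)
  define \<eta> where "\<eta> = c / L powr (1/p)"
  have \<eta>: "\<eta> > 0" using c L by (simp add: \<eta>_def)
  have "(\<integral>\<^sup>+t. ennreal \<bar>g t\<bar> \<partial>M) \<le> (\<integral>\<^sup>+t. ennreal \<eta> + ennreal (\<eta> powr (1-p)) * ennreal (\<bar>g t\<bar> powr p) \<partial>M)"
    using le_eta_add_powr[OF _ \<eta> p] \<eta> by (intro nn_integral_mono) (simp flip: ennreal_mult ennreal_plus)
  also have "\<dots> = ennreal \<eta> * emeasure M (space M) + ennreal (\<eta> powr (1-p)) * (\<integral>\<^sup>+t. ennreal (\<bar>g t\<bar> powr p) \<partial>M)"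
    by (simp add: nn_integral_add nn_integral_cmult)
  also have "\<dots> \<le> ennreal \<eta> * ennreal L + ennreal (\<eta> powr (1-p)) * ennreal (c powr p)"
    using g L by (intro add_mono mult_left_mono) (auto simp: Lp_le_def)
  also have "\<dots> = ennreal (\<eta> * L + \<eta> powr (1-p) * c powr p)"
    using \<eta> L by (simp flip: ennreal_mult ennreal_plus)
  also have "\<eta> * L = L powr (1 - 1/p) * c"
    using L by (simp add: \<eta>_def powr_diff)
  also have "\<eta> powr (1-p) * c powr p = L powr (1 - 1/p) * c"
  proof -
    have "\<eta> powr (1-p) * c powr p = (c powr (1-p) * c powr p) / (L powr (1/p)) powr (1-p)"
      using c L by (simp add: \<eta>_def powr_divide)
    also have "c powr (1-p) * c powr p = c" using c by (simp flip: powr_add)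
    also have "(L powr (1/p)) powr (1-p) = L powr (- (1 - 1/p))"
    proof -
      have "1/p * (1-p) = - (1 - 1/p)" using p by (simp add: right_diff_distrib)
      then show ?thesis by (simp only: powr_powr)
    qed
    also have "\<dots> = inverse (L powr (1 - 1/p))" by (simp only: powr_minus)
    finally show ?thesis by (simp add: field_simps)
  qed
  finally show ?thesis by (simp add: mult_ac)
qed

lemma Lp_le_const:
  assumes p: "p \<ge> 1" and L: "emeasure M (space M) \<le> ennreal L" "L \<ge> 0" and a: "a \<ge> 0"
  shows "Lp_le M p (\<lambda>t. a) (a * L powr (1/p))"
proof -
  have "(\<integral>\<^sup>+t. ennreal (\<bar>a\<bar> powr p) \<partial>M) \<le> ennreal (a powr p) * ennreal L"
    using L a by (simp add: mult_left_mono)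
  also have "\<dots> = ennreal ((a * L powr (1/p)) powr p)"
    using a L p by (simp add: powr_mult powr_powr ennreal_mult)
  finally show ?thesis using a by (simp add: Lp_le_def)
qed

lemma Lp_le_restrict:
  assumes g: "Lp_le (lebesgue_on I) p g c" and J: "J \<subseteq> I" "I \<in> sets lebesgue" "J \<in> sets lebesgue"
  shows "Lp_le (lebesgue_on J) p g c"
proof -
  have m: "g \<in> borel_measurable (lebesgue_on J)"
    using g J by (auto simp: Lp_le_def intro: measurable_restrict_mono)
  have "(\<integral>\<^sup>+t. ennreal (\<bar>g t\<bar> powr p) \<partial>lebesgue_on J) \<le> (\<integral>\<^sup>+t. ennreal (\<bar>g t\<bar> powr p) \<partial>lebesgue_on I)"
    using J by (subst (1 2) nn_integral_restrict_space)
      (auto intro!: nn_integral_mono split: split_indicator)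
  then show ?thesis using g m by (auto simp: Lp_le_def)
qed

lemma Lp_le_extend:
  assumes g: "Lp_le (lebesgue_on J) p g c" and J: "J \<subseteq> I" "I \<in> sets lebesgue" "J \<in> sets lebesgue"
  shows "Lp_le (lebesgue_on I) p (\<lambda>t. if t \<in> J then g t else 0) c"
proof -
  have "(\<lambda>t. if t \<in> J then g t else 0) \<in> borel_measurable lebesgue"
    using g J borel_measurable_if_lebesgue_on[of J UNIV g] borel_measurable_if[of J g] by (auto simp: Lp_le_def)
  then have m: "(\<lambda>t. if t \<in> J then g t else 0) \<in> borel_measurable (lebesgue_on I)"
    by (rule measurable_restrict_space1)
  have "(\<integral>\<^sup>+t. ennreal (\<bar>if t \<in> J then g t else 0\<bar> powr p) \<partial>lebesgue_on I)
      = (\<integral>\<^sup>+t. ennreal (\<bar>g t\<bar> powr p) \<partial>lebesgue_on J)"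
    using J by (subst (1 2) nn_integral_restrict_space)
      (auto intro!: nn_integral_cong split: split_indicator)
  then show ?thesis using g m by (auto simp: Lp_le_def)
qed

section \<open>Strong measurability\<close>

lemma borel_measurable_lebesgue_on_AE:
  fixes f g :: "real \<Rightarrow> real"
  assumes I: "I \<in> sets lebesgue" and g: "g \<in> borel_measurable (lebesgue_on I)"
    and eq: "AE t in lebesgue_on I. g t = f t"
  shows "f \<in> borel_measurable (lebesgue_on I)"
proof -
  have "(\<lambda>t. if t \<in> I then g t else 0) \<in> borel_measurable lebesgue"
    using g I borel_measurable_if[of I g] by auto
  moreover have "AE t in lebesgue. (if t \<in> I then g t else 0) = (if t \<in> I then f t else 0)"
    using eq I by (subst (asm) AE_restrict_space_iff) (auto elim: eventually_mono)
  ultimately have "(\<lambda>t. if t \<in> I then f t else 0) \<in> borel_measurable lebesgue"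
    by (rule borel_measurable_AE)
  then show ?thesis
    using I borel_measurable_if[of I f] by auto
qed

lemma AE_lebesgue_on_mono:
  assumes "AE t in lebesgue_on I. P t" "J \<subseteq> I" "I \<in> sets lebesgue" "J \<in> sets lebesgue"
  shows "AE t in lebesgue_on J. P t"
proof -
  have "AE t in lebesgue. t \<in> I \<longrightarrow> P t"
    using assms(1,3) by (simp add: AE_restrict_space_iff)
  then have "AE t in lebesgue. t \<in> J \<longrightarrow> P t"
    by (rule eventually_mono) (use assms(2) in blast)
  then show ?thesis using assms(4) by (simp add: AE_restrict_space_iff)
qed

lemma simple_function_restrict_mono:
  assumes "simple_function (lebesgue_on I) s" "J \<subseteq> I" "I \<in> sets lebesgue" "J \<in> sets lebesgue"
  shows "simple_function (lebesgue_on J) s"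
proof -
  have "s -` {x} \<inter> J \<in> sets (lebesgue_on J)" for x
  proof (cases "x \<in> s ` I")
    case True
    then have "s -` {x} \<inter> I \<in> sets lebesgue"
      using assms by (auto simp: simple_function_def sets_restrict_space_iff)
    then have "(s -` {x} \<inter> I) \<inter> J \<in> sets lebesgue" using assms by blast
    moreover have "(s -` {x} \<inter> I) \<inter> J = s -` {x} \<inter> J" using assms by blast
    ultimately show ?thesis using assms by (simp add: sets_restrict_space_iff)
  next
    case False
    then have "s -` {x} \<inter> J = {}" using assms by auto
    then show ?thesis by (metis sets.empty_sets)
  qed
  moreover have "finite (s ` J)"
    using assms by (auto simp: simple_function_def intro: finite_subset[OF image_mono])
  ultimately show ?thesis by (simp add: simple_function_def)
qed

lemma strongly_measurableE:
  assumes "strongly_measurable I X u"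
  obtains s :: "nat \<Rightarrow> real \<Rightarrow> 'v::real_vector" where
    "\<And>i. simple_function (lebesgue_on I) (s i)" "\<And>i t. t \<in> I \<Longrightarrow> s i t \<in> car X"
    "AE t in lebesgue_on I. (\<lambda>i. nrm X (s i t - u t)) \<longlonglongrightarrow> 0"
  using assms unfolding strongly_measurable_def Pi_iff by blast

lemma strongly_measurableI:
  assumes "\<And>t. t \<in> I \<Longrightarrow> u t \<in> car X" "\<And>i. simple_function (lebesgue_on I) (s i)"
    "\<And>i t. t \<in> I \<Longrightarrow> s i t \<in> car X"
    "AE t in lebesgue_on I. (\<lambda>i. nrm X (s i t - u t)) \<longlonglongrightarrow> 0"
  shows "strongly_measurable I X u"
  using assms unfolding strongly_measurable_def by blast

lemma strongly_measurable_car: "strongly_measurable I X u \<Longrightarrow> t \<in> I \<Longrightarrow> u t \<in> car X"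
  by (auto simp: strongly_measurable_def)

lemma AE_in_lebesgue_on: "AE t in lebesgue_on I. t \<in> I"
  using AE_space[of "lebesgue_on I"] by simp

lemma strongly_measurable_cong_AE:
  assumes "strongly_measurable I X u" "AE t in lebesgue_on I. u t = v t" "\<And>t. t \<in> I \<Longrightarrow> v t \<in> car X"
  shows "strongly_measurable I X v"
proof -
  obtain s where s: "\<And>i. simple_function (lebesgue_on I) (s i)" "\<And>i t. t \<in> I \<Longrightarrow> s i t \<in> car X"
    "AE t in lebesgue_on I. (\<lambda>i. nrm X (s i t - u t)) \<longlonglongrightarrow> 0"
    by (rule strongly_measurableE[OF assms(1)]) blast
  from s(3) assms(2) have "AE t in lebesgue_on I. (\<lambda>i. nrm X (s i t - v t)) \<longlonglongrightarrow> 0"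
    by eventually_elim simp
  then show ?thesis using s assms(3) by (intro strongly_measurableI[of I v X s])
qed

lemma strongly_measurable_mono:
  assumes "strongly_measurable I X u" "J \<subseteq> I" "I \<in> sets lebesgue" "J \<in> sets lebesgue"
  shows "strongly_measurable J X u"
proof -
  obtain s where s: "\<And>i. simple_function (lebesgue_on I) (s i)" "\<And>i t. t \<in> I \<Longrightarrow> s i t \<in> car X"
    "AE t in lebesgue_on I. (\<lambda>i. nrm X (s i t - u t)) \<longlonglongrightarrow> 0"
    by (rule strongly_measurableE[OF assms(1)]) blast
  show ?thesis
    by (rule strongly_measurableI[of J u X s])
      (use s assms strongly_measurable_car[OF assms(1)] in
        \<open>auto intro: simple_function_restrict_mono AE_lebesgue_on_mono\<close>)
qed

lemma simple_function_real:
  fixes F :: "'v \<Rightarrow> real"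
  assumes "simple_function M s"
  shows "(\<lambda>t. F (s t)) \<in> borel_measurable M"
  using simple_function_compose1[OF assms, of F] by (rule borel_measurable_simple_function)

lemma nrm_tendsto:
  assumes X: "normed_space X" and "\<And>i. s i \<in> car X" "x \<in> car X"
    "(\<lambda>i. nrm X (s i - x)) \<longlonglongrightarrow> 0"
  shows "(\<lambda>i. nrm X (s i)) \<longlonglongrightarrow> nrm X x"
proof -
  have "(\<lambda>i. nrm X (s i) - nrm X x) \<longlonglongrightarrow> 0"
    by (rule Lim_null_comparison[OF _ assms(4)]) (use nrm_abs_diff[OF X] assms in auto)
  then show ?thesis by (simp add: LIM_zero_iff)
qed

lemma borel_measurable_nrm:
  assumes X: "normed_space X" and I: "I \<in> sets lebesgue" and u: "strongly_measurable I X u"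
  shows "(\<lambda>t. nrm X (u t)) \<in> borel_measurable (lebesgue_on I)"
proof -
  obtain s where s: "\<And>i. simple_function (lebesgue_on I) (s i)" "\<And>i t. t \<in> I \<Longrightarrow> s i t \<in> car X"
    "AE t in lebesgue_on I. (\<lambda>i. nrm X (s i t - u t)) \<longlonglongrightarrow> 0"
    by (rule strongly_measurableE[OF u]) blast
  have "(\<lambda>t. lim (\<lambda>i. nrm X (s i t))) \<in> borel_measurable (lebesgue_on I)"
    by (intro borel_measurable_lim_metric simple_function_real s)
  moreover have "AE t in lebesgue_on I. lim (\<lambda>i. nrm X (s i t)) = nrm X (u t)"
    using s(3) AE_in_lebesgue_on
  proof eventually_elim
    fix t assume t: "(\<lambda>i. nrm X (s i t - u t)) \<longlonglongrightarrow> 0" "t \<in> I"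
    show "lim (\<lambda>i. nrm X (s i t)) = nrm X (u t)"
      by (rule limI, rule nrm_tendsto[OF X s(2)[OF t(2)] strongly_measurable_car[OF u t(2)] t(1)])
  qed
  ultimately show ?thesis by (rule borel_measurable_lebesgue_on_AE[OF I])
qed

lemma tendsto_nrm_le:
  assumes "normed_space X" "\<And>i. s i \<in> car X" "f \<longlonglongrightarrow> (0::real)" "\<And>i. nrm X (s i) \<le> f i"
  shows "(\<lambda>i. nrm X (s i)) \<longlonglongrightarrow> 0"
  by (rule Lim_null_comparison[OF _ assms(3)]) (use assms nrm_nonneg[OF assms(1,2)] in auto)

lemma strongly_measurable_simple:
  assumes "normed_space X" "simple_function (lebesgue_on I) s" "\<And>t. t \<in> I \<Longrightarrow> s t \<in> car X"
  shows "strongly_measurable I X s"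
  by (rule strongly_measurableI[of _ _ _ "\<lambda>i. s"]) (use assms nrm_zero[OF assms(1)] in auto)

lemma strongly_measurable_add:
  assumes X: "normed_space X" and u: "strongly_measurable I X u" and v: "strongly_measurable I X v"
  shows "strongly_measurable I X (\<lambda>t. u t + v t)"
proof -
  obtain s where s: "\<And>i. simple_function (lebesgue_on I) (s i)" "\<And>i t. t \<in> I \<Longrightarrow> s i t \<in> car X"
    "AE t in lebesgue_on I. (\<lambda>i. nrm X (s i t - u t)) \<longlonglongrightarrow> 0"
    by (rule strongly_measurableE[OF u]) blast
  obtain r where r: "\<And>i. simple_function (lebesgue_on I) (r i)" "\<And>i t. t \<in> I \<Longrightarrow> r i t \<in> car X"
    "AE t in lebesgue_on I. (\<lambda>i. nrm X (r i t - v t)) \<longlonglongrightarrow> 0"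
    by (rule strongly_measurableE[OF v]) blast
  note c = strongly_measurable_car[OF u] strongly_measurable_car[OF v]
  have "AE t in lebesgue_on I. (\<lambda>i. nrm X ((s i t + r i t) - (u t + v t))) \<longlonglongrightarrow> 0"
    using s(3) r(3) AE_in_lebesgue_on
  proof eventually_elim
    fix t assume t: "(\<lambda>i. nrm X (s i t - u t)) \<longlonglongrightarrow> 0" "(\<lambda>i. nrm X (r i t - v t)) \<longlonglongrightarrow> 0" "t \<in> I"
    from tendsto_add_zero[OF t(1,2)] show "(\<lambda>i. nrm X ((s i t + r i t) - (u t + v t))) \<longlonglongrightarrow> 0"
    proof (rule tendsto_nrm_le[OF X, rotated])
      fix i
      have "s i t - u t \<in> car X" "r i t - v t \<in> car X"
        using t(3) s(2) r(2) c car_diff[OF X] by auto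
      from nrm_triangle[OF X this] car_add[OF X this]
      show "nrm X ((s i t + r i t) - (u t + v t)) \<le> nrm X (s i t - u t) + nrm X (r i t - v t)"
        "(s i t + r i t) - (u t + v t) \<in> car X"
        by (simp_all add: algebra_simps)
    qed
  qed
  then show ?thesis
    by (intro strongly_measurableI[of _ _ _ "\<lambda>i t. s i t + r i t"])
      (use s r c car_add[OF X] in \<open>auto intro: simple_function_compose2\<close>)
qed

lemma strongly_measurable_scale:
  assumes X: "normed_space X" and u: "strongly_measurable I X u"
    and \<phi>: "\<phi> \<in> borel_measurable (lebesgue_on I)"
  shows "strongly_measurable I X (\<lambda>t. \<phi> t *\<^sub>R u t)"
proof -
  obtain s where s: "\<And>i. simple_function (lebesgue_on I) (s i)" "\<And>i t. t \<in> I \<Longrightarrow> s i t \<in> car X"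
    "AE t in lebesgue_on I. (\<lambda>i. nrm X (s i t - u t)) \<longlonglongrightarrow> 0"
    by (rule strongly_measurableE[OF u]) blast
  obtain F where F: "\<And>i. simple_function (lebesgue_on I) (F i)"
    "\<And>t. t \<in> I \<Longrightarrow> (\<lambda>i. F i t) \<longlonglongrightarrow> (\<phi> t :: real)"
    using borel_measurable_implies_sequence_metric[OF \<phi>, of 0] by auto
  note c = strongly_measurable_car[OF u]
  have "AE t in lebesgue_on I. (\<lambda>i. nrm X (F i t *\<^sub>R s i t - \<phi> t *\<^sub>R u t)) \<longlonglongrightarrow> 0"
    using s(3) AE_in_lebesgue_on
  proof eventually_elim
    fix t assume t: "(\<lambda>i. nrm X (s i t - u t)) \<longlonglongrightarrow> 0" "t \<in> I"
    have "(\<lambda>i. \<bar>F i t\<bar> * nrm X (s i t - u t) + \<bar>F i t - \<phi> t\<bar> * nrm X (u t)) \<longlonglongrightarrow> \<bar>\<phi> t\<bar> * 0 + \<bar>\<phi> t - \<phi> t\<bar> * nrm X (u t)"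
      by (intro tendsto_intros t F)
    then have "(\<lambda>i. \<bar>F i t\<bar> * nrm X (s i t - u t) + \<bar>F i t - \<phi> t\<bar> * nrm X (u t)) \<longlonglongrightarrow> 0" by simp
    then show "(\<lambda>i. nrm X (F i t *\<^sub>R s i t - \<phi> t *\<^sub>R u t)) \<longlonglongrightarrow> 0"
    proof (rule tendsto_nrm_le[OF X, rotated])
      fix i
      have m: "s i t - u t \<in> car X" "u t \<in> car X" using t(2) s(2) c car_diff[OF X] by auto
      have eq: "F i t *\<^sub>R s i t - \<phi> t *\<^sub>R u t = F i t *\<^sub>R (s i t - u t) + (F i t - \<phi> t) *\<^sub>R u t"
        by (simp add: algebra_simps)
      show "F i t *\<^sub>R s i t - \<phi> t *\<^sub>R u t \<in> car X"
        unfolding eq using m car_add[OF X] car_scale[OF X] by blast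
      show "nrm X (F i t *\<^sub>R s i t - \<phi> t *\<^sub>R u t) \<le> \<bar>F i t\<bar> * nrm X (s i t - u t) + \<bar>F i t - \<phi> t\<bar> * nrm X (u t)"
        unfolding eq using nrm_triangle[OF X car_scale[OF X m(1)] car_scale[OF X m(2)]] nrm_scale[OF X] m
        by simp
    qed
  qed
  then show ?thesis
    by (intro strongly_measurableI[of _ _ _ "\<lambda>i t. F i t *\<^sub>R s i t"])
      (use s F c car_scale[OF X] in \<open>auto intro: simple_function_compose2\<close>)
qed

lemma strongly_measurable_const:
  assumes "normed_space X" "x \<in> car X"
  shows "strongly_measurable I X (\<lambda>t. x)"
  by (rule strongly_measurable_simple[OF assms(1)]) (use assms in auto)

lemma strongly_measurable_diff:
  assumes "normed_space X" "strongly_measurable I X u" "strongly_measurable I X v"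
  shows "strongly_measurable I X (\<lambda>t. u t - v t)"
  using strongly_measurable_add[OF assms(1,2) strongly_measurable_scale[OF assms(1,3), of "\<lambda>_. -1"]] by simp

lemma strongly_measurable_sum:
  assumes "normed_space X" "\<And>a. a \<in> A \<Longrightarrow> strongly_measurable I X (f a)"
  shows "strongly_measurable I X (\<lambda>t. \<Sum>a\<in>A. f a t)"
  using assms(2)
  by (induction A rule: infinite_finite_induct)
    (auto intro: strongly_measurable_const[OF assms(1) car_zero[OF assms(1)]] strongly_measurable_add[OF assms(1)])

definition embeds :: "'v::real_vector nspace \<Rightarrow> 'v nspace \<Rightarrow> real \<Rightarrow> bool" where
  "embeds X Y K \<longleftrightarrow> 0 \<le> K \<and> (\<forall>x\<in>car X. x \<in> car Y \<and> nrm Y x \<le> K * nrm X x)"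

lemma strongly_measurable_embed:
  assumes X: "normed_space X" and Y: "normed_space Y" and e: "embeds X Y K"
    and u: "strongly_measurable I X u"
  shows "strongly_measurable I Y u"
proof -
  obtain s where s: "\<And>i. simple_function (lebesgue_on I) (s i)" "\<And>i t. t \<in> I \<Longrightarrow> s i t \<in> car X"
    "AE t in lebesgue_on I. (\<lambda>i. nrm X (s i t - u t)) \<longlonglongrightarrow> 0"
    by (rule strongly_measurableE[OF u]) blast
  note c = strongly_measurable_car[OF u]
  have "AE t in lebesgue_on I. (\<lambda>i. nrm Y (s i t - u t)) \<longlonglongrightarrow> 0"
    using s(3) AE_in_lebesgue_on
  proof eventually_elim
    fix t assume t: "(\<lambda>i. nrm X (s i t - u t)) \<longlonglongrightarrow> 0" "t \<in> I"
    have "(\<lambda>i. K * nrm X (s i t - u t)) \<longlonglongrightarrow> 0" using tendsto_mult_right_zero[OF t(1)] by simp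
    then show "(\<lambda>i. nrm Y (s i t - u t)) \<longlonglongrightarrow> 0"
      by (rule tendsto_nrm_le[OF Y, rotated])
        (use e car_diff[OF X] c[OF t(2)] s(2)[OF t(2)] in \<open>auto simp: embeds_def\<close>)
  qed
  then show ?thesis
    by (intro strongly_measurableI[of _ _ _ s]) (use s c e in \<open>auto simp: embeds_def\<close>)
qed

text \<open>The approximating simple functions may be taken dominated by the function: where
  \<open>s i\<close> exceeds twice the limit it is replaced by 0, which happens only finitely often at
  almost every point.\<close>

lemma strongly_measurable_dominated_approx:
  assumes X: "normed_space X" and I: "I \<in> sets lebesgue" and u: "strongly_measurable I X u"
  obtains s :: "nat \<Rightarrow> real \<Rightarrow> 'v::real_vector" where
    "\<And>i. simple_function (lebesgue_on I) (s i)" "\<And>i t. t \<in> I \<Longrightarrow> s i t \<in> car X"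
    "AE t in lebesgue_on I. (\<lambda>i. nrm X (s i t - u t)) \<longlonglongrightarrow> 0"
    "\<And>i t. t \<in> I \<Longrightarrow> nrm X (s i t) \<le> 2 * nrm X (u t)"
proof -
  obtain s where s: "\<And>i. simple_function (lebesgue_on I) (s i)" "\<And>i t. t \<in> I \<Longrightarrow> s i t \<in> car X"
    "AE t in lebesgue_on I. (\<lambda>i. nrm X (s i t - u t)) \<longlonglongrightarrow> 0"
    by (rule strongly_measurableE[OF u]) blast
  note c = strongly_measurable_car[OF u]
  define A where "A i = {t \<in> space (lebesgue_on I). nrm X (s i t) \<le> 2 * nrm X (u t)}" for i
  have [measurable]: "(\<lambda>t. nrm X (s i t)) \<in> borel_measurable (lebesgue_on I)"
    "(\<lambda>t. nrm X (u t)) \<in> borel_measurable (lebesgue_on I)" for i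
    using borel_measurable_nrm[OF X I u] simple_function_real[OF s(1)] by auto
  have A: "A i \<in> sets (lebesgue_on I)" for i unfolding A_def by measurable
  define r where "r i t = (if t \<in> A i then s i t else 0)" for i t
  have 1: "simple_function (lebesgue_on I) (r i)" for i
    unfolding r_def by (rule simple_function_If_set[OF s(1) simple_function_const])
      (use A[of i] sets.sets_into_space[OF A] in \<open>auto simp: Int_absorb2\<close>)
  have 2: "r i t \<in> car X" if "t \<in> I" for i t
    using s(2) that car_zero[OF X] by (auto simp: r_def)
  have 3: "AE t in lebesgue_on I. (\<lambda>i. nrm X (r i t - u t)) \<longlonglongrightarrow> 0"
    using s(3) AE_in_lebesgue_on
  proof eventually_elim
    fix t assume t: "(\<lambda>i. nrm X (s i t - u t)) \<longlonglongrightarrow> 0" "t \<in> I"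
    show "(\<lambda>i. nrm X (r i t - u t)) \<longlonglongrightarrow> 0"
    proof (cases "nrm X (u t) = 0")
      case True
      then have u0: "u t = 0" using nrm_eq_0[OF X c[OF t(2)]] by simp
      have "nrm X (r i t) \<le> nrm X (s i t)" for i
        using nrm_nonneg[OF X s(2)[OF t(2)]] nrm_zero[OF X] by (auto simp: r_def)
      then show ?thesis
        by (intro tendsto_nrm_le[OF X _ t(1)]) (use 2[OF t(2)] car_diff[OF X] c[OF t(2)] u0 in auto)
    next
      case False
      then have pos: "nrm X (u t) > 0" using nrm_nonneg[OF X c[OF t(2)]] by simp
      from order_tendstoD(2)[OF t(1) pos]
      have ev: "\<forall>\<^sub>F i in sequentially. nrm X (r i t - u t) = nrm X (s i t - u t)"
      proof eventually_elim
        case (elim i)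
        have "nrm X (s i t) \<le> 2 * nrm X (u t)"
          using elim nrm_le_add_diff[OF X s(2)[OF t(2)] c[OF t(2)], of i] by simp
        then show ?case using t(2) by (simp add: r_def A_def)
      qed
      from t(1) show ?thesis by (rule tendsto_cong[THEN iffD2, OF ev])
    qed
  qed
  have 4: "nrm X (r i t) \<le> 2 * nrm X (u t)" if "t \<in> I" for i t
    using that nrm_nonneg[OF X c] nrm_zero[OF X] by (auto simp: r_def A_def)
  show thesis using that[of r] 1 2 3 4 by blast
qed

text \<open>Density of simple functions in the weighted \<open>p\<close>-norm, by dominated convergence.\<close>

lemma Lp_simple_dense:
  assumes X: "normed_space X" and I: "I \<in> sets lebesgue" and u: "strongly_measurable I X u"
    and \<omega>: "\<omega> \<in> borel_measurable (lebesgue_on I)" and p: "p \<ge> 1"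
    and fin: "Lp_le (lebesgue_on I) p (\<lambda>t. nrm X (u t) * \<omega> t) c" and e: "e > 0"
  obtains s where "simple_function (lebesgue_on I) s" "\<And>t. t \<in> I \<Longrightarrow> s t \<in> car X"
    "\<And>t. t \<in> I \<Longrightarrow> nrm X (s t) \<le> 2 * nrm X (u t)"
    "Lp_le (lebesgue_on I) p (\<lambda>t. nrm X (u t - s t) * \<omega> t) e"
proof -
  obtain s where s: "\<And>i. simple_function (lebesgue_on I) (s i)" "\<And>i t. t \<in> I \<Longrightarrow> s i t \<in> car X"
    "AE t in lebesgue_on I. (\<lambda>i. nrm X (s i t - u t)) \<longlonglongrightarrow> 0"
    "\<And>i t. t \<in> I \<Longrightarrow> nrm X (s i t) \<le> 2 * nrm X (u t)"
    by (rule strongly_measurable_dominated_approx[OF X I u]) blast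
  note c = strongly_measurable_car[OF u]
  have "\<exists>N. \<forall>i\<ge>N. Lp_le (lebesgue_on I) p (\<lambda>t. nrm X (u t - s i t) * \<omega> t) e"
  proof (rule Lp_le_dominated[OF _ Lp_le_scale[OF fin, of 3] p _ _ e])
    show "(\<lambda>t. nrm X (u t - s i t) * \<omega> t) \<in> borel_measurable (lebesgue_on I)" for i
      by (intro borel_measurable_times \<omega> borel_measurable_nrm[OF X I] strongly_measurable_diff[OF X u]
          strongly_measurable_simple[OF X s(1)] s(2))
    show "AE t in lebesgue_on I. \<bar>nrm X (u t - s i t) * \<omega> t\<bar> \<le> \<bar>3 * (nrm X (u t) * \<omega> t)\<bar>" for i
      using AE_in_lebesgue_on
    proof eventually_elim
      fix t assume t: "t \<in> I"
      have "nrm X (u t - s i t) \<le> 3 * nrm X (u t)"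
        using nrm_triangle_sub[OF X c[OF t] s(2)[OF t], of i] s(4)[OF t, of i] by simp
      moreover have "0 \<le> nrm X (u t - s i t)" using nrm_nonneg[OF X car_diff[OF X c[OF t] s(2)[OF t]]] .
      moreover have "0 \<le> nrm X (u t)" using nrm_nonneg[OF X c[OF t]] .
      ultimately show "\<bar>nrm X (u t - s i t) * \<omega> t\<bar> \<le> \<bar>3 * (nrm X (u t) * \<omega> t)\<bar>"
        unfolding mult.assoc[symmetric] abs_mult[of _ "\<omega> t"] by (intro mult_right_mono) auto
    qed
    show "AE t in lebesgue_on I. (\<lambda>i. nrm X (u t - s i t) * \<omega> t) \<longlonglongrightarrow> 0"
      using s(3) AE_in_lebesgue_on
    proof eventually_elim
      fix t assume t: "(\<lambda>i. nrm X (s i t - u t)) \<longlonglongrightarrow> 0" "t \<in> I"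
      then have "(\<lambda>i. nrm X (u t - s i t)) \<longlonglongrightarrow> 0"
        using nrm_minus_commute[OF X c[OF t(2)] s(2)[OF t(2)]] by simp
      then show "(\<lambda>i. nrm X (u t - s i t) * \<omega> t) \<longlonglongrightarrow> 0" by (rule tendsto_mult_left_zero)
    qed
  qed
  then obtain N where "Lp_le (lebesgue_on I) p (\<lambda>t. nrm X (u t - s N t) * \<omega> t) e" by blast
  then show thesis using that[of "s N"] s by blast
qed

section \<open>The Bochner integral\<close>

lemma simple_bochner_integral_in_car:
  assumes X: "normed_space X" and s: "Bochner_Integration.simple_bochner_integrable (lebesgue_on I) s"
    and c: "\<And>t. t \<in> I \<Longrightarrow> s t \<in> car X"
  shows "Bochner_Integration.simple_bochner_integral (lebesgue_on I) s \<in> car X"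
    and "ennreal (nrm X (Bochner_Integration.simple_bochner_integral (lebesgue_on I) s))
      \<le> (\<integral>\<^sup>+t. ennreal (nrm X (s t)) \<partial>lebesgue_on I)"
proof -
  let ?M = "lebesgue_on I"
  have y: "y \<in> car X" if "y \<in> s ` space ?M" for y using that c by auto
  show "Bochner_Integration.simple_bochner_integral ?M s \<in> car X"
    unfolding simple_bochner_integral_def by (intro car_sum[OF X] car_scale[OF X] y)
  have int: "Bochner_Integration.simple_bochner_integrable ?M (\<lambda>t. \<bar>nrm X (s t)\<bar>)"
    using simple_bochner_integrable_compose2[of "\<lambda>x y. \<bar>nrm X x\<bar>", OF _ s s] nrm_zero[OF X] by simp
  have "nrm X (Bochner_Integration.simple_bochner_integral ?M s)
      \<le> (\<Sum>y\<in>s ` space ?M. nrm X (measure ?M {t\<in>space ?M. s t = y} *\<^sub>R y))"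
    unfolding simple_bochner_integral_def by (intro nrm_sum_le[OF X] car_scale[OF X] y)
  also have "\<dots> = (\<Sum>y\<in>s ` space ?M. measure ?M {t\<in>space ?M. s t = y} *\<^sub>R \<bar>nrm X y\<bar>)"
    using y nrm_nonneg[OF X] nrm_scale[OF X] by (intro sum.cong) auto
  also have "\<dots> = Bochner_Integration.simple_bochner_integral ?M (\<lambda>t. \<bar>nrm X (s t)\<bar>)"
    using s int by (intro simple_bochner_integral_partition[symmetric])
      (auto elim: simple_bochner_integrable.cases)
  finally have "ennreal (nrm X (Bochner_Integration.simple_bochner_integral ?M s))
      \<le> ennreal (Bochner_Integration.simple_bochner_integral ?M (\<lambda>t. \<bar>nrm X (s t)\<bar>))"
    by (rule ennreal_leI)
  also have "\<dots> = (\<integral>\<^sup>+t. ennreal \<bar>nrm X (s t)\<bar> \<partial>?M)"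
    by (rule simple_bochner_integral_eq_nn_integral[OF int]) simp
  also have "\<dots> = (\<integral>\<^sup>+t. ennreal (nrm X (s t)) \<partial>?M)"
    using c nrm_nonneg[OF X] by (intro nn_integral_cong) auto
  finally show "ennreal (nrm X (Bochner_Integration.simple_bochner_integral ?M s))
      \<le> (\<integral>\<^sup>+t. ennreal (nrm X (s t)) \<partial>?M)" .
qed

lemma has_bochner_integral_inE:
  assumes "has_bochner_integral_in I X f x"
  obtains s :: "nat \<Rightarrow> real \<Rightarrow> 'v::real_vector" where
    "x \<in> car X" "strongly_measurable I X f"
    "\<And>i. Bochner_Integration.simple_bochner_integrable (lebesgue_on I) (s i)" "\<And>i t. t \<in> I \<Longrightarrow> s i t \<in> car X"
    "(\<lambda>i. \<integral>\<^sup>+t. ennreal (nrm X (f t - s i t)) \<partial>lebesgue_on I) \<longlonglongrightarrow> 0"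
    "(\<lambda>i. nrm X (Bochner_Integration.simple_bochner_integral (lebesgue_on I) (s i) - x)) \<longlonglongrightarrow> 0"
  using assms unfolding has_bochner_integral_in_def Pi_iff by blast

lemma has_bochner_integral_inI:
  assumes "x \<in> car X" "strongly_measurable I X f"
    "\<And>i. Bochner_Integration.simple_bochner_integrable (lebesgue_on I) (s i)" "\<And>i t. t \<in> I \<Longrightarrow> s i t \<in> car X"
    "(\<lambda>i. \<integral>\<^sup>+t. ennreal (nrm X (f t - s i t)) \<partial>lebesgue_on I) \<longlonglongrightarrow> 0"
    "(\<lambda>i. nrm X (Bochner_Integration.simple_bochner_integral (lebesgue_on I) (s i) - x)) \<longlonglongrightarrow> 0"
  shows "has_bochner_integral_in I X f x"
  using assms unfolding has_bochner_integral_in_def by blast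

lemma simple_bochner_integrable_simple:
  "Bochner_Integration.simple_bochner_integrable M s \<Longrightarrow> simple_function M s"
  by (auto elim: simple_bochner_integrable.cases)

text \<open>The estimate for simple functions passes to the limit in the definition of the integral.\<close>

theorem has_bochner_integral_in_norm_bound:
  assumes X: "normed_space X" and I: "I \<in> sets lebesgue" and f: "has_bochner_integral_in I X f x"
  shows "ennreal (nrm X x) \<le> (\<integral>\<^sup>+t. ennreal (nrm X (f t)) \<partial>lebesgue_on I)"
proof -
  obtain s where s: "x \<in> car X" "strongly_measurable I X f"
    "\<And>i. Bochner_Integration.simple_bochner_integrable (lebesgue_on I) (s i)" "\<And>i t. t \<in> I \<Longrightarrow> s i t \<in> car X"
    "(\<lambda>i. \<integral>\<^sup>+t. ennreal (nrm X (f t - s i t)) \<partial>lebesgue_on I) \<longlonglongrightarrow> 0"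
    "(\<lambda>i. nrm X (Bochner_Integration.simple_bochner_integral (lebesgue_on I) (s i) - x)) \<longlonglongrightarrow> 0"
    by (rule has_bochner_integral_inE[OF f]) blast
  let ?int = "Bochner_Integration.simple_bochner_integral (lebesgue_on I)"
  have fm[measurable]: "(\<lambda>t. nrm X (f t)) \<in> borel_measurable (lebesgue_on I)"
    by (rule borel_measurable_nrm[OF X I s(2)])
  have sm: "strongly_measurable I X (s i)" for i
    by (rule strongly_measurable_simple[OF X simple_bochner_integrable_simple[OF s(3)] s(4)])
  have dm[measurable]: "(\<lambda>t. nrm X (f t - s i t)) \<in> borel_measurable (lebesgue_on I)" for i
    by (rule borel_measurable_nrm[OF X I strongly_measurable_diff[OF X s(2) sm]])
  have b: "ennreal (nrm X x) \<le> ennreal (nrm X (?int (s i) - x)) +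
      ((\<integral>\<^sup>+t. ennreal (nrm X (f t)) \<partial>lebesgue_on I) + (\<integral>\<^sup>+t. ennreal (nrm X (f t - s i t)) \<partial>lebesgue_on I))" for i
  proof -
    have c: "?int (s i) \<in> car X" by (rule simple_bochner_integral_in_car(1)[OF X s(3,4)])
    have "ennreal (nrm X x) \<le> ennreal (nrm X (?int (s i) - x)) + ennreal (nrm X (?int (s i)))"
      using nrm_le_add_diff[OF X s(1) c] nrm_minus_commute[OF X s(1) c]
        nrm_nonneg[OF X c] nrm_nonneg[OF X car_diff[OF X c s(1)]]
      by (simp flip: ennreal_plus)
    also have "ennreal (nrm X (?int (s i))) \<le> (\<integral>\<^sup>+t. ennreal (nrm X (s i t)) \<partial>lebesgue_on I)"
      by (rule simple_bochner_integral_in_car(2)[OF X s(3,4)])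
    also have "\<dots> \<le> (\<integral>\<^sup>+t. ennreal (nrm X (f t)) + ennreal (nrm X (f t - s i t)) \<partial>lebesgue_on I)"
    proof (intro nn_integral_mono)
      fix t assume "t \<in> space (lebesgue_on I)"
      then have t: "f t \<in> car X" "s i t \<in> car X" using strongly_measurable_car[OF s(2)] s(4) by auto
      show "ennreal (nrm X (s i t)) \<le> ennreal (nrm X (f t)) + ennreal (nrm X (f t - s i t))"
        using nrm_le_add_diff[OF X t(2,1)] nrm_minus_commute[OF X t]
          nrm_nonneg[OF X t(1)] nrm_nonneg[OF X car_diff[OF X t]] by (simp flip: ennreal_plus)
    qed
    also have "\<dots> = (\<integral>\<^sup>+t. ennreal (nrm X (f t)) \<partial>lebesgue_on I) + (\<integral>\<^sup>+t. ennreal (nrm X (f t - s i t)) \<partial>lebesgue_on I)"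
      by (rule nn_integral_add) auto
    finally show ?thesis by (simp add: add_left_mono)
  qed
  have "(\<lambda>i. ennreal (nrm X (?int (s i) - x)) +
      ((\<integral>\<^sup>+t. ennreal (nrm X (f t)) \<partial>lebesgue_on I) + (\<integral>\<^sup>+t. ennreal (nrm X (f t - s i t)) \<partial>lebesgue_on I)))
      \<longlonglongrightarrow> ennreal 0 + ((\<integral>\<^sup>+t. ennreal (nrm X (f t)) \<partial>lebesgue_on I) + 0)"
    by (intro tendsto_add tendsto_ennrealI s tendsto_const)
  then show ?thesis using b by (intro LIMSEQ_le_const) auto
qed

lemma has_bochner_integral_in_finite:
  assumes X: "normed_space X" and I: "I \<in> sets lebesgue" and f: "has_bochner_integral_in I X f x"
  shows "(\<integral>\<^sup>+t. ennreal (nrm X (f t)) \<partial>lebesgue_on I) < \<infinity>"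
proof -
  obtain s where s: "x \<in> car X" "strongly_measurable I X f"
    "\<And>i. Bochner_Integration.simple_bochner_integrable (lebesgue_on I) (s i)" "\<And>i t. t \<in> I \<Longrightarrow> s i t \<in> car X"
    "(\<lambda>i. \<integral>\<^sup>+t. ennreal (nrm X (f t - s i t)) \<partial>lebesgue_on I) \<longlonglongrightarrow> 0"
    by (rule has_bochner_integral_inE[OF f]) blast
  have sm: "strongly_measurable I X (s i)" for i
    by (rule strongly_measurable_simple[OF X simple_bochner_integrable_simple[OF s(3)] s(4)])
  have [measurable]: "(\<lambda>t. nrm X (f t - s i t)) \<in> borel_measurable (lebesgue_on I)"
    "(\<lambda>t. nrm X (s i t)) \<in> borel_measurable (lebesgue_on I)" for i
    using borel_measurable_nrm[OF X I strongly_measurable_diff[OF X s(2) sm]] borel_measurable_nrm[OF X I sm]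
    by auto
  from order_tendstoD(2)[OF s(5), of 1] obtain i where
    i: "(\<integral>\<^sup>+t. ennreal (nrm X (f t - s i t)) \<partial>lebesgue_on I) < 1"
    by (auto simp: eventually_sequentially)
  have int: "Bochner_Integration.simple_bochner_integrable (lebesgue_on I) (\<lambda>t. \<bar>nrm X (s i t)\<bar>)"
    using simple_bochner_integrable_compose2[of "\<lambda>x y. \<bar>nrm X x\<bar>", OF _ s(3) s(3)] nrm_zero[OF X] by simp
  have "(\<integral>\<^sup>+t. ennreal (nrm X (f t)) \<partial>lebesgue_on I)
      \<le> (\<integral>\<^sup>+t. ennreal \<bar>nrm X (s i t)\<bar> + ennreal (nrm X (f t - s i t)) \<partial>lebesgue_on I)"
  proof (intro nn_integral_mono)
    fix t assume "t \<in> space (lebesgue_on I)"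
    then have t: "f t \<in> car X" "s i t \<in> car X" using strongly_measurable_car[OF s(2)] s(4) by auto
    show "ennreal (nrm X (f t)) \<le> ennreal \<bar>nrm X (s i t)\<bar> + ennreal (nrm X (f t - s i t))"
      using nrm_le_add_diff[OF X t] nrm_nonneg[OF X t(2)] nrm_nonneg[OF X car_diff[OF X t]]
      by (simp flip: ennreal_plus)
  qed
  also have "\<dots> = (\<integral>\<^sup>+t. ennreal \<bar>nrm X (s i t)\<bar> \<partial>lebesgue_on I) + (\<integral>\<^sup>+t. ennreal (nrm X (f t - s i t)) \<partial>lebesgue_on I)"
    by (rule nn_integral_add) auto
  also have "\<dots> < \<infinity>"
    using i simple_bochner_integral_eq_nn_integral[OF int, symmetric] by (auto intro: less_trans)
  finally show ?thesis .
qed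

lemma has_bochner_integral_in_add:
  assumes X: "normed_space X" and f: "has_bochner_integral_in I X f x" and I: "I \<in> sets lebesgue"
    and g: "has_bochner_integral_in I X g y"
  shows "has_bochner_integral_in I X (\<lambda>t. f t + g t) (x + y)"
proof -
  let ?int = "Bochner_Integration.simple_bochner_integral (lebesgue_on I)"
  obtain s where s: "x \<in> car X" "strongly_measurable I X f"
    "\<And>i. Bochner_Integration.simple_bochner_integrable (lebesgue_on I) (s i)" "\<And>i t. t \<in> I \<Longrightarrow> s i t \<in> car X"
    "(\<lambda>i. \<integral>\<^sup>+t. ennreal (nrm X (f t - s i t)) \<partial>lebesgue_on I) \<longlonglongrightarrow> 0"
    "(\<lambda>i. nrm X (?int (s i) - x)) \<longlonglongrightarrow> 0"
    by (rule has_bochner_integral_inE[OF f]) blast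
  obtain r where r: "y \<in> car X" "strongly_measurable I X g"
    "\<And>i. Bochner_Integration.simple_bochner_integrable (lebesgue_on I) (r i)" "\<And>i t. t \<in> I \<Longrightarrow> r i t \<in> car X"
    "(\<lambda>i. \<integral>\<^sup>+t. ennreal (nrm X (g t - r i t)) \<partial>lebesgue_on I) \<longlonglongrightarrow> 0"
    "(\<lambda>i. nrm X (?int (r i) - y)) \<longlonglongrightarrow> 0"
    by (rule has_bochner_integral_inE[OF g]) blast
  have sm: "strongly_measurable I X (s i)" "strongly_measurable I X (r i)" for i
    using strongly_measurable_simple[OF X simple_bochner_integrable_simple[OF s(3)] s(4)]
      strongly_measurable_simple[OF X simple_bochner_integrable_simple[OF r(3)] r(4)] by blast+
  have [measurable]: "(\<lambda>t. nrm X (f t - s i t)) \<in> borel_measurable (lebesgue_on I)"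
    "(\<lambda>t. nrm X (g t - r i t)) \<in> borel_measurable (lebesgue_on I)" for i
    using borel_measurable_nrm[OF X I strongly_measurable_diff[OF X s(2) sm(1)]]
      borel_measurable_nrm[OF X I strongly_measurable_diff[OF X r(2) sm(2)]] by auto
  have sr: "Bochner_Integration.simple_bochner_integrable (lebesgue_on I) (\<lambda>t. s i t + r i t)" for i
    by (rule simple_bochner_integrable_compose2[OF _ s(3) r(3)]) simp
  have "(\<lambda>i. \<integral>\<^sup>+t. ennreal (nrm X ((f t + g t) - (s i t + r i t))) \<partial>lebesgue_on I) \<longlonglongrightarrow> 0"
  proof (rule tendsto_sandwich[OF always_eventually always_eventually tendsto_const])
    show "(\<lambda>i. (\<integral>\<^sup>+t. ennreal (nrm X (f t - s i t)) \<partial>lebesgue_on I) +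
        (\<integral>\<^sup>+t. ennreal (nrm X (g t - r i t)) \<partial>lebesgue_on I)) \<longlonglongrightarrow> 0"
      using tendsto_add[OF s(5) r(5)] by simp
    show "\<forall>i. (\<integral>\<^sup>+t. ennreal (nrm X ((f t + g t) - (s i t + r i t))) \<partial>lebesgue_on I)
        \<le> (\<integral>\<^sup>+t. ennreal (nrm X (f t - s i t)) \<partial>lebesgue_on I) + (\<integral>\<^sup>+t. ennreal (nrm X (g t - r i t)) \<partial>lebesgue_on I)"
    proof
      fix i
      have "(\<integral>\<^sup>+t. ennreal (nrm X ((f t + g t) - (s i t + r i t))) \<partial>lebesgue_on I)
        \<le> (\<integral>\<^sup>+t. ennreal (nrm X (f t - s i t)) + ennreal (nrm X (g t - r i t)) \<partial>lebesgue_on I)"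
      proof (intro nn_integral_mono)
        fix t assume "t \<in> space (lebesgue_on I)"
        then have t: "f t - s i t \<in> car X" "g t - r i t \<in> car X"
          using strongly_measurable_car[OF s(2)] s(4) strongly_measurable_car[OF r(2)] r(4) car_diff[OF X]
          by auto
        have eq: "(f t + g t) - (s i t + r i t) = (f t - s i t) + (g t - r i t)" by simp
        show "ennreal (nrm X ((f t + g t) - (s i t + r i t))) \<le> ennreal (nrm X (f t - s i t)) + ennreal (nrm X (g t - r i t))"
          unfolding eq using nrm_triangle[OF X t] nrm_nonneg[OF X t(1)] nrm_nonneg[OF X t(2)]
          by (simp flip: ennreal_plus)
      qed
      also have "\<dots> = (\<integral>\<^sup>+t. ennreal (nrm X (f t - s i t)) \<partial>lebesgue_on I) + (\<integral>\<^sup>+t. ennreal (nrm X (g t - r i t)) \<partial>lebesgue_on I)"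
        by (rule nn_integral_add) auto
      finally show "(\<integral>\<^sup>+t. ennreal (nrm X ((f t + g t) - (s i t + r i t))) \<partial>lebesgue_on I) \<le> \<dots>" .
    qed
  qed auto
  moreover have "(\<lambda>i. nrm X (?int (\<lambda>t. s i t + r i t) - (x + y))) \<longlonglongrightarrow> 0"
  proof (rule tendsto_nrm_le[OF X _ tendsto_add_zero[OF s(6) r(6)]])
    fix i
    have c: "?int (s i) - x \<in> car X" "?int (r i) - y \<in> car X"
      using simple_bochner_integral_in_car(1)[OF X s(3,4)] simple_bochner_integral_in_car(1)[OF X r(3,4)]
        car_diff[OF X] s(1) r(1) by auto
    have eq: "?int (\<lambda>t. s i t + r i t) - (x + y) = (?int (s i) - x) + (?int (r i) - y)"
      by (simp add: simple_bochner_integral_add[OF s(3) r(3)])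
    show "?int (\<lambda>t. s i t + r i t) - (x + y) \<in> car X"
      unfolding eq by (rule car_add[OF X c])
    show "nrm X (?int (\<lambda>t. s i t + r i t) - (x + y)) \<le> nrm X (?int (s i) - x) + nrm X (?int (r i) - y)"
      unfolding eq by (rule nrm_triangle[OF X c])
  qed
  ultimately show ?thesis
    by (intro has_bochner_integral_inI[OF car_add[OF X s(1) r(1)] strongly_measurable_add[OF X s(2) r(2)] sr])
      (use s(4) r(4) car_add[OF X] in auto)
qed

lemma has_bochner_integral_in_scale:
  assumes X: "normed_space X" and I: "I \<in> sets lebesgue" and f: "has_bochner_integral_in I X f x"
  shows "has_bochner_integral_in I X (\<lambda>t. c *\<^sub>R f t) (c *\<^sub>R x)"
proof -
  let ?int = "Bochner_Integration.simple_bochner_integral (lebesgue_on I)"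
  obtain s where s: "x \<in> car X" "strongly_measurable I X f"
    "\<And>i. Bochner_Integration.simple_bochner_integrable (lebesgue_on I) (s i)" "\<And>i t. t \<in> I \<Longrightarrow> s i t \<in> car X"
    "(\<lambda>i. \<integral>\<^sup>+t. ennreal (nrm X (f t - s i t)) \<partial>lebesgue_on I) \<longlonglongrightarrow> 0"
    "(\<lambda>i. nrm X (?int (s i) - x)) \<longlonglongrightarrow> 0"
    by (rule has_bochner_integral_inE[OF f]) blast
  have sm: "strongly_measurable I X (s i)" for i
    by (rule strongly_measurable_simple[OF X simple_bochner_integrable_simple[OF s(3)] s(4)])
  have [measurable]: "(\<lambda>t. nrm X (f t - s i t)) \<in> borel_measurable (lebesgue_on I)" for i
    using borel_measurable_nrm[OF X I strongly_measurable_diff[OF X s(2) sm]] by auto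
  have sc: "Bochner_Integration.simple_bochner_integrable (lebesgue_on I) (\<lambda>t. c *\<^sub>R s i t)" for i
    using simple_bochner_integrable_compose2[of "\<lambda>x y. c *\<^sub>R x", OF _ s(3) s(3)] by simp
  have ci: "?int (\<lambda>t. c *\<^sub>R s i t) = c *\<^sub>R ?int (s i)" for i
    using simple_bochner_integral_linear[OF _ s(3)[of i], of "\<lambda>x. c *\<^sub>R x"] linear_scale_self by blast
  have "(\<integral>\<^sup>+t. ennreal (nrm X (c *\<^sub>R f t - c *\<^sub>R s i t)) \<partial>lebesgue_on I)
      = ennreal \<bar>c\<bar> * (\<integral>\<^sup>+t. ennreal (nrm X (f t - s i t)) \<partial>lebesgue_on I)" for i
  proof -
    have "nrm X (c *\<^sub>R f t - c *\<^sub>R s i t) = \<bar>c\<bar> * nrm X (f t - s i t) \<and> nrm X (f t - s i t) \<ge> 0" if "t \<in> I" for t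
      using strongly_measurable_car[OF s(2) that] s(4)[OF that, of i] nrm_scale[OF X car_diff[OF X]] nrm_nonneg[OF X car_diff[OF X]]
      by (simp flip: scaleR_diff_right)
    then show ?thesis
      by (subst nn_integral_cmult[symmetric]) (auto intro!: nn_integral_cong simp: ennreal_mult)
  qed
  moreover have "(\<lambda>i. ennreal \<bar>c\<bar> * (\<integral>\<^sup>+t. ennreal (nrm X (f t - s i t)) \<partial>lebesgue_on I)) \<longlonglongrightarrow> ennreal \<bar>c\<bar> * 0"
    by (intro tendsto_mult_ennreal tendsto_const s) auto
  ultimately have 1: "(\<lambda>i. \<integral>\<^sup>+t. ennreal (nrm X (c *\<^sub>R f t - c *\<^sub>R s i t)) \<partial>lebesgue_on I) \<longlonglongrightarrow> 0"
    by simp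
  have "nrm X (?int (\<lambda>t. c *\<^sub>R s i t) - c *\<^sub>R x) = \<bar>c\<bar> * nrm X (?int (s i) - x)" for i
    unfolding ci using nrm_scale[OF X car_diff[OF X simple_bochner_integral_in_car(1)[OF X s(3,4)] s(1)]]
    by (simp flip: scaleR_diff_right)
  then have 2: "(\<lambda>i. nrm X (?int (\<lambda>t. c *\<^sub>R s i t) - c *\<^sub>R x)) \<longlonglongrightarrow> 0"
    using tendsto_mult_right_zero[OF s(6)] by simp
  show ?thesis
    by (rule has_bochner_integral_inI[OF car_scale[OF X s(1)] strongly_measurable_scale[OF X s(2)] sc _ 1 2])
      (use s(4) car_scale[OF X] in auto)
qed

lemma has_bochner_integral_in_diff:
  assumes "normed_space X" "has_bochner_integral_in I X f x" "I \<in> sets lebesgue"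
    "has_bochner_integral_in I X g y"
  shows "has_bochner_integral_in I X (\<lambda>t. f t - g t) (x - y)"
  using has_bochner_integral_in_add[OF assms(1-3) has_bochner_integral_in_scale[OF assms(1,3,4), of "-1"]]
  by simp

lemma has_bochner_integral_in_unique:
  assumes X: "normed_space X" and I: "I \<in> sets lebesgue"
    and f: "has_bochner_integral_in I X f x" "has_bochner_integral_in I X f y"
  shows "x = y"
proof -
  have "has_bochner_integral_in I X (\<lambda>t. f t - f t) (x - y)"
    by (rule has_bochner_integral_in_diff[OF X f(1) I f(2)])
  from has_bochner_integral_in_norm_bound[OF X I this] have "nrm X (x - y) \<le> 0"
    by (simp add: nrm_zero[OF X] ennreal_eq_0_iff)
  moreover have "x - y \<in> car X"
    using f car_diff[OF X] by (auto simp: has_bochner_integral_in_def)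
  ultimately show ?thesis using nrm_nonneg[OF X] nrm_eq_0[OF X] by fastforce
qed

lemma has_bochner_integral_in_cong_AE:
  assumes X: "normed_space X" and f: "has_bochner_integral_in I X f x"
    and eq: "AE t in lebesgue_on I. f t = g t" and g: "\<And>t. t \<in> I \<Longrightarrow> g t \<in> car X"
  shows "has_bochner_integral_in I X g x"
proof -
  have "(\<integral>\<^sup>+t. ennreal (nrm X (f t - s t)) \<partial>lebesgue_on I) = (\<integral>\<^sup>+t. ennreal (nrm X (g t - s t)) \<partial>lebesgue_on I)" for s
    by (intro nn_integral_cong_AE) (use eq in \<open>eventually_elim, simp\<close>)
  then show ?thesis
    using f strongly_measurable_cong_AE[OF _ eq g] unfolding has_bochner_integral_in_def by simp
qed

lemma has_bochner_integral_in_embed: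
  assumes X: "normed_space X" and Y: "normed_space Y" and I: "I \<in> sets lebesgue"
    and e: "embeds X Y K" and f: "has_bochner_integral_in I X f x"
  shows "has_bochner_integral_in I Y f x"
proof -
  let ?int = "Bochner_Integration.simple_bochner_integral (lebesgue_on I)"
  obtain s where s: "x \<in> car X" "strongly_measurable I X f"
    "\<And>i. Bochner_Integration.simple_bochner_integrable (lebesgue_on I) (s i)" "\<And>i t. t \<in> I \<Longrightarrow> s i t \<in> car X"
    "(\<lambda>i. \<integral>\<^sup>+t. ennreal (nrm X (f t - s i t)) \<partial>lebesgue_on I) \<longlonglongrightarrow> 0"
    "(\<lambda>i. nrm X (?int (s i) - x)) \<longlonglongrightarrow> 0"
    by (rule has_bochner_integral_inE[OF f]) blast
  have K: "K \<ge> 0" and e': "\<And>x. x \<in> car X \<Longrightarrow> x \<in> car Y \<and> nrm Y x \<le> K * nrm X x"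
    using e by (auto simp: embeds_def)
  have sm: "strongly_measurable I X (s i)" for i
    by (rule strongly_measurable_simple[OF X simple_bochner_integrable_simple[OF s(3)] s(4)])
  have [measurable]: "(\<lambda>t. nrm X (f t - s i t)) \<in> borel_measurable (lebesgue_on I)" for i
    using borel_measurable_nrm[OF X I strongly_measurable_diff[OF X s(2) sm]] by auto
  have "(\<lambda>i. \<integral>\<^sup>+t. ennreal (nrm Y (f t - s i t)) \<partial>lebesgue_on I) \<longlonglongrightarrow> 0"
  proof (rule tendsto_sandwich[OF always_eventually always_eventually tendsto_const])
    show "(\<lambda>i. ennreal K * (\<integral>\<^sup>+t. ennreal (nrm X (f t - s i t)) \<partial>lebesgue_on I)) \<longlonglongrightarrow> 0"
      using tendsto_mult_ennreal[OF tendsto_const[of "ennreal K"] s(5)] by simp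
    show "\<forall>i. (\<integral>\<^sup>+t. ennreal (nrm Y (f t - s i t)) \<partial>lebesgue_on I)
        \<le> ennreal K * (\<integral>\<^sup>+t. ennreal (nrm X (f t - s i t)) \<partial>lebesgue_on I)"
    proof
      fix i
      have "ennreal (nrm Y (f t - s i t)) \<le> ennreal K * ennreal (nrm X (f t - s i t))" if "t \<in> I" for t
        using e'[OF car_diff[OF X strongly_measurable_car[OF s(2) that] s(4)[OF that]], of i] K
          nrm_nonneg[OF X car_diff[OF X strongly_measurable_car[OF s(2) that] s(4)[OF that]], of i]
        by (simp flip: ennreal_mult add: ennreal_leI)
      then show "(\<integral>\<^sup>+t. ennreal (nrm Y (f t - s i t)) \<partial>lebesgue_on I)
        \<le> ennreal K * (\<integral>\<^sup>+t. ennreal (nrm X (f t - s i t)) \<partial>lebesgue_on I)"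
        by (subst nn_integral_cmult[symmetric]) (auto intro!: nn_integral_mono)
    qed
  qed auto
  moreover have "(\<lambda>i. nrm Y (?int (s i) - x)) \<longlonglongrightarrow> 0"
  proof (rule tendsto_nrm_le[OF Y])
    have c: "?int (s i) - x \<in> car X" for i
      using car_diff[OF X simple_bochner_integral_in_car(1)[OF X s(3,4)] s(1)] .
    show "?int (s i) - x \<in> car Y" for i using e' c by blast
    show "nrm Y (?int (s i) - x) \<le> K * nrm X (?int (s i) - x)" for i using e' c by blast
    show "(\<lambda>i. K * nrm X (?int (s i) - x)) \<longlonglongrightarrow> 0" using tendsto_mult_right_zero[OF s(6)] by simp
  qed
  ultimately show ?thesis
    by (intro has_bochner_integral_inI[OF _ strongly_measurable_embed[OF X Y e s(2)] s(3)])
      (use s(1,4) e' in auto)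
qed

text \<open>Dominated simple functions converge in \<open>L\<^sup>1\<close>, so their integrals form a Cauchy sequence.\<close>

theorem has_bochner_integral_in_exists:
  assumes B: "banach_space X" and I: "I \<in> sets lebesgue" and f: "strongly_measurable I X f"
    and fin: "(\<integral>\<^sup>+t. ennreal (nrm X (f t)) \<partial>lebesgue_on I) < \<infinity>"
  obtains x where "has_bochner_integral_in I X f x"
proof -
  have X: "normed_space X" using B by (simp add: banach_space_def)
  let ?int = "Bochner_Integration.simple_bochner_integral (lebesgue_on I)"
  obtain s where s: "\<And>i. simple_function (lebesgue_on I) (s i)" "\<And>i t. t \<in> I \<Longrightarrow> s i t \<in> car X"
    "AE t in lebesgue_on I. (\<lambda>i. nrm X (s i t - f t)) \<longlonglongrightarrow> 0"
    "\<And>i t. t \<in> I \<Longrightarrow> nrm X (s i t) \<le> 2 * nrm X (f t)"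
    by (rule strongly_measurable_dominated_approx[OF X I f]) blast
  note c = strongly_measurable_car[OF f]
  have sm: "strongly_measurable I X (s i)" for i
    by (rule strongly_measurable_simple[OF X s(1,2)])
  have [measurable]: "(\<lambda>t. nrm X (f t - s i t)) \<in> borel_measurable (lebesgue_on I)"
    "(\<lambda>t. nrm X (f t)) \<in> borel_measurable (lebesgue_on I)" for i
    using borel_measurable_nrm[OF X I strongly_measurable_diff[OF X f sm]] borel_measurable_nrm[OF X I f] by auto
  have si: "Bochner_Integration.simple_bochner_integrable (lebesgue_on I) (s i)" for i
  proof (rule simple_bochner_integrable.intros[OF s(1)])
    define h where "h t = ennreal (if t \<in> I then nrm X (s i t) else 0)" for t
    have hs: "simple_function (lebesgue_on I) h"
      by (rule simple_function_cong[THEN iffD1, OF _ simple_function_compose1[OF s(1)[of i], of "\<lambda>x. ennreal (nrm X x)"]])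
        (simp add: h_def)
    have "(\<integral>\<^sup>+t. h t \<partial>lebesgue_on I) \<le> (\<integral>\<^sup>+t. 2 * ennreal (nrm X (f t)) \<partial>lebesgue_on I)"
      using s(4) nrm_nonneg[OF X c]
      by (intro nn_integral_mono) (auto simp: h_def ennreal_leI simp flip: ennreal_numeral ennreal_mult)
    also have "\<dots> < \<infinity>" using fin by (simp add: nn_integral_cmult ennreal_mult_less_top)
    finally have "emeasure (lebesgue_on I) {t \<in> space (lebesgue_on I). h t \<noteq> 0} \<noteq> \<infinity>"
      by (intro simple_function_finite_support[OF hs]) auto
    moreover have "{t \<in> space (lebesgue_on I). h t \<noteq> 0} = {t \<in> space (lebesgue_on I). s i t \<noteq> 0}"
      using nrm_nonneg[OF X s(2)[of _ i]] nrm_eq_0[OF X s(2)[of _ i]] by (force simp: h_def ennreal_eq_0_iff)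
    ultimately show "emeasure (lebesgue_on I) {t \<in> space (lebesgue_on I). s i t \<noteq> 0} \<noteq> \<infinity>" by simp
  qed
  have lim: "(\<lambda>i. \<integral>\<^sup>+t. ennreal (nrm X (f t - s i t)) \<partial>lebesgue_on I) \<longlonglongrightarrow> (\<integral>\<^sup>+t. 0 \<partial>lebesgue_on I)"
  proof (rule nn_integral_dominated_convergence[where w="\<lambda>t. 3 * ennreal (nrm X (f t))"])
    show "AE t in lebesgue_on I. ennreal (nrm X (f t - s i t)) \<le> 3 * ennreal (nrm X (f t))" for i
      using AE_in_lebesgue_on
    proof eventually_elim
      fix t assume t: "t \<in> I"
      have "nrm X (f t - s i t) \<le> 3 * nrm X (f t)"
        using nrm_triangle_sub[OF X c[OF t] s(2)[OF t], of i] s(4)[OF t, of i] by simp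
      then show "ennreal (nrm X (f t - s i t)) \<le> 3 * ennreal (nrm X (f t))"
        using nrm_nonneg[OF X c[OF t]] by (simp add: ennreal_leI flip: ennreal_numeral ennreal_mult)
    qed
    show "(\<integral>\<^sup>+t. 3 * ennreal (nrm X (f t)) \<partial>lebesgue_on I) < \<infinity>"
      using fin by (simp add: nn_integral_cmult ennreal_mult_less_top)
    show "AE t in lebesgue_on I. (\<lambda>i. ennreal (nrm X (f t - s i t))) \<longlonglongrightarrow> 0"
      using s(3) AE_in_lebesgue_on
    proof eventually_elim
      fix t assume t: "(\<lambda>i. nrm X (s i t - f t)) \<longlonglongrightarrow> 0" "t \<in> I"
      then have "(\<lambda>i. nrm X (f t - s i t)) \<longlonglongrightarrow> 0"
        using nrm_minus_commute[OF X c[OF t(2)] s(2)[OF t(2)]] by simp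
      then show "(\<lambda>i. ennreal (nrm X (f t - s i t))) \<longlonglongrightarrow> 0" using tendsto_ennrealI by fastforce
    qed
  qed auto
  then have lim: "(\<lambda>i. \<integral>\<^sup>+t. ennreal (nrm X (f t - s i t)) \<partial>lebesgue_on I) \<longlonglongrightarrow> 0" by simp
  have ic: "?int (s i) \<in> car X" for i by (rule simple_bochner_integral_in_car(1)[OF X si s(2)])
  obtain x where x: "x \<in> car X" "(\<lambda>i. nrm X (?int (s i) - x)) \<longlonglongrightarrow> 0"
  proof (rule nrm_Cauchy_converges[OF B, of "\<lambda>i. ?int (s i)"])
    fix e :: real assume e: "e > 0"
    then have "(0::ennreal) < ennreal (e/2)" by simp
    from order_tendstoD(2)[OF lim this] obtain N where
      N: "\<And>n. n \<ge> N \<Longrightarrow> (\<integral>\<^sup>+t. ennreal (nrm X (f t - s n t)) \<partial>lebesgue_on I) < ennreal (e/2)"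
      by (auto simp: eventually_sequentially)
    have "nrm X (?int (s m) - ?int (s n)) < e" if mn: "m \<ge> N" "n \<ge> N" for m n
    proof -
      have d: "Bochner_Integration.simple_bochner_integrable (lebesgue_on I) (\<lambda>t. s m t - s n t)"
        by (rule simple_bochner_integrable_compose2[OF _ si si]) simp
      have "ennreal (nrm X (?int (s m) - ?int (s n))) = ennreal (nrm X (?int (\<lambda>t. s m t - s n t)))"
        by (simp add: simple_bochner_integral_diff[OF si si])
      also have "\<dots> \<le> (\<integral>\<^sup>+t. ennreal (nrm X (s m t - s n t)) \<partial>lebesgue_on I)"
        by (rule simple_bochner_integral_in_car(2)[OF X d]) (use s(2) car_diff[OF X] in auto)
      also have "\<dots> \<le> (\<integral>\<^sup>+t. ennreal (nrm X (f t - s m t)) + ennreal (nrm X (f t - s n t)) \<partial>lebesgue_on I)"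
      proof (intro nn_integral_mono)
        fix t assume "t \<in> space (lebesgue_on I)"
        then have t: "t \<in> I" by simp
        show "ennreal (nrm X (s m t - s n t)) \<le> ennreal (nrm X (f t - s m t)) + ennreal (nrm X (f t - s n t))"
          using nrm_diff_triangle[OF X s(2)[OF t] c[OF t] s(2)[OF t], of m n]
            nrm_minus_commute[OF X c[OF t] s(2)[OF t], of m]
            nrm_nonneg[OF X car_diff[OF X c[OF t] s(2)[OF t]]] nrm_nonneg[OF X car_diff[OF X s(2)[OF t] c[OF t]]]
          by (simp add: ennreal_leI flip: ennreal_plus)
      qed
      also have "\<dots> = (\<integral>\<^sup>+t. ennreal (nrm X (f t - s m t)) \<partial>lebesgue_on I) + (\<integral>\<^sup>+t. ennreal (nrm X (f t - s n t)) \<partial>lebesgue_on I)"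
        by (rule nn_integral_add) auto
      also have "\<dots> < ennreal (e/2) + ennreal (e/2)" by (rule add_strict_mono[OF N[OF mn(1)] N[OF mn(2)]])
      also have "\<dots> = ennreal e" using e by (simp flip: ennreal_plus)
      finally show ?thesis using e by (simp add: ennreal_less_iff nrm_nonneg[OF X car_diff[OF X ic ic]])
    qed
    then show "\<exists>N. \<forall>m\<ge>N. \<forall>n\<ge>N. nrm X (?int (s m) - ?int (s n)) < e" by blast
  qed (use ic in auto)
  have "has_bochner_integral_in I X f x"
    by (rule has_bochner_integral_inI[OF x(1) f si s(2) lim x(2)])
  then show thesis by (rule that)
qed

text \<open>Integrals of functions with finite-dimensional range are computed by scalar calculus, through this
  lemma and additivity.\<close>

lemma has_bochner_integral_in_scaleR_const:
  fixes g :: "real \<Rightarrow> real"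
  assumes X: "normed_space X" and I: "I \<in> sets lebesgue" and e: "e \<in> car X"
    and g: "has_bochner_integral (lebesgue_on I) g r"
  shows "has_bochner_integral_in I X (\<lambda>t. g t *\<^sub>R e) (r *\<^sub>R e)"
proof -
  obtain s where gm: "g \<in> borel_measurable (lebesgue_on I)"
    and s: "\<And>i. Bochner_Integration.simple_bochner_integrable (lebesgue_on I) (s i)"
    "(\<lambda>i. \<integral>\<^sup>+t. ennreal (norm (g t - s i t)) \<partial>lebesgue_on I) \<longlonglongrightarrow> 0"
    "(\<lambda>i. Bochner_Integration.simple_bochner_integral (lebesgue_on I) (s i)) \<longlonglongrightarrow> r"
    using g by (elim has_bochner_integral.cases) blast
  have [measurable]: "(\<lambda>t. g t - s i t) \<in> borel_measurable (lebesgue_on I)" for i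
    using gm borel_measurable_simple_function[OF simple_bochner_integrable_simple[OF s(1)]] by auto
  let ?s = "\<lambda>i t. s i t *\<^sub>R e"
  have 1: "Bochner_Integration.simple_bochner_integrable (lebesgue_on I) (?s i)" for i
    using simple_bochner_integrable_compose2[of "\<lambda>x y. x *\<^sub>R e", OF _ s(1) s(1)] by simp
  have 2: "Bochner_Integration.simple_bochner_integral (lebesgue_on I) (?s i)
      = Bochner_Integration.simple_bochner_integral (lebesgue_on I) (s i) *\<^sub>R e" for i
    by (rule simple_bochner_integral_linear[OF _ s(1)]) (rule module_hom.intro | simp add: linear_iff scaleR_add_left)+
  have e0: "nrm X e \<ge> 0" by (rule nrm_nonneg[OF X e])
  have "(\<integral>\<^sup>+t. ennreal (nrm X (g t *\<^sub>R e - ?s i t)) \<partial>lebesgue_on I)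
      = ennreal (nrm X e) * (\<integral>\<^sup>+t. ennreal (norm (g t - s i t)) \<partial>lebesgue_on I)" for i
    using nrm_scale[OF X e] e0
    by (subst nn_integral_cmult[symmetric])
      (auto intro!: nn_integral_cong simp: mult.commute simp flip: scaleR_diff_left ennreal_mult)
  moreover have "(\<lambda>i. ennreal (nrm X e) * (\<integral>\<^sup>+t. ennreal (norm (g t - s i t)) \<partial>lebesgue_on I)) \<longlonglongrightarrow> ennreal (nrm X e) * 0"
    by (intro tendsto_mult_ennreal tendsto_const s) auto
  ultimately have 3: "(\<lambda>i. \<integral>\<^sup>+t. ennreal (nrm X (g t *\<^sub>R e - ?s i t)) \<partial>lebesgue_on I) \<longlonglongrightarrow> 0" by simp
  have "(\<lambda>i. \<bar>Bochner_Integration.simple_bochner_integral (lebesgue_on I) (s i) - r\<bar> * nrm X e) \<longlonglongrightarrow> \<bar>r - r\<bar> * nrm X e"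
    by (intro tendsto_intros s)
  then have 4: "(\<lambda>i. nrm X (Bochner_Integration.simple_bochner_integral (lebesgue_on I) (?s i) - r *\<^sub>R e)) \<longlonglongrightarrow> 0"
    unfolding 2 using nrm_scale[OF X e] by (simp flip: scaleR_diff_left)
  show ?thesis
    by (rule has_bochner_integral_inI[OF car_scale[OF X e]
          strongly_measurable_scale[OF X strongly_measurable_const[OF X e] gm] 1 car_scale[OF X e] 3 4])
qed

section \<open>Smooth scalar functions\<close>

text \<open>A smooth function is handled together with all its derivatives. Closure properties, such as
  Leibniz' rule, then are statements about explicit sequences.\<close>

definition smooth_chain :: "(nat \<Rightarrow> real \<Rightarrow> real) \<Rightarrow> bool" where
  "smooth_chain f \<longleftrightarrow> (\<forall>k t. (f k has_real_derivative f (Suc k) t) (at t))"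

lemma smooth_chainD: "smooth_chain f \<Longrightarrow> (f k has_real_derivative f (Suc k) t) (at t)"
  by (simp add: smooth_chain_def)

lemma smooth_chain_iterated_deriv:
  assumes "smooth_chain f"
  shows "(deriv ^^ k) (f 0) = f k"
proof (induction k)
  case (Suc k)
  have "deriv (f k) = f (Suc k)"
    using smooth_chainD[OF assms] by (intro ext DERIV_imp_deriv) auto
  then show ?case using Suc by simp
qed simp

lemma smooth_chain_continuous: "smooth_chain f \<Longrightarrow> continuous_on S (f k)"
  using smooth_chainD[of f k] by (intro DERIV_continuous_on[of S "f k" "f (Suc k)"])
    (auto intro: has_field_derivative_at_within)

lemma smooth_chain_measurable:
  assumes "smooth_chain f"
  shows "f k \<in> borel_measurable borel" "f k \<in> borel_measurable (lebesgue_on I)"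
proof -
  show 1: "f k \<in> borel_measurable borel"
    by (intro borel_measurable_continuous_onI smooth_chain_continuous[OF assms])
  show "f k \<in> borel_measurable (lebesgue_on I)"
    using 1 by (intro measurable_restrict_space1 measurable_completion) simp
qed

lemma smooth_chain_shift: "smooth_chain f \<Longrightarrow> smooth_chain (\<lambda>k. f (k + j))"
  by (simp add: smooth_chain_def)

lemma smooth_chain_affine:
  assumes "smooth_chain f"
  shows "smooth_chain (\<lambda>k t. a ^ k * f k (a * t + b))"
  unfolding smooth_chain_def
proof (intro allI)
  fix k t
  have "((\<lambda>t. f k (a * t + b)) has_real_derivative f (Suc k) (a * t + b) * a) (at t)"
    by (rule DERIV_chain'[OF _ smooth_chainD[OF assms]]) (auto intro!: derivative_eq_intros)
  then show "((\<lambda>t. a ^ k * f k (a * t + b)) has_real_derivative a ^ Suc k * f (Suc k) (a * t + b)) (at t)"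
    by (auto intro!: derivative_eq_intros simp: mult_ac)
qed

lemma smooth_chain_cmult: "smooth_chain f \<Longrightarrow> smooth_chain (\<lambda>k t. c * f k t)"
  unfolding smooth_chain_def by (auto intro!: derivative_eq_intros)

definition Leibniz :: "(nat \<Rightarrow> real \<Rightarrow> real) \<Rightarrow> (nat \<Rightarrow> real \<Rightarrow> real) \<Rightarrow> nat \<Rightarrow> real \<Rightarrow> real" where
  "Leibniz f g k t = (\<Sum>j\<le>k. real (k choose j) * (f j t * g (k - j) t))"

lemma Leibniz_0 [simp]: "Leibniz f g 0 t = f 0 t * g 0 t"
  by (simp add: Leibniz_def)

lemma smooth_chain_mult:
  assumes f: "smooth_chain f" and g: "smooth_chain g"
  shows "smooth_chain (Leibniz f g)"
  unfolding smooth_chain_def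
proof (intro allI)
  fix k t
  let ?d = "\<Sum>j\<le>k. real (k choose j) * (f (Suc j) t * g (k - j) t + f j t * g (Suc (k - j)) t)"
  have "(Leibniz f g k has_real_derivative ?d) (at t)"
    unfolding Leibniz_def[abs_def]
    by (rule derivative_eq_intros smooth_chainD[OF f] smooth_chainD[OF g] refl | simp add: algebra_simps)+
  also have "?d = Leibniz f g (Suc k) t"
  proof -
    have "Leibniz f g (Suc k) t = f 0 t * g (Suc k) t + (\<Sum>j\<le>k. real (Suc k choose Suc j) * (f (Suc j) t * g (k - j) t))"
      unfolding Leibniz_def by (subst sum.atMost_Suc_shift) simp
    also have "(\<Sum>j\<le>k. real (Suc k choose Suc j) * (f (Suc j) t * g (k - j) t))
        = (\<Sum>j\<le>k. real (k choose j) * (f (Suc j) t * g (k - j) t)) + (\<Sum>j\<le>k. real (k choose Suc j) * (f (Suc j) t * g (k - j) t))"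
      by (simp add: sum.distrib[symmetric] distrib_right)
    also have "f 0 t * g (Suc k) t + (\<dots>) = (\<Sum>j\<le>k. real (k choose j) * (f (Suc j) t * g (k - j) t))
        + (f 0 t * g (Suc k) t + (\<Sum>j\<le>k. real (k choose Suc j) * (f (Suc j) t * g (k - j) t)))" by simp
    also have "f 0 t * g (Suc k) t + (\<Sum>j\<le>k. real (k choose Suc j) * (f (Suc j) t * g (k - j) t))
        = (\<Sum>j\<le>Suc k. real (k choose j) * (f j t * g (Suc k - j) t))"
      by (subst sum.atMost_Suc_shift) simp
    also have "\<dots> = (\<Sum>j\<le>k. real (k choose j) * (f j t * g (Suc (k - j)) t))"
      by (simp add: Suc_diff_le)
    finally show ?thesis by (simp add: sum.distrib[symmetric] distrib_left)
  qed
  finally show "(Leibniz f g k has_real_derivative Leibniz f g (Suc k) t) (at t)" .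
qed

lemma smooth_chain_locally_eq:
  assumes "smooth_chain f" "smooth_chain g" "open U" "\<And>t. t \<in> U \<Longrightarrow> f 0 t = g 0 t" "t \<in> U"
  shows "f k t = g k t"
  using assms(5)
proof (induction k arbitrary: t)
  case 0 then show ?case using assms by simp
next
  case (Suc k)
  have "(f k has_real_derivative g (Suc k) t) (at t)"
    by (rule DERIV_cong_ev[THEN iffD2, OF refl _ refl smooth_chainD[OF assms(2)]])
      (use Suc assms(3) eventually_nhds in blast)
  then show ?case using DERIV_unique[OF smooth_chainD[OF assms(1)]] by blast
qed

lemma smooth_chain_zero: "smooth_chain (\<lambda>k t. 0)"
  by (simp add: smooth_chain_def)

lemma smooth_chain_const: "smooth_chain (\<lambda>k t. if k = 0 then c else 0)"
  by (simp add: smooth_chain_def)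

definition supported_in :: "real set \<Rightarrow> (real \<Rightarrow> real) \<Rightarrow> bool" where
  "supported_in K f \<longleftrightarrow> (\<forall>t. t \<notin> K \<longrightarrow> f t = 0)"

lemma supported_inD: "supported_in K f \<Longrightarrow> t \<notin> K \<Longrightarrow> f t = 0"
  by (simp add: supported_in_def)

lemma smooth_chain_supported:
  assumes "smooth_chain f" "supported_in {a..b} (f 0)"
  shows "supported_in {a..b} (f k)"
  unfolding supported_in_def
proof (intro allI impI)
  fix t assume t: "t \<notin> {a..b}"
  show "f k t = 0"
    by (rule smooth_chain_locally_eq[OF assms(1) smooth_chain_zero, of "- {a..b}"])
      (use t assms(2) in \<open>auto simp: open_Compl supported_in_def\<close>)
qed

lemma smooth_chain_bounded:
  assumes "smooth_chain f" "supported_in {a..b} (f 0)"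
  obtains C where "C > 0" "\<And>t. \<bar>f k t\<bar> \<le> C"
proof -
  have "compact (f k ` {a..b})"
    by (intro compact_continuous_image smooth_chain_continuous[OF assms(1)]) auto
  from compact_imp_bounded[OF this] obtain C where C: "C > 0" "\<forall>y\<in>f k ` {a..b}. norm y \<le> C"
    unfolding bounded_pos by (elim exE conjE)
  have "\<bar>f k t\<bar> \<le> C" for t
    using C supported_inD[OF smooth_chain_supported[OF assms], of t k] by (cases "t \<in> {a..b}") auto
  then show thesis using that C by blast
qed

lemma test_functionsI:
  assumes "smooth_chain f" "supported_in {a..b} (f 0)" "{a..b} \<subseteq> interior I"
  shows "f 0 \<in> test_functions I"
proof -
  have "closure {t. f 0 t \<noteq> 0} \<subseteq> {a..b}"
    by (rule closure_minimal) (use assms(2) in \<open>auto simp: supported_in_def\<close>)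
  moreover from this have "compact (closure {t. f 0 t \<noteq> 0})"
    by (metis closed_closure compact_Icc compact_Int_closed inf.absorb_iff2)
  moreover have "(deriv ^^ k) (f 0) field_differentiable (at t)" for k t
    using smooth_chain_iterated_deriv[OF assms(1)] smooth_chainD[OF assms(1)] field_differentiable_def
    by metis
  ultimately show ?thesis using assms(3) by (auto simp: test_functions_def)
qed

text \<open>A compact subset of the interior of an interval lies between its extreme points; compact intervals
  are what integration by parts needs.\<close>

lemma test_functionsE:
  assumes \<phi>: "\<phi> \<in> test_functions I" and I: "connected I" and ne: "interior I \<noteq> {}"
  obtains a b where "smooth_chain (\<lambda>k. (deriv ^^ k) \<phi>)" "supported_in {a..b} \<phi>" "a \<le> b" "{a..b} \<subseteq> interior I"
proof -
  let ?K = "closure {t. \<phi> t \<noteq> 0}"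
  have sm: "smooth_chain (\<lambda>k. (deriv ^^ k) \<phi>)"
    using \<phi> by (auto simp: smooth_chain_def test_functions_def field_differentiable_derivI)
  have K: "compact ?K" "?K \<subseteq> interior I" using \<phi> by (auto simp: test_functions_def)
  have conv: "convex (interior I)" using I is_interval_connected_1 is_interval_convex by (intro convex_interior) blast
  show thesis
  proof (cases "?K = {}")
    case True
    then have "{t. \<phi> t \<noteq> 0} = {}" by (metis closure_eq_empty)
    then have 0: "\<phi> t = 0" for t by blast
    \<comment> \<open>For the zero function any one-point interval serves.\<close>
    obtain c where "c \<in> interior I" using ne by blast
    then show thesis using that[of c c] sm 0 by (auto simp: supported_in_def)
  next
    case False
    obtain a where a: "a \<in> ?K" "\<And>t. t \<in> ?K \<Longrightarrow> a \<le> t" using compact_attains_inf[OF K(1) False] by blast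
    obtain b where b: "b \<in> ?K" "\<And>t. t \<in> ?K \<Longrightarrow> t \<le> b" using compact_attains_sup[OF K(1) False] by blast
    have "{a..b} \<subseteq> interior I"
      using conv a(1) b(1) K(2) a(2)[OF b(1)] closed_segment_subset[of a "interior I" b]
      by (auto simp: closed_segment_eq_real_ivl)
    moreover have "\<phi> t = 0" if "t \<notin> {a..b}" for t
    proof (rule ccontr)
      assume "\<phi> t \<noteq> 0"
      then have "t \<in> ?K" using subsetD[OF closure_subset, of t "{t. \<phi> t \<noteq> 0}"] by simp
      from a(2)[OF this] b(2)[OF this] that show False by simp
    qed
    then have sup: "supported_in {a..b} \<phi>" by (simp add: supported_in_def)
    ultimately show thesis using that[OF sm sup a(2)[OF b(1)]] by simp
  qed
qed

lemma test_function_has_chain: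
  assumes \<phi>: "\<phi> \<in> test_functions I"
  shows "smooth_chain (\<lambda>k. (deriv ^^ k) \<phi>)"
  using \<phi> by (auto simp: smooth_chain_def test_functions_def field_differentiable_derivI)

subsection \<open>A bump function\<close>

text \<open>The standard example: \<open>exp (- 1 / x)\<close> for \<open>x > 0\<close>, whose derivatives are polynomials in
  \<open>1 / x\<close> times the function itself.\<close>

primrec bump_poly :: "nat \<Rightarrow> real poly" where
  "bump_poly 0 = 1"
| "bump_poly (Suc k) = [:0, 0, 1:] * (bump_poly k - pderiv (bump_poly k))"

definition exp_chain :: "nat \<Rightarrow> real \<Rightarrow> real" where
  "exp_chain k x = (if x \<le> 0 then 0 else poly (bump_poly k) (1/x) * exp (- (1/x)))"

lemma poly_exp_decay: "((\<lambda>y::real. poly Q y * exp (- y)) \<longlongrightarrow> 0) at_top"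
proof -
  have "((\<lambda>y. \<Sum>i\<le>degree Q. coeff Q i * (y ^ i / exp y)) \<longlongrightarrow> (\<Sum>i\<le>degree Q. coeff Q i * 0)) at_top"
    by (intro tendsto_sum tendsto_mult tendsto_const tendsto_power_div_exp_0)
  moreover have "(\<Sum>i\<le>degree Q. coeff Q i * (y ^ i / exp y)) = poly Q y * exp (- y)" for y
    by (simp add: poly_altdef exp_minus sum_distrib_left divide_inverse mult_ac)
  ultimately show ?thesis by simp
qed

lemma smooth_chain_exp: "smooth_chain exp_chain"
  unfolding smooth_chain_def
proof (intro allI)
  fix k and t :: real
  let ?P = "bump_poly k"
  consider "t < 0" | "t > 0" | "t = 0" by linarith
  then show "(exp_chain k has_real_derivative exp_chain (Suc k) t) (at t)"
  proof cases
    case 1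
    have "\<forall>\<^sub>F x in nhds t. exp_chain k x = 0"
      using eventually_nhds_in_open[of "{..<0}" t] 1 by (auto simp: exp_chain_def elim: eventually_mono)
    then have "(exp_chain k has_real_derivative 0) (at t)"
      by (subst DERIV_cong_ev[OF refl _ refl]) auto
    then show ?thesis using 1 by (simp add: exp_chain_def)
  next
    case 2
    let ?d = "poly (pderiv ?P) (1/t) * (- 1 / t^2) * exp (- (1/t)) + poly ?P (1/t) * (exp (- (1/t)) * (1 / t^2))"
    have "((\<lambda>x. poly ?P (1/x) * exp (- (1/x))) has_real_derivative ?d) (at t)"
    proof -
      have i: "((\<lambda>x. 1/x) has_real_derivative (- 1 / t^2)) (at t)"
        using 2 by (auto intro!: derivative_eq_intros simp: power2_eq_square)
      have 1: "((\<lambda>x. poly ?P (1/x)) has_real_derivative poly (pderiv ?P) (1/t) * (- 1 / t^2)) (at t)"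
        by (rule DERIV_chain'[OF i poly_DERIV])
      have 2: "((\<lambda>x. exp (- (1/x))) has_real_derivative exp (- (1/t)) * (1 / t^2)) (at t)"
        using DERIV_chain'[OF DERIV_minus[OF i] DERIV_exp] by simp
      show ?thesis by (rule DERIV_cong[OF DERIV_mult[OF 1 2]]) (simp add: mult_ac)
    qed
    also have "?d = exp_chain (Suc k) t"
      using 2 by (simp add: exp_chain_def field_simps power2_eq_square)
    finally have "((\<lambda>x. poly ?P (1/x) * exp (- (1/x))) has_real_derivative exp_chain (Suc k) t) (at t)" .
    moreover have "\<forall>\<^sub>F x in nhds t. exp_chain k x = poly ?P (1/x) * exp (- (1/x))"
      using eventually_nhds_in_open[of "{0<..}" t] 2 by (auto simp: exp_chain_def elim: eventually_mono)
    ultimately show ?thesis by (subst DERIV_cong_ev[OF refl _ refl]) auto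
  next
    case 3
    have "((\<lambda>h. exp_chain k h / h) \<longlongrightarrow> 0) (at 0)"
    proof (rule filterlim_split_at)
      have "\<forall>\<^sub>F h in at_left (0::real). exp_chain k h / h = 0"
        by (auto simp: exp_chain_def eventually_at_filter)
      then show "((\<lambda>h. exp_chain k h / h) \<longlongrightarrow> 0) (at_left 0)"
        by (rule tendsto_eventually)
      have "((\<lambda>y. poly (pCons 0 ?P) y * exp (- y)) \<longlongrightarrow> 0) at_top" by (rule poly_exp_decay)
      then have "((\<lambda>h. poly (pCons 0 ?P) (inverse h) * exp (- inverse h)) \<longlongrightarrow> 0) (at_right 0)"
        by (rule filterlim_compose) (rule filterlim_inverse_at_top_right)
      moreover have "\<forall>\<^sub>F h in at_right (0::real). poly (pCons 0 ?P) (inverse h) * exp (- inverse h) = exp_chain k h / h"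
        by (auto simp: exp_chain_def eventually_at_filter divide_inverse)
      ultimately show "((\<lambda>h. exp_chain k h / h) \<longlongrightarrow> 0) (at_right 0)"
        using tendsto_cong by force
    qed
    then show ?thesis using 3 by (simp add: DERIV_def exp_chain_def)
  qed
qed

text \<open>A smooth step: the normalised antiderivative of a bump supported in \<open>[-1, 1]\<close>. Its derivative
  is the mollifier, and differences of its translates are the test functions that compare two
  averages.\<close>

lemma smooth_step_exists:
  "\<exists>H. smooth_chain H \<and> (\<forall>x\<le>-1. H 0 x = 0) \<and> (\<forall>x\<ge>1. H 0 x = 1) \<and> (\<forall>x. H 1 x \<ge> 0)"
proof -
  define b where "b = Leibniz (\<lambda>k t. 1 ^ k * exp_chain k (1 * t + 1)) (\<lambda>k t. (- 1) ^ k * exp_chain k (- 1 * t + 1))"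
  have b: "smooth_chain b"
    unfolding b_def by (intro smooth_chain_mult smooth_chain_affine smooth_chain_exp)
  have b0: "b 0 x = exp_chain 0 (x + 1) * exp_chain 0 (1 - x)" for x by (simp add: b_def)
  have bpos: "b 0 x > 0" if "- 1 < x" "x < 1" for x using that by (simp add: b0 exp_chain_def)
  have bz: "b 0 x = 0" if "x \<le> - 1 \<or> x \<ge> 1" for x using that by (auto simp: b0 exp_chain_def)
  define G where "G x = integral {-2..x} (b 0)" for x
  have G0: "G x = 0" if "x \<le> -1" for x
  proof -
    have "G x = integral {-2..x} (\<lambda>_. 0)" unfolding G_def by (rule integral_cong) (use bz that in auto)
    then show ?thesis by simp
  qed
  have dG: "(G has_real_derivative b 0 x) (at x)" for x
  proof (cases "x < -1")
    case True
    have "\<forall>\<^sub>F y in nhds x. G y = 0"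
      using eventually_nhds_in_open[of "{..<-1}" x] True G0 by (auto elim!: eventually_mono)
    then have "(G has_real_derivative 0) (at x)" by (subst DERIV_cong_ev[OF refl _ refl]) auto
    then show ?thesis using True bz by simp
  next
    case False
    have "(G has_real_derivative b 0 x) (at x within {-2..x+1})"
      unfolding G_def[abs_def]
      by (rule integral_has_real_derivative) (use False smooth_chain_continuous[OF b] in auto)
    then show ?thesis using False by (subst (asm) at_within_interior) auto
  qed
  have Gc: "continuous_on S G" for S
    by (rule continuous_at_imp_continuous_on) (use DERIV_isCont[OF dG] in blast)
  define C where "C = G 1"
  have "G (-1) < G 1"
  proof (rule DERIV_pos_imp_increasing_open[OF _ _ Gc])
    show "\<exists>y. DERIV G x :> y \<and> y > 0" if "-1 < x" "x < 1" for x
      using dG bpos[OF that] by blast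
  qed simp
  then have C: "C > 0" using G0[of "-1"] by (simp add: C_def)
  have G1: "G x = C" if "x \<ge> 1" for x
  proof (cases "x = 1")
    case False
    have "G x = G 1"
    proof (rule DERIV_isconst_end[OF _ Gc])
      show "DERIV G y :> 0" if "1 < y" "y < x" for y using dG[of y] bz[of y] that by simp
    qed (use that False in simp)
    then show ?thesis by (simp add: C_def)
  qed (simp add: C_def)
  define H where "H k = (case k of 0 \<Rightarrow> (\<lambda>x. G x / C) | Suc j \<Rightarrow> (\<lambda>x. b j x / C))" for k
  have "smooth_chain H"
    unfolding smooth_chain_def
  proof (intro allI)
    fix k t show "(H k has_real_derivative H (Suc k) t) (at t)"
      by (cases k) (auto simp: H_def intro!: DERIV_cdivide dG smooth_chainD[OF b])
  qed
  moreover have "b 0 x \<ge> 0" for x using bpos[of x] bz[of x] by fastforce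
  ultimately show ?thesis using G0 G1 C by (intro exI[of _ H]) (auto simp: H_def)
qed

definition step :: "nat \<Rightarrow> real \<Rightarrow> real" where
  "step = (SOME H. smooth_chain H \<and> (\<forall>x\<le>-1. H 0 x = 0) \<and> (\<forall>x\<ge>1. H 0 x = 1) \<and> (\<forall>x. H 1 x \<ge> 0))"

lemma step:
  shows smooth_step: "smooth_chain step"
    and step_0: "x \<le> -1 \<Longrightarrow> step 0 x = 0"
    and step_1: "x \<ge> 1 \<Longrightarrow> step 0 x = 1"
    and step_deriv_nonneg: "step (Suc 0) x \<ge> 0"
  using someI_ex[OF smooth_step_exists, folded step_def] by auto

lemma step_mono: "x \<le> y \<Longrightarrow> step 0 x \<le> step 0 y"
  by (rule DERIV_nonneg_imp_nondecreasing) (use smooth_chainD[OF smooth_step, of 0] step_deriv_nonneg in auto)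

lemma step_range: "0 \<le> step 0 x" "step 0 x \<le> 1"
  using step_mono[of "min x (-1)" x] step_mono[of x "max x 1"] step_0[of "min x (-1)"] step_1[of "max x 1"]
  by auto

lemma step_deriv_zero: 
  assumes "\<bar>x\<bar> > 1"
  shows "step (Suc k) x = 0"
proof (cases "x > 1")
  case True
  have "step (Suc k) x = (if Suc k = 0 then 1 else 0)"
    by (rule smooth_chain_locally_eq[OF smooth_step smooth_chain_const[of 1], of "{1<..}"]) (use True step_1 in auto)
  then show ?thesis by simp
next
  case False
  have "step (Suc k) x = 0"
    by (rule smooth_chain_locally_eq[OF smooth_step smooth_chain_zero, of "{..<-1}"]) (use False assms step_0 in auto)
  then show ?thesis by simp
qed

text \<open>\<open>mollifier \<epsilon> k\<close> is the \<open>k\<close>-th derivative of the bump of mass 1 supported in \<open>[-\<epsilon>, \<epsilon>]\<close>.\<close>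

definition mollifier :: "real \<Rightarrow> nat \<Rightarrow> real \<Rightarrow> real" where
  "mollifier \<epsilon> k x = (1/\<epsilon>) ^ Suc k * step (Suc k) (x / \<epsilon>)"

lemma smooth_step_scaled: "smooth_chain (\<lambda>k x. (1/\<epsilon>) ^ k * step k (x / \<epsilon>))"
  using smooth_chain_affine[OF smooth_step, of "1/\<epsilon>" 0] by simp

lemma smooth_mollifier: "smooth_chain (mollifier \<epsilon>)"
  using smooth_chain_shift[OF smooth_step_scaled[of \<epsilon>], of 1] by (simp add: mollifier_def[abs_def])

lemma mollifier_nonneg: "\<epsilon> > 0 \<Longrightarrow> mollifier \<epsilon> 0 x \<ge> 0"
  by (simp add: mollifier_def step_deriv_nonneg)

lemma mollifier_zero: "\<epsilon> > 0 \<Longrightarrow> \<bar>x\<bar> > \<epsilon> \<Longrightarrow> mollifier \<epsilon> k x = 0"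
  unfolding mollifier_def by (subst step_deriv_zero) auto

lemma mollifier_bounded:
  assumes "\<epsilon> > 0"
  obtains C where "C > 0" "\<And>x. \<bar>mollifier \<epsilon> k x\<bar> \<le> C"
proof -
  have "supported_in {-\<epsilon>..\<epsilon>} (mollifier \<epsilon> 0)"
    unfolding supported_in_def by (intro allI impI mollifier_zero[OF assms]) auto
  from smooth_chain_bounded[OF smooth_mollifier this, of k] that show thesis by blast
qed

lemma smooth_mollifier_reflected: "smooth_chain (\<lambda>k s. (- 1) ^ k * mollifier \<epsilon> k (a - s))"
  using smooth_chain_affine[OF smooth_mollifier, of "-1" \<epsilon> a] by simp

text \<open>The antiderivative of a difference of two mollifiers; it is compactly supported because both
  have mass 1.\<close>

lemma smooth_mollifier_diff_primitive:
  assumes "\<epsilon> > 0" "\<delta> > 0" and ab: "a - \<epsilon> \<ge> l" "a + \<epsilon> \<le> r" "b - \<delta> \<ge> l" "b + \<delta> \<le> r"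
  obtains f where "smooth_chain f" "\<And>s. f (Suc 0) s = mollifier \<epsilon> 0 (a - s) - mollifier \<delta> 0 (b - s)"
    "supported_in {l..r} (f 0)" "\<And>s. \<bar>f 0 s\<bar> \<le> 1"
proof -
  let ?g = "\<lambda>\<epsilon> a k s. (- (1/\<epsilon>)) ^ k * step k (- (1/\<epsilon>) * s + a/\<epsilon>)"
  define f where "f k s = ?g \<delta> b k s - ?g \<epsilon> a k s" for k s
  have g: "smooth_chain (?g \<epsilon> a)" "smooth_chain (?g \<delta> b)"
    by (intro smooth_chain_affine smooth_step)+
  have "smooth_chain f"
    unfolding smooth_chain_def f_def by (intro allI DERIV_diff smooth_chainD[OF g(2)] smooth_chainD[OF g(1)])
  moreover have "f (Suc 0) s = mollifier \<epsilon> 0 (a - s) - mollifier \<delta> 0 (b - s)" for s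
    by (simp add: f_def mollifier_def diff_divide_distrib)
  moreover have "f 0 s = 0" if "s \<notin> {l..r}" for s
  proof -
    have "s < l \<or> s > r" using that by auto
    then show ?thesis
    proof (elim disjE)
      assume "s < l"
      then have "(a - s)/\<epsilon> \<ge> 1" "(b - s)/\<delta> \<ge> 1" using assms by (auto simp: field_simps)
      then show ?thesis by (simp add: f_def step_1 diff_divide_distrib)
    next
      assume "s > r"
      then have "(a - s)/\<epsilon> \<le> -1" "(b - s)/\<delta> \<le> -1" using assms by (auto simp: field_simps)
      then show ?thesis by (simp add: f_def step_0 diff_divide_distrib)
    qed
  qed
  moreover have "\<bar>f 0 s\<bar> \<le> 1" for s
    using step_range[of "- (1/\<epsilon>) * s + a/\<epsilon>"] step_range[of "- (1/\<delta>) * s + b/\<delta>"]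
    unfolding f_def by auto
  ultimately show thesis using that by (auto simp: supported_in_def)
qed

text \<open>Cutoffs equal to 1 on \<open>[-R, R]\<close>; stretching makes their derivatives small.\<close>

lemma smooth_cutoff:
  obtains \<eta> :: "real \<Rightarrow> nat \<Rightarrow> real \<Rightarrow> real" and C :: "nat \<Rightarrow> real" where
    "\<And>R. smooth_chain (\<eta> R)"
    "\<And>R t. R > 0 \<Longrightarrow> \<bar>t\<bar> \<le> R \<Longrightarrow> \<eta> R 0 t = 1" "\<And>R t k. R > 0 \<Longrightarrow> \<bar>t\<bar> > 3 * R \<Longrightarrow> \<eta> R k t = 0"
    "\<And>R t. 0 \<le> \<eta> R 0 t" "\<And>R t. \<eta> R 0 t \<le> 1"
    "\<And>k. C k > 0" "\<And>R t k. R > 0 \<Longrightarrow> \<bar>\<eta> R k t\<bar> \<le> C k / R ^ k"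
proof -
  define c where "c = Leibniz (\<lambda>k t. 1 ^ k * step k (1 * t + 2)) (\<lambda>k t. (- 1) ^ k * step k (- 1 * t + 2))"
  have c: "smooth_chain c" unfolding c_def by (intro smooth_chain_mult smooth_chain_affine smooth_step)
  have c0: "c 0 t = step 0 (t + 2) * step 0 (2 - t)" for t by (simp add: c_def)
  have cz: "supported_in {-3..3} (c 0)"
    unfolding supported_in_def c0 using step_0 by force
  have "\<exists>C>0. \<forall>t. \<bar>c k t\<bar> \<le> C" for k
    using smooth_chain_bounded[OF c cz, of k] by blast
  then obtain C where C: "\<And>k. C k > 0" "\<And>k t. \<bar>c k t\<bar> \<le> C k" by metis
  define \<eta> where "\<eta> R k t = (1/R)^k * c k ((1/R) * t + 0)" for R :: real and k and t :: real
  show thesis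
  proof (rule that[of \<eta> C])
    show "smooth_chain (\<eta> R)" for R unfolding \<eta>_def by (rule smooth_chain_affine[OF c])
    show "\<eta> R 0 t = 1" if "R > 0" "\<bar>t\<bar> \<le> R" for R t
    proof -
      have "\<bar>t / R\<bar> \<le> 1" using that by (simp add: field_simps abs_le_iff)
      then have "t/R + 2 \<ge> 1" "2 - t/R \<ge> 1" by linarith+
      then show ?thesis by (simp add: \<eta>_def c0 step_1)
    qed
    show "\<eta> R k t = 0" if "R > 0" "\<bar>t\<bar> > 3 * R" for R t k
    proof -
      have "\<bar>t / R\<bar> > 3" using that by (simp add: field_simps)
      then have "t / R \<notin> {-3..3}" by auto
      then show ?thesis using supported_inD[OF smooth_chain_supported[OF c cz], of "t/R" k] by (simp add: \<eta>_def)
    qed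
    show "0 \<le> \<eta> R 0 t" "\<eta> R 0 t \<le> 1" for R t
      using step_range by (auto simp: \<eta>_def c0 intro!: mult_nonneg_nonneg mult_le_one)
    show "C k > 0" for k by (rule C)
    show "\<bar>\<eta> R k t\<bar> \<le> C k / R ^ k" if "R > 0" for R t k
      using C(2)[of k "t/R"] that by (simp add: \<eta>_def abs_mult power_one_over divide_right_mono)
  qed
qed

subsection \<open>Integrals of smooth functions\<close>

lemma has_bochner_integral_compact_support:
  fixes g :: "real \<Rightarrow> real"
  assumes I: "I \<in> sets lebesgue" and ab: "{a..b} \<subseteq> I" and z: "supported_in {a..b} g"
    and g: "has_bochner_integral lborel (\<lambda>t. g t * indicator {a..b} t) r"
  shows "has_bochner_integral (lebesgue_on I) g r"
proof -
  have eq: "(\<lambda>t. g t * indicator {a..b} t) = g" using z by (auto simp: fun_eq_iff supported_in_def split: split_indicator)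
  have "has_bochner_integral lebesgue g r"
    using g unfolding eq by (auto simp: has_bochner_integral_iff integrable_completion integral_completion borel_measurable_integrable)
  moreover have "(\<lambda>t. indicator I t *\<^sub>R g t) = g"
  proof
    fix t show "indicator I t *\<^sub>R g t = g t"
      using supported_inD[OF z, of t] ab by (cases "t \<in> {a..b}") auto
  qed
  ultimately show ?thesis using I by (subst has_bochner_integral_restrict_space) auto
qed

lemma has_bochner_integral_smooth_derivative:
  assumes I: "I \<in> sets lebesgue" and ab: "a \<le> b" "{a..b} \<subseteq> I" and f: "smooth_chain f"
    and z: "supported_in {a..b} (f (Suc k))"
  shows "has_bochner_integral (lebesgue_on I) (f (Suc k)) (f k b - f k a)"
proof (rule has_bochner_integral_compact_support[OF I ab(2) z])
  show "has_bochner_integral lborel (\<lambda>t. f (Suc k) t * indicator {a..b} t) (f k b - f k a)"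
    by (rule has_bochner_integral_FTC_Icc_real[OF ab(1) smooth_chainD[OF f]])
      (use DERIV_isCont[OF smooth_chainD[OF f]] in auto)
qed

lemma mollifier_mass:
  assumes I: "I \<in> sets lebesgue" and e: "\<epsilon> > 0" and sub: "{a - \<epsilon>..a + \<epsilon>} \<subseteq> I"
  shows "has_bochner_integral (lebesgue_on I) (\<lambda>s. mollifier \<epsilon> 0 (a - s)) 1"
proof -
  define g where "g k s = - 1 * ((- (1/\<epsilon>)) ^ k * step k (- (1/\<epsilon>) * s + a/\<epsilon>))" for k s
  have g: "smooth_chain g" unfolding g_def by (intro smooth_chain_cmult smooth_chain_affine smooth_step)
  have eq: "g (Suc 0) = (\<lambda>s. mollifier \<epsilon> 0 (a - s))"
    by (simp add: g_def mollifier_def diff_divide_distrib fun_eq_iff)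
  have z: "supported_in {a - \<epsilon>..a + \<epsilon>} (g (Suc 0))"
    unfolding eq supported_in_def by (intro allI impI mollifier_zero[OF e]) auto
  have "has_bochner_integral (lebesgue_on I) (g (Suc 0)) (g 0 (a + \<epsilon>) - g 0 (a - \<epsilon>))"
    by (rule has_bochner_integral_smooth_derivative[OF I _ sub g z]) (use e in simp)
  moreover have "g 0 (a + \<epsilon>) - g 0 (a - \<epsilon>) = 1"
  proof -
    have "- (1/\<epsilon>) * (a + \<epsilon>) + a/\<epsilon> = -1" "- (1/\<epsilon>) * (a - \<epsilon>) + a/\<epsilon> = 1" using e by (auto simp: field_simps)
    then show ?thesis unfolding g_def by (simp only: step_0 step_1) (simp add: step_0 step_1)
  qed
  ultimately show ?thesis unfolding eq by simp
qed

lemma smooth_chain_zero_ends: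
  assumes f: "smooth_chain f" and z: "supported_in {a..b} (f 0)"
  shows "f k a = 0" "f k b = 0"
proof -
  have "closed {t. f k t = 0}"
    using continuous_closed_preimage_constant[OF smooth_chain_continuous[OF f] closed_UNIV] by simp
  moreover have "{..<a} \<subseteq> {t. f k t = 0}" "{b<..} \<subseteq> {t. f k t = 0}"
    using supported_inD[OF smooth_chain_supported[OF f z]] by auto
  ultimately have "closure {..<a} \<subseteq> {t. f k t = 0}" "closure {b<..} \<subseteq> {t. f k t = 0}"
    using closure_minimal[of "{..<a}" "{t. f k t = 0}"] closure_minimal[of "{b<..}" "{t. f k t = 0}"] by blast+
  then show "f k a = 0" "f k b = 0" by auto
qed

text \<open>One derivative at a time: by Leibniz' rule, the sum of the two integrands is the derivative of a
  function that vanishes at \<open>a\<close> and \<open>b\<close>.\<close>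

lemma integration_by_parts_smooth:
  assumes I: "I \<in> sets lebesgue" and ab: "a \<le> b" "{a..b} \<subseteq> I" and \<psi>: "smooth_chain \<psi>"
    and "smooth_chain \<phi>" "supported_in {a..b} (\<phi> 0)"
  shows "\<exists>r. has_bochner_integral (lebesgue_on I) (\<lambda>t. \<phi> k t * \<psi> 0 t) r \<and>
    has_bochner_integral (lebesgue_on I) (\<lambda>t. \<phi> 0 t * \<psi> k t) ((- 1) ^ k * r)"
  using assms(5,6)
proof (induction k arbitrary: \<phi>)
  case 0
  have "has_bochner_integral (lebesgue_on I) (\<lambda>t. \<phi> 0 t * \<psi> 0 t)
      (integral\<^sup>L lborel (\<lambda>t. \<phi> 0 t * \<psi> 0 t * indicator {a..b} t))"
  proof (rule has_bochner_integral_compact_support[OF I ab(2)])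
    have "continuous_on UNIV (\<lambda>t. \<phi> 0 t * \<psi> 0 t)"
      by (intro continuous_intros smooth_chain_continuous[OF 0(1)] smooth_chain_continuous[OF \<psi>])
    then show "has_bochner_integral lborel (\<lambda>t. \<phi> 0 t * \<psi> 0 t * indicator {a..b} t)
        (integral\<^sup>L lborel (\<lambda>t. \<phi> 0 t * \<psi> 0 t * indicator {a..b} t))"
      by (intro has_bochner_integral_integrable borel_integrable_atLeastAtMost)
        (simp add: continuous_on_eq_continuous_at)
  qed (use 0(2) in \<open>simp add: supported_in_def\<close>)
  then show ?case by auto
next
  case (Suc k)
  let ?\<phi> = "\<lambda>j. \<phi> (j + 1)"
  have s: "smooth_chain ?\<phi>" by (rule smooth_chain_shift[OF Suc(2)])
  have z: "supported_in {a..b} (\<phi> j)" for j by (rule smooth_chain_supported[OF Suc(2,3)])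
  obtain r where r: "has_bochner_integral (lebesgue_on I) (\<lambda>t. ?\<phi> k t * \<psi> 0 t) r"
    "has_bochner_integral (lebesgue_on I) (\<lambda>t. ?\<phi> 0 t * \<psi> k t) ((- 1) ^ k * r)"
    using Suc.IH[OF s z] by blast
  let ?f = "Leibniz \<phi> (\<lambda>j. \<psi> (j + k))"
  have f: "smooth_chain ?f" by (intro smooth_chain_mult Suc smooth_chain_shift \<psi>)
  have f1: "?f (Suc 0) t = \<phi> 0 t * \<psi> (Suc k) t + \<phi> 1 t * \<psi> k t" for t
    by (simp add: Leibniz_def)
  have "has_bochner_integral (lebesgue_on I) (?f (Suc 0)) (?f 0 b - ?f 0 a)"
    by (rule has_bochner_integral_smooth_derivative[OF I ab f]) (use z in \<open>simp add: f1 supported_in_def\<close>)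
  then have "has_bochner_integral (lebesgue_on I) (\<lambda>t. \<phi> 0 t * \<psi> (Suc k) t + \<phi> 1 t * \<psi> k t) 0"
    using smooth_chain_zero_ends[OF Suc(2,3), of 0] by (simp add: f1[abs_def])
  from has_bochner_integral_diff[OF this r(2)]
  have "has_bochner_integral (lebesgue_on I) (\<lambda>t. \<phi> 0 t * \<psi> (Suc k) t) ((- 1) ^ Suc k * r)" by simp
  then show ?case using r(1) by auto
qed

section \<open>Mollification\<close>

lemma connected_in_lebesgue:
  fixes I :: "real set"
  assumes "connected I"
  shows "I \<in> sets lebesgue"
proof -
  have "convex I" using assms is_interval_connected_1 is_interval_convex by blast
  then have "negligible (frontier I)" by (rule negligible_convex_frontier)
  then have "I \<inter> frontier I \<in> sets lebesgue"
    by (meson Int_lower2 negligible_imp_sets negligible_subset)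
  moreover have "interior I \<in> sets lebesgue" by simp
  moreover have "I = interior I \<union> (I \<inter> frontier I)"
    using interior_subset closure_subset by (auto simp: frontier_def)
  ultimately show ?thesis by (metis sets.Un)
qed

lemma AE_interior:
  fixes I :: "real set"
  assumes "connected I"
  shows "AE t in lebesgue_on I. t \<in> interior I"
proof -
  have "convex I" using assms is_interval_connected_1 is_interval_convex by blast
  then have "frontier I \<in> null_sets lebesgue"
    by (simp add: negligible_convex_frontier flip: negligible_iff_null_sets)
  then have "AE t in lebesgue. t \<notin> frontier I" by (rule AE_not_in)
  then have "AE t in lebesgue. t \<in> I \<longrightarrow> t \<in> interior I"
    by (rule eventually_mono) (use closure_subset in \<open>auto simp: frontier_def\<close>)
  then show ?thesis using connected_in_lebesgue[OF assms] by (simp add: AE_restrict_space_iff)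
qed

lemma emeasure_bounded_set:
  assumes "K \<in> sets lebesgue" "K \<subseteq> {-L..L}" "L > 0"
  shows "emeasure (lebesgue_on K) (space (lebesgue_on K)) \<le> ennreal (2 * L)"
proof -
  have "emeasure (lebesgue_on K) (space (lebesgue_on K)) = emeasure lebesgue K"
    using assms by (simp add: emeasure_restrict_space)
  also have "\<dots> \<le> emeasure lebesgue {-L..L}" using assms by (intro emeasure_mono) auto
  also have "\<dots> = ennreal (2 * L)" using assms by simp
  finally show ?thesis .
qed

subsection \<open>Approximation by continuous functions with finite-dimensional range\<close>

text \<open>Inner and outer regularity of Lebesgue measure, and a Urysohn function between the closed and the
  open set.\<close>

lemma Lp_continuous_approx_indicator:
  fixes A :: "real set"
  assumes A: "A \<in> sets lebesgue" and K: "K \<in> sets lebesgue" and p: "p \<ge> 1" and e: "e > 0"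
  obtains g :: "real \<Rightarrow> real" where "continuous_on UNIV g" "\<And>t. 0 \<le> g t" "\<And>t. g t \<le> 1"
    "Lp_le (lebesgue_on K) p (\<lambda>t. indicator A t - g t) e"
proof -
  define d where "d = e powr p / 2"
  have d: "d > 0" using e by (simp add: d_def)
  obtain C where C: "closed C" "C \<subseteq> A" "A - C \<in> lmeasurable" "emeasure lebesgue (A - C) < ennreal d"
    using sets_lebesgue_inner_closed[OF A d] by blast
  obtain U where U: "open U" "A \<subseteq> U" "U - A \<in> lmeasurable" "emeasure lebesgue (U - A) < ennreal d"
    using sets_lebesgue_outer_open[OF A d] by blast
  obtain g :: "real \<Rightarrow> real" where g: "continuous_on UNIV g" "\<And>x. x \<in> UNIV \<Longrightarrow> g x \<in> closed_segment 1 0"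
    "\<And>x. x \<in> C \<Longrightarrow> g x = 1" "\<And>x. x \<in> - U \<Longrightarrow> g x = 0"
  proof (rule Urysohn_local[of UNIV C "- U" "1::real" 0])
    show "closedin (top_of_set UNIV) C" "closedin (top_of_set UNIV) (- U)"
      using C U by (auto simp: closed_Compl)
    show "C \<inter> - U = {}" using C U by auto
  qed blast
  have g01: "0 \<le> g t" "g t \<le> 1" for t
    using g(2)[of t] by (auto simp: closed_segment_eq_real_ivl)
  let ?N = "(A - C) \<union> (U - A)"
  have N: "?N \<in> sets lebesgue" using C(3) U(3) by (auto simp: fmeasurableD)
  have dom: "\<bar>indicator A t - g t\<bar> \<le> indicator ?N t" for t
    using g01[of t] g(3)[of t] g(4)[of t] C(2) U(2) by (auto split: split_indicator)
  have gm: "(\<lambda>t. indicator A t - g t) \<in> borel_measurable (lebesgue_on K)"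
    using A borel_measurable_continuous_onI[OF g(1)]
    by (intro measurable_restrict_space1 borel_measurable_diff borel_measurable_indicator measurable_completion) auto
  have le: "ennreal (\<bar>indicator A t - g t\<bar> powr p) \<le> indicator ?N t" for t
  proof -
    have "\<bar>indicator A t - g t\<bar> powr p \<le> indicator ?N t powr p"
      using dom p by (intro powr_mono2) auto
    also have "\<dots> = indicator ?N t" by (simp split: split_indicator)
    finally show ?thesis by (simp add: ennreal_indicator[symmetric] ennreal_leI del: ennreal_indicator)
  qed
  have "(\<integral>\<^sup>+t. ennreal (\<bar>indicator A t - g t\<bar> powr p) \<partial>lebesgue_on K)
      = (\<integral>\<^sup>+t. ennreal (\<bar>indicator A t - g t\<bar> powr p) * indicator K t \<partial>lebesgue)"
    using K by (subst nn_integral_restrict_space) auto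
  also have "\<dots> \<le> (\<integral>\<^sup>+t. indicator ?N t \<partial>lebesgue)"
  proof (intro nn_integral_mono)
    fix t
    show "ennreal (\<bar>indicator A t - g t\<bar> powr p) * indicator K t \<le> indicator ?N t"
      using le[of t] by (cases "t \<in> K") (simp_all del: indicator_simps(1) add: indicator_simps(1)[of t K])
  qed
  also have "\<dots> = emeasure lebesgue ?N" using N by simp
  also have "\<dots> \<le> emeasure lebesgue (A - C) + emeasure lebesgue (U - A)"
    using C(3) U(3) by (intro emeasure_subadditive) (auto simp: fmeasurableD)
  also have "\<dots> \<le> ennreal d + ennreal d" using C(4) U(4) by (intro add_mono) auto
  also have "\<dots> = ennreal (e powr p)" using d by (simp add: d_def flip: ennreal_plus)
  finally have "Lp_le (lebesgue_on K) p (\<lambda>t. indicator A t - g t) e"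
    using gm e by (simp add: Lp_le_def)
  then show thesis using that g(1) g01 by blast
qed

text \<open>A nearby simple function has finitely many values; these are moved into the dense set \<open>D\<close>, and the
  indicators of its level sets are replaced by continuous functions.\<close>

theorem Lp_continuous_dense:
  fixes v :: "real \<Rightarrow> 'v::real_vector"
  assumes X: "normed_space X" and K: "K \<in> sets lebesgue" "K \<subseteq> {-L..L}" "L > 0"
    and v: "strongly_measurable K X v" and p: "p \<ge> 1"
    and fin: "Lp_le (lebesgue_on K) p (\<lambda>t. nrm X (v t)) c" and e: "e > 0"
    and D: "\<And>x r. x \<in> car X \<Longrightarrow> r > 0 \<Longrightarrow> \<exists>y\<in>D. nrm X (x - y) < r" "D \<subseteq> car X"
  obtains F :: "'v set" and b :: "'v \<Rightarrow> 'v" and g :: "'v \<Rightarrow> real \<Rightarrow> real" where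
    "finite F" "\<And>a. a \<in> F \<Longrightarrow> b a \<in> D" "\<And>a. continuous_on UNIV (g a)" "\<And>a t. 0 \<le> g a t" "\<And>a t. g a t \<le> 1"
    "Lp_le (lebesgue_on K) p (\<lambda>t. nrm X (v t - (\<Sum>a\<in>F. g a t *\<^sub>R b a))) e"
proof -
  let ?M = "lebesgue_on K"
  have e2: "e/2 > 0" using e by simp
  have one: "Lp_le ?M p (\<lambda>t. nrm X (v t) * 1) c" using fin by simp
  obtain s where s': "simple_function ?M s" "\<And>t. t \<in> K \<Longrightarrow> s t \<in> car X"
    "Lp_le ?M p (\<lambda>t. nrm X (v t - s t) * 1) (e/2)"
    by (rule Lp_simple_dense[OF X K(1) v borel_measurable_const p one e2]) blast
  note s = s'(1,2) s'(3)[unfolded mult_1_right]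
  define F where "F = s ` K"
  have F: "finite F" "F \<subseteq> car X" using s by (auto simp: F_def simple_function_def)
  define N where "N = real (card F) + 1"
  have N: "N > 0" by (simp add: N_def)
  define l where "l = (2 * L) powr (1/p)"
  have l: "l > 0" using K by (simp add: l_def)
  have "\<exists>y\<in>D. nrm X (a - y) < e/(4*N*l)" if "a \<in> F" for a
    using D(1)[of a "e/(4*N*l)"] that F N l e by auto
  then obtain b where b: "\<And>a. a \<in> F \<Longrightarrow> b a \<in> D" "\<And>a. a \<in> F \<Longrightarrow> nrm X (a - b a) < e/(4*N*l)" by metis
  have bc: "b a \<in> car X" if "a \<in> F" for a using b(1)[OF that] D(2) by blast
  define A where "A a = s -` {a} \<inter> K" for a
  have A: "A a \<in> sets lebesgue" for a
  proof (cases "a \<in> F")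
    case True
    then show ?thesis using s(1) K by (auto simp: A_def F_def simple_function_def sets_restrict_space_iff)
  next
    case False
    then have "A a = {}" by (auto simp: A_def F_def)
    then show ?thesis by simp
  qed
  have "\<exists>g. continuous_on UNIV g \<and> (\<forall>t. 0 \<le> g t) \<and> (\<forall>t. g t \<le> 1) \<and>
      Lp_le ?M p (\<lambda>t. indicator (A a) t - g t) (e/(4*N*(1 + \<bar>nrm X (b a)\<bar>)))" for a
  proof -
    have "e/(4*N*(1 + \<bar>nrm X (b a)\<bar>)) > 0" using e N by (simp add: add_pos_nonneg)
    from Lp_continuous_approx_indicator[OF A[of a] K(1) p this] show ?thesis by metis
  qed
  then obtain g where g: "\<And>a. continuous_on UNIV (g a)" "\<And>a t. 0 \<le> g a t" "\<And>a t. g a t \<le> 1"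
    "\<And>a. Lp_le ?M p (\<lambda>t. indicator (A a) t - g a t) (e/(4*N*(1 + \<bar>nrm X (b a)\<bar>)))" by metis
  define \<sigma> where "\<sigma> t = (\<Sum>a\<in>F. g a t *\<^sub>R b a)" for t
  have gm: "g a \<in> borel_measurable ?M" for a
    by (intro measurable_restrict_space1 measurable_completion)
      (simp add: borel_measurable_continuous_onI[OF g(1)])
  have \<sigma>m: "strongly_measurable K X \<sigma>"
    unfolding \<sigma>_def by (intro strongly_measurable_sum[OF X] strongly_measurable_scale[OF X] strongly_measurable_const[OF X] bc gm)
  have s_eq: "s t = (\<Sum>a\<in>F. indicator (A a) t *\<^sub>R a)" if "t \<in> K" for t
  proof -
    have "(\<Sum>a\<in>F. indicator (A a) t *\<^sub>R a) = (\<Sum>a\<in>F. if a = s t then a else 0)"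
      using that by (intro sum.cong) (auto simp: A_def)
    then show ?thesis using F(1) that by (simp add: F_def)
  qed
  have pt: "nrm X (v t - \<sigma> t) \<le> \<bar>nrm X (v t - s t)\<bar> +
      \<bar>\<Sum>a\<in>F. \<bar>\<bar>nrm X (a - b a)\<bar> + \<bar>nrm X (b a) * (indicator (A a) t - g a t)\<bar>\<bar>\<bar>" if t: "t \<in> K" for t
  proof -
    have vc: "v t \<in> car X" using strongly_measurable_car[OF v t] .
    have \<sigma>c: "\<sigma> t \<in> car X" using strongly_measurable_car[OF \<sigma>m t] .
    have d: "s t - \<sigma> t = (\<Sum>a\<in>F. indicator (A a) t *\<^sub>R (a - b a) + (indicator (A a) t - g a t) *\<^sub>R b a)"
      unfolding s_eq[OF t] \<sigma>_def sum_subtractf[symmetric] by (intro sum.cong) (auto simp: algebra_simps)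
    have "nrm X (s t - \<sigma> t) \<le> (\<Sum>a\<in>F. nrm X (indicator (A a) t *\<^sub>R (a - b a) + (indicator (A a) t - g a t) *\<^sub>R b a))"
      unfolding d using F(2) bc
      by (intro nrm_sum_le[OF X] car_add[OF X] car_scale[OF X] car_diff[OF X]) auto
    also have "\<dots> \<le> (\<Sum>a\<in>F. \<bar>\<bar>nrm X (a - b a)\<bar> + \<bar>nrm X (b a) * (indicator (A a) t - g a t)\<bar>\<bar>)"
    proof (intro sum_mono)
      fix a assume a: "a \<in> F"
      have c: "a - b a \<in> car X" "b a \<in> car X" using a F(2) bc car_diff[OF X] by auto
      have "nrm X (indicator (A a) t *\<^sub>R (a - b a) + (indicator (A a) t - g a t) *\<^sub>R b a)
          \<le> \<bar>indicator (A a) t\<bar> * nrm X (a - b a) + \<bar>indicator (A a) t - g a t\<bar> * nrm X (b a)"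
        using nrm_triangle[OF X car_scale[OF X c(1)] car_scale[OF X c(2)]] nrm_scale[OF X c(1)] nrm_scale[OF X c(2)]
        by metis
      moreover have "\<bar>indicator (A a) t\<bar> * nrm X (a - b a) \<le> nrm X (a - b a)"
        using nrm_nonneg[OF X c(1)] by (simp split: split_indicator)
      ultimately show "nrm X (indicator (A a) t *\<^sub>R (a - b a) + (indicator (A a) t - g a t) *\<^sub>R b a)
          \<le> \<bar>\<bar>nrm X (a - b a)\<bar> + \<bar>nrm X (b a) * (indicator (A a) t - g a t)\<bar>\<bar>"
        using nrm_nonneg[OF X c(1)] nrm_nonneg[OF X c(2)] by (simp add: abs_mult mult.commute)
    qed
    finally show ?thesis
      using nrm_diff_triangle[OF X vc s(2)[OF t] \<sigma>c] by linarith
  qed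
  have total: "Lp_le ?M p (\<lambda>t. \<bar>nrm X (v t - s t)\<bar> +
      \<bar>\<Sum>a\<in>F. \<bar>\<bar>nrm X (a - b a)\<bar> + \<bar>nrm X (b a) * (indicator (A a) t - g a t)\<bar>\<bar>\<bar>)
      (e/2 + (\<Sum>a\<in>F. \<bar>nrm X (a - b a)\<bar> * l + \<bar>nrm X (b a)\<bar> * (e/(4*N*(1 + \<bar>nrm X (b a)\<bar>)))))"
  proof (intro Lp_le_add Lp_le_sum s(3) F(1) p Lp_le_scale g(4))
    fix a
    show "Lp_le ?M p (\<lambda>t. nrm X (a - b a)) (\<bar>nrm X (a - b a)\<bar> * l)"
    proof (rule Lp_le_mono[OF Lp_le_const[OF p emeasure_bounded_set[OF K], of "\<bar>nrm X (a - b a)\<bar>"]])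
    qed (use K p in \<open>auto simp: l_def\<close>)
  qed
  have "(\<Sum>a\<in>F. \<bar>nrm X (a - b a)\<bar> * l + \<bar>nrm X (b a)\<bar> * (e/(4*N*(1 + \<bar>nrm X (b a)\<bar>)))) \<le> (\<Sum>a\<in>F. e/(2*N))"
  proof (intro sum_mono)
    fix a assume a: "a \<in> F"
    have "a - b a \<in> car X" using a F(2) bc car_diff[OF X] by auto
    then have "\<bar>nrm X (a - b a)\<bar> * l \<le> e/(4*N*l) * l"
      using b(2)[OF a] nrm_nonneg[OF X] l by (intro mult_right_mono) auto
    also have "\<dots> = e/(4*N)" using l by simp
    finally have 1: "\<bar>nrm X (a - b a)\<bar> * l \<le> e/(4*N)" .
    have "\<bar>nrm X (b a)\<bar> * (e/(4*N*(1 + \<bar>nrm X (b a)\<bar>))) = (\<bar>nrm X (b a)\<bar>/(1 + \<bar>nrm X (b a)\<bar>)) * (e/(4*N))"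
      by simp
    also have "\<dots> \<le> 1 * (e/(4*N))" using e N by (intro mult_right_mono) auto
    finally show "\<bar>nrm X (a - b a)\<bar> * l + \<bar>nrm X (b a)\<bar> * (e/(4*N*(1 + \<bar>nrm X (b a)\<bar>))) \<le> e/(2*N)"
      using 1 by simp
  qed
  moreover have "(\<Sum>a\<in>F. e/(2*N)) \<le> e/2"
    using e N by (simp add: N_def field_simps)
  ultimately have sum_le: "e/2 + (\<Sum>a\<in>F. \<bar>nrm X (a - b a)\<bar> * l + \<bar>nrm X (b a)\<bar> * (e/(4*N*(1 + \<bar>nrm X (b a)\<bar>)))) \<le> e"
    by linarith
  have "Lp_le ?M p (\<lambda>t. nrm X (v t - \<sigma> t)) e"
  proof (rule Lp_le_mono[OF total _ p sum_le])
    show "(\<lambda>t. nrm X (v t - \<sigma> t)) \<in> borel_measurable ?M"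
      by (rule borel_measurable_nrm[OF X K(1) strongly_measurable_diff[OF X v \<sigma>m]])
    show "AE t in ?M. \<bar>nrm X (v t - \<sigma> t)\<bar> \<le> \<bar>\<bar>nrm X (v t - s t)\<bar> +
      \<bar>\<Sum>a\<in>F. \<bar>\<bar>nrm X (a - b a)\<bar> + \<bar>nrm X (b a) * (indicator (A a) t - g a t)\<bar>\<bar>\<bar>\<bar>"
      using AE_in_lebesgue_on
    proof eventually_elim
      fix t assume t: "t \<in> K"
      have "0 \<le> nrm X (v t - \<sigma> t)"
        by (rule nrm_nonneg[OF X car_diff[OF X strongly_measurable_car[OF v t] strongly_measurable_car[OF \<sigma>m t]]])
      then show "\<bar>nrm X (v t - \<sigma> t)\<bar> \<le> \<bar>\<bar>nrm X (v t - s t)\<bar> +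
        \<bar>\<Sum>a\<in>F. \<bar>\<bar>nrm X (a - b a)\<bar> + \<bar>nrm X (b a) * (indicator (A a) t - g a t)\<bar>\<bar>\<bar>\<bar>"
        using pt[OF t] by linarith
    qed
  qed
  then show thesis using that[of F b g] F(1) b(1) g unfolding \<sigma>_def by blast
qed

subsection \<open>Mollification of scalar functions\<close>

lemma nn_integral_mollifier:
  assumes e: "\<epsilon> > 0" and c: "c \<noteq> 0"
  shows "(\<integral>\<^sup>+t. ennreal (mollifier \<epsilon> 0 (c * t + b)) \<partial>lebesgue) = ennreal (1 / \<bar>c\<bar>)"
proof -
  have m: "(\<lambda>t. ennreal (mollifier \<epsilon> 0 t)) \<in> borel_measurable lebesgue"
    using smooth_chain_measurable(1)[OF smooth_mollifier[of \<epsilon>], of 0] by (intro measurable_completion) simp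
  have "has_bochner_integral (lebesgue_on UNIV) (\<lambda>s. mollifier \<epsilon> 0 (0 - s)) 1"
    by (rule mollifier_mass[OF _ e]) auto
  then have "(\<integral>\<^sup>+s. ennreal (mollifier \<epsilon> 0 (0 - s)) \<partial>lebesgue) = 1"
    using nn_integral_eq_integral[of lebesgue "\<lambda>s. mollifier \<epsilon> 0 (0 - s)"] mollifier_nonneg[OF e]
    by (simp add: lebesgue_on_UNIV_eq has_bochner_integral_iff)
  then have 1: "(\<integral>\<^sup>+t. ennreal (mollifier \<epsilon> 0 t) \<partial>lebesgue) = 1"
    using nn_integral_real_affine_lebesgue[OF m, of "-1" 0] by simp
  have "1 = ennreal \<bar>c\<bar> * (\<integral>\<^sup>+t. ennreal (mollifier \<epsilon> 0 (c * t + b)) \<partial>lebesgue)"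
    using nn_integral_real_affine_lebesgue[OF m c, of b] 1 by (simp add: add.commute)
  moreover have "ennreal (1 / \<bar>c\<bar>) * ennreal \<bar>c\<bar> = 1"
    using c by (simp flip: ennreal_mult)
  ultimately show ?thesis by (metis mult.assoc mult.left_neutral mult.right_neutral)
qed

lemma sigma_finite_lebesgue: "sigma_finite_measure (lebesgue :: real measure)"
proof
  show "\<exists>A. countable A \<and> A \<subseteq> sets (lebesgue :: real measure) \<and> \<Union> A = space lebesgue \<and> (\<forall>a\<in>A. emeasure lebesgue a \<noteq> \<infinity>)"
  proof (intro exI[of _ "range (\<lambda>n::nat. {- real n..real n})"] conjI)
    have "\<exists>n. x \<in> {- real n..real n}" for x
    proof -
      obtain n where "\<bar>x\<bar> \<le> real n" using real_arch_simple by blast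
      then show ?thesis by (intro exI[of _ n]) auto
    qed
    then show "(\<Union> (range (\<lambda>n::nat. {- real n..real n}))) = space lebesgue" by auto
  qed auto
qed

text \<open>Young's inequality for the mollification of \<open>h\<close>, pulled back by an affine map. The
  constant 4 comes from the crude form of Hoelder's inequality above and from \<open>c \<ge> 1/2\<close>.\<close>

lemma Lp_le_mollified:
  fixes h :: "real \<Rightarrow> real" and b c :: real
  assumes h: "Lp_le lebesgue p h d" and h0: "\<And>s. 0 \<le> h s" and p: "p \<ge> 1"
    and e: "\<epsilon> > 0" and c: "c \<ge> 1/2"
  defines "G \<equiv> \<lambda>t. \<integral>\<^sup>+s. ennreal (mollifier \<epsilon> 0 (c * t + b - s) * h s) \<partial>lebesgue"
  shows "G t < \<infinity>" and "Lp_le lebesgue p (\<lambda>t. enn2real (G t)) (4 * d)"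
proof -
  interpret S: sigma_finite_measure "lebesgue :: real measure" by (rule sigma_finite_lebesgue)
  interpret P: pair_sigma_finite "lebesgue :: real measure" "lebesgue :: real measure" ..
  have hm[measurable]: "h \<in> borel_measurable lebesgue" and d: "d \<ge> 0" using h by (auto simp: Lp_le_def)
  have mm: "mollifier \<epsilon> 0 \<in> borel_measurable borel" by (rule smooth_chain_measurable(1)[OF smooth_mollifier])
  have id: "(\<lambda>x::real. x) \<in> borel_measurable lebesgue" by (intro measurable_completion) simp
  have pm: "(\<lambda>(t, s). mollifier \<epsilon> 0 (c * t + b - s)) \<in> borel_measurable (lebesgue \<Otimes>\<^sub>M lebesgue)"
    unfolding split_beta
    by (rule measurable_compose[OF _ mm])
      (intro borel_measurable_diff borel_measurable_add borel_measurable_times borel_measurable_const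
        measurable_compose[OF measurable_fst id] measurable_compose[OF measurable_snd id])
  have m1: "(\<lambda>s. mollifier \<epsilon> 0 (c * t + b - s)) \<in> borel_measurable lebesgue" for t
    by (rule measurable_compose[OF _ mm]) (intro borel_measurable_diff borel_measurable_const id)
  define Q where "Q t = (\<integral>\<^sup>+s. ennreal (mollifier \<epsilon> 0 (c * t + b - s)) * ennreal (h s powr p) \<partial>lebesgue)" for t
  have hp: "(\<integral>\<^sup>+s. ennreal (h s powr p) \<partial>lebesgue) \<le> ennreal (d powr p)"
    using h h0 by (simp add: Lp_le_def)
  obtain C where C: "C > 0" "\<And>x. \<bar>mollifier \<epsilon> 0 x\<bar> \<le> C" using mollifier_bounded[OF e, of 0] by blast
  have Qfin: "Q t < \<infinity>" for t
  proof -
    have "Q t \<le> (\<integral>\<^sup>+s. ennreal C * ennreal (h s powr p) \<partial>lebesgue)"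
      unfolding Q_def using C(2) by (intro nn_integral_mono mult_right_mono ennreal_leI) (auto simp: abs_le_iff)
    also have "\<dots> = ennreal C * (\<integral>\<^sup>+s. ennreal (h s powr p) \<partial>lebesgue)"
      by (intro nn_integral_cmult) simp
    also have "\<dots> < \<infinity>"
      using le_less_trans[OF hp, of \<infinity>] by (simp add: ennreal_mult_less_top)
    finally show ?thesis .
  qed
  have ineq: "G t \<le> ennreal (\<eta> + \<eta> powr (1 - p) * enn2real (Q t))" if \<eta>: "\<eta> > 0" for \<eta> t
  proof -
    have "G t \<le> (\<integral>\<^sup>+s. ennreal \<eta> * ennreal (mollifier \<epsilon> 0 (c * t + b - s)) +
        ennreal (\<eta> powr (1 - p)) * (ennreal (mollifier \<epsilon> 0 (c * t + b - s)) * ennreal (h s powr p)) \<partial>lebesgue)"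
      unfolding G_def
    proof (intro nn_integral_mono)
      fix s
      have "mollifier \<epsilon> 0 (c * t + b - s) * h s \<le> mollifier \<epsilon> 0 (c * t + b - s) * (\<eta> + \<eta> powr (1 - p) * h s powr p)"
        by (intro mult_left_mono le_eta_add_powr h0 \<eta> p mollifier_nonneg e)
      then have "ennreal (mollifier \<epsilon> 0 (c * t + b - s) * h s)
          \<le> ennreal (\<eta> * mollifier \<epsilon> 0 (c * t + b - s) + \<eta> powr (1 - p) * (mollifier \<epsilon> 0 (c * t + b - s) * h s powr p))"
        by (intro ennreal_leI) (simp add: algebra_simps)
      also have "\<dots> = ennreal \<eta> * ennreal (mollifier \<epsilon> 0 (c * t + b - s)) +
        ennreal (\<eta> powr (1 - p)) * (ennreal (mollifier \<epsilon> 0 (c * t + b - s)) * ennreal (h s powr p))"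
        using \<eta> mollifier_nonneg[OF e] by (simp flip: ennreal_mult ennreal_plus)
      finally show "ennreal (mollifier \<epsilon> 0 (c * t + b - s) * h s) \<le> \<dots>" .
    qed
    also have "\<dots> = ennreal \<eta> * (\<integral>\<^sup>+s. ennreal (mollifier \<epsilon> 0 (c * t + b - s)) \<partial>lebesgue) + ennreal (\<eta> powr (1 - p)) * Q t"
      unfolding Q_def using m1 by (subst nn_integral_add) (auto simp: nn_integral_cmult)
    also have "(\<integral>\<^sup>+s. ennreal (mollifier \<epsilon> 0 (c * t + b - s)) \<partial>lebesgue) = 1"
      using nn_integral_mollifier[OF e, of "-1" "c * t + b"] by (simp add: algebra_simps)
    also have "Q t = ennreal (enn2real (Q t))" using Qfin by simp
    finally show ?thesis using \<eta> by (simp flip: ennreal_mult ennreal_plus)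
  qed
  show Gfin: "G t < \<infinity>" for t
    using ineq[of 1 t] by (auto intro: le_less_trans)
  have bound: "enn2real (G t) powr p \<le> 2 powr p * enn2real (Q t)" for t
  proof -
    define q where "q = enn2real (Q t)"
    have q: "q \<ge> 0" by (simp add: q_def)
    have r: "enn2real (G t) \<le> \<eta> + \<eta> powr (1 - p) * q" if "\<eta> > 0" for \<eta>
      using ineq[OF that, of t] that q unfolding q_def[symmetric] by (intro enn2real_leI) auto
    show ?thesis
    proof (cases "q = 0")
      case True
      have "enn2real (G t) \<le> 0"
        by (rule field_le_epsilon) (use r True in simp)
      then have "enn2real (G t) = 0" using enn2real_nonneg[of "G t"] by linarith
      then show ?thesis using p by simp
    next
      case False
      then have qp: "q > 0" using q by simp
      define \<eta> where "\<eta> = q powr (1/p)"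
      have \<eta>: "\<eta> > 0" using qp by (simp add: \<eta>_def)
      have "\<eta> powr p = q" using p qp by (simp add: \<eta>_def powr_powr)
      then have "\<eta> powr (1 - p) * q = \<eta>" using \<eta> by (metis diff_add_cancel powr_add powr_one less_imp_le)
      then have "enn2real (G t) \<le> 2 * \<eta>" using r[OF \<eta>] by simp
      then have "enn2real (G t) powr p \<le> (2 * \<eta>) powr p" using p by (intro powr_mono2) auto
      also have "\<dots> = 2 powr p * q" using \<open>\<eta> powr p = q\<close> by (simp add: powr_mult)
      finally show ?thesis by (simp add: q_def)
    qed
  qed
  have hm2: "(\<lambda>x. h (snd x)) \<in> borel_measurable (lebesgue \<Otimes>\<^sub>M lebesgue)"
    by (rule measurable_compose[OF measurable_snd hm])
  have Gm: "G \<in> borel_measurable lebesgue"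
    unfolding G_def
  proof (rule S.borel_measurable_nn_integral)
    show "(\<lambda>(t, s). ennreal (mollifier \<epsilon> 0 (c * t + b - s) * h s)) \<in> borel_measurable (lebesgue \<Otimes>\<^sub>M lebesgue)"
      using pm hm2 unfolding split_beta by measurable
  qed
  have "(\<integral>\<^sup>+t. Q t \<partial>lebesgue) = (\<integral>\<^sup>+s. (\<integral>\<^sup>+t. ennreal (mollifier \<epsilon> 0 (c * t + b - s)) * ennreal (h s powr p) \<partial>lebesgue) \<partial>lebesgue)"
    unfolding Q_def
  proof (rule P.Fubini'[symmetric])
    show "(\<lambda>(t, s). ennreal (mollifier \<epsilon> 0 (c * t + b - s)) * ennreal (h s powr p)) \<in> borel_measurable (lebesgue \<Otimes>\<^sub>M lebesgue)"
      using pm hm2 unfolding split_beta by measurable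
  qed
  also have "\<dots> = (\<integral>\<^sup>+s. ennreal (1 / c) * ennreal (h s powr p) \<partial>lebesgue)"
  proof (intro nn_integral_cong)
    fix s
    have "(\<lambda>t. ennreal (mollifier \<epsilon> 0 (c * t + b - s))) \<in> borel_measurable lebesgue"
      by (intro measurable_compose[OF _ measurable_ennreal] measurable_compose[OF _ mm]
          borel_measurable_diff borel_measurable_add borel_measurable_times borel_measurable_const id)
    then have "(\<integral>\<^sup>+t. ennreal (mollifier \<epsilon> 0 (c * t + b - s)) * ennreal (h s powr p) \<partial>lebesgue)
        = (\<integral>\<^sup>+t. ennreal (mollifier \<epsilon> 0 (c * t + b - s)) \<partial>lebesgue) * ennreal (h s powr p)"
      by (rule nn_integral_multc)
    then show "(\<integral>\<^sup>+t. ennreal (mollifier \<epsilon> 0 (c * t + b - s)) * ennreal (h s powr p) \<partial>lebesgue)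
        = ennreal (1 / c) * ennreal (h s powr p)"
      using nn_integral_mollifier[OF e, of c "b - s"] c by (simp add: add_diff_eq)
  qed
  also have "\<dots> = ennreal (1 / c) * (\<integral>\<^sup>+s. ennreal (h s powr p) \<partial>lebesgue)"
    by (intro nn_integral_cmult) simp
  also have "\<dots> \<le> ennreal 2 * ennreal (d powr p)"
    using c by (intro mult_mono hp ennreal_leI) (auto simp: field_simps)
  finally have Qint: "(\<integral>\<^sup>+t. Q t \<partial>lebesgue) \<le> ennreal 2 * ennreal (d powr p)" .
  have Qm: "Q \<in> borel_measurable lebesgue"
    unfolding Q_def
  proof (rule S.borel_measurable_nn_integral)
    show "(\<lambda>(t, s). ennreal (mollifier \<epsilon> 0 (c * t + b - s)) * ennreal (h s powr p)) \<in> borel_measurable (lebesgue \<Otimes>\<^sub>M lebesgue)"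
      using pm hm2 unfolding split_beta by measurable
  qed
  have "(\<integral>\<^sup>+t. ennreal (\<bar>enn2real (G t)\<bar> powr p) \<partial>lebesgue) \<le> (\<integral>\<^sup>+t. ennreal (2 powr p) * Q t \<partial>lebesgue)"
  proof (intro nn_integral_mono)
    fix t
    have "ennreal (\<bar>enn2real (G t)\<bar> powr p) \<le> ennreal (2 powr p * enn2real (Q t))"
      using bound[of t] by (intro ennreal_leI) simp
    also have "\<dots> = ennreal (2 powr p) * Q t" using Qfin[of t] by (simp add: ennreal_mult)
    finally show "ennreal (\<bar>enn2real (G t)\<bar> powr p) \<le> ennreal (2 powr p) * Q t" .
  qed
  also have "\<dots> = ennreal (2 powr p) * (\<integral>\<^sup>+t. Q t \<partial>lebesgue)" by (intro nn_integral_cmult Qm)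
  also have "\<dots> \<le> ennreal (2 powr p) * (ennreal 2 * ennreal (d powr p))" by (intro mult_left_mono Qint) simp
  also have "\<dots> = ennreal (2 powr p * (2 * d powr p))" by (simp flip: ennreal_mult ennreal_numeral)
  also have "\<dots> \<le> ennreal ((4 * d) powr p)"
  proof (intro ennreal_leI)
    have "(2::real) powr 1 \<le> 2 powr p" using p by (intro powr_mono) auto
    then have "2 powr p * (2 * d powr p) \<le> 2 powr p * (2 powr p * d powr p)"
      by (intro mult_left_mono mult_right_mono) auto
    also have "\<dots> = (2 * (2 * d)) powr p" by (simp only: powr_mult)
    finally show "2 powr p * (2 * d powr p) \<le> (4 * d) powr p" by simp
  qed
  finally show "Lp_le lebesgue p (\<lambda>t. enn2real (G t)) (4 * d)"
    using Gm d by (auto simp: Lp_le_def)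
qed

subsection \<open>Mollification of vector-valued functions\<close>

text \<open>Mollified values are compared with the function through a majorant: \<open>x\<close> is the value of the
  mollified function at \<open>a * t + b\<close>, given as a Bochner integral for each \<open>t\<close> separately, so that
  measurability of the mollified function is never at issue. The function is split into a
  continuous part \<open>\<sigma>\<close>, which is uniformly continuous on bounded sets, and a part of small norm, for
  which the scalar estimate applies. The affine map serves to push an interval into its interior.\<close>

theorem mollification:
  fixes v :: "real \<Rightarrow> 'v::real_vector"
  assumes X: "normed_space X" and I: "I \<in> sets lebesgue"
    and K: "K \<in> sets lebesgue" "K \<subseteq> {-L..L}" "L > 0" "K \<subseteq> I" and J: "J \<in> sets lebesgue" "J \<subseteq> K"
    and v: "strongly_measurable K X v" "\<And>t. t \<in> I \<Longrightarrow> v t \<in> car X" and p: "p \<ge> 1"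
    and fin: "Lp_le (lebesgue_on K) p (\<lambda>t. nrm X (v t)) c" and e: "e > 0"
  obtains \<eta> where "\<eta> > 0"
    "\<And>\<epsilon> a b. 0 < \<epsilon> \<Longrightarrow> \<epsilon> \<le> \<eta> \<Longrightarrow> 1/2 \<le> a \<Longrightarrow> \<forall>t\<in>J. \<bar>a * t + b - t\<bar> \<le> \<eta> \<Longrightarrow>
      \<exists>g. Lp_le (lebesgue_on J) p g e \<and> (\<forall>t\<in>J. \<forall>x. {a * t + b - \<epsilon>..a * t + b + \<epsilon>} \<subseteq> K \<longrightarrow>
        has_bochner_integral_in I X (\<lambda>s. mollifier \<epsilon> 0 (a * t + b - s) *\<^sub>R v s) x \<longrightarrow> nrm X (x - v t) \<le> g t)"
proof -
  \<comment> \<open>The majorant below has norm at most \<open>4 * \<delta> + (\<zeta> * l + \<delta>)\<close>, with \<open>\<zeta> * l \<le> e/2\<close>.\<close>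
  define \<delta> where "\<delta> = e/10"
  define l where "l = (2 * L) powr (1/p)"
  define \<zeta> where "\<zeta> = e/(2*(l+1))"
  have l: "l > 0" using K by (simp add: l_def)
  have \<zeta>: "\<zeta> > 0" using e l by (simp add: \<zeta>_def)
  have \<delta>: "\<delta> > 0" using e by (simp add: \<delta>_def)
  have dense: "\<exists>y\<in>car X. nrm X (x - y) < r" if "x \<in> car X" "r > 0" for x r
    using that nrm_zero[OF X] by (intro bexI[of _ x]) auto
  obtain F :: "'v set" and bb :: "'v \<Rightarrow> 'v" and gg :: "'v \<Rightarrow> real \<Rightarrow> real" where
    F: "finite F" "\<And>a. a \<in> F \<Longrightarrow> bb a \<in> car X" "\<And>a. continuous_on UNIV (gg a)" "\<And>a t. 0 \<le> gg a t" "\<And>a t. gg a t \<le> 1"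
    "Lp_le (lebesgue_on K) p (\<lambda>t. nrm X (v t - (\<Sum>a\<in>F. gg a t *\<^sub>R bb a))) \<delta>"
  proof (rule Lp_continuous_dense[OF X K(1-3) v(1) p fin \<delta>, of "car X"])
    fix x r assume "x \<in> car X" "r > (0::real)"
    then show "\<exists>y\<in>car X. nrm X (x - y) < r" by (rule dense)
  next
    fix F :: "'v set" and b g
    assume "finite F" "\<And>a. a \<in> F \<Longrightarrow> b a \<in> car X" "\<And>a. continuous_on UNIV (g a)" "\<And>a t. 0 \<le> g a t" "\<And>a t. g a t \<le> (1::real)"
      "Lp_le (lebesgue_on K) p (\<lambda>t. nrm X (v t - (\<Sum>a\<in>F. g a t *\<^sub>R b a))) \<delta>"
    then show thesis by (rule that)
  qed simp
  define \<sigma> where "\<sigma> t = (\<Sum>a\<in>F. gg a t *\<^sub>R bb a)" for t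
  have \<sigma>c: "\<sigma> t \<in> car X" for t
    unfolding \<sigma>_def by (intro car_sum[OF X] car_scale[OF X] F(2))
  have "\<forall>\<^sub>F \<eta> in at_right 0. \<forall>a\<in>F. \<forall>s\<in>{-L..L}. \<forall>t\<in>{-L..L}. \<bar>s - t\<bar> \<le> 2 * \<eta> \<longrightarrow>
      \<bar>gg a s - gg a t\<bar> * nrm X (bb a) \<le> \<zeta> / (real (card F) + 1)"
  proof (rule eventually_ball_finite[OF F(1)], rule ballI)
    fix a assume a: "a \<in> F"
    have nb: "nrm X (bb a) \<ge> 0" by (rule nrm_nonneg[OF X F(2)[OF a]])
    define r where "r = \<zeta> / (real (card F) + 1) / (nrm X (bb a) + 1)"
    have r: "r > 0" using \<zeta> nb by (simp add: r_def)
    have "uniformly_continuous_on {-L..L} (gg a)"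
      by (intro compact_uniformly_continuous continuous_on_subset[OF F(3)]) auto
    then obtain d where d: "d > 0" "\<And>s t. s \<in> {-L..L} \<Longrightarrow> t \<in> {-L..L} \<Longrightarrow> dist s t < d \<Longrightarrow> dist (gg a s) (gg a t) < r"
      using r unfolding uniformly_continuous_on_def by metis
    show "\<forall>\<^sub>F \<eta> in at_right 0. \<forall>s\<in>{-L..L}. \<forall>t\<in>{-L..L}. \<bar>s - t\<bar> \<le> 2 * \<eta> \<longrightarrow>
      \<bar>gg a s - gg a t\<bar> * nrm X (bb a) \<le> \<zeta> / (real (card F) + 1)"
      unfolding eventually_at_right_field
    proof (intro exI[of _ "d/2"] conjI allI impI ballI)
      fix y s t assume y: "0 < y" "y < d/2" and st: "s \<in> {-L..L}" "t \<in> {-L..L}" "\<bar>s - t\<bar> \<le> 2 * y"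
      have "dist (gg a s) (gg a t) < r" by (rule d(2)) (use y st in \<open>auto simp: dist_real_def\<close>)
      then have "\<bar>gg a s - gg a t\<bar> * nrm X (bb a) \<le> r * (nrm X (bb a) + 1)"
        using nb r by (intro mult_mono) (auto simp: dist_real_def)
      also have "\<dots> = \<zeta> / (real (card F) + 1)" using nb by (simp add: r_def)
      finally show "\<bar>gg a s - gg a t\<bar> * nrm X (bb a) \<le> \<zeta> / (real (card F) + 1)" .
    qed (use d(1) in simp)
  qed
  then have "\<forall>\<^sub>F \<eta> in at_right 0. 0 < \<eta> \<and> (\<forall>a\<in>F. \<forall>s\<in>{-L..L}. \<forall>t\<in>{-L..L}. \<bar>s - t\<bar> \<le> 2 * \<eta> \<longrightarrow>
      \<bar>gg a s - gg a t\<bar> * nrm X (bb a) \<le> \<zeta> / (real (card F) + 1))"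
    by (intro eventually_conj eventually_at_right_less)
  from eventually_happens'[OF trivial_limit_at_right_real this] obtain \<eta> where \<eta>: "\<eta> > 0"
    "\<And>a s t. a \<in> F \<Longrightarrow> s \<in> {-L..L} \<Longrightarrow> t \<in> {-L..L} \<Longrightarrow> \<bar>s - t\<bar> \<le> 2 * \<eta> \<Longrightarrow>
      \<bar>gg a s - gg a t\<bar> * nrm X (bb a) \<le> \<zeta> / (real (card F) + 1)" by blast
  have unif: "nrm X (\<sigma> s - \<sigma> t) \<le> \<zeta>" if st: "s \<in> {-L..L}" "t \<in> {-L..L}" "\<bar>s - t\<bar> \<le> 2 * \<eta>" for s t
  proof -
    have "nrm X (\<sigma> s - \<sigma> t) = nrm X (\<Sum>a\<in>F. (gg a s - gg a t) *\<^sub>R bb a)"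
      by (simp add: \<sigma>_def sum_subtractf scaleR_diff_left)
    also have "\<dots> \<le> (\<Sum>a\<in>F. nrm X ((gg a s - gg a t) *\<^sub>R bb a))"
      by (intro nrm_sum_le[OF X] car_scale[OF X] F(2))
    also have "\<dots> \<le> (\<Sum>a\<in>F. \<zeta> / (real (card F) + 1))"
      by (intro sum_mono) (use \<eta>(2)[OF _ st] nrm_scale[OF X F(2)] in auto)
    also have "\<dots> \<le> \<zeta>" using \<zeta> by (simp add: field_simps)
    finally show ?thesis .
  qed
  define h where "h s = (if s \<in> K then nrm X (v s - \<sigma> s) else 0)" for s
  have h0: "0 \<le> h s" for s
    using nrm_nonneg[OF X car_diff[OF X v(2) \<sigma>c]] K(4) by (auto simp: h_def)
  have hL: "Lp_le lebesgue p h \<delta>"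
    using Lp_le_extend[OF F(6), of UNIV] K(1) unfolding h_def \<sigma>_def lebesgue_on_UNIV_eq by simp
  have hm: "h \<in> borel_measurable lebesgue" using hL by (simp add: Lp_le_def)
  have main: "\<exists>g. Lp_le (lebesgue_on J) p g e \<and> (\<forall>t\<in>J. \<forall>x. {a * t + b - \<epsilon>..a * t + b + \<epsilon>} \<subseteq> K \<longrightarrow>
        has_bochner_integral_in I X (\<lambda>s. mollifier \<epsilon> 0 (a * t + b - s) *\<^sub>R v s) x \<longrightarrow> nrm X (x - v t) \<le> g t)"
    if ep: "0 < \<epsilon>" "\<epsilon> \<le> \<eta>" and a: "1/2 \<le> a" and ab: "\<forall>t\<in>J. \<bar>a * t + b - t\<bar> \<le> \<eta>" for \<epsilon> a b
  proof -
    define G where "G t = (\<integral>\<^sup>+s. ennreal (mollifier \<epsilon> 0 (a * t + b - s) * h s) \<partial>lebesgue)" for t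
    note G = Lp_le_mollified[OF hL h0 p ep(1) a, where b=b, folded G_def]
    define g where "g t = \<bar>enn2real (G t)\<bar> + \<bar>\<bar>\<zeta>\<bar> + \<bar>h t\<bar>\<bar>" for t
    have "Lp_le (lebesgue_on J) p g (4 * \<delta> + (\<zeta> * l + \<delta>))"
      unfolding g_def
    proof (intro Lp_le_add p)
      show "Lp_le (lebesgue_on J) p (\<lambda>t. enn2real (G t)) (4 * \<delta>)" "Lp_le (lebesgue_on J) p h \<delta>"
        using G(2) hL J(1) Lp_le_restrict[of UNIV p _ _ J] by (auto simp: lebesgue_on_UNIV_eq)
      show "Lp_le (lebesgue_on J) p (\<lambda>t. \<zeta>) (\<zeta> * l)"
        unfolding l_def using \<zeta> J K by (intro Lp_le_const[OF p emeasure_bounded_set]) auto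
    qed
    moreover have "4 * \<delta> + (\<zeta> * l + \<delta>) \<le> e"
    proof -
      have "\<zeta> * l \<le> \<zeta> * (l + 1)" using \<zeta> by simp
      also have "\<dots> = e/2" using l by (simp add: \<zeta>_def field_simps)
      finally show ?thesis by (simp add: \<delta>_def)
    qed
    ultimately have gL: "Lp_le (lebesgue_on J) p g e"
      by (intro Lp_le_mono[of "lebesgue_on J" p g _ g e] p) (auto simp: Lp_le_def)
    have "nrm X (x - v t) \<le> g t" if t: "t \<in> J" and sub: "{a * t + b - \<epsilon>..a * t + b + \<epsilon>} \<subseteq> K"
      and x: "has_bochner_integral_in I X (\<lambda>s. mollifier \<epsilon> 0 (a * t + b - s) *\<^sub>R v s) x" for t x
    proof -
      let ?m = "\<lambda>s. mollifier \<epsilon> 0 (a * t + b - s)"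
      have tK: "t \<in> K" "t \<in> I" using t J K by auto
      have xc: "x \<in> car X" using x by (simp add: has_bochner_integral_in_def)
      have "has_bochner_integral_in I X (\<lambda>s. ?m s *\<^sub>R v s - ?m s *\<^sub>R \<sigma> t) (x - 1 *\<^sub>R \<sigma> t)"
        by (rule has_bochner_integral_in_diff[OF X x I
              has_bochner_integral_in_scaleR_const[OF X I \<sigma>c mollifier_mass[OF I ep(1)]]]) (use sub K(4) in blast)
      from has_bochner_integral_in_norm_bound[OF X I this]
      have "ennreal (nrm X (x - \<sigma> t)) \<le> (\<integral>\<^sup>+s. ennreal (nrm X (?m s *\<^sub>R v s - ?m s *\<^sub>R \<sigma> t)) \<partial>lebesgue_on I)"
        by simp
      also have "\<dots> \<le> (\<integral>\<^sup>+s. ennreal (?m s * h s) + ennreal \<zeta> * ennreal (?m s) \<partial>lebesgue_on I)"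
      proof (intro nn_integral_mono)
        fix s assume "s \<in> space (lebesgue_on I)"
        then have s: "s \<in> I" by simp
        have m0: "?m s \<ge> 0" by (rule mollifier_nonneg[OF ep(1)])
        have "nrm X (?m s *\<^sub>R v s - ?m s *\<^sub>R \<sigma> t) = ?m s * nrm X (v s - \<sigma> t)"
          using nrm_scale[OF X car_diff[OF X v(2)[OF s] \<sigma>c]] m0 by (simp flip: scaleR_diff_right)
        also have "\<dots> \<le> ?m s * (h s + \<zeta>)"
        proof (cases "\<bar>a * t + b - s\<bar> > \<epsilon>")
          case True
          then show ?thesis using mollifier_zero[OF ep(1)] by simp
        next
          case False
          then have "s \<in> {a * t + b - \<epsilon>..a * t + b + \<epsilon>}" by (auto simp: abs_le_iff not_less)
          then have sK: "s \<in> K" using sub by blast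
          have "\<bar>s - t\<bar> \<le> 2 * \<eta>" using False ab t ep(2) by force
          moreover have "s \<in> {-L..L}" "t \<in> {-L..L}" using sK tK K(2) by auto
          ultimately have "nrm X (\<sigma> s - \<sigma> t) \<le> \<zeta>" using unif by blast
          then have "nrm X (v s - \<sigma> t) \<le> h s + \<zeta>"
            using nrm_diff_triangle[OF X v(2)[OF s] \<sigma>c[of s] \<sigma>c[of t]] sK by (simp add: h_def)
          then show ?thesis using m0 by (rule mult_left_mono)
        qed
        finally have "ennreal (nrm X (?m s *\<^sub>R v s - ?m s *\<^sub>R \<sigma> t)) \<le> ennreal (?m s * h s + \<zeta> * ?m s)"
          by (intro ennreal_leI) (simp add: algebra_simps)
        then show "ennreal (nrm X (?m s *\<^sub>R v s - ?m s *\<^sub>R \<sigma> t)) \<le> ennreal (?m s * h s) + ennreal \<zeta> * ennreal (?m s)"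
          using m0 h0[of s] \<zeta> by (simp flip: ennreal_mult ennreal_plus)
      qed
      also have "\<dots> \<le> (\<integral>\<^sup>+s. ennreal (?m s * h s) + ennreal \<zeta> * ennreal (?m s) \<partial>lebesgue)"
        using I by (subst nn_integral_restrict_space) (auto intro!: nn_integral_mono split: split_indicator)
      also have "\<dots> = G t + ennreal \<zeta>"
      proof -
        have mm: "?m \<in> borel_measurable lebesgue"
          by (rule measurable_compose[OF _ smooth_chain_measurable(1)[OF smooth_mollifier]])
            (intro borel_measurable_diff borel_measurable_const measurable_completion, simp)
        have "(\<integral>\<^sup>+s. ennreal (?m s) \<partial>lebesgue) = 1"
          using nn_integral_mollifier[OF ep(1), of "-1" "a * t + b"] by (simp add: algebra_simps)
        then show ?thesis
          using mm hm by (subst nn_integral_add) (auto simp: nn_integral_cmult G_def)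
      qed
      also have "\<dots> = ennreal (enn2real (G t) + \<zeta>)" using G(1)[of t] \<zeta> by simp
      finally have "nrm X (x - \<sigma> t) \<le> enn2real (G t) + \<zeta>" 
        by (subst (asm) ennreal_le_iff) (use \<zeta> in auto)
      moreover have "nrm X (\<sigma> t - v t) = h t"
        using nrm_minus_commute[OF X \<sigma>c v(2)[OF tK(2)]] tK by (simp add: h_def)
      ultimately show ?thesis
        using nrm_diff_triangle[OF X xc \<sigma>c v(2)[OF tK(2)], of t] h0[of t] \<zeta> by (simp add: g_def)
    qed
    then show ?thesis using gL by blast
  qed
  show thesis by (rule that[OF \<eta>(1) main])
qed

subsection \<open>Functions determined by their averages\<close>

text \<open>On the compact subintervals, local Bochner integrability amounts to measurability and a finite
  integral of the norm.\<close>

definition locally_L1 :: "real set \<Rightarrow> 'v::real_vector nspace \<Rightarrow> (real \<Rightarrow> 'v) \<Rightarrow> bool" where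
  "locally_L1 I X u \<longleftrightarrow> (\<forall>t\<in>I. u t \<in> car X) \<and> (\<forall>a b. {a..b} \<subseteq> I \<longrightarrow>
     strongly_measurable {a..b} X u \<and> (\<exists>c. Lp_le (lebesgue_on {a..b}) 1 (\<lambda>t. nrm X (u t)) c))"

lemma locally_L1D:
  assumes "locally_L1 I X u" "{a..b} \<subseteq> I"
  shows "strongly_measurable {a..b} X u" "\<exists>c. Lp_le (lebesgue_on {a..b}) 1 (\<lambda>t. nrm X (u t)) c"
  using assms unfolding locally_L1_def by blast+

lemma Lp_le_1_exists:
  assumes "g \<in> borel_measurable M" "(\<integral>\<^sup>+t. ennreal (g t) \<partial>M) < \<infinity>" "\<And>t. t \<in> space M \<Longrightarrow> 0 \<le> g t"
  shows "\<exists>c. Lp_le M 1 g c"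
proof -
  have "(\<integral>\<^sup>+t. ennreal (\<bar>g t\<bar> powr 1) \<partial>M) = (\<integral>\<^sup>+t. ennreal (g t) \<partial>M)"
    using assms(3) by (intro nn_integral_cong) auto
  then show ?thesis using Lp_le_exists[of g M 1] assms by auto
qed

lemma locally_bochner_integrable_imp_locally_L1:
  assumes X: "normed_space X" and u: "locally_bochner_integrable I X u"
  shows "locally_L1 I X u"
  unfolding locally_L1_def
proof (intro conjI allI impI ballI)
  fix t assume "t \<in> I" then show "u t \<in> car X" using u by (auto simp: locally_bochner_integrable_def)
next
  fix a b :: real assume ab: "{a..b} \<subseteq> I"
  then obtain x where x: "has_bochner_integral_in {a..b} X u x"
    using u by (auto simp: locally_bochner_integrable_def)
  then show sm: "strongly_measurable {a..b} X u" by (simp add: has_bochner_integral_in_def)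
  show "\<exists>c. Lp_le (lebesgue_on {a..b}) 1 (\<lambda>t. nrm X (u t)) c"
    using has_bochner_integral_in_finite[OF X _ x] borel_measurable_nrm[OF X _ sm]
      strongly_measurable_car[OF sm] nrm_nonneg[OF X] by (intro Lp_le_1_exists) auto
qed

lemma locally_L1_diff:
  assumes X: "normed_space X" and u: "locally_L1 I X u" and v: "locally_L1 I X v"
  shows "locally_L1 I X (\<lambda>t. u t - v t)"
  unfolding locally_L1_def
proof (intro conjI allI impI ballI)
  fix t assume "t \<in> I" then show "u t - v t \<in> car X"
    using u v car_diff[OF X] by (auto simp: locally_L1_def)
next
  fix a b :: real assume ab: "{a..b} \<subseteq> I"
  have sm: "strongly_measurable {a..b} X u" "strongly_measurable {a..b} X v"
    using u v ab by (auto simp: locally_L1_def)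
  obtain c where c: "Lp_le (lebesgue_on {a..b}) 1 (\<lambda>t. nrm X (u t)) c"
    using locally_L1D(2)[OF u ab] by blast
  obtain d where d: "Lp_le (lebesgue_on {a..b}) 1 (\<lambda>t. nrm X (v t)) d"
    using locally_L1D(2)[OF v ab] by blast
  show sd: "strongly_measurable {a..b} X (\<lambda>t. u t - v t)" by (rule strongly_measurable_diff[OF X sm])
  have "Lp_le (lebesgue_on {a..b}) 1 (\<lambda>t. nrm X (u t - v t)) (c + d)"
  proof (rule Lp_le_mono[OF Lp_le_add[OF c d]])
    show "AE t in lebesgue_on {a..b}. \<bar>nrm X (u t - v t)\<bar> \<le> \<bar>\<bar>nrm X (u t)\<bar> + \<bar>nrm X (v t)\<bar>\<bar>"
      using AE_in_lebesgue_on
    proof eventually_elim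
      fix t assume t: "t \<in> {a..b}"
      show "\<bar>nrm X (u t - v t)\<bar> \<le> \<bar>\<bar>nrm X (u t)\<bar> + \<bar>nrm X (v t)\<bar>\<bar>"
        using nrm_triangle_sub[OF X strongly_measurable_car[OF sm(1) t] strongly_measurable_car[OF sm(2) t]]
          nrm_nonneg[OF X strongly_measurable_car[OF sd t]] by linarith
    qed
  qed (use borel_measurable_nrm[OF X _ sd] in auto)
  then show "\<exists>c. Lp_le (lebesgue_on {a..b}) 1 (\<lambda>t. nrm X (u t - v t)) c" by blast
qed

text \<open>Countably many intervals, those with rational end points, cover the interior, and the boundary of an
  interval is a null set.\<close>

lemma AE_from_compact_subintervals:
  fixes I :: "real set"
  assumes I: "connected I"
    and P: "\<And>a b. a < b \<Longrightarrow> {a..b} \<subseteq> interior I \<Longrightarrow> AE t in lebesgue_on {a..b}. P t"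
  shows "AE t in lebesgue_on I. P t"
proof -
  have "AE t in lebesgue. \<forall>y\<in>\<rat> \<times> \<rat>. fst y < snd y \<and> {fst y..snd y} \<subseteq> interior I \<and> t \<in> {fst y..snd y} \<longrightarrow> P t"
  proof (subst AE_ball_countable)
    show "countable ((\<rat>::real set) \<times> (\<rat>::real set))" by (intro countable_SIGMA countable_rat)
    show "\<forall>y\<in>\<rat> \<times> \<rat>. AE t in lebesgue. fst y < snd y \<and> {fst y..snd y} \<subseteq> interior I \<and> t \<in> {fst y..snd y} \<longrightarrow> P t"
    proof
      fix y :: "real \<times> real"
      show "AE t in lebesgue. fst y < snd y \<and> {fst y..snd y} \<subseteq> interior I \<and> t \<in> {fst y..snd y} \<longrightarrow> P t"
      proof (cases "fst y < snd y \<and> {fst y..snd y} \<subseteq> interior I")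
        case True
        then have "AE t in lebesgue. t \<in> {fst y..snd y} \<longrightarrow> P t"
          using P[of "fst y" "snd y"] by (simp add: AE_restrict_space_iff)
        then show ?thesis by (rule eventually_mono) blast
      qed (auto intro: always_eventually)
    qed
  qed
  then have "AE t in lebesgue. t \<in> interior I \<longrightarrow> P t"
  proof (rule eventually_mono, intro impI)
    fix t assume H: "\<forall>y\<in>\<rat> \<times> \<rat>. fst y < snd y \<and> {fst y..snd y} \<subseteq> interior I \<and> t \<in> {fst y..snd y} \<longrightarrow> P t"
      and t: "t \<in> interior I"
    obtain e where e: "e > 0" "cball t e \<subseteq> interior I" using t open_contains_cball[of "interior I"] by auto
    obtain q where q: "q \<in> \<rat>" "t - e < q" "q < t" using Rats_dense_in_real[of "t - e" t] e by auto
    obtain r where r: "r \<in> \<rat>" "t < r" "r < t + e" using Rats_dense_in_real[of t "t + e"] e by auto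
    have "{q..r} \<subseteq> cball t e" using q r by (auto simp: dist_real_def)
    then show "P t" using H[rule_format, of "(q, r)"] q r e by auto
  qed
  moreover have "AE t in lebesgue. t \<in> I \<longrightarrow> t \<in> interior I"
    using AE_interior[OF I] connected_in_lebesgue[OF I] by (simp add: AE_restrict_space_iff)
  ultimately have "AE t in lebesgue. t \<in> I \<longrightarrow> P t" by eventually_elim blast
  then show ?thesis using connected_in_lebesgue[OF I] by (simp add: AE_restrict_space_iff)
qed

lemma compact_interval_enlarge:
  fixes U :: "real set"
  assumes "open U" "{a..b} \<subseteq> U" "a < b"
  obtains d where "d > 0" "{a - d..b + d} \<subseteq> U"
proof -
  have "a \<in> U" "b \<in> U" using assms by auto
  then obtain d1 d2 where d: "d1 > 0" "cball a d1 \<subseteq> U" "d2 > 0" "cball b d2 \<subseteq> U"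
    using assms(1) by (meson open_contains_cball)
  have "{a - min d1 d2..b + min d1 d2} \<subseteq> U"
  proof
    fix t assume t: "t \<in> {a - min d1 d2..b + min d1 d2}"
    then consider "t \<in> {a..b}" | "t \<in> cball a d1" | "t \<in> cball b d2" by (fastforce simp: dist_real_def)
    then show "t \<in> U" using d assms by cases auto
  qed
  then show thesis using that[of "min d1 d2"] d by auto
qed

lemma Lp_le_small_AE_le_0:
  assumes "\<And>e. e > 0 \<Longrightarrow> \<exists>g. Lp_le M p g e \<and> (AE t in M. f t \<le> g t)" and f: "f \<in> borel_measurable M" and p: "p \<ge> 1"
  shows "AE t in M. f t \<le> (0::real)"
proof -
  define f' where "f' t = max 0 (f t)" for t
  have fm: "f' \<in> borel_measurable M" using f unfolding f'_def by measurable
  have le: "Lp_le M p f' e" if e: "e > 0" for e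
  proof -
    obtain g where g: "Lp_le M p g e" "AE t in M. f t \<le> g t" using assms(1)[OF e] by blast
    show ?thesis
      by (rule Lp_le_mono[OF g(1) fm p order_refl])
        (use g(2) in \<open>auto simp: f'_def elim!: eventually_mono\<close>)
  qed
  have "(\<integral>\<^sup>+t. ennreal (\<bar>f' t\<bar> powr p) \<partial>M) \<le> 0"
  proof (rule ennreal_le_epsilon)
    fix e :: real assume e: "e > 0"
    have "Lp_le M p f' (e powr (1/p))" using le e by simp
    then show "(\<integral>\<^sup>+t. ennreal (\<bar>f' t\<bar> powr p) \<partial>M) \<le> 0 + ennreal e"
      using e p by (simp add: Lp_le_def powr_powr)
  qed
  then have "Lp_le M p f' 0" using fm p by (simp add: Lp_le_def)
  from Lp_le_0_AE[OF this p] show ?thesis by (rule eventually_mono) (auto simp: f'_def max_def split: if_splits)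
qed

text \<open>The common core of the uniqueness of weak derivatives and of the Poincare inequality: if all
  averages of \<open>u\<close> at small scale stay within \<open>V\<close> of a vector \<open>x0\<close>, then so do almost all values,
  because the averages converge to the values in \<open>L\<^sup>1\<close>.\<close>

theorem AE_near_if_averages_near:
  fixes u :: "real \<Rightarrow> 'v::real_vector"
  assumes X: "normed_space X" and I: "I \<in> sets lebesgue" and u: "locally_L1 I X u" and x0: "x0 \<in> car X"
    and U: "connected U" "open U" "U \<subseteq> I"
    and avg: "\<And>t \<epsilon>. \<epsilon> > 0 \<Longrightarrow> {t - \<epsilon>..t + \<epsilon>} \<subseteq> U \<Longrightarrow>
      \<exists>x. has_bochner_integral_in I X (\<lambda>s. mollifier \<epsilon> 0 (t - s) *\<^sub>R u s) x \<and> nrm X (x - x0) \<le> V"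
  shows "AE t in lebesgue_on U. nrm X (u t - x0) \<le> V"
proof (rule AE_from_compact_subintervals[OF U(1)])
  fix a b :: real assume ab: "a < b" "{a..b} \<subseteq> interior U"
  then have abU: "{a..b} \<subseteq> U" using interior_subset by blast
  obtain d where d: "d > 0" "{a - d..b + d} \<subseteq> U"
    using compact_interval_enlarge[OF U(2) abU ab(1)] by blast
  let ?K = "{a - d..b + d}" and ?J = "{a..b}"
  have KI: "?K \<subseteq> I" using d U by blast
  have uc: "u t \<in> car X" if "t \<in> I" for t using u that by (auto simp: locally_L1_def)
  have um: "strongly_measurable ?K X u" by (rule locally_L1D(1)[OF u KI])
  obtain c where c: "Lp_le (lebesgue_on ?K) 1 (\<lambda>t. nrm X (u t)) c" using locally_L1D(2)[OF u KI] by blast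
  have umJ: "strongly_measurable ?J X u" by (rule locally_L1D(1)[OF u]) (use abU U in blast)
  define L where "L = \<bar>a - d\<bar> + \<bar>b + d\<bar> + 1"
  have L: "?K \<subseteq> {-L..L}" "L > 0" unfolding L_def by auto
  have "AE t in lebesgue_on ?J. nrm X (u t - x0) - V \<le> 0"
  proof (rule Lp_le_small_AE_le_0[where p=1])
    show "(\<lambda>t. nrm X (u t - x0) - V) \<in> borel_measurable (lebesgue_on ?J)"
      by (intro borel_measurable_diff borel_measurable_const borel_measurable_nrm[OF X]
          strongly_measurable_diff[OF X umJ] strongly_measurable_const[OF X x0]) auto
    fix e :: real assume e: "e > 0"
    show "\<exists>g. Lp_le (lebesgue_on ?J) 1 g e \<and> (AE t in lebesgue_on ?J. nrm X (u t - x0) - V \<le> g t)"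
    proof (rule mollification[OF X I _ L KI _ _ um uc _ c e])
      fix \<eta> assume \<eta>: "\<eta> > 0" and M: "\<And>\<epsilon> a' b'. 0 < \<epsilon> \<Longrightarrow> \<epsilon> \<le> \<eta> \<Longrightarrow> 1/2 \<le> a' \<Longrightarrow> \<forall>t\<in>?J. \<bar>a' * t + b' - t\<bar> \<le> \<eta> \<Longrightarrow>
        \<exists>g. Lp_le (lebesgue_on ?J) 1 g e \<and> (\<forall>t\<in>?J. \<forall>x. {a' * t + b' - \<epsilon>..a' * t + b' + \<epsilon>} \<subseteq> ?K \<longrightarrow>
        has_bochner_integral_in I X (\<lambda>s. mollifier \<epsilon> 0 (a' * t + b' - s) *\<^sub>R u s) x \<longrightarrow> nrm X (x - u t) \<le> g t)"
      define \<epsilon> where "\<epsilon> = min \<eta> d"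
      have ep: "\<epsilon> > 0" "\<epsilon> \<le> \<eta>" "\<epsilon> \<le> d" using \<eta> d by (auto simp: \<epsilon>_def)
      obtain g where g: "Lp_le (lebesgue_on ?J) 1 g e" "\<And>t x. t \<in> ?J \<Longrightarrow> {t - \<epsilon>..t + \<epsilon>} \<subseteq> ?K \<Longrightarrow>
        has_bochner_integral_in I X (\<lambda>s. mollifier \<epsilon> 0 (t - s) *\<^sub>R u s) x \<Longrightarrow> nrm X (x - u t) \<le> g t"
        using M[of \<epsilon> 1 0] ep \<eta> by auto
      have "nrm X (u t - x0) - V \<le> g t" if t: "t \<in> ?J" for t
      proof -
        have sub: "{t - \<epsilon>..t + \<epsilon>} \<subseteq> ?K" using t ep by auto
        obtain x where x: "has_bochner_integral_in I X (\<lambda>s. mollifier \<epsilon> 0 (t - s) *\<^sub>R u s) x" "nrm X (x - x0) \<le> V"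
          using avg[OF ep(1), of t] sub d(2) by blast
        have xc: "x \<in> car X" using x by (simp add: has_bochner_integral_in_def)
        have utc: "u t \<in> car X" using uc t abU U by blast
        show ?thesis
          using g(2)[OF t sub x(1)] x(2) nrm_diff_triangle[OF X utc xc x0] nrm_minus_commute[OF X utc xc] by simp
      qed
      then have "AE t in lebesgue_on ?J. nrm X (u t - x0) - V \<le> g t" by (intro AE_I2) auto
      then show ?thesis using g(1) by blast
    qed (use ab d in auto)
  qed simp
  then show "AE t in lebesgue_on ?J. nrm X (u t - x0) \<le> V" by (rule eventually_mono) simp
qed

lemma mollifier_test_function:
  assumes "\<epsilon> > 0" "{t - \<epsilon>..t + \<epsilon>} \<subseteq> interior I"
  shows "(\<lambda>s. mollifier \<epsilon> 0 (t - s)) \<in> test_functions I"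
proof -
  have z: "supported_in {t - \<epsilon>..t + \<epsilon>} (\<lambda>s. (- 1) ^ 0 * mollifier \<epsilon> 0 (t - s))"
    unfolding supported_in_def using mollifier_zero[OF assms(1)] by force
  show ?thesis using test_functionsI[OF smooth_mollifier_reflected z assms(2)] by simp
qed

text \<open>Mollifiers centred in the interior of \<open>I\<close> are test functions, so all averages of \<open>u - v\<close> vanish there.\<close>

theorem fundamental_lemma:
  fixes u v :: "real \<Rightarrow> 'v::real_vector"
  assumes X: "normed_space X" and I: "connected I" and u: "locally_L1 I X u" and v: "locally_L1 I X v"
    and eq: "\<And>\<phi>. \<phi> \<in> test_functions I \<Longrightarrow> \<exists>x. has_bochner_integral_in I X (\<lambda>t. \<phi> t *\<^sub>R u t) x \<and>
      has_bochner_integral_in I X (\<lambda>t. \<phi> t *\<^sub>R v t) x"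
  shows "AE t in lebesgue_on I. u t = v t"
proof -
  note Im = connected_in_lebesgue[OF I]
  have uc: "u t \<in> car X" "v t \<in> car X" if "t \<in> I" for t using u v that by (auto simp: locally_L1_def)
  have conv: "connected (interior I)"
    using I by (meson convex_connected convex_interior is_interval_connected_1 is_interval_convex)
  have "AE t in lebesgue_on (interior I). nrm X ((u t - v t) - 0) \<le> 0"
  proof (rule AE_near_if_averages_near[OF X Im locally_L1_diff[OF X u v] car_zero[OF X] conv open_interior interior_subset])
    fix t \<epsilon> :: real assume e: "\<epsilon> > 0" "{t - \<epsilon>..t + \<epsilon>} \<subseteq> interior I"
    obtain x where "has_bochner_integral_in I X (\<lambda>s. mollifier \<epsilon> 0 (t - s) *\<^sub>R u s) x"
      "has_bochner_integral_in I X (\<lambda>s. mollifier \<epsilon> 0 (t - s) *\<^sub>R v s) x"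
      using eq[OF mollifier_test_function[OF e]] by blast
    then have "has_bochner_integral_in I X (\<lambda>s. mollifier \<epsilon> 0 (t - s) *\<^sub>R u s - mollifier \<epsilon> 0 (t - s) *\<^sub>R v s) (x - x)"
      by (intro has_bochner_integral_in_diff[OF X _ Im])
    then show "\<exists>x. has_bochner_integral_in I X (\<lambda>s. mollifier \<epsilon> 0 (t - s) *\<^sub>R (u s - v s)) x \<and> nrm X (x - 0) \<le> 0"
      using nrm_zero[OF X] by (intro exI[of _ 0]) (simp add: scaleR_diff_right)
  qed
  then have "AE t in lebesgue. t \<in> interior I \<longrightarrow> nrm X (u t - v t) \<le> 0"
    by (simp add: AE_restrict_space_iff)
  moreover have "AE t in lebesgue. t \<in> I \<longrightarrow> t \<in> interior I"
    using AE_interior[OF I] Im by (simp add: AE_restrict_space_iff)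
  ultimately have "AE t in lebesgue. t \<in> I \<longrightarrow> u t = v t"
  proof eventually_elim
    fix t assume t: "t \<in> interior I \<longrightarrow> nrm X (u t - v t) \<le> 0" "t \<in> I \<longrightarrow> t \<in> interior I"
    show "t \<in> I \<longrightarrow> u t = v t"
    proof
      assume tI: "t \<in> I"
      have c: "u t - v t \<in> car X" using uc[OF tI] car_diff[OF X] by blast
      show "u t = v t" using t tI nrm_nonneg[OF X c] nrm_eq_0[OF X c] by simp
    qed
  qed
  then show ?thesis using Im by (simp add: AE_restrict_space_iff)
qed

text \<open>On an open interval, a function stays within the \<open>L\<^sup>1\<close>-norm of its weak derivative of each of
  its averages: the difference of two averages is \<open>- \<integral> f *\<^sub>R v\<close> with \<open>f\<close> the primitive of the
  difference of the two mollifiers, and \<open>\<bar>f\<bar> \<le> 1\<close>.\<close>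

theorem Poincare_average:
  fixes u v :: "real \<Rightarrow> 'v::real_vector"
  assumes X: "normed_space X" and I: "connected I" and u: "locally_L1 I X u"
    and weak: "\<And>\<phi>. \<phi> \<in> test_functions I \<Longrightarrow> \<exists>x. has_bochner_integral_in I X (\<lambda>t. deriv \<phi> t *\<^sub>R u t) x \<and>
      has_bochner_integral_in I X (\<lambda>t. \<phi> t *\<^sub>R v t) (- x)"
    and v: "\<And>t. t \<in> I \<Longrightarrow> v t \<in> car X"
    and U: "connected U" "open U" "U \<subseteq> interior I" and a0: "\<epsilon>0 > 0" "{a0 - \<epsilon>0..a0 + \<epsilon>0} \<subseteq> U"
    and x0: "has_bochner_integral_in I X (\<lambda>s. mollifier \<epsilon>0 0 (a0 - s) *\<^sub>R u s) x0"
    and V: "(\<integral>\<^sup>+t. ennreal (nrm X (v t)) \<partial>lebesgue_on U) \<le> ennreal V" "V \<ge> 0"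
  shows "AE t in lebesgue_on U. nrm X (u t - x0) \<le> V"
proof (rule AE_near_if_averages_near[OF X connected_in_lebesgue[OF I] u])
  note Im = connected_in_lebesgue[OF I]
  show x0c: "x0 \<in> car X" using x0 by (simp add: has_bochner_integral_in_def)
  show "U \<subseteq> I" using U(3) interior_subset by blast
  fix t \<epsilon> :: real assume e: "\<epsilon> > 0" "{t - \<epsilon>..t + \<epsilon>} \<subseteq> U"
  define l' where "l' = min (t - \<epsilon>) (a0 - \<epsilon>0)"
  define r' where "r' = max (t + \<epsilon>) (a0 + \<epsilon>0)"
  have mem: "t - \<epsilon> \<in> U" "t + \<epsilon> \<in> U" "a0 - \<epsilon>0 \<in> U" "a0 + \<epsilon>0 \<in> U"
    using e a0 by (auto simp: subset_iff)
  have lr': "{l'..r'} \<subseteq> U"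
    by (rule connected_contains_Icc[OF U(1)]) (use mem in \<open>auto simp: l'_def r'_def min_def max_def\<close>)
  obtain f where f: "smooth_chain f" "\<And>s. f (Suc 0) s = mollifier \<epsilon> 0 (t - s) - mollifier \<epsilon>0 0 (a0 - s)"
    "supported_in {l'..r'} (f 0)" "\<And>s. \<bar>f 0 s\<bar> \<le> 1"
    by (rule smooth_mollifier_diff_primitive[OF e(1) a0(1), of l' t r' a0])
      (auto simp: l'_def r'_def)
  have ft: "f 0 \<in> test_functions I"
    by (rule test_functionsI[OF f(1,3)]) (use lr' U(3) in blast)
  have df: "deriv (f 0) = f (Suc 0)" using smooth_chain_iterated_deriv[OF f(1), of "Suc 0"] by simp
  obtain y where y: "has_bochner_integral_in I X (\<lambda>s. f (Suc 0) s *\<^sub>R u s) y"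
    "has_bochner_integral_in I X (\<lambda>s. f 0 s *\<^sub>R v s) (- y)"
    using weak[OF ft] unfolding df by blast
  have yc: "y \<in> car X" using y by (simp add: has_bochner_integral_in_def)
  have "has_bochner_integral_in I X (\<lambda>s. f (Suc 0) s *\<^sub>R u s + mollifier \<epsilon>0 0 (a0 - s) *\<^sub>R u s) (y + x0)"
    by (rule has_bochner_integral_in_add[OF X y(1) Im x0])
  then have 1: "has_bochner_integral_in I X (\<lambda>s. mollifier \<epsilon> 0 (t - s) *\<^sub>R u s) (y + x0)"
    by (simp add: f(2) scaleR_diff_left)
  have "ennreal (nrm X (- y)) \<le> (\<integral>\<^sup>+s. ennreal (nrm X (f 0 s *\<^sub>R v s)) \<partial>lebesgue_on I)"
    by (rule has_bochner_integral_in_norm_bound[OF X Im y(2)])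
  also have "\<dots> = (\<integral>\<^sup>+s. ennreal (nrm X (f 0 s *\<^sub>R v s)) * indicator I s \<partial>lebesgue)"
    using Im by (subst nn_integral_restrict_space) auto
  also have "\<dots> \<le> (\<integral>\<^sup>+s. ennreal (nrm X (v s)) * indicator U s \<partial>lebesgue)"
  proof (intro nn_integral_mono)
    fix s
    consider "s \<notin> I" | "s \<in> I" "s \<notin> {l'..r'}" | "s \<in> I" "s \<in> {l'..r'}" by blast
    then show "ennreal (nrm X (f 0 s *\<^sub>R v s)) * indicator I s \<le> ennreal (nrm X (v s)) * indicator U s"
    proof cases
      case 2 then show ?thesis using supported_inD[OF f(3)] nrm_zero[OF X] by simp
    next
      case 3
      have "nrm X (f 0 s *\<^sub>R v s) = \<bar>f 0 s\<bar> * nrm X (v s)" by (rule nrm_scale[OF X v[OF 3(1)]])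
      also have "\<dots> \<le> 1 * nrm X (v s)" by (intro mult_right_mono f(4) nrm_nonneg[OF X v[OF 3(1)]])
      finally show ?thesis using 3 subsetD[OF lr' 3(2)] by (simp add: ennreal_leI)
    qed simp
  qed
  also have "\<dots> = (\<integral>\<^sup>+t. ennreal (nrm X (v t)) \<partial>lebesgue_on U)"
    using U(2) by (subst nn_integral_restrict_space) auto
  also have "\<dots> \<le> ennreal V" by (rule V)
  finally have "nrm X (- y) \<le> V" using V(2) by simp
  then have "nrm X (y + x0 - x0) \<le> V" using nrm_scale[OF X yc, of "-1"] by simp
  with 1 show "\<exists>x. has_bochner_integral_in I X (\<lambda>s. mollifier \<epsilon> 0 (t - s) *\<^sub>R u s) x \<and> nrm X (x - x0) \<le> V" by blast
qed (use U in auto)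

section \<open>Weighted Bochner spaces\<close>

definition weight :: "(real \<Rightarrow> real) \<Rightarrow> bool" where
  "weight \<omega> \<longleftrightarrow> continuous_on UNIV \<omega> \<and> (\<forall>t. 0 < \<omega> t)"

lemma weight_pos: "weight \<omega> \<Longrightarrow> 0 < \<omega> t"
  by (simp add: weight_def)

lemma weight_measurable:
  assumes "weight \<omega>"
  shows "\<omega> \<in> borel_measurable (lebesgue_on I)"
proof -
  have "\<omega> \<in> borel_measurable borel" using assms by (auto simp: weight_def intro: borel_measurable_continuous_onI)
  then show ?thesis by (intro measurable_restrict_space1 measurable_completion) simp
qed

lemma weight_bounded_below:
  assumes "weight \<omega>"
  obtains w where "w > 0" "\<And>t. t \<in> {a..b} \<Longrightarrow> w \<le> \<omega> t"
proof (cases "a \<le> b")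
  case True
  have "\<exists>x\<in>{a..b}. \<forall>y\<in>{a..b}. \<omega> x \<le> \<omega> y"
    by (rule continuous_attains_inf) (use True assms in \<open>auto simp: weight_def intro: continuous_on_subset\<close>)
  then show thesis using that weight_pos[OF assms] by blast
next
  case False
  then show thesis using that[of 1] by auto
qed

lemma weight_bounded_above:
  assumes "weight \<omega>"
  obtains w where "w > 0" "\<And>t. t \<in> {a..b} \<Longrightarrow> \<omega> t \<le> w"
proof (cases "a \<le> b")
  case True
  have "\<exists>x\<in>{a..b}. \<forall>y\<in>{a..b}. \<omega> y \<le> \<omega> x"
    by (rule continuous_attains_sup) (use True assms in \<open>auto simp: weight_def intro: continuous_on_subset\<close>)
  then show thesis using that weight_pos[OF assms] by blast
next
  case False
  then show thesis using that[of 1] by auto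
qed

text \<open>All estimates are made for functions. For their classes, \<open>lpn\<close> is the norm, and the linear operations
  are computed on representatives by the lemmas on \<^const>\<open>cls\<close>.\<close>

definition Lp_fun :: "real \<Rightarrow> real set \<Rightarrow> (real \<Rightarrow> real) \<Rightarrow> 'v::real_vector nspace \<Rightarrow> (real \<Rightarrow> 'v) \<Rightarrow> bool" where
  "Lp_fun p I \<omega> X u \<longleftrightarrow> strongly_measurable I X u \<and> Lp_nn_integral p I \<omega> X u < \<infinity>"

definition lpn :: "real \<Rightarrow> real set \<Rightarrow> (real \<Rightarrow> real) \<Rightarrow> 'v::real_vector nspace \<Rightarrow> (real \<Rightarrow> 'v) \<Rightarrow> real" where
  "lpn p I \<omega> X u = enn2real (Lp_nn_integral p I \<omega> X u) powr (1 / p)"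

lemma Lp_fun_strongly_measurable: "Lp_fun p I \<omega> X u \<Longrightarrow> strongly_measurable I X u"
  by (simp add: Lp_fun_def)

lemma Lp_fun_car: "Lp_fun p I \<omega> X u \<Longrightarrow> t \<in> I \<Longrightarrow> u t \<in> car X"
  using strongly_measurable_car Lp_fun_strongly_measurable by blast

lemma lpn_nonneg: "0 \<le> lpn p I \<omega> X u"
  by (simp add: lpn_def)

lemma Lp_nn_integral_eq:
  assumes X: "normed_space X" and u: "strongly_measurable I X u" and \<omega>: "weight \<omega>"
  shows "Lp_nn_integral p I \<omega> X u = (\<integral>\<^sup>+t. ennreal (\<bar>nrm X (u t) * \<omega> t\<bar> powr p) \<partial>lebesgue_on I)"
  unfolding Lp_nn_integral_def
  using nrm_nonneg[OF X strongly_measurable_car[OF u]] weight_pos[OF \<omega>]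
  by (intro nn_integral_cong) (simp add: powr_mult abs_mult less_imp_le)

lemma weighted_nrm_measurable:
  assumes "normed_space X" "I \<in> sets lebesgue" "strongly_measurable I X u" "weight \<omega>"
  shows "(\<lambda>t. nrm X (u t) * \<omega> t) \<in> borel_measurable (lebesgue_on I)"
  by (intro borel_measurable_times borel_measurable_nrm weight_measurable assms)

lemma nrm_Lp_space: "I \<in> sets lebesgue \<Longrightarrow> nrm (Lp_space p I \<omega> X) (cls I u) = lpn p I \<omega> X u"
  by (simp add: nrm_Lp_space_cls lpn_def)

lemma car_Lp_space: "car (Lp_space p I \<omega> X) = {cls I u | u. Lp_fun p I \<omega> X u}"
  by (simp add: Lp_space_def Lp_fun_def)

lemma cls_eq_iff:
  assumes "I \<in> sets lebesgue"
  shows "cls I u = cls I v \<longleftrightarrow> (AE t in lebesgue_on I. u t = v t)"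
proof -
  have "cls I u = cls I v \<longleftrightarrow> (AE t in lebesgue. (if t \<in> I then u t else 0) = (if t \<in> I then v t else 0))"
    unfolding cls_def by (rule aefun.abs_eq_iff)
  also have "\<dots> \<longleftrightarrow> (AE t in lebesgue. t \<in> I \<longrightarrow> u t = v t)"
    by (intro arg_cong[where f="\<lambda>P. almost_everywhere lebesgue P"] ext) auto
  finally show ?thesis using assms by (simp add: AE_restrict_space_iff)
qed

lemma cls_add: "cls I u + cls I v = cls I (\<lambda>t. u t + v t)"
  unfolding cls_def plus_aefun.abs_eq by (rule arg_cong[where f=abs_aefun]) auto

lemma cls_diff: "cls I u - cls I v = cls I (\<lambda>t. u t - v t)"
  unfolding cls_def minus_aefun.abs_eq by (rule arg_cong[where f=abs_aefun]) auto

lemma cls_scale: "c *\<^sub>R cls I u = cls I (\<lambda>t. c *\<^sub>R u t)"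
  unfolding cls_def scaleR_aefun.abs_eq by (rule arg_cong[where f=abs_aefun]) auto

lemma cls_zero: "0 = cls I (\<lambda>t. 0)"
  unfolding cls_def zero_aefun_def by (rule arg_cong[where f=abs_aefun]) auto

lemma nrm_summable_converges:
  assumes X: "banach_space X" and s: "\<And>i. s i \<in> car X" and sm: "summable (\<lambda>i. nrm X (s (Suc i) - s i))"
  obtains x where "x \<in> car X" "(\<lambda>i. nrm X (s i - x)) \<longlonglongrightarrow> 0"
proof (rule nrm_Cauchy_converges[OF X s])
  have n: "normed_space X" using X by (simp add: banach_space_def)
  have tel: "nrm X (s (m + k) - s m) \<le> (\<Sum>i=m..<m+k. nrm X (s (Suc i) - s i))" for m k
  proof (induction k)
    case 0 then show ?case using nrm_zero[OF n] by simp
  next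
    case (Suc k)
    have "nrm X (s (m + Suc k) - s m) \<le> nrm X (s (Suc (m + k)) - s (m + k)) + nrm X (s (m + k) - s m)"
      using nrm_diff_triangle[OF n s[of "m + Suc k"] s[of "m + k"] s[of m]] by simp
    then show ?case using Suc by simp
  qed
  fix e :: real assume e: "e > 0"
  then obtain N where N: "\<And>m n. m \<ge> N \<Longrightarrow> norm (\<Sum>i=m..<n. nrm X (s (Suc i) - s i)) < e"
    using sm unfolding summable_Cauchy by blast
  have *: "nrm X (s n - s m) < e" if mn: "N \<le> m" "m \<le> n" for m n
  proof -
    have "nrm X (s n - s m) \<le> (\<Sum>i=m..<n. nrm X (s (Suc i) - s i))"
      using tel[of m "n - m"] mn by simp
    also have "\<dots> < e" using N[OF mn(1), of n] by (simp add: abs_less_iff)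
    finally show ?thesis .
  qed
  have "nrm X (s m - s n) < e" if "m \<ge> N" "n \<ge> N" for m n
    using *[of m n] *[of n m] that nrm_minus_commute[OF n s s, of m n] by (cases "m \<le> n") auto
  then show "\<exists>N. \<forall>m\<ge>N. \<forall>n\<ge>N. nrm X (s m - s n) < e" by blast
qed (use that in blast)

locale Lp_setting =
  fixes I :: "real set" and p :: real
  assumes conn: "connected I" and p1: "1 \<le> p"
begin

lemma I_sets: "I \<in> sets lebesgue"
  by (rule connected_in_lebesgue[OF conn])

abbreviation "M \<equiv> lebesgue_on I"

lemma Lp_fun_iff:
  assumes X: "normed_space X" and \<omega>: "weight \<omega>"
  shows "Lp_fun p I \<omega> X u \<longleftrightarrow> strongly_measurable I X u \<and> (\<exists>c. Lp_le M p (\<lambda>t. nrm X (u t) * \<omega> t) c)"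
proof (cases "strongly_measurable I X u")
  case True
  note m = weighted_nrm_measurable[OF X I_sets True \<omega>]
  have eq: "Lp_nn_integral p I \<omega> X u = (\<integral>\<^sup>+t. ennreal (\<bar>nrm X (u t) * \<omega> t\<bar> powr p) \<partial>M)"
    by (rule Lp_nn_integral_eq[OF X True \<omega>])
  have "(\<integral>\<^sup>+t. ennreal (\<bar>nrm X (u t) * \<omega> t\<bar> powr p) \<partial>M) < \<infinity> \<longleftrightarrow> (\<exists>c. Lp_le M p (\<lambda>t. nrm X (u t) * \<omega> t) c)"
  proof
    assume "\<exists>c. Lp_le M p (\<lambda>t. nrm X (u t) * \<omega> t) c"
    then obtain c where c: "Lp_le M p (\<lambda>t. nrm X (u t) * \<omega> t) c" ..
    show "(\<integral>\<^sup>+t. ennreal (\<bar>nrm X (u t) * \<omega> t\<bar> powr p) \<partial>M) < \<infinity>"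
      by (rule le_less_trans[OF Lp_leD(3)[OF c]]) simp
  qed (use Lp_le_exists[OF m _ p1] in blast)
  then show ?thesis unfolding Lp_fun_def eq using True by simp
qed (simp add: Lp_fun_def)

lemma Lp_fun_Lp_le:
  assumes X: "normed_space X" and \<omega>: "weight \<omega>" and u: "Lp_fun p I \<omega> X u"
  shows "Lp_le M p (\<lambda>t. nrm X (u t) * \<omega> t) (lpn p I \<omega> X u)"
proof -
  have sm: "strongly_measurable I X u" using u by (simp add: Lp_fun_def)
  show ?thesis
    using Lp_le_exists[OF weighted_nrm_measurable[OF X I_sets sm \<omega>] _ p1] u
    unfolding lpn_def Lp_fun_def Lp_nn_integral_eq[OF X sm \<omega>] by blast
qed

lemma Lp_funI:
  assumes X: "normed_space X" and \<omega>: "weight \<omega>" and u: "strongly_measurable I X u"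
    and c: "Lp_le M p (\<lambda>t. nrm X (u t) * \<omega> t) c"
  shows "Lp_fun p I \<omega> X u" "lpn p I \<omega> X u \<le> c"
proof -
  show "Lp_fun p I \<omega> X u" using Lp_fun_iff[OF X \<omega>] u c by blast
  show "lpn p I \<omega> X u \<le> c"
    using Lp_le_least[OF c p1] unfolding lpn_def Lp_nn_integral_eq[OF X u \<omega>] .
qed

text \<open>The majorant is scalar, so it may be built from norms in other spaces and from other weights.\<close>

lemma Lp_fun_dominated:
  assumes X: "normed_space X" and \<omega>: "weight \<omega>" and u: "strongly_measurable I X u"
    and g: "Lp_le M p g c" and le: "\<And>t. t \<in> I \<Longrightarrow> nrm X (u t) * \<omega> t \<le> g t"
  shows "Lp_fun p I \<omega> X u" "lpn p I \<omega> X u \<le> c"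
proof -
  have "Lp_le M p (\<lambda>t. nrm X (u t) * \<omega> t) c"
  proof (rule Lp_le_mono[OF g weighted_nrm_measurable[OF X I_sets u \<omega>] p1 order_refl])
    show "AE t in M. \<bar>nrm X (u t) * \<omega> t\<bar> \<le> \<bar>g t\<bar>"
      using AE_in_lebesgue_on
    proof eventually_elim
      fix t assume t: "t \<in> I"
      have "0 \<le> nrm X (u t) * \<omega> t"
        using nrm_nonneg[OF X strongly_measurable_car[OF u t]] weight_pos[OF \<omega>, of t] by simp
      then show "\<bar>nrm X (u t) * \<omega> t\<bar> \<le> \<bar>g t\<bar>" using le[OF t] by linarith
    qed
  qed
  then show "Lp_fun p I \<omega> X u" "lpn p I \<omega> X u \<le> c" using Lp_funI[OF X \<omega> u] by blast+
qed

lemma Lp_fun_add: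
  assumes X: "normed_space X" and \<omega>: "weight \<omega>" and u: "Lp_fun p I \<omega> X u" and v: "Lp_fun p I \<omega> X v"
  shows "Lp_fun p I \<omega> X (\<lambda>t. u t + v t)"
    and "lpn p I \<omega> X (\<lambda>t. u t + v t) \<le> lpn p I \<omega> X u + lpn p I \<omega> X v"
proof -
  note g = Lp_le_add[OF Lp_fun_Lp_le[OF X \<omega> u] Lp_fun_Lp_le[OF X \<omega> v] p1]
  have sm: "strongly_measurable I X (\<lambda>t. u t + v t)"
    by (intro strongly_measurable_add[OF X] Lp_fun_strongly_measurable[OF u] Lp_fun_strongly_measurable[OF v])
  have le: "nrm X (u t + v t) * \<omega> t \<le> \<bar>nrm X (u t) * \<omega> t\<bar> + \<bar>nrm X (v t) * \<omega> t\<bar>" if t: "t \<in> I" for t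
  proof -
    have "nrm X (u t + v t) * \<omega> t \<le> (nrm X (u t) + nrm X (v t)) * \<omega> t"
      using nrm_triangle[OF X Lp_fun_car[OF u t] Lp_fun_car[OF v t]] weight_pos[OF \<omega>, of t]
      by (intro mult_right_mono) auto
    then show ?thesis by (simp add: distrib_right)
  qed
  show "Lp_fun p I \<omega> X (\<lambda>t. u t + v t)" "lpn p I \<omega> X (\<lambda>t. u t + v t) \<le> lpn p I \<omega> X u + lpn p I \<omega> X v"
    using Lp_fun_dominated[OF X \<omega> sm g le] by blast+
qed

lemma Lp_fun_scale_le:
  assumes X: "normed_space X" and \<omega>: "weight \<omega>" and u: "Lp_fun p I \<omega> X u"
  shows "Lp_fun p I \<omega> X (\<lambda>t. c *\<^sub>R u t)" and "lpn p I \<omega> X (\<lambda>t. c *\<^sub>R u t) \<le> \<bar>c\<bar> * lpn p I \<omega> X u"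
proof -
  note g = Lp_le_scale[OF Lp_fun_Lp_le[OF X \<omega> u], of "\<bar>c\<bar>"]
  have sm: "strongly_measurable I X (\<lambda>t. c *\<^sub>R u t)"
    by (intro strongly_measurable_scale[OF X] Lp_fun_strongly_measurable[OF u]) simp
  have le: "nrm X (c *\<^sub>R u t) * \<omega> t \<le> \<bar>c\<bar> * (nrm X (u t) * \<omega> t)" if t: "t \<in> I" for t
    using nrm_scale[OF X Lp_fun_car[OF u t]] by simp
  show "Lp_fun p I \<omega> X (\<lambda>t. c *\<^sub>R u t)" "lpn p I \<omega> X (\<lambda>t. c *\<^sub>R u t) \<le> \<bar>c\<bar> * lpn p I \<omega> X u"
    using Lp_fun_dominated[OF X \<omega> sm g le] by auto
qed

lemma lpn_scale:
  assumes X: "normed_space X" and \<omega>: "weight \<omega>" and u: "Lp_fun p I \<omega> X u"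
  shows "lpn p I \<omega> X (\<lambda>t. c *\<^sub>R u t) = \<bar>c\<bar> * lpn p I \<omega> X u"
proof (cases "c = 0")
  case True
  then show ?thesis using Lp_fun_scale_le(2)[OF X \<omega> u, of c] lpn_nonneg[of p I \<omega> X "\<lambda>t. c *\<^sub>R u t"] by simp
next
  case False
  have "lpn p I \<omega> X (\<lambda>t. (1/c) *\<^sub>R (c *\<^sub>R u t)) \<le> \<bar>1/c\<bar> * lpn p I \<omega> X (\<lambda>t. c *\<^sub>R u t)"
    by (rule Lp_fun_scale_le(2)[OF X \<omega> Lp_fun_scale_le(1)[OF X \<omega> u]])
  then have "\<bar>c\<bar> * lpn p I \<omega> X u \<le> lpn p I \<omega> X (\<lambda>t. c *\<^sub>R u t)"
    using False by (simp add: field_simps)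
  then show ?thesis using Lp_fun_scale_le(2)[OF X \<omega> u, of c] by linarith
qed

lemma Lp_fun_diff:
  assumes X: "normed_space X" and \<omega>: "weight \<omega>" and u: "Lp_fun p I \<omega> X u" and v: "Lp_fun p I \<omega> X v"
  shows "Lp_fun p I \<omega> X (\<lambda>t. u t - v t)"
    and "lpn p I \<omega> X (\<lambda>t. u t - v t) \<le> lpn p I \<omega> X u + lpn p I \<omega> X v"
  using Lp_fun_add[OF X \<omega> u Lp_fun_scale_le(1)[OF X \<omega> v, of "-1"]] lpn_scale[OF X \<omega> v, of "-1"] by simp_all

lemma lpn_cong_AE:
  assumes "AE t in M. u t = v t"
  shows "lpn p I \<omega> X u = lpn p I \<omega> X v"
proof -
  have "Lp_nn_integral p I \<omega> X u = Lp_nn_integral p I \<omega> X v"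
    unfolding Lp_nn_integral_def by (intro nn_integral_cong_AE) (use assms in \<open>auto elim: eventually_mono\<close>)
  then show ?thesis by (simp add: lpn_def)
qed

lemma lpn_zero: "normed_space X \<Longrightarrow> lpn p I \<omega> X (\<lambda>t. 0) = 0"
  using p1 nrm_zero[of X] by (simp add: lpn_def Lp_nn_integral_def)

lemma lpn_eq_0_iff:
  assumes X: "normed_space X" and \<omega>: "weight \<omega>" and u: "Lp_fun p I \<omega> X u"
  shows "lpn p I \<omega> X u = 0 \<longleftrightarrow> (AE t in M. u t = 0)"
proof
  assume "lpn p I \<omega> X u = 0"
  then have "Lp_le M p (\<lambda>t. nrm X (u t) * \<omega> t) 0"
    using Lp_fun_Lp_le[OF X \<omega> u] by simp
  from Lp_le_0_AE[OF this p1] show "AE t in M. u t = 0"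
    using AE_in_lebesgue_on
  proof eventually_elim
    fix t assume t: "nrm X (u t) * \<omega> t = 0" "t \<in> I"
    then show "u t = 0" using weight_pos[OF \<omega>, of t] nrm_eq_0[OF X Lp_fun_car[OF u t(2)]] by simp
  qed
next
  assume "AE t in M. u t = 0"
  then have "lpn p I \<omega> X u = lpn p I \<omega> X (\<lambda>t. 0)" by (rule lpn_cong_AE)
  also have "\<dots> = 0" by (rule lpn_zero[OF X])
  finally show "lpn p I \<omega> X u = 0" .
qed

lemma Lp_fun_embed:
  assumes X: "normed_space X" and Y: "normed_space Y" and \<omega>: "weight \<omega>" and \<omega>': "weight \<omega>'"
    and e: "embeds X Y K" and C: "C \<ge> 0" "\<And>t. \<omega>' t \<le> C * \<omega> t" and u: "Lp_fun p I \<omega> X u"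
  shows "Lp_fun p I \<omega>' Y u" "lpn p I \<omega>' Y u \<le> K * C * lpn p I \<omega> X u"
proof -
  have K: "K \<ge> 0" using e by (simp add: embeds_def)
  note g = Lp_le_scale[OF Lp_fun_Lp_le[OF X \<omega> u], of "K * C"]
  have sm: "strongly_measurable I Y u" by (rule strongly_measurable_embed[OF X Y e Lp_fun_strongly_measurable[OF u]])
  have le: "nrm Y (u t) * \<omega>' t \<le> K * C * (nrm X (u t) * \<omega> t)" if t: "t \<in> I" for t
  proof -
    have "nrm Y (u t) * \<omega>' t \<le> (K * nrm X (u t)) * (C * \<omega> t)"
      using e Lp_fun_car[OF u t] C(2)[of t] weight_pos[OF \<omega>', of t] K nrm_nonneg[OF X Lp_fun_car[OF u t]]
      by (intro mult_mono) (auto simp: embeds_def)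
    then show ?thesis by (simp add: mult_ac)
  qed
  show "Lp_fun p I \<omega>' Y u" "lpn p I \<omega>' Y u \<le> K * C * lpn p I \<omega> X u"
    using Lp_fun_dominated[OF Y \<omega>' sm g le] K C(1) by auto
qed

text \<open>Completeness. Replacing each function by a nearby simple one, the almost everywhere limit of a
  rapidly convergent sequence is strongly measurable by definition.\<close>

theorem Lp_fun_complete:
  assumes X: "banach_space X" and \<omega>: "weight \<omega>" and u: "\<And>j. Lp_fun p I \<omega> X (u j)"
    and fast: "\<And>j. lpn p I \<omega> X (\<lambda>t. u (Suc j) t - u j t) \<le> (1/2)^j"
  obtains v where "Lp_fun p I \<omega> X v" "(\<lambda>j. lpn p I \<omega> X (\<lambda>t. u j t - v t)) \<longlonglongrightarrow> 0"
proof -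
  have n: "normed_space X" using X by (simp add: banach_space_def)
  have "\<exists>s. simple_function M s \<and> (\<forall>t\<in>I. s t \<in> car X) \<and> Lp_le M p (\<lambda>t. nrm X (u j t - s t) * \<omega> t) ((1/2)^j)" for j
  proof (rule Lp_simple_dense[OF n I_sets Lp_fun_strongly_measurable[OF u] weight_measurable[OF \<omega>] p1 Lp_fun_Lp_le[OF n \<omega> u]])
    show "(0::real) < (1/2)^j" by simp
  qed blast
  then obtain s where s: "\<And>j. simple_function M (s j)" "\<And>j t. t \<in> I \<Longrightarrow> s j t \<in> car X"
    "\<And>j. Lp_le M p (\<lambda>t. nrm X (u j t - s j t) * \<omega> t) ((1/2)^j)" by metis
  have sm: "strongly_measurable I X (s j)" for j by (rule strongly_measurable_simple[OF n s(1,2)])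
  have us: "Lp_fun p I \<omega> X (\<lambda>t. u j t - s j t)" "lpn p I \<omega> X (\<lambda>t. u j t - s j t) \<le> (1/2)^j" for j
    using Lp_funI[OF n \<omega> strongly_measurable_diff[OF n Lp_fun_strongly_measurable[OF u] sm] s(3)] by blast+
  have sL: "Lp_fun p I \<omega> X (s j)" for j
    using Lp_fun_diff(1)[OF n \<omega> u[of j] us(1)[of j]] by simp
  have step: "Lp_fun p I \<omega> X (\<lambda>t. s (Suc j) t - s j t)" "lpn p I \<omega> X (\<lambda>t. s (Suc j) t - s j t) \<le> 3 * (1/2)^j" for j
  proof -
    show "Lp_fun p I \<omega> X (\<lambda>t. s (Suc j) t - s j t)" by (rule Lp_fun_diff(1)[OF n \<omega> sL sL])
    have eq: "s (Suc j) t - s j t = (u j t - s j t) - ((u (Suc j) t - s (Suc j) t) - (u (Suc j) t - u j t))" for t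
      by simp
    have "lpn p I \<omega> X (\<lambda>t. s (Suc j) t - s j t)
        \<le> lpn p I \<omega> X (\<lambda>t. u j t - s j t) + (lpn p I \<omega> X (\<lambda>t. u (Suc j) t - s (Suc j) t) + lpn p I \<omega> X (\<lambda>t. u (Suc j) t - u j t))"
      unfolding eq
      by (intro order_trans[OF Lp_fun_diff(2)[OF n \<omega>]] add_left_mono Lp_fun_diff[OF n \<omega>] us u)
    also have "\<dots> \<le> (1/2)^j + ((1/2)^Suc j + (1/2)^j)" by (intro add_mono us fast)
    also have "\<dots> \<le> 3 * (1/2)^j" by simp
    finally show "lpn p I \<omega> X (\<lambda>t. s (Suc j) t - s j t) \<le> 3 * (1/2)^j" .
  qed
  have "AE t in M. summable (\<lambda>j. \<bar>(1/3) * (nrm X (s (Suc j) t - s j t) * \<omega> t)\<bar>)"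
  proof (rule Lp_le_geometric_sum[OF _ p1])
    fix j
    have L: "Lp_le M p (\<lambda>t. (1/3) * (nrm X (s (Suc j) t - s j t) * \<omega> t)) (\<bar>1/3\<bar> * lpn p I \<omega> X (\<lambda>t. s (Suc j) t - s j t))"
      by (rule Lp_le_scale[OF Lp_fun_Lp_le[OF n \<omega> step(1)]])
    show "Lp_le M p (\<lambda>t. (1/3) * (nrm X (s (Suc j) t - s j t) * \<omega> t)) ((1/2)^j)"
      by (rule Lp_le_mono[OF L Lp_leD(1)[OF L] p1]) (use step(2)[of j] in auto)
  qed
  then have conv: "AE t in M. \<exists>x\<in>car X. (\<lambda>j. nrm X (s j t - x)) \<longlonglongrightarrow> 0"
    using AE_in_lebesgue_on
  proof eventually_elim
    fix t assume t: "summable (\<lambda>j. \<bar>(1/3) * (nrm X (s (Suc j) t - s j t) * \<omega> t)\<bar>)" "t \<in> I"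
    have nn: "nrm X (s (Suc j) t - s j t) \<ge> 0" for j by (rule nrm_nonneg[OF n car_diff[OF n s(2)[OF t(2)] s(2)[OF t(2)]]])
    have "summable (\<lambda>j. (3 / \<omega> t) * \<bar>(1/3) * (nrm X (s (Suc j) t - s j t) * \<omega> t)\<bar>)"
      by (rule summable_mult[OF t(1)])
    then have "summable (\<lambda>j. nrm X (s (Suc j) t - s j t))"
      using nn weight_pos[OF \<omega>, of t] by (simp add: abs_mult)
    from nrm_summable_converges[OF X s(2)[OF t(2)] this] show "\<exists>x\<in>car X. (\<lambda>j. nrm X (s j t - x)) \<longlonglongrightarrow> 0" by blast
  qed
  define v where "v t = (if \<exists>x\<in>car X. (\<lambda>j. nrm X (s j t - x)) \<longlonglongrightarrow> 0
    then SOME x. x \<in> car X \<and> (\<lambda>j. nrm X (s j t - x)) \<longlonglongrightarrow> 0 else 0)" for t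
  have v: "v t \<in> car X \<and> (\<lambda>j. nrm X (s j t - v t)) \<longlonglongrightarrow> 0" if "\<exists>x\<in>car X. (\<lambda>j. nrm X (s j t - x)) \<longlonglongrightarrow> 0" for t
    using someI_ex[of "\<lambda>x. x \<in> car X \<and> (\<lambda>j. nrm X (s j t - x)) \<longlonglongrightarrow> 0"] that by (auto simp: v_def)
  have vc: "v t \<in> car X" for t
    using v[of t] car_zero[OF n] by (cases "\<exists>x\<in>car X. (\<lambda>j. nrm X (s j t - x)) \<longlonglongrightarrow> 0") (auto simp: v_def)
  have vlim: "AE t in M. (\<lambda>j. nrm X (s j t - v t)) \<longlonglongrightarrow> 0"
    using conv by (rule eventually_mono) (use v in blast)
  have vm: "strongly_measurable I X v" by (rule strongly_measurableI[OF vc s(1,2) vlim])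
  have tail: "lpn p I \<omega> X (\<lambda>t. s (j + k) t - s j t) \<le> 6 * ((1/2)^j - (1/2)^(j + k))" for j k
  proof (induction k)
    case 0
    show ?case using lpn_zero[OF n] by simp
  next
    case (Suc k)
    have eq: "s (j + Suc k) t - s j t = (s (Suc (j + k)) t - s (j + k) t) + (s (j + k) t - s j t)" for t by simp
    have "lpn p I \<omega> X (\<lambda>t. s (j + Suc k) t - s j t) \<le> lpn p I \<omega> X (\<lambda>t. s (Suc (j + k)) t - s (j + k) t) + lpn p I \<omega> X (\<lambda>t. s (j + k) t - s j t)"
      unfolding eq by (intro Lp_fun_add(2)[OF n \<omega>] step Lp_fun_diff[OF n \<omega>] sL)
    also have "\<dots> \<le> 3 * (1/2)^(j + k) + 6 * ((1/2)^j - (1/2)^(j + k))" by (intro add_mono step Suc)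
    finally show ?case by simp
  qed
  have vs: "Lp_fun p I \<omega> X (\<lambda>t. v t - s j t)" "lpn p I \<omega> X (\<lambda>t. v t - s j t) \<le> 6 * (1/2)^j" for j
  proof -
    have d: "strongly_measurable I X (\<lambda>t. v t - s j t)" by (rule strongly_measurable_diff[OF n vm sm])
    have "Lp_le M p (\<lambda>t. nrm X (v t - s j t) * \<omega> t) (6 * (1/2)^j)"
    proof (rule Lp_le_Fatou[OF _ weighted_nrm_measurable[OF n I_sets d \<omega>] p1])
      show "Lp_le M p (\<lambda>t. nrm X (s (j + k) t - s j t) * \<omega> t) (6 * (1/2)^j)" for k
      proof (rule Lp_le_mono[OF Lp_fun_Lp_le[OF n \<omega> Lp_fun_diff(1)[OF n \<omega> sL sL]] _ p1])
        have "6 * ((1/2)^j - (1/2)^(j + k)) \<le> (6 * (1/2)^j :: real)" by simp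
        then show "lpn p I \<omega> X (\<lambda>t. s (j + k) t - s j t) \<le> 6 * (1/2)^j" by (rule order_trans[OF tail])
      qed (auto intro!: weighted_nrm_measurable[OF n I_sets] strongly_measurable_diff[OF n] sm \<omega>)
      show "AE t in M. (\<lambda>k. nrm X (s (j + k) t - s j t) * \<omega> t) \<longlonglongrightarrow> nrm X (v t - s j t) * \<omega> t"
        using vlim AE_in_lebesgue_on
      proof eventually_elim
        fix t assume t: "(\<lambda>k. nrm X (s k t - v t)) \<longlonglongrightarrow> 0" "t \<in> I"
        have "(\<lambda>k. nrm X (s (k + j) t - v t)) \<longlonglongrightarrow> 0" using LIMSEQ_ignore_initial_segment[OF t(1), of j] .
        then have "(\<lambda>k. nrm X ((s (j + k) t - s j t) - (v t - s j t))) \<longlonglongrightarrow> 0" by (simp add: add.commute)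
        then have "(\<lambda>k. nrm X (s (j + k) t - s j t)) \<longlonglongrightarrow> nrm X (v t - s j t)"
          by (rule nrm_tendsto[OF n, rotated 2]) (use s(2)[OF t(2)] vc car_diff[OF n] in auto)
        then show "(\<lambda>k. nrm X (s (j + k) t - s j t) * \<omega> t) \<longlonglongrightarrow> nrm X (v t - s j t) * \<omega> t"
          by (intro tendsto_mult tendsto_const)
      qed
    qed
    then show "Lp_fun p I \<omega> X (\<lambda>t. v t - s j t)" "lpn p I \<omega> X (\<lambda>t. v t - s j t) \<le> 6 * (1/2)^j"
      using Lp_funI[OF n \<omega> d] by blast+
  qed
  have vL: "Lp_fun p I \<omega> X v" using Lp_fun_add(1)[OF n \<omega> vs(1)[of 0] sL[of 0]] by simp
  have bound: "lpn p I \<omega> X (\<lambda>t. u j t - v t) \<le> 7 * (1/2)^j" for j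
  proof -
    have eq: "u j t - v t = (u j t - s j t) - (v t - s j t)" for t by simp
    have "lpn p I \<omega> X (\<lambda>t. u j t - v t) \<le> lpn p I \<omega> X (\<lambda>t. u j t - s j t) + lpn p I \<omega> X (\<lambda>t. v t - s j t)"
      unfolding eq by (intro Lp_fun_diff(2)[OF n \<omega>] us vs)
    then show ?thesis using us(2)[of j] vs(2)[of j] by simp
  qed
  have "(\<lambda>j. lpn p I \<omega> X (\<lambda>t. u j t - v t)) \<longlonglongrightarrow> 0"
  proof (rule Lim_null_comparison)
    show "\<forall>\<^sub>F j in sequentially. norm (lpn p I \<omega> X (\<lambda>t. u j t - v t)) \<le> 7 * (1/2)^j"
      using bound by (simp add: lpn_nonneg)
    show "(\<lambda>j. 7 * (1/2)^j :: real) \<longlonglongrightarrow> 0"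
      by (intro tendsto_mult_right_zero LIMSEQ_power_zero) simp
  qed
  then show thesis using that vL by blast
qed

text \<open>Pairing with a bounded function of bounded support is continuous on \<open>L\<^sup>p\<close>: there the weight
  is bounded below and Hoelder's inequality applies. The constant does not depend on the space.\<close>

lemma Lp_pairing_bound:
  fixes g :: "real \<Rightarrow> real"
  assumes \<omega>: "weight \<omega>" and g: "\<And>t. \<bar>g t\<bar> \<le> B" "supported_in {a..b} g"
  obtains C where "C \<ge> 0" "\<forall>(X :: 'v::real_vector nspace) u. normed_space X \<and> Lp_fun p I \<omega> X u \<longrightarrow>
    (\<integral>\<^sup>+t. ennreal (nrm X (g t *\<^sub>R u t)) \<partial>M) \<le> ennreal (C * lpn p I \<omega> X u)"
proof -
  have B: "B \<ge> 0" using g(1)[of 0] by linarith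
  obtain w where w: "w > 0" "\<And>t. t \<in> {a..b} \<Longrightarrow> w \<le> \<omega> t" using weight_bounded_below[OF \<omega>] by blast
  define L where "L = \<bar>a\<bar> + \<bar>b\<bar> + 1"
  have L: "L > 0" "{a..b} \<subseteq> {-L..L}" unfolding L_def by auto
  define C where "C = B / w * (2 * (2 * L) powr (1 - 1/p))"
  show thesis
  proof (rule that[of C])
    show "C \<ge> 0" using B w by (simp add: C_def)
    show "\<forall>(X :: 'v::real_vector nspace) u. normed_space X \<and> Lp_fun p I \<omega> X u \<longrightarrow>
      (\<integral>\<^sup>+t. ennreal (nrm X (g t *\<^sub>R u t)) \<partial>M) \<le> ennreal (C * lpn p I \<omega> X u)"
    proof (intro allI impI, elim conjE)
    fix X :: "'v nspace" and u assume X: "normed_space X" and u: "Lp_fun p I \<omega> X u"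
    let ?S = "I \<inter> {a..b}"
    have S: "?S \<in> sets lebesgue" using I_sets by auto
    have LS: "Lp_le (lebesgue_on ?S) p (\<lambda>t. nrm X (u t) * \<omega> t) (lpn p I \<omega> X u)"
      by (rule Lp_le_restrict[OF Lp_fun_Lp_le[OF X \<omega> u] _ I_sets S]) auto
    have "(\<integral>\<^sup>+t. ennreal (nrm X (g t *\<^sub>R u t)) \<partial>M) = (\<integral>\<^sup>+t. ennreal (nrm X (g t *\<^sub>R u t)) * indicator I t \<partial>lebesgue)"
      using I_sets by (subst nn_integral_restrict_space) auto
    also have "\<dots> \<le> (\<integral>\<^sup>+t. (ennreal (B / w) * ennreal \<bar>nrm X (u t) * \<omega> t\<bar>) * indicator ?S t \<partial>lebesgue)"
    proof (intro nn_integral_mono)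
      fix t
      consider "t \<notin> I" | "t \<in> I" "t \<notin> {a..b}" | "t \<in> I" "t \<in> {a..b}" by blast
      then show "ennreal (nrm X (g t *\<^sub>R u t)) * indicator I t \<le> (ennreal (B / w) * ennreal \<bar>nrm X (u t) * \<omega> t\<bar>) * indicator ?S t"
      proof cases
        case 2 then show ?thesis using supported_inD[OF g(2)] nrm_zero[OF X] by simp
      next
        case 3
        have nn: "0 \<le> nrm X (u t)" by (rule nrm_nonneg[OF X Lp_fun_car[OF u 3(1)]])
        have "nrm X (g t *\<^sub>R u t) = \<bar>g t\<bar> * nrm X (u t)" by (rule nrm_scale[OF X Lp_fun_car[OF u 3(1)]])
        also have "\<dots> \<le> B * nrm X (u t)" by (intro mult_right_mono g nn)
        also have "\<dots> = (B / w) * (nrm X (u t) * w)" using w by simp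
        also have "\<dots> \<le> (B / w) * (nrm X (u t) * \<omega> t)" using w 3 B nn by (intro mult_left_mono) auto
        finally have "ennreal (nrm X (g t *\<^sub>R u t)) \<le> ennreal ((B / w) * \<bar>nrm X (u t) * \<omega> t\<bar>)"
          using nn weight_pos[OF \<omega>, of t] by (intro ennreal_leI) simp
        also have "\<dots> = ennreal (B / w) * ennreal \<bar>nrm X (u t) * \<omega> t\<bar>"
          by (rule ennreal_mult) (use B w in auto)
        finally show ?thesis using 3 by simp
      qed simp
    qed
    also have "\<dots> = (\<integral>\<^sup>+t. ennreal (B / w) * ennreal \<bar>nrm X (u t) * \<omega> t\<bar> \<partial>lebesgue_on ?S)"
      using S by (subst nn_integral_restrict_space) auto
    also have "\<dots> = ennreal (B / w) * (\<integral>\<^sup>+t. ennreal \<bar>nrm X (u t) * \<omega> t\<bar> \<partial>lebesgue_on ?S)"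
      using Lp_leD(1)[OF LS] by (intro nn_integral_cmult) simp
    also have "\<dots> \<le> ennreal (B / w) * ennreal (2 * (2 * L) powr (1 - 1/p) * lpn p I \<omega> X u)"
      by (intro mult_left_mono Lp_le_imp_L1[OF LS p1 emeasure_bounded_set[OF S]]) (use L in auto)
    also have "\<dots> = ennreal (C * lpn p I \<omega> X u)"
      using B w by (simp add: C_def mult_ac flip: ennreal_mult')
    finally show "(\<integral>\<^sup>+t. ennreal (nrm X (g t *\<^sub>R u t)) \<partial>M) \<le> ennreal (C * lpn p I \<omega> X u)" .
    qed
  qed
qed

lemma Lp_pairing_exists:
  assumes X: "banach_space X" and \<omega>: "weight \<omega>" and g: "\<And>t. \<bar>g t\<bar> \<le> B" "supported_in {a..b} g" "g \<in> borel_measurable M"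
    and u: "Lp_fun p I \<omega> X u"
  shows "\<exists>x. has_bochner_integral_in I X (\<lambda>t. g t *\<^sub>R u t) x"
proof -
  have n: "normed_space X" using X by (simp add: banach_space_def)
  obtain C where C: "(\<integral>\<^sup>+t. ennreal (nrm X (g t *\<^sub>R u t)) \<partial>M) \<le> ennreal (C * lpn p I \<omega> X u)"
    by (rule Lp_pairing_bound[OF \<omega> g(1,2)]) (use n u in blast)
  show ?thesis
    by (rule has_bochner_integral_in_exists[OF X I_sets strongly_measurable_scale[OF n Lp_fun_strongly_measurable[OF u] g(3)]])
      (use C in \<open>auto intro: le_less_trans\<close>)
qed

lemma Lp_fun_locally_bochner_integrable:
  assumes X: "banach_space X" and \<omega>: "weight \<omega>" and u: "Lp_fun p I \<omega> X u"
  shows "locally_bochner_integrable I X u"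
  unfolding locally_bochner_integrable_def
proof (intro conjI allI impI)
  show "u \<in> I \<rightarrow> car X" using Lp_fun_car[OF u] by blast
  fix K assume K: "compact K \<and> K \<subseteq> I"
  have n: "normed_space X" using X by (simp add: banach_space_def)
  have Ks: "K \<in> sets lebesgue" using K by (simp add: compact_imp_closed borel_closed)
  obtain L where L: "\<And>t. t \<in> K \<Longrightarrow> \<bar>t\<bar> \<le> L" using K compact_imp_bounded[of K] by (auto simp: bounded_iff)
  have sm: "strongly_measurable K X u" by (rule strongly_measurable_mono[OF Lp_fun_strongly_measurable[OF u] _ I_sets Ks]) (use K in blast)
  have ks: "supported_in {-L..L} (indicator K)" unfolding supported_in_def using L by (force split: split_indicator)
  have k1: "\<bar>indicator K t\<bar> \<le> (1::real)" for t by (simp split: split_indicator)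
  obtain C where C: "(\<integral>\<^sup>+t. ennreal (nrm X (indicator K t *\<^sub>R u t)) \<partial>M) \<le> ennreal (C * lpn p I \<omega> X u)"
    by (rule Lp_pairing_bound[OF \<omega> k1 ks]) (use n u in blast)
  have "(\<integral>\<^sup>+t. ennreal (nrm X (u t)) \<partial>lebesgue_on K) = (\<integral>\<^sup>+t. ennreal (nrm X (indicator K t *\<^sub>R u t)) \<partial>M)"
    using K Ks I_sets nrm_zero[OF n]
    by (subst (1 2) nn_integral_restrict_space) (auto intro!: nn_integral_cong split: split_indicator)
  also have "\<dots> < \<infinity>" using C by (auto intro: le_less_trans)
  finally show "\<exists>x. has_bochner_integral_in K X u x"
    using has_bochner_integral_in_exists[OF X Ks sm] by blast
qed

lemma Lp_fun_locally_L1: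
  assumes "banach_space X" "weight \<omega>" "Lp_fun p I \<omega> X u"
  shows "locally_L1 I X u"
  using locally_bochner_integrable_imp_locally_L1 Lp_fun_locally_bochner_integrable[OF assms] assms(1)
  by (auto simp: banach_space_def)

end

section \<open>Weak derivatives\<close>

text \<open>The identity in \<^const>\<open>weak_derivative\<close>, separated from local integrability, which holds for all
  functions in the spaces considered.\<close>

definition wder :: "real set \<Rightarrow> nat \<Rightarrow> 'v::real_vector nspace \<Rightarrow> (real \<Rightarrow> 'v) \<Rightarrow> (real \<Rightarrow> 'v) \<Rightarrow> bool" where
  "wder I k Y u v \<longleftrightarrow> (\<forall>\<phi>\<in>test_functions I. \<exists>x.
     has_bochner_integral_in I Y (\<lambda>t. (deriv ^^ k) \<phi> t *\<^sub>R u t) x \<and>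
     has_bochner_integral_in I Y (\<lambda>t. \<phi> t *\<^sub>R v t) ((-1) ^ k *\<^sub>R x))"

lemma wderE:
  assumes "wder I k Y u v" "\<phi> \<in> test_functions I"
  obtains x where "has_bochner_integral_in I Y (\<lambda>t. (deriv ^^ k) \<phi> t *\<^sub>R u t) x"
    "has_bochner_integral_in I Y (\<lambda>t. \<phi> t *\<^sub>R v t) ((-1) ^ k *\<^sub>R x)"
  using assms unfolding wder_def by blast

lemma weak_derivative_iff_wder:
  "weak_derivative I k X Y u v \<longleftrightarrow> locally_bochner_integrable I X u \<and> locally_bochner_integrable I Y v \<and> wder I k Y u v"
  by (simp add: weak_derivative_def wder_def)

lemma wder_unique:
  assumes Y: "normed_space Y" and I: "connected I" and v: "wder I k Y u v" "wder I k Y u' v'"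
    and u: "AE t in lebesgue_on I. u t = u' t" "\<And>t. t \<in> I \<Longrightarrow> u' t \<in> car Y"
    and l: "locally_L1 I Y v" "locally_L1 I Y v'"
  shows "AE t in lebesgue_on I. v t = v' t"
proof (rule fundamental_lemma[OF Y I l])
  note Im = connected_in_lebesgue[OF I]
  fix \<phi> assume \<phi>: "\<phi> \<in> test_functions I"
  obtain x where x: "has_bochner_integral_in I Y (\<lambda>t. (deriv ^^ k) \<phi> t *\<^sub>R u t) x"
    "has_bochner_integral_in I Y (\<lambda>t. \<phi> t *\<^sub>R v t) ((-1) ^ k *\<^sub>R x)" using wderE[OF v(1) \<phi>] by blast
  obtain y where y: "has_bochner_integral_in I Y (\<lambda>t. (deriv ^^ k) \<phi> t *\<^sub>R u' t) y"
    "has_bochner_integral_in I Y (\<lambda>t. \<phi> t *\<^sub>R v' t) ((-1) ^ k *\<^sub>R y)" using wderE[OF v(2) \<phi>] by blast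
  have "has_bochner_integral_in I Y (\<lambda>t. (deriv ^^ k) \<phi> t *\<^sub>R u' t) x"
    by (rule has_bochner_integral_in_cong_AE[OF Y x(1)]) (use u car_scale[OF Y] in \<open>auto elim: eventually_mono\<close>)
  then have "x = y" using has_bochner_integral_in_unique[OF Y Im _ y(1)] by blast
  then show "\<exists>x. has_bochner_integral_in I Y (\<lambda>t. \<phi> t *\<^sub>R v t) x \<and> has_bochner_integral_in I Y (\<lambda>t. \<phi> t *\<^sub>R v' t) x"
    using x y by blast
qed

lemma wder_cong_AE:
  assumes Y: "normed_space Y" and w: "wder I k Y u v"
    and u: "AE t in lebesgue_on I. u t = u' t" "\<And>t. t \<in> I \<Longrightarrow> u' t \<in> car Y"
    and v: "AE t in lebesgue_on I. v t = v' t" "\<And>t. t \<in> I \<Longrightarrow> v' t \<in> car Y"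
  shows "wder I k Y u' v'"
  unfolding wder_def
proof
  fix \<phi> assume \<phi>: "\<phi> \<in> test_functions I"
  obtain x where x: "has_bochner_integral_in I Y (\<lambda>t. (deriv ^^ k) \<phi> t *\<^sub>R u t) x"
    "has_bochner_integral_in I Y (\<lambda>t. \<phi> t *\<^sub>R v t) ((-1) ^ k *\<^sub>R x)" using wderE[OF w \<phi>] by blast
  have "has_bochner_integral_in I Y (\<lambda>t. (deriv ^^ k) \<phi> t *\<^sub>R u' t) x"
    by (rule has_bochner_integral_in_cong_AE[OF Y x(1)]) (use u car_scale[OF Y] in \<open>auto elim: eventually_mono\<close>)
  moreover have "has_bochner_integral_in I Y (\<lambda>t. \<phi> t *\<^sub>R v' t) ((-1) ^ k *\<^sub>R x)"
    by (rule has_bochner_integral_in_cong_AE[OF Y x(2)]) (use v car_scale[OF Y] in \<open>auto elim: eventually_mono\<close>)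
  ultimately show "\<exists>x. has_bochner_integral_in I Y (\<lambda>t. (deriv ^^ k) \<phi> t *\<^sub>R u' t) x \<and>
    has_bochner_integral_in I Y (\<lambda>t. \<phi> t *\<^sub>R v' t) ((-1) ^ k *\<^sub>R x)" by blast
qed

lemma wder_add:
  assumes Y: "normed_space Y" and I: "I \<in> sets lebesgue" and w: "wder I k Y u v" "wder I k Y u' v'"
  shows "wder I k Y (\<lambda>t. u t + u' t) (\<lambda>t. v t + v' t)"
  unfolding wder_def
proof
  fix \<phi> assume \<phi>: "\<phi> \<in> test_functions I"
  obtain x where x: "has_bochner_integral_in I Y (\<lambda>t. (deriv ^^ k) \<phi> t *\<^sub>R u t) x"
    "has_bochner_integral_in I Y (\<lambda>t. \<phi> t *\<^sub>R v t) ((-1) ^ k *\<^sub>R x)" using wderE[OF w(1) \<phi>] by blast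
  obtain y where y: "has_bochner_integral_in I Y (\<lambda>t. (deriv ^^ k) \<phi> t *\<^sub>R u' t) y"
    "has_bochner_integral_in I Y (\<lambda>t. \<phi> t *\<^sub>R v' t) ((-1) ^ k *\<^sub>R y)" using wderE[OF w(2) \<phi>] by blast
  show "\<exists>x. has_bochner_integral_in I Y (\<lambda>t. (deriv ^^ k) \<phi> t *\<^sub>R (u t + u' t)) x \<and>
    has_bochner_integral_in I Y (\<lambda>t. \<phi> t *\<^sub>R (v t + v' t)) ((-1) ^ k *\<^sub>R x)"
    using has_bochner_integral_in_add[OF Y x(1) I y(1)] has_bochner_integral_in_add[OF Y x(2) I y(2)]
    by (intro exI[of _ "x + y"]) (simp add: scaleR_add_right)
qed

lemma wder_scale:
  assumes Y: "normed_space Y" and I: "I \<in> sets lebesgue" and w: "wder I k Y u v"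
  shows "wder I k Y (\<lambda>t. c *\<^sub>R u t) (\<lambda>t. c *\<^sub>R v t)"
  unfolding wder_def
proof
  fix \<phi> assume \<phi>: "\<phi> \<in> test_functions I"
  obtain x where x: "has_bochner_integral_in I Y (\<lambda>t. (deriv ^^ k) \<phi> t *\<^sub>R u t) x"
    "has_bochner_integral_in I Y (\<lambda>t. \<phi> t *\<^sub>R v t) ((-1) ^ k *\<^sub>R x)" using wderE[OF w \<phi>] by blast
  show "\<exists>x. has_bochner_integral_in I Y (\<lambda>t. (deriv ^^ k) \<phi> t *\<^sub>R c *\<^sub>R u t) x \<and>
    has_bochner_integral_in I Y (\<lambda>t. \<phi> t *\<^sub>R c *\<^sub>R v t) ((-1) ^ k *\<^sub>R x)"
    using has_bochner_integral_in_scale[OF Y I x(1), of c] has_bochner_integral_in_scale[OF Y I x(2), of c]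
    by (intro exI[of _ "c *\<^sub>R x"]) (simp add: mult.commute)
qed

lemma wder_embed:
  assumes "normed_space X" "normed_space Y" "I \<in> sets lebesgue" "embeds X Y K" "wder I k X u v"
  shows "wder I k Y u v"
  using assms(5) has_bochner_integral_in_embed[OF assms(1-4)] unfolding wder_def by blast

lemma test_function_deriv:
  assumes "\<phi> \<in> test_functions I"
  shows "deriv \<phi> \<in> test_functions I"
proof -
  let ?f = "\<lambda>k. (deriv ^^ k) \<phi>"
  have sm: "smooth_chain ?f" by (rule test_function_has_chain[OF assms])
  have "{t. deriv \<phi> t \<noteq> 0} \<subseteq> closure {t. \<phi> t \<noteq> 0}"
  proof (rule subsetI, rule ccontr)
    fix t assume t: "t \<in> {t. deriv \<phi> t \<noteq> 0}" "t \<notin> closure {t. \<phi> t \<noteq> 0}"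
    have "?f 1 t = 0"
      by (rule smooth_chain_locally_eq[OF sm smooth_chain_zero, of "- closure {t. \<phi> t \<noteq> 0}"])
        (use t closure_subset[of "{t. \<phi> t \<noteq> 0}"] in auto)
    then show False using t by simp
  qed
  then have sub: "closure {t. deriv \<phi> t \<noteq> 0} \<subseteq> closure {t. \<phi> t \<noteq> 0}" by (simp add: closure_minimal)
  moreover from sub assms have "compact (closure {t. deriv \<phi> t \<noteq> 0})"
    by (metis (mono_tags, lifting) closed_closure compact_Int_closed inf.absorb_iff2 mem_Collect_eq test_functions_def)
  moreover have "(deriv ^^ k) (deriv \<phi>) field_differentiable (at t)" for k t
    using smooth_chainD[OF sm, of "Suc k" t] unfolding field_differentiable_def by (metis funpow_Suc_right o_apply)
  ultimately show ?thesis using assms by (auto simp: test_functions_def)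
qed

text \<open>The \<open>(k + 1)\<close>-st weak derivative is the weak derivative of the \<open>k\<close>-th, since derivatives of test
  functions are test functions.\<close>

lemma wder_successive:
  assumes Y: "normed_space Y" and Z: "normed_space Z" and I: "I \<in> sets lebesgue" and e: "embeds Y Z K"
    and v: "wder I k Y u v" and w: "wder I (Suc k) Z u w" and \<phi>: "\<phi> \<in> test_functions I"
  shows "\<exists>x. has_bochner_integral_in I Z (\<lambda>t. deriv \<phi> t *\<^sub>R v t) x \<and>
    has_bochner_integral_in I Z (\<lambda>t. \<phi> t *\<^sub>R w t) (- x)"
proof -
  obtain x where x: "has_bochner_integral_in I Y (\<lambda>t. (deriv ^^ k) (deriv \<phi>) t *\<^sub>R u t) x"
    "has_bochner_integral_in I Y (\<lambda>t. deriv \<phi> t *\<^sub>R v t) ((-1) ^ k *\<^sub>R x)"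
    using wderE[OF v test_function_deriv[OF \<phi>]] by blast
  obtain y where y: "has_bochner_integral_in I Z (\<lambda>t. (deriv ^^ Suc k) \<phi> t *\<^sub>R u t) y"
    "has_bochner_integral_in I Z (\<lambda>t. \<phi> t *\<^sub>R w t) ((-1) ^ Suc k *\<^sub>R y)"
    using wderE[OF w \<phi>] by blast
  have "(deriv ^^ k) (deriv \<phi>) = (deriv ^^ Suc k) \<phi>" by (simp add: funpow_swap1)
  then have "x = y"
    using has_bochner_integral_in_unique[OF Z I has_bochner_integral_in_embed[OF Y Z I e x(1)]] y(1) by simp
  then show ?thesis
    using has_bochner_integral_in_embed[OF Y Z I e x(2)] y(2) by (intro exI[of _ "(-1)^k *\<^sub>R x"]) simp
qed

lemma (in Lp_setting) test_function_pairing: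
  assumes \<phi>: "\<phi> \<in> test_functions I" and \<omega>: "weight \<omega>"
  obtains C where "C \<ge> 0" "\<forall>(X :: 'v::real_vector nspace) u. normed_space X \<and> Lp_fun p I \<omega> X u \<longrightarrow>
      (\<integral>\<^sup>+t. ennreal (nrm X ((deriv ^^ k) \<phi> t *\<^sub>R u t)) \<partial>M) \<le> ennreal (C * lpn p I \<omega> X u)"
    "\<forall>(X :: 'v::real_vector nspace) u. banach_space X \<and> Lp_fun p I \<omega> X u \<longrightarrow> (\<exists>x. has_bochner_integral_in I X (\<lambda>t. (deriv ^^ k) \<phi> t *\<^sub>R u t) x)"
proof -
  let ?f = "\<lambda>k. (deriv ^^ k) \<phi>"
  have sm: "smooth_chain ?f" by (rule test_function_has_chain[OF \<phi>])
  have "bounded {t. \<phi> t \<noteq> 0}" using \<phi> by (simp add: test_functions_def bounded_closure_image compact_closure)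
  then obtain L where L: "\<And>t. \<phi> t \<noteq> 0 \<Longrightarrow> \<bar>t\<bar> \<le> L" by (auto simp: bounded_iff)
  have "supported_in {-L..L} (?f 0)" unfolding supported_in_def using L by (force simp: abs_le_iff)
  note s = smooth_chain_supported[OF sm this, of k]
  obtain B where B: "\<And>t. \<bar>?f k t\<bar> \<le> B"
    using smooth_chain_bounded[OF sm \<open>supported_in {-L..L} (?f 0)\<close>, of k] by blast
  obtain C where C: "C \<ge> 0" "\<forall>(X :: 'v::real_vector nspace) u. normed_space X \<and> Lp_fun p I \<omega> X u \<longrightarrow>
      (\<integral>\<^sup>+t. ennreal (nrm X (?f k t *\<^sub>R u t)) \<partial>M) \<le> ennreal (C * lpn p I \<omega> X u)"
    by (rule Lp_pairing_bound[OF \<omega> B s])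
  show thesis
    by (rule that[OF C]) (use Lp_pairing_exists[OF _ \<omega> B s smooth_chain_measurable(2)[OF sm]] in blast)
qed

text \<open>Weak derivatives survive limits: both sides of the defining identity are continuous.\<close>

theorem (in Lp_setting) wder_limit:
  fixes X Y :: "'v::real_vector nspace"
  assumes X: "banach_space X" and Y: "banach_space Y" and e: "embeds X Y K" and \<omega>: "weight \<omega>"
    and u: "\<And>j. Lp_fun p I \<omega> X (u j)" "Lp_fun p I \<omega> X u'" "(\<lambda>j. lpn p I \<omega> X (\<lambda>t. u j t - u' t)) \<longlonglongrightarrow> 0"
    and v: "\<And>j. Lp_fun p I \<omega> Y (v j)" "Lp_fun p I \<omega> Y v'" "(\<lambda>j. lpn p I \<omega> Y (\<lambda>t. v j t - v' t)) \<longlonglongrightarrow> 0"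
    and w: "\<And>j. wder I k Y (u j) (v j)"
  shows "wder I k Y u' v'"
  unfolding wder_def
proof
  have nX: "normed_space X" and nY: "normed_space Y" using X Y by (auto simp: banach_space_def)
  fix \<phi> assume \<phi>: "\<phi> \<in> test_functions I"
  obtain C where C0: "C \<ge> 0" "\<forall>X u. normed_space X \<and> Lp_fun p I \<omega> X u \<longrightarrow>
      (\<integral>\<^sup>+t. ennreal (nrm (X :: 'v nspace) ((deriv ^^ k) \<phi> t *\<^sub>R u t)) \<partial>M) \<le> ennreal (C * lpn p I \<omega> X u)"
    "\<forall>X u. banach_space X \<and> Lp_fun p I \<omega> X u \<longrightarrow> (\<exists>x. has_bochner_integral_in I (X :: 'v nspace) (\<lambda>t. (deriv ^^ k) \<phi> t *\<^sub>R u t) x)"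
    by (rule test_function_pairing[OF \<phi> \<omega>, of k])
  note C = C0(1) C0(2)[rule_format, OF conjI] C0(3)[rule_format, OF conjI]
  obtain C' where C0': "C' \<ge> 0" "\<forall>X u. normed_space X \<and> Lp_fun p I \<omega> X u \<longrightarrow>
      (\<integral>\<^sup>+t. ennreal (nrm (X :: 'v nspace) ((deriv ^^ 0) \<phi> t *\<^sub>R u t)) \<partial>M) \<le> ennreal (C' * lpn p I \<omega> X u)"
    "\<forall>X u. banach_space X \<and> Lp_fun p I \<omega> X u \<longrightarrow> (\<exists>x. has_bochner_integral_in I (X :: 'v nspace) (\<lambda>t. (deriv ^^ 0) \<phi> t *\<^sub>R u t) x)"
    by (rule test_function_pairing[OF \<phi> \<omega>, of 0])
  note C' = C0'(1) C0'(2)[unfolded funpow_0, rule_format, OF conjI] C0'(3)[unfolded funpow_0, rule_format, OF conjI]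
  obtain x where x: "has_bochner_integral_in I X (\<lambda>t. (deriv ^^ k) \<phi> t *\<^sub>R u' t) x" using C(3)[OF X u(2)] by blast
  obtain y where y: "has_bochner_integral_in I Y (\<lambda>t. \<phi> t *\<^sub>R v' t) y" using C'(3)[OF Y v(2)] by blast
  have xc: "x \<in> car Y" using x e by (auto simp: has_bochner_integral_in_def embeds_def)
  have yc: "y \<in> car Y" using y by (auto simp: has_bochner_integral_in_def)
  have "\<exists>xj. has_bochner_integral_in I X (\<lambda>t. (deriv ^^ k) \<phi> t *\<^sub>R u j t) xj \<and>
      has_bochner_integral_in I Y (\<lambda>t. \<phi> t *\<^sub>R v j t) ((-1) ^ k *\<^sub>R xj)" for j
  proof -
    obtain a where a: "has_bochner_integral_in I X (\<lambda>t. (deriv ^^ k) \<phi> t *\<^sub>R u j t) a" using C(3)[OF X u(1)] by blast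
    obtain b where b: "has_bochner_integral_in I Y (\<lambda>t. (deriv ^^ k) \<phi> t *\<^sub>R u j t) b"
      "has_bochner_integral_in I Y (\<lambda>t. \<phi> t *\<^sub>R v j t) ((-1) ^ k *\<^sub>R b)" using wderE[OF w \<phi>] by blast
    have "a = b"
      by (rule has_bochner_integral_in_unique[OF nY I_sets has_bochner_integral_in_embed[OF nX nY I_sets e a] b(1)])
    then show ?thesis using a b by blast
  qed
  then obtain xj where xj: "\<And>j. has_bochner_integral_in I X (\<lambda>t. (deriv ^^ k) \<phi> t *\<^sub>R u j t) (xj j)"
    "\<And>j. has_bochner_integral_in I Y (\<lambda>t. \<phi> t *\<^sub>R v j t) ((-1) ^ k *\<^sub>R xj j)" by metis
  have xjc: "xj j \<in> car X" for j using xj(1)[of j] by (auto simp: has_bochner_integral_in_def)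
  have xjY: "xj j \<in> car Y" for j using xjc e by (auto simp: embeds_def)
  have bnd_x: "nrm Y (xj j - x) \<le> K * (C * lpn p I \<omega> X (\<lambda>t. u j t - u' t))" for j
  proof -
    have d: "has_bochner_integral_in I X (\<lambda>t. (deriv ^^ k) \<phi> t *\<^sub>R (u j t - u' t)) (xj j - x)"
      using has_bochner_integral_in_diff[OF nX xj(1) I_sets x, of j] by (simp add: scaleR_diff_right)
    have "ennreal (nrm X (xj j - x)) \<le> ennreal (C * lpn p I \<omega> X (\<lambda>t. u j t - u' t))"
      by (rule order_trans[OF has_bochner_integral_in_norm_bound[OF nX I_sets d] C(2)[OF nX Lp_fun_diff(1)[OF nX \<omega> u(1,2)]]])
    then have "nrm X (xj j - x) \<le> C * lpn p I \<omega> X (\<lambda>t. u j t - u' t)" 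
      by (subst (asm) ennreal_le_iff) (simp_all add: C(1) lpn_nonneg)
    moreover have "nrm Y (xj j - x) \<le> K * nrm X (xj j - x)"
      using e d by (auto simp: embeds_def has_bochner_integral_in_def)
    ultimately show ?thesis using e by (auto simp: embeds_def intro: order_trans mult_left_mono)
  qed
  have bnd_y: "nrm Y ((-1) ^ k *\<^sub>R xj j - y) \<le> C' * lpn p I \<omega> Y (\<lambda>t. v j t - v' t)" for j
  proof -
    have d: "has_bochner_integral_in I Y (\<lambda>t. \<phi> t *\<^sub>R (v j t - v' t)) ((-1) ^ k *\<^sub>R xj j - y)"
      using has_bochner_integral_in_diff[OF nY xj(2) I_sets y, of j] by (simp add: scaleR_diff_right)
    have "ennreal (nrm Y ((-1) ^ k *\<^sub>R xj j - y)) \<le> ennreal (C' * lpn p I \<omega> Y (\<lambda>t. v j t - v' t))"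
      by (rule order_trans[OF has_bochner_integral_in_norm_bound[OF nY I_sets d] C'(2)[OF nY Lp_fun_diff(1)[OF nY \<omega> v(1,2)]]])
    then show ?thesis by (subst (asm) ennreal_le_iff) (simp_all add: C'(1) lpn_nonneg)
  qed
  have "(-1) ^ k *\<^sub>R x = y"
  proof (rule nrm_limit_unique[OF nY car_scale[OF nY xc] yc car_scale[OF nY xjY]])
    have eq: "nrm Y ((-1) ^ k *\<^sub>R xj j - (-1) ^ k *\<^sub>R x) = nrm Y (xj j - x)" for j
      using nrm_scale[OF nY car_diff[OF nY xjY xc], of "(-1)^k" j] by (simp add: scaleR_diff_right power_abs)
    show "(\<lambda>j. nrm Y ((-1) ^ k *\<^sub>R xj j - (-1) ^ k *\<^sub>R x)) \<longlonglongrightarrow> 0"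
      unfolding eq
      by (rule tendsto_nrm_le[OF nY car_diff[OF nY xjY xc] _ bnd_x]) (intro tendsto_mult_right_zero u(3))
    show "(\<lambda>j. nrm Y ((-1) ^ k *\<^sub>R xj j - y)) \<longlonglongrightarrow> 0"
      by (rule tendsto_nrm_le[OF nY car_diff[OF nY car_scale[OF nY xjY] yc] _ bnd_y]) (intro tendsto_mult_right_zero v(3))
  qed
  then show "\<exists>x. has_bochner_integral_in I Y (\<lambda>t. (deriv ^^ k) \<phi> t *\<^sub>R u' t) x \<and>
     has_bochner_integral_in I Y (\<lambda>t. \<phi> t *\<^sub>R v' t) ((-1) ^ k *\<^sub>R x)"
    using has_bochner_integral_in_embed[OF nX nY I_sets e x] y by blast
qed

section \<open>Compactness\<close>

text \<open>Replacing \<open>g\<close> on each cell by its integral over the cell costs a factor \<open>h\<close>, a bound for the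
  measure of the cells: this is where the mesh of the partition enters.\<close>

lemma Lp_le_cell_integrals:
  fixes g :: "real \<Rightarrow> real" and O' :: "nat \<Rightarrow> real set"
  assumes g: "Lp_le lebesgue p g c" and p: "p \<ge> 1" and S: "finite S" and h: "h > 0"
    and O: "\<And>i. O' i \<in> sets lebesgue" "\<And>i. emeasure lebesgue (O' i) \<le> ennreal h"
    and djf: "disjoint_family O'"
  defines "V \<equiv> \<lambda>i. enn2real (\<integral>\<^sup>+t. ennreal \<bar>g t\<bar> \<partial>lebesgue_on (O' i))"
  shows "(\<integral>\<^sup>+t. ennreal \<bar>g t\<bar> \<partial>lebesgue_on (O' i)) < \<infinity>"
    and "Lp_le lebesgue p (\<lambda>t. \<Sum>i\<in>S. indicator (O' i) t * V i) (2 * h * c)"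
proof -
  have disj: "\<And>i j t. t \<in> O' i \<Longrightarrow> t \<in> O' j \<Longrightarrow> i = j"
    using djf unfolding disjoint_family_on_def by blast
  have gm: "g \<in> borel_measurable lebesgue" and c: "c \<ge> 0" using g by (auto simp: Lp_le_def)
  define q where "q i = enn2real (\<integral>\<^sup>+t. ennreal (\<bar>g t\<bar> powr p) \<partial>lebesgue_on (O' i))" for i
  have Lg: "Lp_le (lebesgue_on (O' i)) p g c" for i
    using Lp_le_restrict[of UNIV p g c "O' i"] g O(1) by (simp add: lebesgue_on_UNIV_eq)
  have fin: "(\<integral>\<^sup>+t. ennreal (\<bar>g t\<bar> powr p) \<partial>lebesgue_on (O' i)) < \<infinity>" for i
    by (rule le_less_trans[OF Lp_leD(3)[OF Lg]]) simp
  have em: "emeasure (lebesgue_on (O' i)) (space (lebesgue_on (O' i))) \<le> ennreal h" for i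
    using O by (simp add: emeasure_restrict_space)
  have Lq: "Lp_le (lebesgue_on (O' i)) p g (q i powr (1/p))" for i
    unfolding q_def by (rule Lp_le_exists[OF Lp_leD(1)[OF Lg] fin p])
  note L1 = Lp_le_imp_L1[OF Lq p em h]
  show "(\<integral>\<^sup>+t. ennreal \<bar>g t\<bar> \<partial>lebesgue_on (O' i)) < \<infinity>" by (rule le_less_trans[OF L1]) simp
  have V0: "V i \<ge> 0" for i by (simp add: V_def)
  have Vq: "V i powr p * h \<le> (2 * h) powr p * q i" for i
  proof -
    have q0: "q i \<ge> 0" by (simp add: q_def)
    have "V i \<le> 2 * h powr (1 - 1/p) * q i powr (1/p)"
      unfolding V_def by (rule enn2real_leI[OF _ L1]) simp
    then have "V i powr p \<le> (2 * h powr (1 - 1/p) * q i powr (1/p)) powr p"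
      using p V0 by (intro powr_mono2) auto
    also have "\<dots> = 2 powr p * h powr (p - 1) * q i"
      using p h q0 by (simp add: powr_mult powr_powr left_diff_distrib)
    finally have "V i powr p * h \<le> 2 powr p * h powr (p - 1) * q i * h"
      using h by (intro mult_right_mono) auto
    also have "h powr (p - 1) * h = h powr p" using h powr_add[of h "p - 1" 1] by simp
    then have "2 powr p * h powr (p - 1) * q i * h = (2 * h) powr p * q i"
      by (simp add: powr_mult mult_ac)
    finally show ?thesis .
  qed
  have pt: "ennreal (\<bar>\<Sum>i\<in>S. indicator (O' i) t * V i\<bar> powr p) = (\<Sum>i\<in>S. ennreal (V i powr p) * indicator (O' i) t)" for t
  proof (cases "\<exists>j\<in>S. t \<in> O' j")
    case True
    then obtain j where j: "j \<in> S" "t \<in> O' j" by blast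
    have ind: "t \<notin> O' i" if "i \<noteq> j" for i using disj[OF _ j(2)] that by blast
    have "(\<Sum>i\<in>S. indicator (O' i) t * V i) = (\<Sum>i\<in>S. if i = j then V j else 0)"
      by (rule sum.cong[OF refl]) (use ind j(2) in simp)
    moreover have "(\<Sum>i\<in>S. ennreal (V i powr p) * indicator (O' i) t) = (\<Sum>i\<in>S. if i = j then ennreal (V j powr p) else 0)"
      by (rule sum.cong[OF refl]) (use ind j(2) in simp)
    ultimately show ?thesis using j(1) S V0 by simp
  next
    case False
    then have "\<forall>i\<in>S. indicator (O' i) t = (0::real)" "\<forall>i\<in>S. indicator (O' i) t = (0::ennreal)" by auto
    then show ?thesis using p by simp
  qed
  have disj_sum: "(\<Sum>i\<in>S. ennreal (\<bar>g t\<bar> powr p) * indicator (O' i) t) \<le> ennreal (\<bar>g t\<bar> powr p)" for t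
  proof (cases "\<exists>j\<in>S. t \<in> O' j")
    case True
    then obtain j where j: "j \<in> S" "t \<in> O' j" by blast
    have ind: "t \<notin> O' i" if "i \<noteq> j" for i using disj[OF _ j(2)] that by blast
    have "(\<Sum>i\<in>S. ennreal (\<bar>g t\<bar> powr p) * indicator (O' i) t) = (\<Sum>i\<in>S. if i = j then ennreal (\<bar>g t\<bar> powr p) else 0)"
      by (rule sum.cong[OF refl]) (use ind j(2) in simp)
    then show ?thesis using j(1) S by simp
  next
    case False
    then have "\<forall>i\<in>S. indicator (O' i) t = (0::ennreal)" by auto
    then show ?thesis by simp
  qed
  have "(\<integral>\<^sup>+t. ennreal (\<bar>\<Sum>i\<in>S. indicator (O' i) t * V i\<bar> powr p) \<partial>lebesgue) = (\<Sum>i\<in>S. ennreal (V i powr p) * emeasure lebesgue (O' i))"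
    unfolding pt using O(1) by (subst nn_integral_sum) (auto simp: nn_integral_cmult)
  also have "\<dots> \<le> (\<Sum>i\<in>S. ennreal (V i powr p) * ennreal h)"
    by (intro sum_mono mult_left_mono O) auto
  also have "\<dots> \<le> (\<Sum>i\<in>S. ennreal ((2 * h) powr p) * ennreal (q i))"
    using Vq h by (intro sum_mono) (simp add: ennreal_leI q_def flip: ennreal_mult)
  also have "\<dots> = ennreal ((2 * h) powr p) * (\<Sum>i\<in>S. ennreal (q i))" by (simp add: sum_distrib_left)
  also have "(\<Sum>i\<in>S. ennreal (q i)) = (\<Sum>i\<in>S. \<integral>\<^sup>+t. ennreal (\<bar>g t\<bar> powr p) * indicator (O' i) t \<partial>lebesgue)"
    using fin O(1) by (intro sum.cong refl) (simp add: q_def nn_integral_restrict_space)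
  also have "\<dots> = (\<integral>\<^sup>+t. (\<Sum>i\<in>S. ennreal (\<bar>g t\<bar> powr p) * indicator (O' i) t) \<partial>lebesgue)"
    using gm O(1) by (subst nn_integral_sum) auto
  also have "ennreal ((2 * h) powr p) * (\<dots>) \<le> ennreal ((2 * h) powr p) * (\<integral>\<^sup>+t. ennreal (\<bar>g t\<bar> powr p) \<partial>lebesgue)"
    by (intro mult_left_mono nn_integral_mono disj_sum) auto
  also have "\<dots> \<le> ennreal ((2 * h) powr p) * ennreal (c powr p)"
    by (intro mult_left_mono Lp_leD(3)[OF g]) auto
  also have "\<dots> = ennreal ((2 * h * c) powr p)" by (simp add: powr_mult flip: ennreal_mult)
  finally have "(\<integral>\<^sup>+t. ennreal (\<bar>\<Sum>i\<in>S. indicator (O' i) t * V i\<bar> powr p) \<partial>lebesgue) \<le> ennreal ((2 * h * c) powr p)" .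
  moreover have "(\<lambda>t. \<Sum>i\<in>S. indicator (O' i) t * V i) \<in> borel_measurable lebesgue" using O(1) by simp
  ultimately show "Lp_le lebesgue p (\<lambda>t. \<Sum>i\<in>S. indicator (O' i) t * V i) (2 * h * c)"
    using h c by (simp add: Lp_le_def)
qed

lemma AE_interior_empty:
  assumes "connected (I :: real set)" "interior I = {}"
  shows "AE t in lebesgue_on I. P t"
  using AE_interior[OF assms(1)] assms(2) by (auto elim: eventually_mono)

text \<open>The compactness theorem of Aubin and Lions. Outside a bounded interval the gain in the weight makes
  everything small. Inside, up to an error proportional to the mesh, a function is determined by
  finitely many averages; these are bounded in \<open>X\<close>, hence totally bounded in \<open>Y\<close>.\<close>

theorem (in Lp_setting) Aubin_Lions:
  fixes X Y :: "'v::real_vector nspace" and u v :: "'b \<Rightarrow> real \<Rightarrow> 'v"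
  assumes X: "banach_space X" and Y: "banach_space Y" and cpt: "compact_inclusion X Y"
    and \<omega>: "weight \<omega>" and \<omega>': "weight \<omega>'"
    and decay: "\<And>e. e > 0 \<Longrightarrow> \<exists>R. \<forall>t. \<bar>t\<bar> > R \<longrightarrow> \<omega>' t \<le> e * \<omega> t"
    and u: "\<And>x. x \<in> B \<Longrightarrow> Lp_fun p I \<omega> X (u x)" "\<And>x. x \<in> B \<Longrightarrow> lpn p I \<omega> X (u x) \<le> A"
    and v: "\<And>x. x \<in> B \<Longrightarrow> Lp_fun p I \<omega> Y (v x)" "\<And>x. x \<in> B \<Longrightarrow> lpn p I \<omega> Y (v x) \<le> A"
    and weak: "\<And>x \<phi>. x \<in> B \<Longrightarrow> \<phi> \<in> test_functions I \<Longrightarrow> \<exists>z.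
      has_bochner_integral_in I Y (\<lambda>t. deriv \<phi> t *\<^sub>R u x t) z \<and> has_bochner_integral_in I Y (\<lambda>t. \<phi> t *\<^sub>R v x t) (- z)"
  shows "tot_bounded B (\<lambda>x y. lpn p I \<omega>' Y (\<lambda>t. u x t - u y t))"
proof (cases "interior I = {}")
  case True
  have "lpn p I \<omega>' Y w = 0" for w
  proof -
    have "lpn p I \<omega>' Y w = lpn p I \<omega>' Y (\<lambda>t. 0)" by (intro lpn_cong_AE AE_interior_empty conn True)
    also have "\<dots> = 0" using Y by (intro lpn_zero) (simp add: banach_space_def)
    finally show ?thesis .
  qed
  then show ?thesis by (simp add: tot_bounded_zero)
next
  case False
  have nX: "normed_space X" and nY: "normed_space Y" using X Y by (auto simp: banach_space_def)
  obtain K where K: "0 < K" "\<And>x. x \<in> car X \<Longrightarrow> nrm Y x \<le> K * nrm X x"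
    using compact_inclusion_bounded[OF nX nY cpt] by blast
  have sub: "car X \<subseteq> car Y" using cpt by (simp add: compact_inclusion_def)
  have emb: "embeds X Y K" using K sub by (auto simp: embeds_def)
  have uY: "u x t \<in> car Y" if "x \<in> B" "t \<in> I" for x t using Lp_fun_car[OF u(1)[OF that(1)] that(2)] sub by blast
  have usY: "strongly_measurable I Y (u x)" if "x \<in> B" for x
    by (rule strongly_measurable_embed[OF nX nY emb Lp_fun_strongly_measurable[OF u(1)[OF that]]])
  show ?thesis
  proof (rule tot_bounded_approx)
    fix e :: real assume e: "e > 0"
    define A' where "A' = \<bar>A\<bar> + 1"
    have A': "A' > 0" "A \<le> A'" by (auto simp: A'_def)
    \<comment> \<open>With this \<open>\<eta>\<close> each of the two functions contributes at most \<open>e/4\<close> outside \<open>{-R..R}\<close>.\<close>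
    define \<eta> where "\<eta> = e / (4 * K * A')"
    have \<eta>: "\<eta> > 0" using e K A' by (simp add: \<eta>_def)
    obtain R0 where R0: "\<And>t. \<bar>t\<bar> > R0 \<Longrightarrow> \<omega>' t \<le> \<eta> * \<omega> t" using decay[OF \<eta>] by blast
    define R where "R = max R0 1"
    have R: "R > 0" "\<And>t. \<bar>t\<bar> > R \<Longrightarrow> \<omega>' t \<le> \<eta> * \<omega> t" using R0 by (auto simp: R_def)
    obtain W where W: "W > 0" "\<And>t. t \<in> {-R..R} \<Longrightarrow> \<omega>' t \<le> W" using weight_bounded_above[OF \<omega>'] by blast
    obtain w where w: "w > 0" "\<And>t. t \<in> {-R..R} \<Longrightarrow> w \<le> \<omega> t" using weight_bounded_below[OF \<omega>] by blast
    \<comment> \<open>The mesh \<open>h\<close> is chosen so that \<open>2 * h * W * A' / w \<le> e / 4\<close>.\<close>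
    obtain N :: nat where N: "16 * R * W * A' / (w * e) < real N" using reals_Archimedean2 by blast
    have N0: "real N > 0"
    proof -
      have "16 * R * W * A' / (w * e) > 0" using R W A' w e by simp
      then show ?thesis using N by linarith
    qed
    define h where "h = 2 * R / real N"
    have h: "h > 0" using R N0 by (simp add: h_def)
    have hW: "W * (2 * h * (A' / w)) \<le> e / 4"
    proof -
      define Q where "Q = R * W * A' / (real N * w)"
      have "16 * R * W * A' < real N * (w * e)" using N w e by (simp add: field_simps)
      then have "16 * Q \<le> e" using N0 w by (simp add: Q_def field_simps)
      moreover have "W * (2 * h * (A' / w)) = 4 * Q" by (simp add: h_def Q_def mult_ac)
      ultimately show ?thesis by linarith
    qed
    define cell where "cell i = {-R + real i * h<..<-R + real (Suc i) * h}" for i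
    define O' where "O' i = interior I \<inter> cell i" for i
    have cell_disj: "i = j" if "t \<in> cell i" "t \<in> cell j" for i j t
    proof -
      have "real i * h < real (Suc j) * h" "real j * h < real (Suc i) * h" using that by (auto simp: cell_def)
      then have "real i < real (Suc j)" "real j < real (Suc i)" using h by (auto simp: mult_less_cancel_right)
      then show ?thesis by simp
    qed
    have O_open: "open (O' i)" for i by (auto simp: O'_def cell_def)
    have O_sub: "O' i \<subseteq> interior I" for i by (auto simp: O'_def)
    have O_conn: "connected (O' i)" for i
    proof -
      have "convex (interior I)" using conn is_interval_connected_1 is_interval_convex convex_interior by blast
      then have "convex (O' i)" unfolding O'_def cell_def by (intro convex_Int convex_real_interval) auto
      then show ?thesis by (rule convex_connected)
    qed
    have O_em: "emeasure lebesgue (O' i) \<le> ennreal h" for i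
    proof -
      have "emeasure lebesgue (O' i) \<le> emeasure lebesgue (cell i)" by (rule emeasure_mono) (auto simp: O'_def cell_def)
      also have "\<dots> = ennreal h" using h by (simp add: cell_def algebra_simps)
      finally show ?thesis .
    qed
    define S where "S = {i. i < N \<and> O' i \<noteq> {}}"
    have S: "finite S" by (auto simp: S_def)
    \<comment> \<open>The average \<open>m i x\<close> over a cell is taken against a mollifier supported in the cell.\<close>
    have "\<exists>a \<epsilon>. \<epsilon> > 0 \<and> {a - \<epsilon>..a + \<epsilon>} \<subseteq> O' i" if i: "i \<in> S" for i
    proof -
      obtain a where a: "a \<in> O' i" using i unfolding S_def by blast
      then obtain \<epsilon> where "\<epsilon> > 0" "cball a \<epsilon> \<subseteq> O' i" using O_open open_contains_cball by blast
      then show ?thesis by (intro exI[of _ a] exI[of _ \<epsilon>]) (auto simp: cball_eq_atLeastAtMost)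
    qed
    then obtain a \<epsilon> where a: "\<And>i. i \<in> S \<Longrightarrow> \<epsilon> i > 0" "\<And>i. i \<in> S \<Longrightarrow> {a i - \<epsilon> i..a i + \<epsilon> i} \<subseteq> O' i" by metis
    have "\<exists>m. \<forall>x\<in>B. has_bochner_integral_in I X (\<lambda>s. mollifier (\<epsilon> i) 0 (a i - s) *\<^sub>R u x s) (m x)" if i: "i \<in> S" for i
    proof -
      obtain C where C: "C > 0" "\<And>t. \<bar>mollifier (\<epsilon> i) 0 t\<bar> \<le> C" using mollifier_bounded[OF a(1)[OF i], of 0] by blast
      have sp: "supported_in {a i - \<epsilon> i..a i + \<epsilon> i} (\<lambda>s. mollifier (\<epsilon> i) 0 (a i - s))"
        unfolding supported_in_def using mollifier_zero[OF a(1)[OF i]] by force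
      have mm: "(\<lambda>s. mollifier (\<epsilon> i) 0 (a i - s)) \<in> borel_measurable M"
        using smooth_chain_measurable(2)[OF smooth_mollifier_reflected[of "\<epsilon> i" "a i"], of 0] by simp
      have "\<forall>x\<in>B. \<exists>z. has_bochner_integral_in I X (\<lambda>s. mollifier (\<epsilon> i) 0 (a i - s) *\<^sub>R u x s) z"
        using Lp_pairing_exists[OF X \<omega> C(2) sp mm u(1)] by blast
      then show ?thesis by (rule bchoice)
    qed
    then obtain m where m: "\<And>i x. i \<in> S \<Longrightarrow> x \<in> B \<Longrightarrow>
      has_bochner_integral_in I X (\<lambda>s. mollifier (\<epsilon> i) 0 (a i - s) *\<^sub>R u x s) (m i x)" by metis
    have mX: "m i x \<in> car X" if "i \<in> S" "x \<in> B" for i x using m[OF that] by (simp add: has_bochner_integral_in_def)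
    have mY: "m i x \<in> car Y" if "i \<in> S" "x \<in> B" for i x using mX[OF that] sub by blast
    have tb: "tot_bounded B (\<lambda>x y. nrm Y (m i x - m i y))" if i: "i \<in> S" for i
    proof (rule tot_bounded_image)
      obtain C where C: "C > 0" "\<And>t. \<bar>mollifier (\<epsilon> i) 0 t\<bar> \<le> C" using mollifier_bounded[OF a(1)[OF i], of 0] by blast
      have sp: "supported_in {a i - \<epsilon> i..a i + \<epsilon> i} (\<lambda>s. mollifier (\<epsilon> i) 0 (a i - s))"
        unfolding supported_in_def using mollifier_zero[OF a(1)[OF i]] by force
      obtain D where D: "D \<ge> 0" "\<forall>(X :: 'v nspace) u. normed_space X \<and> Lp_fun p I \<omega> X u \<longrightarrow>
        (\<integral>\<^sup>+t. ennreal (nrm X (mollifier (\<epsilon> i) 0 (a i - t) *\<^sub>R u t)) \<partial>M) \<le> ennreal (D * lpn p I \<omega> X u)"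
        by (rule Lp_pairing_bound[OF \<omega> C(2) sp])
      have bd: "nrm X (m i x) \<le> D * A'" if x: "x \<in> B" for x
      proof -
        have "ennreal (nrm X (m i x)) \<le> ennreal (D * lpn p I \<omega> X (u x))"
          by (rule order_trans[OF has_bochner_integral_in_norm_bound[OF nX I_sets m[OF i x]]]) (use D(2) nX u(1)[OF x] in blast)
        then have "nrm X (m i x) \<le> D * lpn p I \<omega> X (u x)"
          by (subst (asm) ennreal_le_iff) (simp_all add: D(1) lpn_nonneg)
        also have "\<dots> \<le> D * A'" using u(2)[OF x] A'(2) D(1) by (intro mult_left_mono) auto
        finally show ?thesis .
      qed
      show "tot_bounded (m i ` B) (\<lambda>x y. nrm Y (x - y))"
        by (rule compact_inclusion_tot_bounded[OF nY cpt, of _ "D * A'"]) (use mX[OF i] bd in auto)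
    qed
    define d' where "d' x y = (\<Sum>i\<in>S. nrm Y (m i x - m i y))" for x y
    have tb': "tot_bounded B d'" unfolding d'_def[abs_def] by (rule tot_bounded_sum[OF S tb])
    \<comment> \<open>On the bounded part, where the weight is at least \<open>w\<close>, the unweighted norm of the weak
      derivative is controlled.\<close>
    define SR where "SR = I \<inter> {-R..R}"
    have SRs: "SR \<in> sets lebesgue" using I_sets by (auto simp: SR_def)
    define g where "g x t = (if t \<in> SR then nrm Y (v x t) else 0)" for x t
    have gL: "Lp_le lebesgue p (g x) (A' / w)" if x: "x \<in> B" for x
    proof -
      have vm: "strongly_measurable SR Y (v x)"
        by (rule strongly_measurable_mono[OF Lp_fun_strongly_measurable[OF v(1)[OF x]] _ I_sets SRs]) (simp add: SR_def)
      have "Lp_le (lebesgue_on SR) p (\<lambda>t. nrm Y (v x t)) (A' / w)"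
      proof (rule Lp_le_mono[OF Lp_le_scale[OF Lp_le_restrict[OF Lp_fun_Lp_le[OF nY \<omega> v(1)[OF x]] _ I_sets SRs], of "1/w"] borel_measurable_nrm[OF nY SRs vm] p1])
        have "\<bar>1/w\<bar> * lpn p I \<omega> Y (v x) \<le> (1/w) * A'" using w v(2)[OF x] A'(2) by (intro mult_mono) (auto simp: lpn_nonneg)
        then show "\<bar>1/w\<bar> * lpn p I \<omega> Y (v x) \<le> A' / w" by simp
        show "AE t in lebesgue_on SR. \<bar>nrm Y (v x t)\<bar> \<le> \<bar>1/w * (nrm Y (v x t) * \<omega> t)\<bar>"
          using AE_in_lebesgue_on
        proof eventually_elim
          fix t assume t: "t \<in> SR"
          have "0 \<le> nrm Y (v x t)" by (rule nrm_nonneg[OF nY strongly_measurable_car[OF vm t]])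
          moreover have "w \<le> \<omega> t" using t w(2) by (simp add: SR_def)
          ultimately have "nrm Y (v x t) * w \<le> nrm Y (v x t) * \<omega> t" by (intro mult_left_mono)
          then show "\<bar>nrm Y (v x t)\<bar> \<le> \<bar>1/w * (nrm Y (v x t) * \<omega> t)\<bar>"
            using w(1) \<open>0 \<le> nrm Y (v x t)\<close> weight_pos[OF \<omega>, of t] by (simp add: field_simps abs_mult)
        qed
      qed (simp add: SR_def)
      from Lp_le_extend[OF this, of UNIV] SRs show ?thesis
        unfolding g_def[abs_def] by (simp add: lebesgue_on_UNIV_eq)
    qed
    define V where "V x i = enn2real (\<integral>\<^sup>+t. ennreal \<bar>g x t\<bar> \<partial>lebesgue_on (O' i))" for x i
    have disj: "\<And>i j t. t \<in> O' i \<Longrightarrow> t \<in> O' j \<Longrightarrow> i = j" using cell_disj by (auto simp: O'_def)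
    have djf: "disjoint_family O'" using disj unfolding disjoint_family_on_def by blast
    have Om: "O' i \<in> sets lebesgue" for i using O_open by simp
    have cellL: "Lp_le lebesgue p (\<lambda>t. \<Sum>i\<in>S. indicator (O' i) t * V x i) (2 * h * (A' / w))"
      and Vfin: "(\<integral>\<^sup>+t. ennreal \<bar>g x t\<bar> \<partial>lebesgue_on (O' i)) < \<infinity>" if x: "x \<in> B" for x i
      using Lp_le_cell_integrals[OF gL[OF x] p1 S h Om O_em djf] unfolding V_def by blast+
    have V0: "V x i \<ge> 0" for x i by (simp add: V_def)
    have near: "AE t in lebesgue_on (O' i). nrm Y (u x t - m i x) \<le> V x i" if i: "i \<in> S" and x: "x \<in> B" for i x
    proof (rule Poincare_average[OF nY conn _ weak[OF x] _ O_conn O_open O_sub a(1)[OF i] a(2)[OF i]])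
      show "locally_L1 I Y (u x)"
      proof -
        have "Lp_fun p I \<omega> Y (u x)"
          by (rule Lp_fun_embed(1)[OF nX nY \<omega> \<omega> emb _ _ u(1)[OF x], of 1]) auto
        then show ?thesis by (rule Lp_fun_locally_L1[OF Y \<omega>])
      qed
      show "v x t \<in> car Y" if "t \<in> I" for t by (rule Lp_fun_car[OF v(1)[OF x] that])
      show "has_bochner_integral_in I Y (\<lambda>s. mollifier (\<epsilon> i) 0 (a i - s) *\<^sub>R u x s) (m i x)"
        by (rule has_bochner_integral_in_embed[OF nX nY I_sets emb m[OF i x]])
      have "cell i \<subseteq> {-R..R}"
      proof -
        have "real (Suc i) * h \<le> real N * h" using i h by (intro mult_right_mono) (auto simp: S_def)
        also have "\<dots> = 2 * R" using N0 by (simp add: h_def)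
        finally have "real (Suc i) * h \<le> 2 * R" .
        moreover have "0 \<le> real i * h" using h by simp
        ultimately show ?thesis unfolding cell_def
          by (intro subsetI) (unfold greaterThanLessThan_iff atLeastAtMost_iff, intro conjI, linarith+)
      qed
      then have "O' i \<subseteq> SR" using interior_subset by (auto simp: O'_def SR_def)
      then have "(\<integral>\<^sup>+t. ennreal (nrm Y (v x t)) \<partial>lebesgue_on (O' i)) = (\<integral>\<^sup>+t. ennreal \<bar>g x t\<bar> \<partial>lebesgue_on (O' i))"
        using nrm_nonneg[OF nY Lp_fun_car[OF v(1)[OF x]]] by (intro nn_integral_cong) (auto simp: g_def SR_def)
      also have "\<dots> = ennreal (V x i)" using Vfin[OF x, of i] by (simp add: V_def)
      finally show "(\<integral>\<^sup>+t. ennreal (nrm Y (v x t)) \<partial>lebesgue_on (O' i)) \<le> ennreal (V x i)" by simp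
    qed (simp_all add: V0)
    have near': "AE t in lebesgue. \<forall>i\<in>S. t \<in> O' i \<longrightarrow> nrm Y (u x t - m i x) \<le> V x i" if x: "x \<in> B" for x
      using near[OF _ x] S O_open by (intro AE_finite_allI) (simp_all add: AE_restrict_space_iff)
    \<comment> \<open>The open cells miss only their finitely many end points and the boundary of \<open>I\<close>.\<close>
    have cover: "AE t in lebesgue. t \<in> SR \<longrightarrow> (\<exists>i\<in>S. t \<in> O' i)"
    proof -
      define F where "F = (\<lambda>i. -R + real i * h) ` {..N}"
      have "F \<in> null_sets lebesgue" by (intro negligible_iff_null_sets[THEN iffD1] negligible_finite) (simp add: F_def)
      then have "AE t in lebesgue. t \<notin> F" by (rule AE_not_in)
      moreover have "AE t in lebesgue. t \<in> I \<longrightarrow> t \<in> interior I"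
        using AE_interior[OF conn] I_sets by (simp add: AE_restrict_space_iff)
      ultimately show ?thesis
      proof eventually_elim
        fix t assume t: "t \<notin> F" "t \<in> I \<longrightarrow> t \<in> interior I"
        show "t \<in> SR \<longrightarrow> (\<exists>i\<in>S. t \<in> O' i)"
        proof
          assume ts: "t \<in> SR"
          define y where "y = (t + R) / h"
          have tR: "0 \<le> t + R" "t + R \<le> 2 * R" using ts by (auto simp: SR_def)
          have "2 * R / h = real N" using R(1) N0 by (simp add: h_def)
          then have y: "0 \<le> y" "y \<le> real N" using tR h divide_right_mono[OF tR(2), of h] by (simp_all add: y_def)
          have ty: "t = -R + y * h" using h by (simp add: y_def)
          define i where "i = nat \<lfloor>y\<rfloor>"
          have i: "real i \<le> y" "y < real i + 1" using y by (auto simp: i_def)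
          have "real i \<noteq> y"
          proof
            assume "real i = y"
            then have "t \<in> F" using y ty unfolding F_def by (intro image_eqI[of _ _ i]) auto
            then show False using t by blast
          qed
          then have i1: "real i < y" using i by simp
          then have iN: "i < N" using y by linarith
          have "real i * h < y * h" "y * h < real (Suc i) * h" using i1 i h by (auto intro!: mult_strict_right_mono)
          then have "t \<in> cell i" unfolding cell_def ty by auto
          then have "t \<in> O' i" using t ts by (auto simp: O'_def SR_def)
          then show "\<exists>i\<in>S. t \<in> O' i" using iN by (auto simp: S_def)
        qed
      qed
    qed
    define l where "l = (2 * R) powr (1/p)"
    have l: "l > 0" using R by (simp add: l_def)
    have "lpn p I \<omega>' Y (\<lambda>t. u x t - u y t) \<le> e + W * l * d' x y" if x: "x \<in> B" and y: "y \<in> B" for x y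
    proof -
      let ?P = "\<lambda>x t. \<Sum>i\<in>S. indicator (O' i) t * V x i"
      let ?c = "\<lambda>t. if t \<in> SR then d' x y else 0"
      let ?F = "\<lambda>t. \<bar>\<bar>(\<eta> * K) * (nrm X (u x t) * \<omega> t)\<bar> + \<bar>(\<eta> * K) * (nrm X (u y t) * \<omega> t)\<bar>\<bar> +
        \<bar>\<bar>\<bar>W * ?P x t\<bar> + \<bar>W * ?P y t\<bar>\<bar> + \<bar>W * ?c t\<bar>\<bar>"
      have d0: "d' x y \<ge> 0" unfolding d'_def
        by (intro sum_nonneg nrm_nonneg[OF nY] car_diff[OF nY] mY x y)
      have P0: "?P x t \<ge> 0" for x t using V0 by (intro sum_nonneg) auto
      have cL: "Lp_le M p ?c (d' x y * l)"
        unfolding l_def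
        by (rule Lp_le_extend[OF Lp_le_const[OF p1 emeasure_bounded_set[OF SRs]]]) (use R d0 I_sets SRs in \<open>auto simp: SR_def\<close>)
      have PL: "Lp_le M p (?P z) (2 * h * (A' / w))" if "z \<in> B" for z
        using Lp_le_restrict[of UNIV p _ _ I] cellL[OF that] I_sets by (simp add: lebesgue_on_UNIV_eq)
      have uL: "Lp_le M p (\<lambda>t. (\<eta> * K) * (nrm X (u z t) * \<omega> t)) (e/4)" if z: "z \<in> B" for z
      proof (rule Lp_le_mono[OF Lp_le_scale[OF Lp_fun_Lp_le[OF nX \<omega> u(1)[OF z]]] _ p1])
        have "\<bar>\<eta> * K\<bar> * lpn p I \<omega> X (u z) \<le> (\<eta> * K) * A'"
          using \<eta> K u(2)[OF z] A' by (intro mult_mono) (auto simp: lpn_nonneg)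
        also have "\<dots> = e/4" using K A' by (simp add: \<eta>_def)
        finally show "\<bar>\<eta> * K\<bar> * lpn p I \<omega> X (u z) \<le> e/4" .
        show "(\<lambda>t. (\<eta> * K) * (nrm X (u z t) * \<omega> t)) \<in> borel_measurable M"
          using weighted_nrm_measurable[OF nX I_sets Lp_fun_strongly_measurable[OF u(1)[OF z]] \<omega>] by simp
      qed simp
      have FL: "Lp_le M p ?F ((e/4 + e/4) + ((\<bar>W\<bar> * (2 * h * (A' / w)) + \<bar>W\<bar> * (2 * h * (A' / w))) + \<bar>W\<bar> * (d' x y * l)))"
        by (intro Lp_le_add Lp_le_scale uL PL cL x y p1)
      have dm: "strongly_measurable I Y (\<lambda>t. u x t - u y t)" by (rule strongly_measurable_diff[OF nY usY[OF x] usY[OF y]])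
      have "Lp_le M p (\<lambda>t. nrm Y (u x t - u y t) * \<omega>' t) (e + W * l * d' x y)"
      proof (rule Lp_le_mono[OF FL weighted_nrm_measurable[OF nY I_sets dm \<omega>'] p1])
        show "(e/4 + e/4) + ((\<bar>W\<bar> * (2 * h * (A' / w)) + \<bar>W\<bar> * (2 * h * (A' / w))) + \<bar>W\<bar> * (d' x y * l)) \<le> e + W * l * d' x y"
        proof -
          have eqs: "\<bar>W\<bar> = W" "W * (d' x y * l) = W * l * d' x y" using W(1) by simp_all
          have "q \<le> e/4 \<Longrightarrow> e/4 + e/4 + (q + q + r) \<le> e + r" for q r :: real by linarith
          from this[OF hW] show ?thesis unfolding eqs .
        qed
        have "AE t in lebesgue. t \<in> I \<longrightarrow> \<bar>nrm Y (u x t - u y t) * \<omega>' t\<bar> \<le> \<bar>?F t\<bar>"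
          using near'[OF x] near'[OF y] cover
        proof eventually_elim
          fix t assume nx: "\<forall>i\<in>S. t \<in> O' i \<longrightarrow> nrm Y (u x t - m i x) \<le> V x i"
            and ny: "\<forall>i\<in>S. t \<in> O' i \<longrightarrow> nrm Y (u y t - m i y) \<le> V y i" and cv: "t \<in> SR \<longrightarrow> (\<exists>i\<in>S. t \<in> O' i)"
          show "t \<in> I \<longrightarrow> \<bar>nrm Y (u x t - u y t) * \<omega>' t\<bar> \<le> \<bar>?F t\<bar>"
          proof
            assume tI: "t \<in> I"
            have cx: "u x t \<in> car Y" "u y t \<in> car Y" using uY x y tI by auto
            have nn: "0 \<le> nrm Y (u x t - u y t)" by (rule nrm_nonneg[OF nY car_diff[OF nY cx]])
            have wp: "0 < \<omega>' t" "0 < \<omega> t" using weight_pos \<omega> \<omega>' by auto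
            have xX: "u x t \<in> car X" "u y t \<in> car X" using Lp_fun_car[OF u(1)] x y tI by auto
            have uX: "0 \<le> nrm X (u x t)" "0 \<le> nrm X (u y t)" using nrm_nonneg[OF nX] xX by auto
            have "nrm Y (u x t - u y t) * \<omega>' t \<le> ?F t"
            proof (cases "t \<in> SR")
              case False
              then have "\<bar>t\<bar> > R" using tI by (auto simp: SR_def abs_if)
              then have wt: "\<omega>' t \<le> \<eta> * \<omega> t" by (rule R(2))
              have "nrm Y (u x t - u y t) \<le> nrm Y (u x t) + nrm Y (u y t)" by (rule nrm_triangle_sub[OF nY cx])
              also have "\<dots> \<le> K * nrm X (u x t) + K * nrm X (u y t)" by (intro add_mono K xX)
              finally have "nrm Y (u x t - u y t) * \<omega>' t \<le> (K * nrm X (u x t) + K * nrm X (u y t)) * (\<eta> * \<omega> t)"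
                using wt wp uX K by (intro mult_mono) auto
              then show ?thesis using False \<eta> K wp uX by (simp add: algebra_simps)
            next
              case True
              then obtain i where i: "i \<in> S" "t \<in> O' i" using cv by blast
              have mm: "m i x \<in> car Y" "m i y \<in> car Y" using mY i x y by auto
              have Pi: "?P z t = V z i" for z
              proof -
                have ind: "t \<notin> O' j" if "j \<noteq> i" for j using disj[OF _ i(2)] that by blast
                have "?P z t = (\<Sum>j\<in>S. if j = i then V z i else 0)"
                  by (rule sum.cong[OF refl]) (use ind i(2) in simp)
                then show ?thesis using S i by simp
              qed
              have "nrm Y (m i x - m i y) \<le> d' x y"
                unfolding d'_def by (rule member_le_sum[OF i(1)]) (use S mY x y car_diff[OF nY] nrm_nonneg[OF nY] in auto)
              moreover have "nrm Y (u x t - u y t) \<le> nrm Y (u x t - m i x) + (nrm Y (m i x - m i y) + nrm Y (m i y - u y t))"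
                using nrm_diff_triangle[OF nY cx(1) mm(1) cx(2)] nrm_diff_triangle[OF nY mm cx(2)] by linarith
              moreover have "nrm Y (m i y - u y t) = nrm Y (u y t - m i y)" by (rule nrm_minus_commute[OF nY mm(2) cx(2)])
              ultimately have "nrm Y (u x t - u y t) \<le> V x i + V y i + d' x y"
                using nx ny i by fastforce
              then have "nrm Y (u x t - u y t) * \<omega>' t \<le> (V x i + V y i + d' x y) * W"
                using wp W True V0 d0 by (intro mult_mono) (auto simp: SR_def)
              also have "\<dots> = W * ?P x t + W * ?P y t + W * ?c t" using True Pi by (simp add: algebra_simps)
              finally show ?thesis by linarith
            qed
            note le = this
            have "\<bar>nrm Y (u x t - u y t) * \<omega>' t\<bar> = nrm Y (u x t - u y t) * \<omega>' t"
              using nn wp by (intro abs_of_nonneg mult_nonneg_nonneg) auto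
            from order_trans[OF order_trans[OF eq_refl[OF this] le] abs_ge_self]
            show "\<bar>nrm Y (u x t - u y t) * \<omega>' t\<bar> \<le> \<bar>?F t\<bar>" .
          qed
        qed
        then show "AE t in M. \<bar>nrm Y (u x t - u y t) * \<omega>' t\<bar> \<le> \<bar>?F t\<bar>" using I_sets by (simp add: AE_restrict_space_iff)
      qed
      then show ?thesis using Lp_funI(2)[OF nY \<omega>' dm] by blast
    qed
    then show "\<exists>d'. tot_bounded B d' \<and> (\<exists>c>0. \<forall>x\<in>B. \<forall>y\<in>B. lpn p I \<omega>' Y (\<lambda>t. u x t - u y t) \<le> e + c * d' x y)"
      using tb' W l by (intro exI[of _ d'] exI[of _ "W * l"] conjI ballI) simp_all
  qed
qed

section \<open>The Sobolev scale\<close>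

text \<open>The data of the theorem with the hypotheses in the form in which the estimates use them: inclusions
  by their constants, density by norms, and the growth of the weights by two inequalities.\<close>

locale Sobolev_setting = Lp_setting I p for I and p +
  fixes E :: "nat \<Rightarrow> 'v::real_vector nspace" and \<omega> :: "nat \<Rightarrow> real \<Rightarrow> real"
  assumes E_banach: "banach_space (E n)"
    and E_embeds: "m \<le> n \<Longrightarrow> \<exists>K. embeds (E n) (E m) K"
    and E_compact: "m < n \<Longrightarrow> compact_inclusion (E n) (E m)"
    and E_dense: "x \<in> car (E m) \<Longrightarrow> r > 0 \<Longrightarrow> \<exists>y\<in>(\<Inter>n. car (E n)). nrm (E m) (x - y) < r"
    and weights: "weight (\<omega> n)"
    and weights_mono: "m \<le> n \<Longrightarrow> \<exists>C\<ge>0. \<forall>t. \<omega> m t \<le> C * \<omega> n t"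
    and weights_decay: "m < n \<Longrightarrow> e > 0 \<Longrightarrow> \<exists>R. \<forall>t. \<bar>t\<bar> > R \<longrightarrow> \<omega> m t \<le> e * \<omega> n t"
begin

lemma E_normed: "normed_space (E n)"
  using E_banach[of n] by (simp add: banach_space_def)

lemma E_sub: "m \<le> n \<Longrightarrow> car (E n) \<subseteq> car (E m)"
  using E_embeds[of m n] by (auto simp: embeds_def)

abbreviation "S n \<equiv> Sobolev_space n p I (\<omega> n) E"

text \<open>An element of the Sobolev space, presented by representatives of all its derivatives.\<close>

definition jet :: "nat \<Rightarrow> (nat \<Rightarrow> real \<Rightarrow> 'v) \<Rightarrow> bool" where
  "jet n U \<longleftrightarrow> (\<forall>k\<le>n. Lp_fun p I (\<omega> n) (E (n - k)) (U k) \<and> wder I k (E (n - k)) (U 0) (U k))"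

lemma jetD:
  assumes "jet n U" "k \<le> n"
  shows "Lp_fun p I (\<omega> n) (E (n - k)) (U k)" "wder I k (E (n - k)) (U 0) (U k)"
  using assms by (auto simp: jet_def)

lemma wder_0:
  assumes u: "Lp_fun p I (\<omega> n) (E l) u"
  shows "wder I 0 (E l) u u"
  unfolding wder_def
proof
  fix \<phi> assume \<phi>: "\<phi> \<in> test_functions I"
  obtain C where "C \<ge> 0" "\<forall>(X :: 'v nspace) u. normed_space X \<and> Lp_fun p I (\<omega> n) X u \<longrightarrow>
      (\<integral>\<^sup>+t. ennreal (nrm X ((deriv ^^ 0) \<phi> t *\<^sub>R u t)) \<partial>M) \<le> ennreal (C * lpn p I (\<omega> n) X u)"
    and ex: "\<forall>(X :: 'v nspace) u. banach_space X \<and> Lp_fun p I (\<omega> n) X u \<longrightarrow>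
      (\<exists>x. has_bochner_integral_in I X (\<lambda>t. (deriv ^^ 0) \<phi> t *\<^sub>R u t) x)"
    by (rule test_function_pairing[OF \<phi> weights])
  obtain x where "has_bochner_integral_in I (E l) (\<lambda>t. (deriv ^^ 0) \<phi> t *\<^sub>R u t) x"
    using ex[rule_format, OF conjI, OF E_banach u] by blast
  then show "\<exists>x. has_bochner_integral_in I (E l) (\<lambda>t. (deriv ^^ 0) \<phi> t *\<^sub>R u t) x \<and>
    has_bochner_integral_in I (E l) (\<lambda>t. \<phi> t *\<^sub>R u t) ((- 1) ^ 0 *\<^sub>R x)" by auto
qed

lemma jet_weak_derivative:
  assumes U: "jet n U" and k: "k \<le> n"
  shows "weak_derivative I k (E n) (E (n - k)) (U 0) (U k)"
  using jetD[OF U k] jetD(1)[OF U, of 0] Lp_fun_locally_bochner_integrable[OF E_banach weights]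
  by (simp add: weak_derivative_iff_wder)

lemma jet_wderiv:
  assumes U: "jet n U" and k: "k \<le> n"
  shows "wderiv I k (E n) (E (n - k)) (cls I (U 0)) = cls I (U k)"
proof (cases "k = 0")
  case True then show ?thesis by (simp add: wderiv_def)
next
  case False
  have "(THE d. weak_derivative_cls I k (E n) (E (n - k)) (cls I (U 0)) d) = cls I (U k)"
  proof (rule the_equality)
    show "weak_derivative_cls I k (E n) (E (n - k)) (cls I (U 0)) (cls I (U k))"
      unfolding weak_derivative_cls_def using jet_weak_derivative[OF U k] by blast
    fix d assume "weak_derivative_cls I k (E n) (E (n - k)) (cls I (U 0)) d"
    then obtain u v where uv: "cls I (U 0) = cls I u" "d = cls I v" "weak_derivative I k (E n) (E (n - k)) u v"
      unfolding weak_derivative_cls_def by blast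
    have eq: "AE t in M. U 0 t = u t" using uv(1) cls_eq_iff[OF I_sets] by blast
    have u: "u t \<in> car (E (n - k))" if "t \<in> I" for t
      using uv(3) that E_sub[of "n - k" n] by (auto simp: weak_derivative_def locally_bochner_integrable_def)
    have l: "locally_L1 I (E (n - k)) v" "wder I k (E (n - k)) u v"
      using uv(3) locally_bochner_integrable_imp_locally_L1[OF E_normed] by (auto simp: weak_derivative_iff_wder)
    have "AE t in M. U k t = v t"
      by (rule wder_unique[OF E_normed conn jetD(2)[OF U k] l(2) eq u Lp_fun_locally_L1[OF E_banach weights jetD(1)[OF U k]] l(1)])
    then show "d = cls I (U k)" using uv(2) cls_eq_iff[OF I_sets] by metis
  qed
  then show ?thesis using False by (simp add: wderiv_def)
qed

text \<open>Every weak derivative of a class comes with its own representative of the class. Since weak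
  derivatives are unaffected by changes on null sets, one representative \<open>U 0\<close> serves for all of them.\<close>

lemma car_S: "car (S n) = {cls I (U 0) | U. jet n U}"
proof (intro equalityI subsetI)
  fix c assume "c \<in> {cls I (U 0) | U. jet n U}"
  then obtain U where U: "jet n U" "c = cls I (U 0)" by blast
  have "c \<in> car (Lp_space p I (\<omega> n) (E n))" using jetD(1)[OF U(1), of 0] U(2) by (auto simp: car_Lp_space)
  moreover have "\<exists>d\<in>car (Lp_space p I (\<omega> n) (E (n - k))). weak_derivative_cls I k (E n) (E (n - k)) c d" if k: "k \<in> {1..n}" for k
  proof (rule bexI[of _ "cls I (U k)"])
    show "weak_derivative_cls I k (E n) (E (n - k)) c (cls I (U k))"
      unfolding weak_derivative_cls_def using jet_weak_derivative[OF U(1), of k] k U(2) by auto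
    show "cls I (U k) \<in> car (Lp_space p I (\<omega> n) (E (n - k)))"
      using jetD(1)[OF U(1), of k] k by (auto simp: car_Lp_space)
  qed
  ultimately show "c \<in> car (S n)" by (simp add: Sobolev_space_def)
next
  fix c assume c: "c \<in> car (S n)"
  then have "c \<in> car (Lp_space p I (\<omega> n) (E n))" by (simp add: Sobolev_space_def)
  then obtain u where u: "Lp_fun p I (\<omega> n) (E n) u" "c = cls I u" unfolding car_Lp_space by blast
  have "\<exists>v. Lp_fun p I (\<omega> n) (E (n - k)) v \<and> wder I k (E (n - k)) u v" if k: "k \<in> {1..n}" for k
  proof -
    obtain d where d: "d \<in> car (Lp_space p I (\<omega> n) (E (n - k)))" "weak_derivative_cls I k (E n) (E (n - k)) c d"
      using c k unfolding Sobolev_space_def by (simp only: nspace.simps mem_Collect_eq) blast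
    obtain v where v: "Lp_fun p I (\<omega> n) (E (n - k)) v" "d = cls I v" using d(1) unfolding car_Lp_space by blast
    obtain u' v' where uv: "c = cls I u'" "d = cls I v'" "weak_derivative I k (E n) (E (n - k)) u' v'"
      using d(2) unfolding weak_derivative_cls_def by blast
    have eq: "AE t in M. u' t = u t" "AE t in M. v' t = v t"
      using uv u(2) v(2) cls_eq_iff[OF I_sets] by metis+
    have ut: "u t \<in> car (E (n - k))" if "t \<in> I" for t
      using Lp_fun_car[OF u(1) that] E_sub[of "n - k" n] by auto
    have "wder I k (E (n - k)) u v"
      by (rule wder_cong_AE[OF E_normed _ eq(1) ut eq(2) Lp_fun_car[OF v(1)]])
        (use uv(3) in \<open>simp_all add: weak_derivative_iff_wder\<close>)
    then show ?thesis using v(1) by blast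
  qed
  then obtain V where V: "\<And>k. k \<in> {1..n} \<Longrightarrow> Lp_fun p I (\<omega> n) (E (n - k)) (V k) \<and> wder I k (E (n - k)) u (V k)" by metis
  define U where "U k = (if k = 0 then u else V k)" for k
  have "jet n U"
    unfolding jet_def
  proof (intro allI impI)
    fix k assume "k \<le> n"
    then show "Lp_fun p I (\<omega> n) (E (n - k)) (U k) \<and> wder I k (E (n - k)) (U 0) (U k)"
      using V[of k] u(1) wder_0[OF u(1)] by (cases "k = 0") (auto simp: U_def)
  qed
  moreover have "c = cls I (U 0)" using u by (simp add: U_def)
  ultimately show "c \<in> {cls I (U 0) | U. jet n U}" by blast
qed

lemma in_car_S: "jet n U \<Longrightarrow> cls I (U 0) = x \<Longrightarrow> x \<in> car (S n)"
  unfolding car_S by blast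

lemma nrm_S:
  assumes U: "jet n U"
  shows "nrm (S n) (cls I (U 0)) = (\<Sum>k\<le>n. lpn p I (\<omega> n) (E (n - k)) (U k))"
  unfolding Sobolev_space_def
  using jet_wderiv[OF U] by (simp add: atMost_atLeast0 nrm_Lp_space[OF I_sets])

lemma jet_add:
  assumes U: "jet n U" and V: "jet n V"
  shows "jet n (\<lambda>k t. U k t + V k t)"
  unfolding jet_def
  using Lp_fun_add(1)[OF E_normed weights jetD(1)[OF U] jetD(1)[OF V]]
    wder_add[OF E_normed I_sets jetD(2)[OF U] jetD(2)[OF V]] by blast

lemma jet_scale:
  assumes U: "jet n U"
  shows "jet n (\<lambda>k t. c *\<^sub>R U k t)"
  unfolding jet_def
  using Lp_fun_scale_le(1)[OF E_normed weights jetD(1)[OF U]] wder_scale[OF E_normed I_sets jetD(2)[OF U]] by blast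

lemma jet_diff: "jet n U \<Longrightarrow> jet n V \<Longrightarrow> jet n (\<lambda>k t. U k t - V k t)"
  using jet_add[of n U "\<lambda>k t. (-1) *\<^sub>R V k t"] jet_scale[of n V "-1"] by simp

lemma jet_zero: "jet n (\<lambda>k t. 0)"
  unfolding jet_def
proof (intro allI impI conjI)
  fix k
  show "Lp_fun p I (\<omega> n) (E (n - k)) (\<lambda>t. 0)"
    by (rule Lp_fun_dominated(1)[OF E_normed weights strongly_measurable_const[OF E_normed car_zero[OF E_normed]] Lp_le_zero])
      (simp add: nrm_zero[OF E_normed])
  have "has_bochner_integral_in I (E (n - k)) (\<lambda>t. 0 *\<^sub>R 0) (0 *\<^sub>R 0)"
    by (rule has_bochner_integral_in_scaleR_const[OF E_normed I_sets car_zero[OF E_normed] has_bochner_integral_zero])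
  then show "wder I k (E (n - k)) (\<lambda>t. 0) (\<lambda>t. 0)" by (auto simp: wder_def intro!: exI[of _ 0])
qed

lemma nrm_S_diff:
  assumes U: "jet n U" and V: "jet n V"
  shows "nrm (S n) (cls I (U 0) - cls I (V 0)) = (\<Sum>k\<le>n. lpn p I (\<omega> n) (E (n - k)) (\<lambda>t. U k t - V k t))"
  using nrm_S[OF jet_diff[OF U V]] by (simp add: cls_diff)

lemma normed_S: "normed_space (S n)"
  unfolding normed_space_def
proof (intro conjI ballI allI)
  show "subspace (car (S n))"
    unfolding subspace_def
  proof (intro conjI ballI allI)
    show "0 \<in> car (S n)" by (rule in_car_S[OF jet_zero cls_zero[symmetric]])
    fix x assume "x \<in> car (S n)"
    then obtain U where U: "jet n U" "x = cls I (U 0)" unfolding car_S by blast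
    show "c *\<^sub>R x \<in> car (S n)" for c
      unfolding U(2) cls_scale by (rule in_car_S[OF jet_scale[OF U(1)] refl])
    fix y assume "y \<in> car (S n)"
    then obtain V where V: "jet n V" "y = cls I (V 0)" unfolding car_S by blast
    show "x + y \<in> car (S n)"
      unfolding U(2) V(2) cls_add by (rule in_car_S[OF jet_add[OF U(1) V(1)] refl])
  qed
  fix x assume "x \<in> car (S n)"
  then obtain U where U: "jet n U" "x = cls I (U 0)" unfolding car_S by blast
  show "0 \<le> nrm (S n) x" unfolding U(2) nrm_S[OF U(1)] by (intro sum_nonneg lpn_nonneg)
  show "nrm (S n) x = 0 \<longleftrightarrow> x = 0"
  proof
    assume "nrm (S n) x = 0"
    then have "\<forall>k\<in>{..n}. lpn p I (\<omega> n) (E (n - k)) (U k) = 0"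
      unfolding U(2) nrm_S[OF U(1)] by (subst (asm) sum_nonneg_eq_0_iff) (auto simp: lpn_nonneg)
    then have "AE t in M. U 0 t = 0" using lpn_eq_0_iff[OF E_normed weights jetD(1)[OF U(1), of 0]] by force
    then have "cls I (U 0) = cls I (\<lambda>t. 0)" unfolding cls_eq_iff[OF I_sets] .
    then show "x = 0" using U(2) cls_zero[of I] by simp
  next
    assume "x = 0"
    moreover have "nrm (S n) 0 = (\<Sum>k\<le>n. lpn p I (\<omega> n) (E (n - k)) (\<lambda>t. 0))"
      by (subst cls_zero[of I]) (rule nrm_S[OF jet_zero])
    ultimately have "nrm (S n) x = (\<Sum>k\<le>n. lpn p I (\<omega> n) (E (n - k)) (\<lambda>t. 0))" by simp
    then show "nrm (S n) x = 0" using lpn_zero[OF E_normed] by simp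
  qed
  show "nrm (S n) (c *\<^sub>R x) = \<bar>c\<bar> * nrm (S n) x" for c
  proof -
    have "nrm (S n) (c *\<^sub>R x) = (\<Sum>k\<le>n. lpn p I (\<omega> n) (E (n - k)) (\<lambda>t. c *\<^sub>R U k t))"
      unfolding U(2) cls_scale by (rule nrm_S[OF jet_scale[OF U(1)]])
    also have "\<dots> = (\<Sum>k\<le>n. \<bar>c\<bar> * lpn p I (\<omega> n) (E (n - k)) (U k))"
      by (intro sum.cong refl lpn_scale[OF E_normed weights] jetD(1)[OF U(1)]) simp
    finally show ?thesis unfolding U(2) nrm_S[OF U(1)] by (simp add: sum_distrib_left)
  qed
  fix y assume "y \<in> car (S n)"
  then obtain V where V: "jet n V" "y = cls I (V 0)" unfolding car_S by blast
  have "nrm (S n) (x + y) = (\<Sum>k\<le>n. lpn p I (\<omega> n) (E (n - k)) (\<lambda>t. U k t + V k t))"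
    unfolding U(2) V(2) cls_add by (rule nrm_S[OF jet_add[OF U(1) V(1)]])
  also have "\<dots> \<le> (\<Sum>k\<le>n. lpn p I (\<omega> n) (E (n - k)) (U k) + lpn p I (\<omega> n) (E (n - k)) (V k))"
    by (intro sum_mono Lp_fun_add(2)[OF E_normed weights] jetD(1)[OF U(1)] jetD(1)[OF V(1)]) auto
  finally show "nrm (S n) (x + y) \<le> nrm (S n) x + nrm (S n) y"
    unfolding U(2) V(2) nrm_S[OF U(1)] nrm_S[OF V(1)] by (simp add: sum.distrib)
qed

text \<open>The entries of the jets converge separately, and by \<open>wder_limit\<close> the limits again form a jet.\<close>

theorem banach_S: "banach_space (S n)"
proof (rule banach_spaceI[OF normed_S])
  fix s assume s: "\<And>i. s i \<in> car (S n)" and fast: "\<And>i. nrm (S n) (s (Suc i) - s i) \<le> (1/2)^i"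
  have "\<exists>U. jet n U \<and> s i = cls I (U 0)" for i using s[of i] unfolding car_S by blast
  then obtain U where U: "\<And>i. jet n (U i)" "\<And>i. s i = cls I (U i 0)" by metis
  have "\<exists>v. Lp_fun p I (\<omega> n) (E (n - k)) v \<and> (\<lambda>i. lpn p I (\<omega> n) (E (n - k)) (\<lambda>t. U i k t - v t)) \<longlonglongrightarrow> 0" if k: "k \<le> n" for k
  proof (rule Lp_fun_complete[OF E_banach weights jetD(1)[OF U(1) k]])
    fix i
    have "lpn p I (\<omega> n) (E (n - k)) (\<lambda>t. U (Suc i) k t - U i k t)
        \<le> (\<Sum>k\<le>n. lpn p I (\<omega> n) (E (n - k)) (\<lambda>t. U (Suc i) k t - U i k t))"
      using k by (intro member_le_sum[of k "{..n}" "\<lambda>k. lpn p I (\<omega> n) (E (n - k)) (\<lambda>t. U (Suc i) k t - U i k t)"]) (auto simp: lpn_nonneg)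
    also have "\<dots> \<le> (1/2)^i" using fast[of i] unfolding U(2) nrm_S_diff[OF U(1) U(1)] .
    finally show "lpn p I (\<omega> n) (E (n - k)) (\<lambda>t. U (Suc i) k t - U i k t) \<le> (1/2)^i" .
  qed blast
  then have "\<forall>k. \<exists>v. k \<le> n \<longrightarrow> Lp_fun p I (\<omega> n) (E (n - k)) v \<and>
      (\<lambda>i. lpn p I (\<omega> n) (E (n - k)) (\<lambda>t. U i k t - v t)) \<longlonglongrightarrow> 0" by blast
  from choice[OF this] obtain V where V': "\<forall>k. k \<le> n \<longrightarrow> Lp_fun p I (\<omega> n) (E (n - k)) (V k) \<and>
      (\<lambda>i. lpn p I (\<omega> n) (E (n - k)) (\<lambda>t. U i k t - V k t)) \<longlonglongrightarrow> 0" ..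
  have V: "\<And>k. k \<le> n \<Longrightarrow> Lp_fun p I (\<omega> n) (E (n - k)) (V k)"
    "\<And>k. k \<le> n \<Longrightarrow> (\<lambda>i. lpn p I (\<omega> n) (E (n - k)) (\<lambda>t. U i k t - V k t)) \<longlonglongrightarrow> 0" using V' by simp_all
  have jV: "jet n V"
    unfolding jet_def
  proof (intro allI impI conjI V)
    fix k assume k: "k \<le> n"
    obtain K where e: "embeds (E n) (E (n - k)) K" using E_embeds[of "n - k" n] by auto
    show "wder I k (E (n - k)) (V 0) (V k)"
      by (rule wder_limit[OF E_banach[of n] E_banach e weights[of n] _ _ _ jetD(1)[OF U(1) k] V(1)[OF k] V(2)[OF k] jetD(2)[OF U(1) k]])
        (use jetD(1)[OF U(1), of 0] V[of 0] in auto)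
  qed
  have "(\<lambda>i. \<Sum>k\<le>n. lpn p I (\<omega> n) (E (n - k)) (\<lambda>t. U i k t - V k t)) \<longlonglongrightarrow> (\<Sum>k\<le>n. 0)"
    by (intro tendsto_sum V) auto
  then have "(\<lambda>i. nrm (S n) (s i - cls I (V 0))) \<longlonglongrightarrow> 0"
    unfolding U(2) nrm_S_diff[OF U(1) jV] by simp
  then show "\<exists>x\<in>car (S n). (\<lambda>i. nrm (S n) (s i - x)) \<longlonglongrightarrow> 0" using jV unfolding car_S by blast
qed

lemma jet_mono:
  assumes U: "jet n U" and mn: "m \<le> n"
  shows "jet m U"
  unfolding jet_def
proof (intro allI impI conjI)
  fix k assume k: "k \<le> m"
  obtain C where C: "C \<ge> 0" "\<And>t. \<omega> m t \<le> C * \<omega> n t" using weights_mono[OF mn] by blast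
  have "m - k \<le> n - k" using mn by simp
  from E_embeds[OF this] obtain K where K: "embeds (E (n - k)) (E (m - k)) K" by blast
  show "Lp_fun p I (\<omega> m) (E (m - k)) (U k)"
    by (rule Lp_fun_embed(1)[OF E_normed E_normed weights weights K C jetD(1)[OF U]]) (use k mn in simp)
  show "wder I k (E (m - k)) (U 0) (U k)"
    by (rule wder_embed[OF E_normed E_normed I_sets K jetD(2)[OF U]]) (use k mn in simp)
qed

lemma car_S_mono: "m \<le> n \<Longrightarrow> car (S n) \<subseteq> car (S m)"
  unfolding car_S using jet_mono by blast

text \<open>Each entry of order \<open>k \<le> m < n\<close> gains both a level of the scale and a derivative, as the theorem of
  Aubin and Lions requires.\<close>

theorem compact_S:
  assumes mn: "m < n"
  shows "compact_inclusion (S n) (S m)"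
proof (rule compact_inclusionI[OF banach_S car_S_mono])
  show "m \<le> n" using mn by simp
  fix B C assume B: "B \<subseteq> car (S n)" and C: "\<And>x. x \<in> B \<Longrightarrow> nrm (S n) x \<le> C"
  have "\<exists>U. jet n U \<and> x = cls I (U 0)" if "x \<in> B" for x using that B unfolding car_S by blast
  then obtain U where U: "\<And>x. x \<in> B \<Longrightarrow> jet n (U x)" "\<And>x. x \<in> B \<Longrightarrow> x = cls I (U x 0)" by metis
  have bd: "lpn p I (\<omega> n) (E (n - k)) (U x k) \<le> C" if x: "x \<in> B" and k: "k \<le> n" for x k
  proof -
    have "lpn p I (\<omega> n) (E (n - k)) (U x k) \<le> (\<Sum>k\<le>n. lpn p I (\<omega> n) (E (n - k)) (U x k))"
      using k by (intro member_le_sum[of k "{..n}" "\<lambda>k. lpn p I (\<omega> n) (E (n - k)) (U x k)"]) (auto simp: lpn_nonneg)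
    also have "\<dots> \<le> C" using C[OF x] nrm_S[OF U(1)[OF x]] U(2)[OF x] by metis
    finally show ?thesis .
  qed
  have tb: "tot_bounded B (\<lambda>x y. lpn p I (\<omega> m) (E (m - k)) (\<lambda>t. U x k t - U y k t))" if k: "k \<le> m" for k
  proof -
    have kn: "k \<le> n" "Suc k \<le> n" using k mn by auto
    have le: "m - k \<le> n - Suc k" "m - k \<le> n - k" using k mn by auto
    from E_embeds[OF le(1)] obtain K where K: "embeds (E (n - Suc k)) (E (m - k)) K" by blast
    from E_embeds[OF le(2)] obtain K' where K': "embeds (E (n - k)) (E (m - k)) K'" by blast
    have v: "Lp_fun p I (\<omega> n) (E (m - k)) (U x (Suc k))" "lpn p I (\<omega> n) (E (m - k)) (U x (Suc k)) \<le> max C (K * C)" if x: "x \<in> B" for x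
    proof -
      note e = Lp_fun_embed[OF E_normed E_normed weights weights K _ _ jetD(1)[OF U(1)[OF x] kn(2)], of 1]
      show "Lp_fun p I (\<omega> n) (E (m - k)) (U x (Suc k))" using e by simp
      have "lpn p I (\<omega> n) (E (m - k)) (U x (Suc k)) \<le> K * lpn p I (\<omega> n) (E (n - Suc k)) (U x (Suc k))" using e by simp
      also have "\<dots> \<le> K * C" using K by (intro mult_left_mono bd x kn) (simp add: embeds_def)
      finally show "lpn p I (\<omega> n) (E (m - k)) (U x (Suc k)) \<le> max C (K * C)" by simp
    qed
    have weak: "\<exists>z. has_bochner_integral_in I (E (m - k)) (\<lambda>t. deriv \<phi> t *\<^sub>R U x k t) z \<and>
        has_bochner_integral_in I (E (m - k)) (\<lambda>t. \<phi> t *\<^sub>R U x (Suc k) t) (- z)"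
      if x: "x \<in> B" and \<phi>: "\<phi> \<in> test_functions I" for x \<phi>
      by (rule wder_successive[OF E_normed E_normed I_sets K' jetD(2)[OF U(1)[OF x] kn(1)] _ \<phi>])
        (rule wder_embed[OF E_normed E_normed I_sets K jetD(2)[OF U(1)[OF x] kn(2)]])
    show ?thesis
    proof (rule Aubin_Lions[OF E_banach E_banach _ weights weights, of "n - k"])
      show "compact_inclusion (E (n - k)) (E (m - k))" using k mn by (intro E_compact) simp
      show "\<exists>R. \<forall>t. \<bar>t\<bar> > R \<longrightarrow> \<omega> m t \<le> e * \<omega> n t" if "e > 0" for e by (rule weights_decay[OF mn that])
      show "lpn p I (\<omega> n) (E (n - k)) (U x k) \<le> max C (K * C)" if "x \<in> B" for x
        using bd[OF that kn(1)] by simp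
    qed (use v weak jetD(1)[OF U(1) kn(1)] in blast)+
  qed
  have "tot_bounded B (\<lambda>x y. \<Sum>k\<le>m. lpn p I (\<omega> m) (E (m - k)) (\<lambda>t. U x k t - U y k t))"
    by (rule tot_bounded_sum) (use tb in auto)
  then show "tot_bounded B (\<lambda>x y. nrm (S m) (x - y))"
  proof (rule tot_bounded_approx[OF exI, OF conjI])
    fix e :: real assume "e > 0"
    have "nrm (S m) (x - y) = (\<Sum>k\<le>m. lpn p I (\<omega> m) (E (m - k)) (\<lambda>t. U x k t - U y k t))" if "x \<in> B" "y \<in> B" for x y
      using nrm_S_diff[OF jet_mono[OF U(1)[OF that(1)]] jet_mono[OF U(1)[OF that(2)]], of m] mn U(2)[OF that(1)] U(2)[OF that(2)]
      by simp
    then show "\<exists>c>0. \<forall>x\<in>B. \<forall>y\<in>B. nrm (S m) (x - y) \<le> e + c * (\<Sum>k\<le>m. lpn p I (\<omega> m) (E (m - k)) (\<lambda>t. U x k t - U y k t))"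
      using \<open>e > 0\<close> by (intro exI[of _ 1]) auto
  qed
qed

end

section \<open>Density\<close>

lemma has_bochner_integral_in_zero:
  assumes "normed_space X" "I \<in> sets lebesgue"
  shows "has_bochner_integral_in I X (\<lambda>t. 0) 0"
  using has_bochner_integral_in_scaleR_const[OF assms car_zero[OF assms(1)] has_bochner_integral_zero] by simp

lemma has_bochner_integral_in_sum:
  assumes X: "normed_space X" and I: "I \<in> sets lebesgue"
    and f: "\<And>a. a \<in> F \<Longrightarrow> has_bochner_integral_in I X (f a) (x a)"
  shows "has_bochner_integral_in I X (\<lambda>t. \<Sum>a\<in>F. f a t) (\<Sum>a\<in>F. x a)"
  using f
  by (induction F rule: infinite_finite_induct)
    (auto intro: has_bochner_integral_in_zero[OF X I] has_bochner_integral_in_add[OF X _ I])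

text \<open>Derivatives of the convolution fall on the smooth factor.\<close>

lemma smooth_convolution:
  fixes g :: "real \<Rightarrow> real"
  assumes f: "smooth_chain f" and g: "continuous_on UNIV g"
  shows "smooth_chain (\<lambda>k x. integral {l..r} (\<lambda>s. f k (x - s) * g s))"
  unfolding smooth_chain_def
proof (intro allI)
  fix k x
  have fc: "continuous_on UNIV (f k)" for k by (rule smooth_chain_continuous[OF f])
  have fd: "((\<lambda>x. f k (x - s)) has_field_derivative f (Suc k) (x - s)) (at x)" for s x
  proof -
    have "((\<lambda>x. x - s) has_field_derivative 1) (at x)" by (auto intro!: derivative_eq_intros)
    from DERIV_chain'[OF this smooth_chainD[OF f, of k "x - s"]] show ?thesis by simp
  qed
  have "((\<lambda>x. integral (cbox l r) (\<lambda>s. f k (x - s) * g s)) has_field_derivative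
      integral (cbox l r) (\<lambda>s. f (Suc k) (x - s) * g s)) (at x within UNIV)"
  proof (rule leibniz_rule_field_derivative)
    show "((\<lambda>x. f k (x - s) * g s) has_field_derivative f (Suc k) (y - s) * g s) (at y within UNIV)" for y s
      using DERIV_cmult_right[OF fd] by simp
    show "(\<lambda>s. f k (y - s) * g s) integrable_on cbox l r" for y
      by (intro integrable_continuous continuous_intros continuous_on_compose2[OF fc] continuous_on_subset[OF g]) auto
    show "continuous_on (UNIV \<times> cbox l r) (\<lambda>(y, s). f (Suc k) (y - s) * g s)"
      unfolding split_beta
      by (intro continuous_intros continuous_on_compose2[OF fc] continuous_on_compose2[OF g]) auto
  qed auto
  then show "((\<lambda>x. integral {l..r} (\<lambda>s. f k (x - s) * g s)) has_real_derivative
      integral {l..r} (\<lambda>s. f (Suc k) (x - s) * g s)) (at x)" by simp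
qed

lemma has_bochner_integral_continuous:
  fixes g :: "real \<Rightarrow> real"
  assumes I: "I \<in> sets lebesgue" and g: "continuous_on UNIV g" and s: "supported_in {a..b} g"
    and sub: "{a..b} \<subseteq> I" "{a..b} \<subseteq> {l..r}"
  shows "has_bochner_integral (lebesgue_on I) g (integral {l..r} g)"
proof (rule has_bochner_integral_compact_support[OF I sub(1) s])
  have "set_integrable lborel {l..r} g"
    by (intro borel_integrable_atLeastAtMost' continuous_on_subset[OF g]) auto
  then have "has_bochner_integral lborel (\<lambda>t. indicator {l..r} t *\<^sub>R g t) (integral {l..r} g)"
    using set_borel_integral_eq_integral(2)[of "{l..r}" g]
    by (simp add: has_bochner_integral_iff set_integrable_def set_lebesgue_integral_def)
  moreover have "(\<lambda>t. indicator {l..r} t *\<^sub>R g t) = (\<lambda>t. g t * indicator {a..b} t)"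
  proof
    fix t show "indicator {l..r} t *\<^sub>R g t = g t * indicator {a..b} t"
      using supported_inD[OF s, of t] sub(2) by (cases "t \<in> {a..b}") auto
  qed
  ultimately show "has_bochner_integral lborel (\<lambda>t. g t * indicator {a..b} t) (integral {l..r} g)" by simp
qed

context Lp_setting
begin

lemma Lp_fun_tail_small:
  assumes X: "normed_space X" and \<omega>: "weight \<omega>" and u: "Lp_fun p I \<omega> X u" and d: "d > 0"
  shows "\<exists>R0. \<forall>R\<ge>R0. Lp_le M p (\<lambda>t. if \<bar>t\<bar> > R then nrm X (u t) * \<omega> t else 0) d"
proof -
  let ?g = "\<lambda>t. nrm X (u t) * \<omega> t"
  note L = Lp_fun_Lp_le[OF X \<omega> u]
  have gm: "?g \<in> borel_measurable M" by (rule Lp_leD(1)[OF L])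
  have cut: "(\<lambda>t. if \<bar>t\<bar> > R then ?g t else 0) \<in> borel_measurable M" for R
  proof -
    have "{t \<in> space M. \<bar>t\<bar> > R} \<in> sets M"
      using I_sets by (auto simp: sets_restrict_space_iff Collect_conj_eq)
    then show ?thesis by (intro measurable_If gm) auto
  qed
  have "\<exists>N::nat. \<forall>i\<ge>N. Lp_le M p (\<lambda>t. if \<bar>t\<bar> > real i then ?g t else 0) d"
  proof (rule Lp_le_dominated[OF cut L p1 _ _ d])
    show "AE t in M. (\<lambda>i. if \<bar>t\<bar> > real i then ?g t else 0) \<longlonglongrightarrow> 0"
    proof (intro AE_I2 tendsto_eventually)
      fix t
      obtain n :: nat where n: "\<bar>t\<bar> \<le> real n" using real_arch_simple by blast
      show "\<forall>\<^sub>F i in sequentially. (if \<bar>t\<bar> > real i then ?g t else 0) = 0"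
        using eventually_ge_at_top[of n] by eventually_elim (use n in auto)
    qed
  qed auto
  then obtain N :: nat where N: "Lp_le M p (\<lambda>t. if \<bar>t\<bar> > real N then ?g t else 0) d" by blast
  have "Lp_le M p (\<lambda>t. if \<bar>t\<bar> > R then ?g t else 0) d" if "R \<ge> real N" for R
    by (rule Lp_le_mono[OF N cut p1 order_refl]) (use that in auto)
  then show ?thesis by blast
qed

text \<open>On bounded sets the weight is bounded below and can be removed.\<close>

lemma Lp_fun_bounded_part:
  assumes X: "normed_space X" and \<omega>: "weight \<omega>" and u: "Lp_fun p I \<omega> X u"
    and J: "J \<in> sets lebesgue" "J \<subseteq> I" "J \<subseteq> {-L..L}" and L: "L > 0"
  shows "\<exists>c. Lp_le (lebesgue_on J) p (\<lambda>t. nrm X (u t)) c" "\<exists>c. Lp_le (lebesgue_on J) 1 (\<lambda>t. nrm X (u t)) c"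
proof -
  obtain w where w: "w > 0" "\<And>t. t \<in> {-L..L} \<Longrightarrow> w \<le> \<omega> t" using weight_bounded_below[OF \<omega>] by blast
  have um: "strongly_measurable J X u"
    by (rule strongly_measurable_mono[OF Lp_fun_strongly_measurable[OF u] J(2) I_sets J(1)])
  note m = borel_measurable_nrm[OF X J(1) um]
  have c: "Lp_le (lebesgue_on J) p (\<lambda>t. nrm X (u t)) (\<bar>1/w\<bar> * lpn p I \<omega> X u)"
  proof (rule Lp_le_mono[OF Lp_le_scale[OF Lp_le_restrict[OF Lp_fun_Lp_le[OF X \<omega> u] J(2) I_sets J(1)], of "1/w"] m p1 order_refl])
    show "AE t in lebesgue_on J. \<bar>nrm X (u t)\<bar> \<le> \<bar>1/w * (nrm X (u t) * \<omega> t)\<bar>"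
      using AE_in_lebesgue_on
    proof eventually_elim
      fix t assume t: "t \<in> J"
      have nn: "0 \<le> nrm X (u t)" by (rule nrm_nonneg[OF X strongly_measurable_car[OF um t]])
      have "w \<le> \<omega> t" using t w(2) J(3) by blast
      then have "nrm X (u t) * w \<le> nrm X (u t) * \<omega> t" using nn by (rule mult_left_mono)
      then show "\<bar>nrm X (u t)\<bar> \<le> \<bar>1/w * (nrm X (u t) * \<omega> t)\<bar>"
        using w(1) nn weight_pos[OF \<omega>, of t] by (simp add: field_simps abs_mult)
    qed
  qed
  then show "\<exists>c. Lp_le (lebesgue_on J) p (\<lambda>t. nrm X (u t)) c" by blast
  have nn: "0 \<le> nrm X (u t)" if "t \<in> J" for t by (rule nrm_nonneg[OF X strongly_measurable_car[OF um that]])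
  have "(\<integral>\<^sup>+t. ennreal (nrm X (u t)) \<partial>lebesgue_on J) = (\<integral>\<^sup>+t. ennreal \<bar>nrm X (u t)\<bar> \<partial>lebesgue_on J)"
    using nn by (intro nn_integral_cong) auto
  also have "\<dots> < \<infinity>"
    by (rule le_less_trans[OF Lp_le_imp_L1[OF c p1 emeasure_bounded_set[OF J(1,3) L]]]) (use L in auto)
  finally show "\<exists>c. Lp_le (lebesgue_on J) 1 (\<lambda>t. nrm X (u t)) c"
    by (intro Lp_le_1_exists m) (use nn in auto)
qed

end

context Sobolev_setting
begin

text \<open>Smooth functions with compact support and finite-dimensional range in the intersection of the
  scale lie in every Sobolev space: integration by parts reduces to the scalar case.\<close>

lemma smooth_jet_single:
  assumes ne: "interior I \<noteq> {}" and e: "e \<in> car (E n)" "\<And>k. k \<le> n \<Longrightarrow> e \<in> car (E (n - k))"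
    and f: "smooth_chain f" "supported_in {l..r} (f 0)"
  shows "jet n (\<lambda>k t. f k t *\<^sub>R e)"
  unfolding jet_def
proof (intro allI impI conjI)
  fix k assume k: "k \<le> n"
  let ?X = "E (n - k)"
  note s = smooth_chain_supported[OF f, of k]
  obtain C where C: "C > 0" "\<And>t. \<bar>f k t\<bar> \<le> C" using smooth_chain_bounded[OF f, of k] by blast
  obtain W where W: "W > 0" "\<And>t. t \<in> {l..r} \<Longrightarrow> \<omega> n t \<le> W" using weight_bounded_above[OF weights[of n]] by blast
  define J where "J = I \<inter> {l..r}"
  define L where "L = \<bar>l\<bar> + \<bar>r\<bar> + 1"
  have J: "J \<in> sets lebesgue" "J \<subseteq> {-L..L}" "J \<subseteq> I" using I_sets by (auto simp: J_def L_def)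
  have L: "L > 0" by (simp add: L_def)
  have nn: "0 \<le> nrm ?X e" by (rule nrm_nonneg[OF E_normed e(2)[OF k]])
  have g: "Lp_le M p (\<lambda>t. if t \<in> J then C * nrm ?X e * W else 0) (C * nrm ?X e * W * (2 * L) powr (1/p))"
    by (rule Lp_le_extend[OF Lp_le_const[OF p1 emeasure_bounded_set[OF J(1,2) L]] J(3) I_sets J(1)]) (use L C W nn in auto)
  have sm: "strongly_measurable I ?X (\<lambda>t. f k t *\<^sub>R e)"
    by (rule strongly_measurable_scale[OF E_normed strongly_measurable_const[OF E_normed e(2)[OF k]] smooth_chain_measurable(2)[OF f(1)]])
  show "Lp_fun p I (\<omega> n) ?X (\<lambda>t. f k t *\<^sub>R e)"
  proof (rule Lp_fun_dominated(1)[OF E_normed weights sm g])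
    fix t assume t: "t \<in> I"
    show "nrm ?X (f k t *\<^sub>R e) * \<omega> n t \<le> (if t \<in> J then C * nrm ?X e * W else 0)"
    proof (cases "t \<in> {l..r}")
      case True
      have "nrm ?X (f k t *\<^sub>R e) * \<omega> n t = (\<bar>f k t\<bar> * nrm ?X e) * \<omega> n t" using nrm_scale[OF E_normed e(2)[OF k]] by simp
      also have "\<dots> \<le> (C * nrm ?X e) * W"
        using C W True nn weight_pos[OF weights[of n], of t] by (intro mult_mono) auto
      finally show ?thesis using True t by (simp add: J_def)
    next
      case False
      then show ?thesis using supported_inD[OF s False] nrm_zero[OF E_normed] by (auto simp: J_def)
    qed
  qed
  show "wder I k ?X (\<lambda>t. f 0 t *\<^sub>R e) (\<lambda>t. f k t *\<^sub>R e)"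
    unfolding wder_def
  proof
    fix \<phi> assume \<phi>: "\<phi> \<in> test_functions I"
    obtain a b where ab: "smooth_chain (\<lambda>k. (deriv ^^ k) \<phi>)" "supported_in {a..b} \<phi>" "a \<le> b" "{a..b} \<subseteq> interior I"
      using test_functionsE[OF \<phi> conn ne] by blast
    have abI: "{a..b} \<subseteq> I" using ab(4) interior_subset by blast
    obtain q where q: "has_bochner_integral M (\<lambda>t. (deriv ^^ k) \<phi> t * f 0 t) q"
      "has_bochner_integral M (\<lambda>t. (deriv ^^ 0) \<phi> t * f k t) ((- 1) ^ k * q)"
      using integration_by_parts_smooth[OF I_sets ab(3) abI f(1) ab(1), of k] ab(2) by auto
    show "\<exists>x. has_bochner_integral_in I ?X (\<lambda>t. (deriv ^^ k) \<phi> t *\<^sub>R f 0 t *\<^sub>R e) x \<and>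
        has_bochner_integral_in I ?X (\<lambda>t. \<phi> t *\<^sub>R f k t *\<^sub>R e) ((- 1) ^ k *\<^sub>R x)"
      using has_bochner_integral_in_scaleR_const[OF E_normed I_sets e(2)[OF k] q(1)]
        has_bochner_integral_in_scaleR_const[OF E_normed I_sets e(2)[OF k] q(2)]
      by (intro exI[of _ "q *\<^sub>R e"]) simp
  qed
qed

lemma jet_sum:
  assumes "\<And>a. a \<in> F \<Longrightarrow> jet n (f a)"
  shows "jet n (\<lambda>k t. \<Sum>a\<in>F. f a k t)"
  using assms
  by (induction F rule: infinite_finite_induct) (auto intro: jet_zero jet_add)

lemma smooth_jet:
  assumes ne: "interior I \<noteq> {}" and b: "\<And>a. a \<in> F \<Longrightarrow> b a \<in> (\<Inter>n. car (E n))"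
    and f: "\<And>a. smooth_chain (f a)" "\<And>a. supported_in {l..r} (f a 0)"
  shows "jet n (\<lambda>k t. \<Sum>a\<in>F. f a k t *\<^sub>R b a)"
  by (intro jet_sum smooth_jet_single[OF ne _ _ f]) (use b in auto)

lemma uniform_embedding:
  obtains K where "K > 0" "\<And>i k. i \<le> m \<Longrightarrow> k \<le> i \<Longrightarrow> embeds (E i) (E k) K"
proof -
  have "\<forall>i k. \<exists>K. k \<le> i \<longrightarrow> embeds (E i) (E k) K" using E_embeds by blast
  then obtain K where K: "\<And>i k. k \<le> i \<Longrightarrow> embeds (E i) (E k) (K i k)" by metis
  define Q where "Q = 1 + (\<Sum>i\<le>m. \<Sum>k\<le>m. \<bar>K i k\<bar>)"
  have "\<bar>K i k\<bar> \<le> Q" if "i \<le> m" "k \<le> m" for i k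
  proof -
    have "\<bar>K i k\<bar> \<le> (\<Sum>k\<le>m. \<bar>K i k\<bar>)" using that by (intro member_le_sum[of k "{..m}" "\<lambda>k. \<bar>K i k\<bar>"]) auto
    also have "\<dots> \<le> (\<Sum>i\<le>m. \<Sum>k\<le>m. \<bar>K i k\<bar>)"
      using that by (intro member_le_sum[of i "{..m}" "\<lambda>i. \<Sum>k\<le>m. \<bar>K i k\<bar>"]) (auto intro: sum_nonneg)
    finally show ?thesis by (simp add: Q_def)
  qed
  moreover have "Q > 0" unfolding Q_def by (intro add_pos_nonneg sum_nonneg) auto
  moreover have "embeds (E i) (E k) Q" if "k \<le> i" "\<bar>K i k\<bar> \<le> Q" for i k
    unfolding embeds_def
  proof (intro conjI ballI)
    show "0 \<le> Q" using that(2) by linarith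
    fix x assume x: "x \<in> car (E i)"
    show "x \<in> car (E k)" using x K[OF that(1)] by (auto simp: embeds_def)
    have "nrm (E k) x \<le> K i k * nrm (E i) x" using x K[OF that(1)] by (auto simp: embeds_def)
    also have "\<dots> \<le> Q * nrm (E i) x" using that(2) nrm_nonneg[OF E_normed x] by (intro mult_right_mono) auto
    finally show "nrm (E k) x \<le> Q * nrm (E i) x" .
  qed
  ultimately show thesis using that[of Q] by (meson le_trans)
qed

text \<open>Approximation on bounded sets, of all derivatives at once. The approximants are mollifications
  of a function \<open>\<sigma>\<close> with finite-dimensional range close to \<open>U 0\<close>, pulled back by a dilation that maps
  \<open>I\<close> into its interior. Since the mollifier at each dilated point is a test function, all derivatives
  of the mollified \<open>U 0\<close> are mollifications of the weak derivatives \<open>U i\<close>; after the scale of the mollifier has been fixed, passing from \<open>U 0\<close> to \<open>\<sigma>\<close> only costs a constant times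
  the distance in \<open>L\<^sup>1\<close>.\<close>

theorem jet_local_approx:
  assumes ne: "interior I \<noteq> {}" and U: "jet m U" and \<rho>: "\<rho> > 0" and d: "d > 0"
  obtains F :: "'v set" and b :: "'v \<Rightarrow> 'v" and \<psi> :: "'v \<Rightarrow> nat \<Rightarrow> real \<Rightarrow> real" where
    "finite F" "\<And>a. a \<in> F \<Longrightarrow> b a \<in> (\<Inter>n. car (E n))" "\<And>a. smooth_chain (\<psi> a)"
    "\<And>i. i \<le> m \<Longrightarrow> Lp_le (lebesgue_on (I \<inter> {-\<rho>..\<rho>})) p (\<lambda>t. nrm (E (m - i)) (U i t - (\<Sum>a\<in>F. \<psi> a i t *\<^sub>R b a))) d"
proof -
  obtain c0 where c0: "c0 \<in> interior I" using ne by blast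
  obtain r where r: "r > 0" "cball c0 r \<subseteq> interior I" using c0 open_contains_cball[of "interior I"] by auto
  have Iconv: "convex I" using conn is_interval_connected_1 is_interval_convex by blast
  define q where "q = r + \<bar>c0\<bar> + \<rho>"
  have q: "q > 0" using r \<rho> by (simp add: q_def)
  define L where "L = q + 1"
  have L: "L > 0" using q by (simp add: L_def)
  define J where "J = I \<inter> {-\<rho>..\<rho>}"
  define K where "K = I \<inter> {-L..L}"
  have Js: "J \<in> sets lebesgue" and Ks: "K \<in> sets lebesgue" using I_sets by (auto simp: J_def K_def)
  have JK: "J \<subseteq> K" "J \<subseteq> I" "K \<subseteq> I" "K \<subseteq> {-L..L}" "J \<subseteq> {-L..L}"
    using r by (auto simp: J_def K_def L_def q_def)
  obtain Q where Q: "Q > 0" "\<And>i k. i \<le> m \<Longrightarrow> k \<le> i \<Longrightarrow> embeds (E i) (E k) Q" using uniform_embedding[of m] by blast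
  \<comment> \<open>The error \<open>d\<close> is spent on \<open>2 * d1\<close> for mollifying, \<open>d1\<close> for the factors of the dilation, and \<open>d/6\<close> for \<open>\<sigma>\<close>.\<close>
  define d1 where "d1 = d/6"
  have d1: "d1 > 0" using d by (simp add: d1_def)
  define l where "l = (2 * L) powr (1/p)"
  have l: "l > 0" using L by (simp add: l_def)
  have Uc: "U i t \<in> car (E (m - i))" if "i \<le> m" "t \<in> I" for i t by (rule Lp_fun_car[OF jetD(1)[OF U that(1)] that(2)])
  have UK: "strongly_measurable K (E (m - i)) (U i)" if "i \<le> m" for i
    by (rule strongly_measurable_mono[OF Lp_fun_strongly_measurable[OF jetD(1)[OF U that]] JK(3) I_sets Ks])
  \<comment> \<open>The conclusion of \<open>mollification\<close> for \<open>U i\<close>, named in order to choose one \<open>\<eta>\<close> for all \<open>i \<le> m\<close>.\<close>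
  define good where "good i \<eta> \<longleftrightarrow> (\<forall>\<epsilon> a b. 0 < \<epsilon> \<longrightarrow> \<epsilon> \<le> \<eta> \<longrightarrow> 1/2 \<le> a \<longrightarrow> (\<forall>t\<in>J. \<bar>a * t + b - t\<bar> \<le> \<eta>) \<longrightarrow>
      (\<exists>g. Lp_le (lebesgue_on J) p g d1 \<and> (\<forall>t\<in>J. \<forall>x. {a * t + b - \<epsilon>..a * t + b + \<epsilon>} \<subseteq> K \<longrightarrow>
        has_bochner_integral_in I (E (m - i)) (\<lambda>s. mollifier \<epsilon> 0 (a * t + b - s) *\<^sub>R U i s) x \<longrightarrow>
        nrm (E (m - i)) (x - U i t) \<le> g t)))" for i \<eta>
  have "\<forall>i. \<exists>\<eta>. i \<le> m \<longrightarrow> \<eta> > 0 \<and> good i \<eta>"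
  proof
    fix i
    show "\<exists>\<eta>. i \<le> m \<longrightarrow> \<eta> > 0 \<and> good i \<eta>"
    proof (cases "i \<le> m")
      case True
      obtain c where c: "Lp_le (lebesgue_on K) p (\<lambda>t. nrm (E (m - i)) (U i t)) c"
        using Lp_fun_bounded_part(1)[OF E_normed weights jetD(1)[OF U True] Ks JK(3,4) L] by blast
      show ?thesis
        by (rule mollification[OF E_normed I_sets Ks JK(4) L JK(3) Js JK(1) UK[OF True] Uc[OF True] p1 c d1])
          (unfold good_def, blast+)
    qed blast
  qed
  from choice[OF this] obtain \<eta>f where \<eta>f: "\<forall>i. i \<le> m \<longrightarrow> \<eta>f i > 0 \<and> good i (\<eta>f i)" ..
  define \<eta> where "\<eta> = Min (\<eta>f ` {..m})"
  have \<eta>: "\<eta> > 0" "\<And>i. i \<le> m \<Longrightarrow> \<eta> \<le> \<eta>f i" using \<eta>f by (auto simp: \<eta>_def)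
  have "\<forall>i. \<exists>c. i \<le> m \<longrightarrow> Lp_le (lebesgue_on J) p (\<lambda>t. nrm (E (m - i)) (U i t)) c"
    using Lp_fun_bounded_part(1)[OF E_normed weights jetD(1)[OF U] Js JK(2,5) L] by blast
  from choice[OF this] obtain cf where cf: "\<forall>i. i \<le> m \<longrightarrow> Lp_le (lebesgue_on J) p (\<lambda>t. nrm (E (m - i)) (U i t)) (cf i)" ..
  define c where "c = (\<Sum>i\<le>m. cf i)"
  have cf0: "cf i \<ge> 0" if "i \<le> m" for i using cf that by (auto simp: Lp_le_def)
  have cfc: "cf i \<le> c" if "i \<le> m" for i
    unfolding c_def using that cf0 by (intro member_le_sum[of i "{..m}" cf]) auto
  have c: "c \<ge> 0" unfolding c_def using cf0 by (intro sum_nonneg) auto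
  \<comment> \<open>The dilation \<open>t \<mapsto> (1 - \<theta>) * t + \<theta> * c0\<close> towards the interior point \<open>c0\<close>, and the scale of the
    mollifier, which leaves room inside \<open>I\<close>.\<close>
  define \<theta> where "\<theta> = min (1/2) (min (\<eta>/q) (d1/((real m + 1) * (c + 1))))"
  have \<theta>: "\<theta> > 0" "\<theta> \<le> 1/2" "\<theta> * q \<le> \<eta>" "real m * \<theta> * c \<le> d1"
  proof -
    show "\<theta> > 0" using \<eta> q d1 c by (simp add: \<theta>_def)
    show "\<theta> \<le> 1/2" unfolding \<theta>_def by (rule min.cobounded1)
    have "\<theta> \<le> \<eta>/q" by (simp add: \<theta>_def)
    then show "\<theta> * q \<le> \<eta>" using q by (simp add: field_simps)
    have "\<theta> \<le> d1/((real m + 1) * (c + 1))" by (simp add: \<theta>_def)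
    then have "\<theta> * ((real m + 1) * (c + 1)) \<le> d1" using c by (simp add: pos_le_divide_eq)
    moreover have "real m * \<theta> * c \<le> \<theta> * ((real m + 1) * (c + 1))" using \<open>\<theta> > 0\<close> c by (simp add: algebra_simps)
    ultimately show "real m * \<theta> * c \<le> d1" by simp
  qed
  define la where "la = 1 - \<theta>"
  have la: "1/2 \<le> la" "0 \<le> la" "la \<le> 1" using \<theta> by (auto simp: la_def)
  define \<epsilon> where "\<epsilon> = \<theta> * r / 2"
  have ep: "\<epsilon> > 0" using \<theta> r by (simp add: \<epsilon>_def)
  have "r \<le> q" using \<rho> by (simp add: q_def)
  then have "\<theta> * r \<le> \<theta> * q" using \<theta> by (intro mult_left_mono) auto
  moreover have "\<theta> * r > 0" using \<theta> r by simp
  ultimately have ep\<eta>: "\<epsilon> \<le> \<eta>" using \<theta>(3) unfolding \<epsilon>_def by linarith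
  define \<tau> where "\<tau> t = la * t + \<theta> * c0" for t
  have \<tau>_near: "\<bar>la * t + \<theta> * c0 - t\<bar> \<le> \<eta>" if "t \<in> J" for t
  proof -
    have "la * t + \<theta> * c0 - t = \<theta> * (c0 - t)" by (simp add: la_def algebra_simps)
    moreover have "\<bar>c0 - t\<bar> \<le> q" using that r by (auto simp: J_def q_def)
    ultimately have "\<bar>la * t + \<theta> * c0 - t\<bar> \<le> \<theta> * q" using \<theta>(1) by (simp add: abs_mult)
    then show ?thesis using \<theta>(3) by simp
  qed
  have \<tau>_ball: "ball (\<tau> t) (\<theta> * r) \<subseteq> I" if "t \<in> I" for t
  proof
    fix s assume s: "s \<in> ball (\<tau> t) (\<theta> * r)"
    define z where "z = c0 + (s - \<tau> t) / \<theta>"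
    have "\<bar>s - \<tau> t\<bar> < \<theta> * r" using s by (simp add: dist_real_def abs_minus_commute)
    then have "\<bar>(s - \<tau> t) / \<theta>\<bar> \<le> r" using \<theta>(1) by (simp add: field_simps)
    then have "z \<in> cball c0 r" by (simp add: z_def dist_real_def)
    then have z: "z \<in> I" using r(2) interior_subset by blast
    have "s = la *\<^sub>R t + \<theta> *\<^sub>R z" using \<theta>(1) by (simp add: z_def \<tau>_def field_simps)
    moreover have "la *\<^sub>R t + \<theta> *\<^sub>R z \<in> I"
      using convexD[OF Iconv that z, of la \<theta>] la \<theta> by (simp add: la_def)
    ultimately show "s \<in> I" by simp
  qed
  have \<tau>_int: "{\<tau> t - \<epsilon>..\<tau> t + \<epsilon>} \<subseteq> interior I" if "t \<in> I" for t
  proof -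
    have "\<theta> * r = 2 * \<epsilon>" by (simp add: \<epsilon>_def)
    then have "{\<tau> t - \<epsilon>..\<tau> t + \<epsilon>} \<subseteq> ball (\<tau> t) (\<theta> * r)" using ep by (auto simp: dist_real_def abs_if)
    also have "\<dots> \<subseteq> interior I" by (rule interior_maximal[OF \<tau>_ball[OF that]]) simp
    finally show ?thesis .
  qed
  have \<tau>_K: "{\<tau> t - \<epsilon>..\<tau> t + \<epsilon>} \<subseteq> K" if t: "t \<in> J" for t
  proof -
    have tI: "t \<in> I" "\<bar>t\<bar> \<le> \<rho>" using t by (auto simp: J_def)
    have "\<bar>\<tau> t\<bar> \<le> \<bar>la * t\<bar> + \<bar>\<theta> * c0\<bar>" by (simp add: \<tau>_def abs_triangle_ineq)
    also have "\<dots> \<le> 1 * \<rho> + 1 * \<bar>c0\<bar>" unfolding abs_mult using la \<theta> tI by (intro add_mono mult_mono) auto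
    finally have "\<bar>\<tau> t\<bar> \<le> \<rho> + \<bar>c0\<bar>" by simp
    moreover have "\<epsilon> \<le> r"
    proof -
      have "\<theta> * r \<le> 1 * r" using \<theta>(2) r(1) by (intro mult_right_mono) auto
      then show ?thesis using r(1) \<theta>(1) by (simp add: \<epsilon>_def)
    qed
    ultimately have "{\<tau> t - \<epsilon>..\<tau> t + \<epsilon>} \<subseteq> {-L..L}" by (auto simp: L_def q_def)
    moreover have "{\<tau> t - \<epsilon>..\<tau> t + \<epsilon>} \<subseteq> I" using \<tau>_int[OF tI(1)] interior_subset by blast
    ultimately show ?thesis by (auto simp: K_def)
  qed
  have "\<forall>i. \<exists>g. i \<le> m \<longrightarrow> Lp_le (lebesgue_on J) p g d1 \<and> (\<forall>t\<in>J. \<forall>x. {la * t + \<theta> * c0 - \<epsilon>..la * t + \<theta> * c0 + \<epsilon>} \<subseteq> K \<longrightarrow>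
        has_bochner_integral_in I (E (m - i)) (\<lambda>s. mollifier \<epsilon> 0 (la * t + \<theta> * c0 - s) *\<^sub>R U i s) x \<longrightarrow>
        nrm (E (m - i)) (x - U i t) \<le> g t)"
  proof
    fix i
    show "\<exists>g. i \<le> m \<longrightarrow> Lp_le (lebesgue_on J) p g d1 \<and> (\<forall>t\<in>J. \<forall>x. {la * t + \<theta> * c0 - \<epsilon>..la * t + \<theta> * c0 + \<epsilon>} \<subseteq> K \<longrightarrow>
        has_bochner_integral_in I (E (m - i)) (\<lambda>s. mollifier \<epsilon> 0 (la * t + \<theta> * c0 - s) *\<^sub>R U i s) x \<longrightarrow>
        nrm (E (m - i)) (x - U i t) \<le> g t)"
    proof (cases "i \<le> m")
      case True
      have "good i (\<eta>f i)" using \<eta>f True by blast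
      moreover have "\<epsilon> \<le> \<eta>f i" "\<forall>t\<in>J. \<bar>la * t + \<theta> * c0 - t\<bar> \<le> \<eta>f i"
        using ep\<eta> \<tau>_near \<eta>(2)[OF True] by (auto intro: order_trans)
      ultimately show ?thesis using ep la(1) unfolding good_def by blast
    qed blast
  qed
  from choice[OF this] obtain g where g: "\<forall>i. i \<le> m \<longrightarrow> Lp_le (lebesgue_on J) p (g i) d1 \<and>
      (\<forall>t\<in>J. \<forall>x. {la * t + \<theta> * c0 - \<epsilon>..la * t + \<theta> * c0 + \<epsilon>} \<subseteq> K \<longrightarrow>
        has_bochner_integral_in I (E (m - i)) (\<lambda>s. mollifier \<epsilon> 0 (la * t + \<theta> * c0 - s) *\<^sub>R U i s) x \<longrightarrow>
        nrm (E (m - i)) (x - U i t) \<le> g i t)" ..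
  have gL: "Lp_le (lebesgue_on J) p (g i) d1" if "i \<le> m" for i using g that by blast
  have gt: "nrm (E (m - i)) (x - U i t) \<le> g i t"
    if "i \<le> m" "t \<in> J" "has_bochner_integral_in I (E (m - i)) (\<lambda>s. mollifier \<epsilon> 0 (\<tau> t - s) *\<^sub>R U i s) x" for i t x
    using g that \<tau>_K[OF that(2)] unfolding \<tau>_def by blast
  have "\<forall>i. \<exists>C>0. \<forall>x. \<bar>mollifier \<epsilon> i x\<bar> \<le> C" using mollifier_bounded[OF ep] by metis
  then obtain Cf where Cf: "\<And>i. Cf i > 0" "\<And>i x. \<bar>mollifier \<epsilon> i x\<bar> \<le> Cf i" by metis
  define C where "C = (\<Sum>i\<le>m. Cf i)"
  have C: "C > 0" unfolding C_def by (intro sum_pos Cf) auto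
  have CfC: "\<bar>mollifier \<epsilon> i x\<bar> \<le> C" if "i \<le> m" for i x
  proof -
    have "Cf i \<le> C" unfolding C_def using that Cf(1) by (intro member_le_sum[of i "{..m}" Cf]) (auto intro: less_imp_le)
    then show ?thesis using Cf(2)[of i x] by linarith
  qed
  define d2 where "d2 = d / (6 * (C * Q * l))"
  have d2: "d2 > 0" using d C Q l by (simp add: d2_def)
  obtain cK where cK: "Lp_le (lebesgue_on K) 1 (\<lambda>t. nrm (E m) (U 0 t)) cK"
    using Lp_fun_bounded_part(2)[OF E_normed weights jetD(1)[OF U, of 0] Ks JK(3,4) L] by auto
  have U0K: "strongly_measurable K (E m) (U 0)" using UK[of 0] by simp
  obtain F :: "'v set" and b :: "'v \<Rightarrow> 'v" and h :: "'v \<Rightarrow> real \<Rightarrow> real" where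
    F: "finite F" "\<And>a. a \<in> F \<Longrightarrow> b a \<in> (\<Inter>n. car (E n))" "\<And>a. continuous_on UNIV (h a)"
    "Lp_le (lebesgue_on K) 1 (\<lambda>t. nrm (E m) (U 0 t - (\<Sum>a\<in>F. h a t *\<^sub>R b a))) d2"
  proof (rule Lp_continuous_dense[OF E_normed Ks JK(4) L U0K order_refl cK d2, of "\<Inter>n. car (E n)"])
    show "\<exists>y\<in>(\<Inter>n. car (E n)). nrm (E m) (x - y) < r" if "x \<in> car (E m)" "r > 0" for x r by (rule E_dense[OF that])
    fix F :: "'v set" and b h
    assume H: "finite F" "\<And>a. a \<in> F \<Longrightarrow> b a \<in> (\<Inter>n. car (E n))" "\<And>a. continuous_on UNIV (h a)"
      "\<And>a t. 0 \<le> h a t" "\<And>a t. h a t \<le> (1::real)"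
      "Lp_le (lebesgue_on K) 1 (\<lambda>t. nrm (E m) (U 0 t - (\<Sum>a\<in>F. h a t *\<^sub>R b a))) d2"
    show thesis by (rule that[of F b h]) (fact H)+
  qed auto
  have bE: "b a \<in> car (E n)" if "a \<in> F" for a n using F(2)[OF that] by blast
  define \<sigma> where "\<sigma> s = (\<Sum>a\<in>F. h a s *\<^sub>R b a)" for s
  have \<sigma>c: "\<sigma> s \<in> car (E n)" for s n unfolding \<sigma>_def by (intro car_sum[OF E_normed] car_scale[OF E_normed] bE)
  define \<psi>0 where "\<psi>0 a k x = integral {-L..L} (\<lambda>s. mollifier \<epsilon> k (x - s) * h a s)" for a k x
  define \<psi> where "\<psi> a k t = la ^ k * \<psi>0 a k (la * t + \<theta> * c0)" for a k t
  have \<psi>0s: "smooth_chain (\<psi>0 a)" for a unfolding \<psi>0_def by (rule smooth_convolution[OF smooth_mollifier F(3)])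
  have \<psi>s: "smooth_chain (\<psi> a)" for a unfolding \<psi>_def by (rule smooth_chain_affine[OF \<psi>0s])
  have main: "nrm (E (m - i)) (U i t - (\<Sum>a\<in>F. \<psi> a i t *\<^sub>R b a))
      \<le> \<bar>2 * g i t\<bar> + \<bar>\<bar>(real m * \<theta>) * nrm (E (m - i)) (U i t)\<bar> + \<bar>C * Q * d2\<bar>\<bar>" if i: "i \<le> m" and t: "t \<in> J" for i t
  proof -
    let ?X = "E (m - i)"
    note nX = E_normed[of "m - i"]
    have tI: "t \<in> I" using t JK by blast
    let ?\<phi> = "\<lambda>s. mollifier \<epsilon> 0 (\<tau> t - s)"
    have \<phi>: "?\<phi> \<in> test_functions I" by (rule mollifier_test_function[OF ep \<tau>_int[OF tI]])
    have d\<phi>: "(deriv ^^ i) ?\<phi> = (\<lambda>s. (- 1) ^ i * mollifier \<epsilon> i (\<tau> t - s))"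
      using smooth_chain_iterated_deriv[OF smooth_mollifier_reflected[of \<epsilon> "\<tau> t"], of i] by simp
    have sq: "(- 1 :: real) ^ i * (- 1) ^ i = 1" by (simp flip: power_mult_distrib)
    obtain x0 where x0: "has_bochner_integral_in I ?X (\<lambda>s. (deriv ^^ i) ?\<phi> s *\<^sub>R U 0 s) x0"
      "has_bochner_integral_in I ?X (\<lambda>s. ?\<phi> s *\<^sub>R U i s) ((- 1) ^ i *\<^sub>R x0)"
      by (rule wderE[OF jetD(2)[OF U i] \<phi>])
    define x where "x = (- 1) ^ i *\<^sub>R x0"
    have x1: "has_bochner_integral_in I ?X (\<lambda>s. ?\<phi> s *\<^sub>R U i s) x" using x0(2) by (simp add: x_def)
    have "(\<lambda>s. (- 1) ^ i *\<^sub>R ((deriv ^^ i) ?\<phi> s *\<^sub>R U 0 s)) = (\<lambda>s. mollifier \<epsilon> i (\<tau> t - s) *\<^sub>R U 0 s)"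
      unfolding d\<phi> scaleR_scaleR mult.assoc[symmetric] sq by simp
    then have x2: "has_bochner_integral_in I ?X (\<lambda>s. mollifier \<epsilon> i (\<tau> t - s) *\<^sub>R U 0 s) x"
      using has_bochner_integral_in_scale[OF nX I_sets x0(1), of "(- 1) ^ i"] by (simp add: x_def)
    have xc: "x \<in> car ?X" using x1 by (simp add: has_bochner_integral_in_def)
    have Uic: "U i t \<in> car ?X" by (rule Uc[OF i tI])
    define z where "z = (\<Sum>a\<in>F. \<psi>0 a i (\<tau> t) *\<^sub>R b a)"
    have zc: "z \<in> car ?X" unfolding z_def by (intro car_sum[OF nX] car_scale[OF nX] bE)
    have "has_bochner_integral_in I ?X (\<lambda>s. \<Sum>a\<in>F. (mollifier \<epsilon> i (\<tau> t - s) * h a s) *\<^sub>R b a) z"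
      unfolding z_def \<psi>0_def
    proof (intro has_bochner_integral_in_sum[OF nX I_sets] has_bochner_integral_in_scaleR_const[OF nX I_sets] bE)
      fix a
      show "has_bochner_integral M (\<lambda>s. mollifier \<epsilon> i (\<tau> t - s) * h a s) (integral {-L..L} (\<lambda>s. mollifier \<epsilon> i (\<tau> t - s) * h a s))"
      proof (rule has_bochner_integral_continuous[OF I_sets])
        show "continuous_on UNIV (\<lambda>s. mollifier \<epsilon> i (\<tau> t - s) * h a s)"
          by (intro continuous_intros F(3) continuous_on_compose2[OF smooth_chain_continuous[OF smooth_mollifier, of UNIV]]) auto
        show "supported_in {\<tau> t - \<epsilon>..\<tau> t + \<epsilon>} (\<lambda>s. mollifier \<epsilon> i (\<tau> t - s) * h a s)"
          unfolding supported_in_def using mollifier_zero[OF ep] by force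
      qed (rule order_trans[OF \<tau>_K[OF t] JK(3)], rule order_trans[OF \<tau>_K[OF t] JK(4)])
    qed
    moreover have "(\<lambda>s. \<Sum>a\<in>F. (mollifier \<epsilon> i (\<tau> t - s) * h a s) *\<^sub>R b a) = (\<lambda>s. mollifier \<epsilon> i (\<tau> t - s) *\<^sub>R \<sigma> s)"
      by (simp add: \<sigma>_def scaleR_sum_right)
    ultimately have z1: "has_bochner_integral_in I ?X (\<lambda>s. mollifier \<epsilon> i (\<tau> t - s) *\<^sub>R \<sigma> s) z" by simp
    have xz: "nrm ?X (x - z) \<le> C * Q * d2"
    proof -
      have "has_bochner_integral_in I ?X (\<lambda>s. mollifier \<epsilon> i (\<tau> t - s) *\<^sub>R U 0 s - mollifier \<epsilon> i (\<tau> t - s) *\<^sub>R \<sigma> s) (x - z)"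
        by (rule has_bochner_integral_in_diff[OF nX x2 I_sets z1])
      from has_bochner_integral_in_norm_bound[OF nX I_sets this]
      have "ennreal (nrm ?X (x - z)) \<le> (\<integral>\<^sup>+s. ennreal (nrm ?X (mollifier \<epsilon> i (\<tau> t - s) *\<^sub>R U 0 s - mollifier \<epsilon> i (\<tau> t - s) *\<^sub>R \<sigma> s)) \<partial>M)" .
      also have "\<dots> = (\<integral>\<^sup>+s. ennreal (nrm ?X (mollifier \<epsilon> i (\<tau> t - s) *\<^sub>R U 0 s - mollifier \<epsilon> i (\<tau> t - s) *\<^sub>R \<sigma> s)) * indicator I s \<partial>lebesgue)"
        using I_sets by (subst nn_integral_restrict_space) auto
      also have "\<dots> \<le> (\<integral>\<^sup>+s. (ennreal (C * Q) * ennreal (\<bar>nrm (E m) (U 0 s - \<sigma> s)\<bar> powr 1)) * indicator K s \<partial>lebesgue)"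
      proof (intro nn_integral_mono)
        fix s
        show "ennreal (nrm ?X (mollifier \<epsilon> i (\<tau> t - s) *\<^sub>R U 0 s - mollifier \<epsilon> i (\<tau> t - s) *\<^sub>R \<sigma> s)) * indicator I s
          \<le> (ennreal (C * Q) * ennreal (\<bar>nrm (E m) (U 0 s - \<sigma> s)\<bar> powr 1)) * indicator K s"
        proof (cases "s \<in> I")
          case sI: True
          have Us: "U 0 s - \<sigma> s \<in> car (E m)" using Uc[of 0 s] sI \<sigma>c car_diff[OF E_normed] by simp
          have emb: "embeds (E m) ?X Q" by (rule Q(2)) auto
          have Us': "U 0 s - \<sigma> s \<in> car ?X" "nrm ?X (U 0 s - \<sigma> s) \<le> Q * nrm (E m) (U 0 s - \<sigma> s)"
            using emb Us by (auto simp: embeds_def)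
          have eq: "nrm ?X (mollifier \<epsilon> i (\<tau> t - s) *\<^sub>R U 0 s - mollifier \<epsilon> i (\<tau> t - s) *\<^sub>R \<sigma> s)
              = \<bar>mollifier \<epsilon> i (\<tau> t - s)\<bar> * nrm ?X (U 0 s - \<sigma> s)"
            using nrm_scale[OF nX Us'(1)] by (simp flip: scaleR_diff_right)
          show ?thesis
          proof (cases "s \<in> K")
            case True
            have n0: "0 \<le> nrm (E m) (U 0 s - \<sigma> s)" by (rule nrm_nonneg[OF E_normed Us])
            have "\<bar>mollifier \<epsilon> i (\<tau> t - s)\<bar> * nrm ?X (U 0 s - \<sigma> s) \<le> C * (Q * nrm (E m) (U 0 s - \<sigma> s))"
              using CfC[OF i] Us' nrm_nonneg[OF nX Us'(1)] C by (intro mult_mono) auto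
            then have "ennreal (nrm ?X (mollifier \<epsilon> i (\<tau> t - s) *\<^sub>R U 0 s - mollifier \<epsilon> i (\<tau> t - s) *\<^sub>R \<sigma> s))
                \<le> ennreal ((C * Q) * (\<bar>nrm (E m) (U 0 s - \<sigma> s)\<bar> powr 1))"
              unfolding eq using n0 by (intro ennreal_leI) (simp add: mult.assoc)
            also have "\<dots> = ennreal (C * Q) * ennreal (\<bar>nrm (E m) (U 0 s - \<sigma> s)\<bar> powr 1)"
              by (rule ennreal_mult) (use C Q in auto)
            finally show ?thesis using True sI by simp
          next
            case False
            then have "s \<notin> {\<tau> t - \<epsilon>..\<tau> t + \<epsilon>}" using \<tau>_K[OF t] by blast
            then have "mollifier \<epsilon> i (\<tau> t - s) = 0" by (intro mollifier_zero[OF ep]) auto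
            then show ?thesis unfolding eq by simp
          qed
        qed simp
      qed
      also have "\<dots> = ennreal (C * Q) * (\<integral>\<^sup>+s. ennreal (\<bar>nrm (E m) (U 0 s - \<sigma> s)\<bar> powr 1) \<partial>lebesgue_on K)"
        using Ks Lp_leD(1)[OF F(4)] unfolding \<sigma>_def[symmetric]
        by (subst nn_integral_cmult[symmetric]) (auto simp: nn_integral_restrict_space)
      also have "\<dots> \<le> ennreal (C * Q) * ennreal (d2 powr 1)"
        using Lp_leD(3)[OF F(4)] unfolding \<sigma>_def by (intro mult_left_mono) auto
      also have "\<dots> = ennreal (C * Q * d2)" using C Q d2 by (simp flip: ennreal_mult)
      finally show ?thesis by (subst (asm) ennreal_le_iff) (use C Q d2 in auto)
    qed
    \<comment> \<open>Differentiating along the dilation produces the factor \<open>la ^ i\<close>, which is close to 1.\<close>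
    have V: "(\<Sum>a\<in>F. \<psi> a i t *\<^sub>R b a) = la ^ i *\<^sub>R z"
      by (simp add: \<psi>_def z_def \<tau>_def scaleR_sum_right)
    have la_i: "0 \<le> la ^ i" "la ^ i \<le> 1" "1 - la ^ i \<le> real m * \<theta>"
    proof -
      show "0 \<le> la ^ i" "la ^ i \<le> 1" using la by (auto intro: power_le_one)
      have "1 + real i * (- \<theta>) \<le> (1 + (- \<theta>)) ^ i" by (rule Bernoulli_inequality) (use \<theta> in auto)
      then have "1 - la ^ i \<le> real i * \<theta>" by (simp add: la_def)
      also have "\<dots> \<le> real m * \<theta>" using i \<theta>(1) by (intro mult_right_mono) auto
      finally show "1 - la ^ i \<le> real m * \<theta>" .
    qed
    have gi: "nrm ?X (x - U i t) \<le> g i t" by (rule gt[OF i t x1])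
    have g0: "0 \<le> g i t" using gi nrm_nonneg[OF nX car_diff[OF nX xc Uic]] by linarith
    have s1: "nrm ?X (U i t - x) \<le> g i t" using gi nrm_minus_commute[OF nX Uic xc] by simp
    have s2: "nrm ?X (x - la ^ i *\<^sub>R x) \<le> g i t + (real m * \<theta>) * nrm ?X (U i t)"
    proof -
      have "x - la ^ i *\<^sub>R x = (1 - la ^ i) *\<^sub>R x" by (simp add: scaleR_diff_left)
      then have "nrm ?X (x - la ^ i *\<^sub>R x) = (1 - la ^ i) * nrm ?X x" using nrm_scale[OF nX xc, of "1 - la ^ i"] la_i by simp
      also have "\<dots> \<le> (1 - la ^ i) * (nrm ?X (U i t) + g i t)"
        using nrm_le_add_diff[OF nX xc Uic] gi la_i by (intro mult_left_mono) auto
      also have "\<dots> = (1 - la ^ i) * nrm ?X (U i t) + (1 - la ^ i) * g i t" by (rule distrib_left)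
      also have "\<dots> \<le> (real m * \<theta>) * nrm ?X (U i t) + 1 * g i t"
        using la_i g0 nrm_nonneg[OF nX Uic] by (intro add_mono mult_right_mono) auto
      finally show ?thesis by simp
    qed
    have s3: "nrm ?X (la ^ i *\<^sub>R x - la ^ i *\<^sub>R z) \<le> C * Q * d2"
    proof -
      have "nrm ?X (la ^ i *\<^sub>R x - la ^ i *\<^sub>R z) = la ^ i * nrm ?X (x - z)"
        using nrm_scale[OF nX car_diff[OF nX xc zc], of "la ^ i"] la_i by (simp flip: scaleR_diff_right)
      also have "\<dots> \<le> 1 * nrm ?X (x - z)" using la_i nrm_nonneg[OF nX car_diff[OF nX xc zc]] by (intro mult_right_mono) auto
      finally show ?thesis using xz by simp
    qed
    have "nrm ?X (U i t - la ^ i *\<^sub>R z) \<le> nrm ?X (U i t - x) + nrm ?X (x - la ^ i *\<^sub>R z)"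
      by (rule nrm_diff_triangle[OF nX Uic xc car_scale[OF nX zc]])
    moreover have "nrm ?X (x - la ^ i *\<^sub>R z) \<le> nrm ?X (x - la ^ i *\<^sub>R x) + nrm ?X (la ^ i *\<^sub>R x - la ^ i *\<^sub>R z)"
      by (rule nrm_diff_triangle[OF nX xc car_scale[OF nX xc] car_scale[OF nX zc]])
    ultimately show ?thesis unfolding V using s1 s2 s3 by linarith
  qed
  have approx: "Lp_le (lebesgue_on J) p (\<lambda>t. nrm (E (m - i)) (U i t - (\<Sum>a\<in>F. \<psi> a i t *\<^sub>R b a))) d" if i: "i \<le> m" for i
  proof -
    let ?X = "E (m - i)"
    note nX = E_normed[of "m - i"]
    let ?G = "\<lambda>t. \<bar>2 * g i t\<bar> + \<bar>\<bar>(real m * \<theta>) * nrm ?X (U i t)\<bar> + \<bar>C * Q * d2\<bar>\<bar>"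
    have sm: "strongly_measurable J ?X (\<lambda>t. U i t - (\<Sum>a\<in>F. \<psi> a i t *\<^sub>R b a))"
      by (intro strongly_measurable_diff[OF nX] strongly_measurable_sum[OF nX] strongly_measurable_scale[OF nX]
          strongly_measurable_const[OF nX] bE smooth_chain_measurable(2)[OF \<psi>s]
          strongly_measurable_mono[OF UK[OF i] JK(1) Ks Js])
    have "Lp_le (lebesgue_on J) p ?G (\<bar>2\<bar> * d1 + (\<bar>real m * \<theta>\<bar> * cf i + (C * Q * d2) * l))"
      unfolding l_def
      by (intro Lp_le_add Lp_le_scale gL[OF i] cf[rule_format, OF i] Lp_le_const[OF p1 emeasure_bounded_set[OF Js JK(5) L]] p1)
        (use C Q d2 L in auto)
    then show ?thesis
    proof (rule Lp_le_mono[OF _ borel_measurable_nrm[OF nX Js sm] p1])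
      have "real m * \<theta> * cf i \<le> real m * \<theta> * c" using cfc[OF i] \<theta>(1) by (intro mult_left_mono) auto
      then have "\<bar>real m * \<theta>\<bar> * cf i \<le> d1" using \<theta>(1,4) by simp
      moreover have "C * Q * d2 * l = d/6" using C Q l by (simp add: d2_def)
      ultimately show "\<bar>2\<bar> * d1 + (\<bar>real m * \<theta>\<bar> * cf i + (C * Q * d2) * l) \<le> d" using d by (simp add: d1_def)
      show "AE t in lebesgue_on J. \<bar>nrm ?X (U i t - (\<Sum>a\<in>F. \<psi> a i t *\<^sub>R b a))\<bar> \<le> \<bar>?G t\<bar>"
        using AE_in_lebesgue_on
      proof eventually_elim
        fix t assume t: "t \<in> J"
        have "0 \<le> nrm ?X (U i t - (\<Sum>a\<in>F. \<psi> a i t *\<^sub>R b a))"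
          by (rule nrm_nonneg[OF nX strongly_measurable_car[OF sm t]])
        then have "\<bar>nrm ?X (U i t - (\<Sum>a\<in>F. \<psi> a i t *\<^sub>R b a))\<bar> \<le> ?G t" using main[OF i t] by simp
        then show "\<bar>nrm ?X (U i t - (\<Sum>a\<in>F. \<psi> a i t *\<^sub>R b a))\<bar> \<le> \<bar>?G t\<bar>" by (rule order_trans[OF _ abs_ge_self])
      qed
    qed
  qed
  show thesis by (rule that[OF F(1,2) \<psi>s approx[unfolded J_def]])
qed

end

context Sobolev_setting
begin

text \<open>The local approximants are multiplied by a cutoff function that equals 1 on \<open>{-R..R}\<close>. The
  error has three parts: the tail of \<open>U k\<close>; the terms of the Leibniz rule in which the cutoff function
  is differentiated, which are \<open>O(1/R)\<close>; and the local error, which is chosen after \<open>R\<close> and beats the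
  maximum of the weight on \<open>{-3R..3R}\<close>.\<close>

theorem jet_dense:
  assumes U: "jet m U" and e: "e > 0"
  shows "\<exists>V. (\<forall>n. jet n V) \<and> (\<Sum>k\<le>m. lpn p I (\<omega> m) (E (m - k)) (\<lambda>t. U k t - V k t)) < e"
proof (cases "interior I = {}")
  case True
  have "lpn p I (\<omega> m) (E (m - k)) (\<lambda>t. U k t - 0) = lpn p I (\<omega> m) (E (m - k)) (\<lambda>t. 0)" for k
    by (rule lpn_cong_AE[OF AE_interior_empty[OF conn True]])
  then have "lpn p I (\<omega> m) (E (m - k)) (\<lambda>t. U k t - 0) = 0" for k using lpn_zero[OF E_normed] by simp
  then show ?thesis using jet_zero e by (intro exI[of _ "\<lambda>k t. 0"]) simp
next
  case ne: False
  define \<delta> where "\<delta> = e / (6 * (real m + 1))"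
  have d: "\<delta> > 0" using e by (simp add: \<delta>_def)
  obtain \<eta> :: "real \<Rightarrow> nat \<Rightarrow> real \<Rightarrow> real" and C :: "nat \<Rightarrow> real" where
    \<eta>: "\<And>R. smooth_chain (\<eta> R)" "\<And>R t. R > 0 \<Longrightarrow> \<bar>t\<bar> \<le> R \<Longrightarrow> \<eta> R 0 t = 1"
      "\<And>R t k. R > 0 \<Longrightarrow> \<bar>t\<bar> > 3 * R \<Longrightarrow> \<eta> R k t = 0" "\<And>R t. 0 \<le> \<eta> R 0 t" "\<And>R t. \<eta> R 0 t \<le> 1"
    and C: "\<And>k. C k > 0" "\<And>R t k. R > 0 \<Longrightarrow> \<bar>\<eta> R k t\<bar> \<le> C k / R ^ k"
    by (rule smooth_cutoff) blast
  obtain Q where Q: "Q > 0" "\<And>i k. i \<le> m \<Longrightarrow> k \<le> i \<Longrightarrow> embeds (E i) (E k) Q" using uniform_embedding[of m] by blast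
  \<comment> \<open>A bound for all products of a binomial coefficient and a derivative of the cutoff; \<open>D\<close> also absorbs the embeddings.\<close>
  define B where "B = 2 ^ m * (\<Sum>j\<le>m. C j)"
  have B: "B > 0" unfolding B_def by (intro mult_pos_pos sum_pos C) auto
  define D where "D = B * Q"
  have D: "D > 0" using B Q by (simp add: D_def)
  define A where "A = (\<Sum>i\<le>m. lpn p I (\<omega> m) (E (m - i)) (U i))"
  have A0: "A \<ge> 0" unfolding A_def by (intro sum_nonneg lpn_nonneg)
  have A: "lpn p I (\<omega> m) (E (m - i)) (U i) \<le> A" if "i \<le> m" for i
    unfolding A_def using that
    by (intro member_le_sum[of i "{..m}" "\<lambda>i. lpn p I (\<omega> m) (E (m - i)) (U i)"]) (auto intro: lpn_nonneg)
  let ?nu = "\<lambda>i t. nrm (E (m - i)) (U i t) * \<omega> m t"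
  have "\<forall>k. \<exists>R0. k \<le> m \<longrightarrow> (\<forall>R\<ge>R0. Lp_le M p (\<lambda>t. if \<bar>t\<bar> > R then ?nu k t else 0) \<delta>)"
    using Lp_fun_tail_small[OF E_normed weights jetD(1)[OF U] d] by blast
  from choice[OF this] obtain R0 where R0: "\<forall>k. k \<le> m \<longrightarrow> (\<forall>R\<ge>R0 k. Lp_le M p (\<lambda>t. if \<bar>t\<bar> > R then ?nu k t else 0) \<delta>)" ..
  define R where "R = 1 + (\<Sum>k\<le>m. \<bar>R0 k\<bar>) + real m * D * A / \<delta>"
  have S0: "0 \<le> (\<Sum>k\<le>m. \<bar>R0 k\<bar>)" by (intro sum_nonneg) auto
  have D0: "0 \<le> real m * D * A / \<delta>" using D A0 d by simp
  have R1: "R \<ge> 1" using S0 D0 by (simp add: R_def)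
  have R_R0: "R0 k \<le> R" if "k \<le> m" for k
  proof -
    have "\<bar>R0 k\<bar> \<le> (\<Sum>k\<le>m. \<bar>R0 k\<bar>)" using that by (intro member_le_sum[of k "{..m}" "\<lambda>k. \<bar>R0 k\<bar>"]) auto
    then show ?thesis using D0 unfolding R_def by linarith
  qed
  have RA: "real m * ((D / R) * A) \<le> \<delta>"
  proof -
    have "real m * D * A / \<delta> \<le> R" using S0 by (simp add: R_def)
    then have "real m * D * A \<le> R * \<delta>" using d by (simp add: pos_divide_le_eq)
    then show ?thesis using R1 by (simp add: field_simps)
  qed
  define J where "J = I \<inter> {-(3 * R)..3 * R}"
  have J: "J \<subseteq> I" "J \<in> sets lebesgue" using I_sets by (auto simp: J_def)
  obtain W where W: "W > 0" "\<And>t. t \<in> {-(3 * R)..3 * R} \<Longrightarrow> \<omega> m t \<le> W" using weight_bounded_above[OF weights[of m]] by blast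
  define \<delta>' where "\<delta>' = \<delta> / ((real m + 1) * (D * W))"
  have d': "\<delta>' > 0" using d D W by (simp add: \<delta>'_def)
  have R3: "3 * R > 0" using R1 by simp
  obtain F :: "'v set" and b :: "'v \<Rightarrow> 'v" and \<psi> :: "'v \<Rightarrow> nat \<Rightarrow> real \<Rightarrow> real" where
    F: "finite F" "\<And>a. a \<in> F \<Longrightarrow> b a \<in> (\<Inter>n. car (E n))" "\<And>a. smooth_chain (\<psi> a)"
    "\<And>i. i \<le> m \<Longrightarrow> Lp_le (lebesgue_on J) p (\<lambda>t. nrm (E (m - i)) (U i t - (\<Sum>a\<in>F. \<psi> a i t *\<^sub>R b a))) \<delta>'"
  proof (rule jet_local_approx[OF ne U R3 d', folded J_def])
    fix F :: "'v set" and b and \<psi> :: "'v \<Rightarrow> nat \<Rightarrow> real \<Rightarrow> real"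
    assume H: "finite F" "\<And>a. a \<in> F \<Longrightarrow> b a \<in> (\<Inter>n. car (E n))" "\<And>a. smooth_chain (\<psi> a)"
      "\<And>i. i \<le> m \<Longrightarrow> Lp_le (lebesgue_on J) p (\<lambda>t. nrm (E (m - i)) (U i t - (\<Sum>a\<in>F. \<psi> a i t *\<^sub>R b a))) \<delta>'"
    show thesis by (rule that[of F b \<psi>]) (fact H)+
  qed
  have bE: "b a \<in> car (E n)" if "a \<in> F" for a n using F(2)[OF that] by blast
  define w where "w i t = (\<Sum>a\<in>F. \<psi> a i t *\<^sub>R b a)" for i t
  have wc: "w i t \<in> car (E n)" for i t n unfolding w_def by (intro car_sum[OF E_normed] car_scale[OF E_normed] bE)
  let ?err = "\<lambda>i t. nrm (E (m - i)) (U i t - w i t)"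
  define V where "V k t = (\<Sum>a\<in>F. Leibniz (\<eta> R) (\<psi> a) k t *\<^sub>R b a)" for k t
  have jV: "jet n V" for n
    unfolding V_def
  proof (rule smooth_jet[OF ne F(2)])
    fix a
    show "smooth_chain (Leibniz (\<eta> R) (\<psi> a))" by (rule smooth_chain_mult[OF \<eta>(1) F(3)])
    show "supported_in {-(3 * R)..3 * R} (Leibniz (\<eta> R) (\<psi> a) 0)"
      unfolding supported_in_def
    proof (intro allI impI)
      fix t assume "t \<notin> {-(3 * R)..3 * R}"
      then have "\<bar>t\<bar> > 3 * R" by auto
      then show "Leibniz (\<eta> R) (\<psi> a) 0 t = 0" using \<eta>(3)[of R t 0] R1 by simp
    qed
  qed
  define c where "c k j t = real (k choose j) * \<eta> R j t" for k j t
  have V_eq: "V k t = (\<Sum>j\<le>k. c k j t *\<^sub>R w (k - j) t)" for k t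
  proof -
    have "V k t = (\<Sum>a\<in>F. \<Sum>j\<le>k. (c k j t * \<psi> a (k - j) t) *\<^sub>R b a)"
      by (simp add: V_def Leibniz_def c_def scaleR_sum_left mult.assoc)
    also have "\<dots> = (\<Sum>j\<le>k. \<Sum>a\<in>F. (c k j t * \<psi> a (k - j) t) *\<^sub>R b a)" by (rule sum.swap)
    also have "\<dots> = (\<Sum>j\<le>k. c k j t *\<^sub>R w (k - j) t)" by (simp add: w_def scaleR_sum_right)
    finally show ?thesis .
  qed
  have c_le: "\<bar>c k j t\<bar> \<le> B / R ^ j" if "j \<le> k" "k \<le> m" for k j t
  proof -
    have "real (k choose j) \<le> 2 ^ m"
    proof -
      have "k choose j \<le> 2 ^ k" by (rule binomial_le_pow2)
      also have "\<dots> \<le> 2 ^ m" using that by (intro power_increasing) auto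
      finally show ?thesis by (metis of_nat_le_iff of_nat_numeral of_nat_power)
    qed
    moreover have "\<bar>\<eta> R j t\<bar> \<le> (\<Sum>j\<le>m. C j) / R ^ j"
    proof -
      have "C j \<le> (\<Sum>j\<le>m. C j)" using that C(1) by (intro member_le_sum[of j "{..m}" C]) (auto intro: less_imp_le)
      then have "C j / R ^ j \<le> (\<Sum>j\<le>m. C j) / R ^ j" using R1 by (intro divide_right_mono) auto
      then show ?thesis using C(2)[of R j t] R1 by linarith
    qed
    ultimately have "real (k choose j) * \<bar>\<eta> R j t\<bar> \<le> 2 ^ m * ((\<Sum>j\<le>m. C j) / R ^ j)" by (intro mult_mono) auto
    then show ?thesis by (simp add: c_def abs_mult B_def)
  qed
  have c_B: "\<bar>c k j t\<bar> \<le> B" if "j \<le> k" "k \<le> m" for k j t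
  proof -
    have "B / R ^ j \<le> B / 1" using R1 B by (intro divide_left_mono) (auto simp: one_le_power)
    then show ?thesis using c_le[OF that, of t] by simp
  qed
  have c_BR: "\<bar>c k j t\<bar> \<le> B / R" if "j \<le> k" "k \<le> m" "1 \<le> j" for k j t
  proof -
    have "R ^ 1 \<le> R ^ j" using R1 that(3) by (intro power_increasing)
    then have "B / R ^ j \<le> B / R" using R1 B by (intro divide_left_mono) auto
    then show ?thesis using c_le[OF that(1,2), of t] by simp
  qed
  have Uc: "U i t \<in> car (E (m - i))" if "i \<le> m" "t \<in> I" for i t by (rule Lp_fun_car[OF jetD(1)[OF U that(1)] that(2)])
  have est: "lpn p I (\<omega> m) (E (m - k)) (\<lambda>t. U k t - V k t) \<le> 3 * \<delta>" if k: "k \<le> m" for k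
  proof -
    let ?X = "E (m - k)"
    note nX = E_normed[of "m - k"]
    let ?G1 = "\<lambda>t. if \<bar>t\<bar> > R then ?nu k t else 0"
    let ?G2 = "\<lambda>t. \<Sum>j\<in>{1..k}. \<bar>(D / R) * ?nu (k - j) t\<bar>"
    let ?G3 = "\<lambda>t. \<Sum>j\<in>{..k}. \<bar>(D * W) * (if t \<in> J then ?err (k - j) t else 0)\<bar>"
    have G1: "Lp_le M p ?G1 \<delta>" using R0 k R_R0[OF k] by blast
    have G2: "Lp_le M p ?G2 (\<Sum>j\<in>{1..k}. \<bar>D / R\<bar> * lpn p I (\<omega> m) (E (m - (k - j))) (U (k - j)))"
    proof (rule Lp_le_sum[OF _ _ p1])
      fix j
      have "k - j \<le> m" using k by simp
      then show "Lp_le M p (\<lambda>t. (D / R) * ?nu (k - j) t) (\<bar>D / R\<bar> * lpn p I (\<omega> m) (E (m - (k - j))) (U (k - j)))"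
        by (rule Lp_le_scale[OF Lp_fun_Lp_le[OF E_normed weights jetD(1)[OF U]]])
    qed simp
    have s2: "(\<Sum>j\<in>{1..k}. \<bar>D / R\<bar> * lpn p I (\<omega> m) (E (m - (k - j))) (U (k - j))) \<le> \<delta>"
    proof -
      have "(\<Sum>j\<in>{1..k}. \<bar>D / R\<bar> * lpn p I (\<omega> m) (E (m - (k - j))) (U (k - j))) \<le> (\<Sum>j\<in>{1..k}. (D / R) * A)"
        using D R1 k by (intro sum_mono mult_mono A) (auto intro: lpn_nonneg)
      also have "\<dots> = real k * ((D / R) * A)" by simp
      also have "\<dots> \<le> real m * ((D / R) * A)" using k D R1 A0 by (intro mult_right_mono) auto
      finally show ?thesis using RA by linarith
    qed
    have G3: "Lp_le M p ?G3 (\<Sum>j\<in>{..k}. \<bar>D * W\<bar> * \<delta>')"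
    proof (rule Lp_le_sum[OF _ _ p1])
      fix j
      have "k - j \<le> m" using k by simp
      then show "Lp_le M p (\<lambda>t. (D * W) * (if t \<in> J then ?err (k - j) t else 0)) (\<bar>D * W\<bar> * \<delta>')"
        unfolding w_def by (rule Lp_le_scale[OF Lp_le_extend[OF F(4) J(1) I_sets J(2)]])
    qed simp
    have s3: "(\<Sum>j\<in>{..k}. \<bar>D * W\<bar> * \<delta>') \<le> \<delta>"
    proof -
      have "(\<Sum>j\<in>{..k}. \<bar>D * W\<bar> * \<delta>') = (real k + 1) * (D * W * \<delta>')" using D W by simp
      also have "\<dots> \<le> (real m + 1) * (D * W * \<delta>')" using k D W d' by (intro mult_right_mono) auto
      also have "\<dots> = \<delta>" using D W by (simp add: \<delta>'_def)
      finally show ?thesis .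
    qed
    have sm: "strongly_measurable I ?X (\<lambda>t. U k t - V k t)"
      by (rule Lp_fun_strongly_measurable[OF jetD(1)[OF jet_diff[OF U jV] k]])
    have "lpn p I (\<omega> m) ?X (\<lambda>t. U k t - V k t)
        \<le> \<delta> + ((\<Sum>j\<in>{1..k}. \<bar>D / R\<bar> * lpn p I (\<omega> m) (E (m - (k - j))) (U (k - j))) + (\<Sum>j\<in>{..k}. \<bar>D * W\<bar> * \<delta>'))"
    proof (rule Lp_fun_dominated(2)[OF nX weights sm Lp_le_add[OF G1 Lp_le_add[OF G2 G3 p1] p1]])
      fix t assume t: "t \<in> I"
      have w0: "0 < \<omega> m t" by (rule weight_pos[OF weights])
      have sub: "x \<in> car ?X" "nrm ?X x \<le> Q * nrm (E (m - (k - j))) x" if "x \<in> car (E (m - (k - j)))" for x j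
      proof -
        have "embeds (E (m - (k - j))) ?X Q" by (rule Q(2)) (use k in auto)
        then show "x \<in> car ?X" "nrm ?X x \<le> Q * nrm (E (m - (k - j))) x" using that by (auto simp: embeds_def)
      qed
      have Uj: "U (k - j) t \<in> car (E (m - (k - j)))" for j by (rule Uc) (use k t in auto)
      have Dj: "U (k - j) t - w (k - j) t \<in> car (E (m - (k - j)))" for j by (rule car_diff[OF E_normed Uj wc])
      define x1 where "x1 = (1 - \<eta> R 0 t) *\<^sub>R U k t"
      define x2 where "x2 = (\<Sum>j\<in>{1..k}. c k j t *\<^sub>R U (k - j) t)"
      define x3 where "x3 = (\<Sum>j\<in>{..k}. c k j t *\<^sub>R (U (k - j) t - w (k - j) t))"
      have x1c: "x1 \<in> car ?X" unfolding x1_def by (rule car_scale[OF nX Uc[OF k t]])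
      have x2c: "x2 \<in> car ?X" unfolding x2_def by (intro car_sum[OF nX] car_scale[OF nX] sub[OF Uj])
      have x3c: "x3 \<in> car ?X" unfolding x3_def by (intro car_sum[OF nX] car_scale[OF nX] sub[OF Dj])
      \<comment> \<open>Add and subtract the Leibniz sum for \<open>U\<close>, and split off its term in which the cutoff is not differentiated.\<close>
      have eq: "U k t - V k t = (x1 - x2) + x3"
      proof -
        have "{..k} = insert 0 {1..k}" by auto
        then have "(\<Sum>j\<in>{..k}. c k j t *\<^sub>R U (k - j) t) = \<eta> R 0 t *\<^sub>R U k t + x2"
          by (simp add: x2_def c_def)
        moreover have "x3 = (\<Sum>j\<in>{..k}. c k j t *\<^sub>R U (k - j) t) - V k t"
          by (simp add: x3_def V_eq scaleR_diff_right sum_subtractf)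
        ultimately show ?thesis by (simp add: x1_def scaleR_diff_left)
      qed
      have b1: "nrm ?X x1 * \<omega> m t \<le> ?G1 t"
      proof (cases "\<bar>t\<bar> > R")
        case True
        have "nrm ?X x1 = \<bar>1 - \<eta> R 0 t\<bar> * nrm ?X (U k t)" unfolding x1_def by (rule nrm_scale[OF nX Uc[OF k t]])
        also have "\<dots> \<le> 1 * nrm ?X (U k t)"
          using \<eta>(4,5)[of R t] nrm_nonneg[OF nX Uc[OF k t]] by (intro mult_right_mono) auto
        finally show ?thesis using True w0 by simp
      next
        case False
        then have "x1 = 0" using \<eta>(2)[of R t] R1 by (simp add: x1_def)
        then show ?thesis using False nrm_zero[OF nX] by simp
      qed
      have b2: "nrm ?X x2 * \<omega> m t \<le> ?G2 t"
      proof -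
        have "nrm ?X x2 * \<omega> m t \<le> (\<Sum>j\<in>{1..k}. nrm ?X (c k j t *\<^sub>R U (k - j) t)) * \<omega> m t"
          unfolding x2_def using w0 by (intro mult_right_mono nrm_sum_le[OF nX] car_scale[OF nX] sub[OF Uj]) auto
        also have "\<dots> = (\<Sum>j\<in>{1..k}. nrm ?X (c k j t *\<^sub>R U (k - j) t) * \<omega> m t)" by (rule sum_distrib_right)
        also have "\<dots> \<le> ?G2 t"
        proof (rule sum_mono)
          fix j assume j: "j \<in> {1..k}"
          have "nrm ?X (c k j t *\<^sub>R U (k - j) t) = \<bar>c k j t\<bar> * nrm ?X (U (k - j) t)" by (rule nrm_scale[OF nX sub(1)[OF Uj]])
          also have "\<dots> \<le> (B / R) * (Q * nrm (E (m - (k - j))) (U (k - j) t))"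
            using j k B R1 nrm_nonneg[OF nX sub(1)[OF Uj]] by (intro mult_mono c_BR sub(2)[OF Uj]) auto
          finally have "nrm ?X (c k j t *\<^sub>R U (k - j) t) * \<omega> m t \<le> ((B / R) * (Q * nrm (E (m - (k - j))) (U (k - j) t))) * \<omega> m t"
            using w0 by (intro mult_right_mono) auto
          also have "\<dots> = (D / R) * ?nu (k - j) t" by (simp add: D_def)
          also have "\<dots> \<le> \<bar>(D / R) * ?nu (k - j) t\<bar>" by (rule abs_ge_self)
          finally show "nrm ?X (c k j t *\<^sub>R U (k - j) t) * \<omega> m t \<le> \<bar>(D / R) * ?nu (k - j) t\<bar>" .
        qed
        finally show ?thesis .
      qed
      have b3: "nrm ?X x3 * \<omega> m t \<le> ?G3 t"
      proof -
        have "nrm ?X x3 * \<omega> m t \<le> (\<Sum>j\<in>{..k}. nrm ?X (c k j t *\<^sub>R (U (k - j) t - w (k - j) t))) * \<omega> m t"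
          unfolding x3_def using w0 by (intro mult_right_mono nrm_sum_le[OF nX] car_scale[OF nX] sub[OF Dj]) auto
        also have "\<dots> = (\<Sum>j\<in>{..k}. nrm ?X (c k j t *\<^sub>R (U (k - j) t - w (k - j) t)) * \<omega> m t)" by (rule sum_distrib_right)
        also have "\<dots> \<le> ?G3 t"
        proof (rule sum_mono)
          fix j assume j: "j \<in> {..k}"
          have eq: "nrm ?X (c k j t *\<^sub>R (U (k - j) t - w (k - j) t)) = \<bar>c k j t\<bar> * nrm ?X (U (k - j) t - w (k - j) t)"
            by (rule nrm_scale[OF nX sub(1)[OF Dj]])
          show "nrm ?X (c k j t *\<^sub>R (U (k - j) t - w (k - j) t)) * \<omega> m t
              \<le> \<bar>(D * W) * (if t \<in> J then ?err (k - j) t else 0)\<bar>"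
          proof (cases "t \<in> J")
            case True
            have n0: "0 \<le> ?err (k - j) t" by (rule nrm_nonneg[OF E_normed Dj])
            have h: "\<bar>c k j t\<bar> * nrm ?X (U (k - j) t - w (k - j) t) \<le> B * (Q * ?err (k - j) t)"
              using j k B nrm_nonneg[OF nX sub(1)[OF Dj]] by (intro mult_mono c_B sub(2)[OF Dj]) auto
            have "nrm ?X (c k j t *\<^sub>R (U (k - j) t - w (k - j) t)) * \<omega> m t \<le> (B * (Q * ?err (k - j) t)) * W"
              unfolding eq by (rule mult_mono[OF h W(2)]) (use w0 True B Q(1) n0 in \<open>auto simp: J_def\<close>)
            also have "\<dots> = (D * W) * (if t \<in> J then ?err (k - j) t else 0)" using True by (simp add: D_def)
            also have "\<dots> \<le> \<bar>(D * W) * (if t \<in> J then ?err (k - j) t else 0)\<bar>" by (rule abs_ge_self)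
            finally show ?thesis .
          next
            case False
            then have "\<bar>t\<bar> > 3 * R" using t by (auto simp: J_def)
            then have "c k j t = 0" using \<eta>(3)[of R t j] R1 by (simp add: c_def)
            then show ?thesis unfolding eq using False by simp
          qed
        qed
        finally show ?thesis .
      qed
      have le3: "x \<le> a \<Longrightarrow> y \<le> b \<Longrightarrow> z \<le> c \<Longrightarrow> x + (y + z) \<le> \<bar>a\<bar> + \<bar>\<bar>b\<bar> + \<bar>c\<bar>\<bar>" for x y z a b c :: real by linarith
      have "nrm ?X (U k t - V k t) \<le> (nrm ?X x1 + nrm ?X x2) + nrm ?X x3"
        unfolding eq using nrm_triangle[OF nX car_diff[OF nX x1c x2c] x3c] nrm_triangle_sub[OF nX x1c x2c] by linarith
      then have "nrm ?X (U k t - V k t) * \<omega> m t \<le> ((nrm ?X x1 + nrm ?X x2) + nrm ?X x3) * \<omega> m t"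
        using w0 by (intro mult_right_mono) auto
      also have "\<dots> = nrm ?X x1 * \<omega> m t + (nrm ?X x2 * \<omega> m t + nrm ?X x3 * \<omega> m t)" by (simp add: distrib_right)
      also have "\<dots> \<le> \<bar>?G1 t\<bar> + \<bar>\<bar>?G2 t\<bar> + \<bar>?G3 t\<bar>\<bar>"
        by (rule le3[OF b1 b2 b3])
      finally show "nrm ?X (U k t - V k t) * \<omega> m t \<le> \<bar>?G1 t\<bar> + \<bar>\<bar>?G2 t\<bar> + \<bar>?G3 t\<bar>\<bar>" .
    qed
    then show ?thesis using s2 s3 by linarith
  qed
  have "(\<Sum>k\<le>m. lpn p I (\<omega> m) (E (m - k)) (\<lambda>t. U k t - V k t)) \<le> (\<Sum>k\<le>m. 3 * \<delta>)"
    by (intro sum_mono est) auto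
  also have "\<dots> = e / 2" by (simp add: \<delta>_def field_simps)
  also have "\<dots> < e" using e by simp
  finally show ?thesis using jV by blast
qed

theorem dense_S: "norm_topology (S m) closure_of (\<Inter>n. car (S n)) = car (S m)"
proof -
  have sub: "(\<Inter>n. car (S n)) \<subseteq> car (S m)" by blast
  have "\<exists>y\<in>(\<Inter>n. car (S n)). nrm (S m) (x - y) < r" if x: "x \<in> car (S m)" and r: "r > 0" for x r
  proof -
    obtain U where U: "jet m U" "x = cls I (U 0)" using x unfolding car_S by blast
    obtain V where V: "\<And>n. jet n V" "(\<Sum>k\<le>m. lpn p I (\<omega> m) (E (m - k)) (\<lambda>t. U k t - V k t)) < r"
      using jet_dense[OF U(1) r] by blast
    have "cls I (V 0) \<in> (\<Inter>n. car (S n))" using in_car_S[OF V(1) refl] by blast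
    moreover have "nrm (S m) (x - cls I (V 0)) < r" using V(2) unfolding U(2) nrm_S_diff[OF U(1) V(1)] .
    ultimately show ?thesis by blast
  qed
  then show ?thesis unfolding norm_closure_of[OF normed_S sub] by blast
qed

end

section \<open>The sc-structure\<close>

lemma Sobolev_space_0: "Sobolev_space 0 p I \<omega> E = Lp_space p I \<omega> (E 0)"
  by (simp add: Sobolev_space_def wderiv_def Lp_space_def)

lemma scaled_weights_decay:
  assumes "scaled_weights \<omega>" "m < n" "e > 0"
  shows "\<exists>R. \<forall>t. \<bar>t\<bar> > R \<longrightarrow> \<omega> m t \<le> e * \<omega> n t"
proof -
  have pos: "0 < \<omega> n t" for t using assms(1) by (simp add: scaled_weights_def)
  have lim: "((\<lambda>t. \<omega> m t / \<omega> n t) \<longlongrightarrow> 0) at_top" "((\<lambda>t. \<omega> m t / \<omega> n t) \<longlongrightarrow> 0) at_bot"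
    using assms(1,2) unfolding scaled_weights_def by blast+
  obtain a b where ab: "\<And>t. t \<ge> a \<Longrightarrow> \<omega> m t / \<omega> n t < e" "\<And>t. t \<le> b \<Longrightarrow> \<omega> m t / \<omega> n t < e"
    using order_tendstoD(2)[OF lim(1) assms(3)] order_tendstoD(2)[OF lim(2) assms(3)]
    unfolding eventually_at_top_linorder eventually_at_bot_linorder by blast
  have "\<omega> m t \<le> e * \<omega> n t" if "\<bar>t\<bar> > max \<bar>a\<bar> \<bar>b\<bar>" for t
  proof -
    have "t \<ge> a \<or> t \<le> b" using that by linarith
    then have "\<omega> m t / \<omega> n t < e" using ab by blast
    then show ?thesis using pos[of t] by (simp add: pos_divide_less_eq)
  qed
  then show ?thesis by blast
qed

text \<open>The quotient of two weights is small near both ends and bounded on the compact interval between.\<close>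

lemma scaled_weights_mono:
  assumes \<omega>: "scaled_weights \<omega>" and mn: "m \<le> n"
  shows "\<exists>C\<ge>0. \<forall>t. \<omega> m t \<le> C * \<omega> n t"
proof (cases "m = n")
  case True
  then show ?thesis by (intro exI[of _ 1]) simp
next
  case False
  then have "m < n" using mn by simp
  then obtain R where R: "\<And>t. \<bar>t\<bar> > R \<Longrightarrow> \<omega> m t \<le> 1 * \<omega> n t"
    using scaled_weights_decay[OF \<omega> _ zero_less_one] by blast
  have w: "weight (\<omega> k)" for k using \<omega> by (simp add: scaled_weights_def weight_def)
  obtain W where W: "W > 0" "\<And>t. t \<in> {-R..R} \<Longrightarrow> \<omega> m t \<le> W" using weight_bounded_above[OF w] by blast
  obtain v where v: "v > 0" "\<And>t. t \<in> {-R..R} \<Longrightarrow> v \<le> \<omega> n t" using weight_bounded_below[OF w] by blast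
  have "\<omega> m t \<le> (1 + W / v) * \<omega> n t" for t
  proof (cases "\<bar>t\<bar> > R")
    case True
    have "\<omega> m t \<le> 1 * \<omega> n t" by (rule R[OF True])
    also have "\<dots> \<le> (1 + W / v) * \<omega> n t" using W v weight_pos[OF w, of n t] by (intro mult_right_mono) auto
    finally show ?thesis .
  next
    case False
    then have t: "t \<in> {-R..R}" by auto
    have "\<omega> m t \<le> W / v * v" using W(2)[OF t] v(1) by simp
    also have "\<dots> \<le> (1 + W / v) * \<omega> n t" using W v(1) v(2)[OF t] by (intro mult_mono) auto
    finally show ?thesis .
  qed
  then show ?thesis using W v by (intro exI[of _ "1 + W / v"]) auto
qed

lemma sc_structure_Sobolev_setting:
  assumes E: "sc_structure E0 E" and I: "connected I" and p: "1 \<le> p" and \<omega>: "scaled_weights \<omega>"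
  shows "Sobolev_setting I p E \<omega>"
proof
  have B: "banach_space (E n)" and C: "m < n \<Longrightarrow> compact_inclusion (E n) (E m)"
    and D: "norm_topology (E m) closure_of (\<Inter>n. car (E n)) = car (E m)" for m n
    using E by (auto simp: sc_structure_def)
  have N: "normed_space (E n)" for n using B by (simp add: banach_space_def)
  show "connected I" "1 \<le> p" by (fact I p)+
  show "weight (\<omega> n)" for n using \<omega> by (simp add: scaled_weights_def weight_def)
  show "\<exists>C\<ge>0. \<forall>t. \<omega> m t \<le> C * \<omega> n t" if "m \<le> n" for m n by (rule scaled_weights_mono[OF \<omega> that])
  show "\<exists>R. \<forall>t. \<bar>t\<bar> > R \<longrightarrow> \<omega> m t \<le> e * \<omega> n t" if "m < n" "e > 0" for m n e
    by (rule scaled_weights_decay[OF \<omega> that])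
  show "banach_space (E n)" for n by (rule B)
  show "compact_inclusion (E n) (E m)" if "m < n" for m n by (rule C[OF that])
  show "\<exists>K. embeds (E n) (E m) K" if "m \<le> n" for m n
  proof (cases "m = n")
    case True
    then show ?thesis by (intro exI[of _ 1]) (simp add: embeds_def)
  next
    case False
    then have c: "compact_inclusion (E n) (E m)" using that by (intro C) simp
    obtain K where K: "0 < K" "\<And>x. x \<in> car (E n) \<Longrightarrow> nrm (E m) x \<le> K * nrm (E n) x"
      by (rule compact_inclusion_bounded[OF N N c]) blast
    have "car (E n) \<subseteq> car (E m)" using c by (simp add: compact_inclusion_def)
    then show ?thesis using K by (intro exI[of _ K]) (auto simp: embeds_def)
  qed
  show "\<exists>y\<in>(\<Inter>n. car (E n)). nrm (E m) (x - y) < r" if "x \<in> car (E m)" "r > 0" for x m r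
  proof -
    have sub: "(\<Inter>n. car (E n)) \<subseteq> car (E m)" by blast
    show ?thesis using that D[of m] unfolding norm_closure_of[OF N sub] by blast
  qed
qed

theorem theorem2p36:
  fixes E\<^sub>0 :: "'v::real_vector nspace" and E :: "nat \<Rightarrow> 'v nspace"
    and I :: "real set" and p :: real and \<omega> :: "nat \<Rightarrow> real \<Rightarrow> real"
  assumes "sc_structure E\<^sub>0 E"
    and "\<And>n. reflexive_space (E n)"
    and "connected I"
    and "1 \<le> p"
    and "scaled_weights \<omega>"
  shows "sc_structure (Lp_space p I (\<omega> 0) (E 0)) (\<lambda>n. Sobolev_space n p I (\<omega> n) E)"
proof -
  interpret Sobolev_setting I p E \<omega>
    by (rule sc_structure_Sobolev_setting[OF assms(1,3,4,5)])
  show ?thesis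
    unfolding sc_structure_def
    using banach_S[of 0] banach_S car_S_mono compact_S dense_S by (auto simp: Sobolev_space_0)
qed



end
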